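(* Let $(\beta_p)_{p\ge 2}$ be real numbers with $\sum_{p\ge2}2^p\beta_p^2<\infty$, and let $\xi(u)=\sum_{p\ge 2}\beta_p^2u^p$. Let $\mu_P$ be a Parisi measure for $\xi$, i.e. a minimizer over $M[0,1]$ of the Parisi functional $\mathcal P$. (i) Suppose there exist a (strictly) increasing sequence $(u_\ell^-)_{\ell\ge1}$ and a (strictly) decreasing sequence $(u_\ell^+)_{\ell\ge1}$ of points of $\operatorname{supp}\mu_P$ such that $\lim_{\ell\to\infty}u_\ell^-=u_0=\lim_{\ell\to\infty}u_\ell^+$. Then $\mu_P$ is continuous at $u_0$, i.e. its distribution function $u\mapsto\mu_P([0,u])$ is continuous at $u_0$. (ii) If $(a,b)\subset\operatorname{supp}\mu_P$ for some $0\le a<b\le1$, then the distribution function $u\mapsto\mu_P([0,u])$ is infinitely differentiable on $[a,b)$ (with one-sided derivatives at $a$).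
   Context: $M[0,1]$ is the set of Borel probability measures on $[0,1]$ with the metric $d(\mu,\mu')=\int_0^1|\mu([0,u])-\mu'([0,u])|\,du$; $M_d[0,1]\subset M[0,1]$ is the subset of measures consisting of a finite number of atoms. Parisi PDE solution. For $\mu\in M_d[0,1]$ with atoms $0\le q_1<\dots<q_{k+1}\le 1$ ($k\ge0$), put $m_p=\mu([0,q_p])$ for $1\le p\le k+1$, $m_0=0$, $q_0=0$, $q_{k+2}=1$. Define $\Phi_\mu:\mathbb R\times[0,1]\to\mathbb R$ by $\Phi_\mu(x,u)=\log\cosh x+\frac12(\xi'(1)-\xi'(u))$ for $q_{k+1}\le u\le1$ and recursively, for $p=k,k-1,\dots,0$ and $q_p\le u<q_{p+1}$, $$\Phi_\mu(x,u)=\frac1{m_p}\log\mathbb E\exp m_p\Phi_\mu\big(x+z\sqrt{\xi'(q_{p+1})-\xi'(u)},\,q_{p+1}\big),$$ $z$ a standard Gaussian, where for $m_p=0$ the right side means $\mathbb E\,\Phi_\mu(x+z\sqrt{\xi'(q_{p+1})-\xi'(u)},q_{p+1})$. (This solves $\partial_u\Phi_\mu=-\frac{\xi''(u)}2(\partial_x^2\Phi_\mu+\mu([0,u])(\partial_x\Phi_\mu)^2)$ with $\Phi_\mu(x,1)=\log\cosh x$.) The map $\mu\mapsto\Phi_\mu$ is known to be Lipschitz from $(M_d[0,1],d)$ to $C(\mathbb R\times[0,1])$ with the uniform distance, and $\Phi_\mu$ for general $\mu\in M[0,1]$ is defined by continuous extension. Parisi functional: $\mathcal P(\mu)=\Phi_\mu(0,0)-\frac12\int_0^1u\,\xi''(u)\,\mu([0,u])\,du$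 for $\mu\in M[0,1]$. A Parisi measure is any minimizer of $\mathcal P$ on $M[0,1]$.
   Formalization: The formal theorem additionally assumes that some β_p with p ≥ 2 is nonzero; for ξ = 0 the functional 𝒫 is identically 0, so every measure, e.g. half Lebesgue plus half a point mass at 1/2, is a minimizer and both (i) and (ii) fail. *)

theory Defs
  imports "HOL-Probability.Probability"
begin

text \<open>The series starts at index 2. If all \<^term>\<open>\<beta> p\<close> with \<open>p \<ge> 2\<close> vanish, the Parisi functional
  below is identically zero and every probability measure minimizes it, so results about
  minimizers have to exclude this case.\<close>

definition mixture :: "(nat \<Rightarrow> real) \<Rightarrow> real \<Rightarrow> real" where
  "mixture \<beta> u = (\<Sum>p. (\<beta> (p + 2))\<^sup>2 * u ^ (p + 2))"

definition prob_measures01 :: "real measure set" where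
  "prob_measures01 = {\<mu>. prob_space \<mu> \<and> sets \<mu> = sets (restrict_space borel {0..1})}"

text \<open>Only used for \<open>u \<in> {0..1}\<close>: for \<open>u > 1\<close> the set \<open>{0..u}\<close> is not a subset of the underlying
  space of the measures above.\<close>

definition dist_fun :: "real measure \<Rightarrow> real \<Rightarrow> real" where
  "dist_fun \<mu> u = measure \<mu> {0..u}"

definition measure_dist :: "real measure \<Rightarrow> real measure \<Rightarrow> real" where
  "measure_dist \<mu> \<nu> = (LINT u:{0..1}|lborel. \<bar>dist_fun \<mu> u - dist_fun \<nu> u\<bar>)"

definition measure_supp :: "real measure \<Rightarrow> real set" where
  "measure_supp \<mu> = {x \<in> {0..1}. \<forall>U. open U \<and> x \<in> U \<longrightarrow> measure \<mu> (U \<inter> {0..1}) > 0}"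

definition discrete_measures01 :: "real measure set" where
  "discrete_measures01 =
    {\<mu> \<in> prob_measures01. \<exists>S. finite S \<and> S \<subseteq> {0..1} \<and> measure \<mu> S = 1}"

definition atoms :: "real measure \<Rightarrow> real set" where
  "atoms \<mu> = {q \<in> {0..1}. measure \<mu> {q} > 0}"

definition gauss_log_mean :: "real \<Rightarrow> (real \<Rightarrow> real) \<Rightarrow> real \<Rightarrow> real \<Rightarrow> real" where
  "gauss_log_mean m f s x =
    (if m = 0 then (LINT z|std_normal_distribution. f (x + z * sqrt s))
     else ln (LINT z|std_normal_distribution. exp (m * f (x + z * sqrt s))) / m)"

text \<open>In \<^term>\<open>parisi_rec \<xi> \<mu> m qs x u\<close>, \<open>qs\<close> is the increasing list \<open>[q\<^sub>p\<^sub>+\<^sub>1, \<dots>, q\<^sub>k\<^sub>+\<^sub>1]\<close> of those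
  atoms of \<open>\<mu>\<close> that remain after \<open>q\<^sub>p\<close>, and \<open>m = m\<^sub>p\<close> is the mass of \<open>{0..q\<^sub>p}\<close>, with \<open>q\<^sub>0 = 0\<close> and
  \<open>m\<^sub>0 = 0\<close>. The argument satisfies \<open>q\<^sub>p \<le> u \<le> 1\<close>: either \<open>u < q\<^sub>p\<^sub>+\<^sub>1\<close> and the Gaussian step applies,
  or the search for the interval containing \<open>u\<close> moves on.\<close>

fun parisi_rec :: "(real \<Rightarrow> real) \<Rightarrow> real measure \<Rightarrow> real \<Rightarrow> real list \<Rightarrow> real \<Rightarrow> real \<Rightarrow> real" where
  "parisi_rec \<xi> \<mu> m [] x u = ln (cosh x) + (deriv \<xi> 1 - deriv \<xi> u) / 2"
| "parisi_rec \<xi> \<mu> m (q # qs) x u =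
    (if u < q
     then gauss_log_mean m (\<lambda>y. parisi_rec \<xi> \<mu> (dist_fun \<mu> q) qs y q) (deriv \<xi> q - deriv \<xi> u) x
     else parisi_rec \<xi> \<mu> (dist_fun \<mu> q) qs x u)"

definition parisi_discrete :: "(real \<Rightarrow> real) \<Rightarrow> real measure \<Rightarrow> real \<Rightarrow> real \<Rightarrow> real" where
  "parisi_discrete \<xi> \<mu> x u = parisi_rec \<xi> \<mu> 0 (sorted_list_of_set (atoms \<mu>)) x u"

definition discrete_near :: "real measure \<Rightarrow> real measure filter" where
  "discrete_near \<mu> =
    (INF \<delta>\<in>{0<..}. principal {\<nu> \<in> discrete_measures01. measure_dist \<nu> \<mu> < \<delta>})"

text \<open>The extension by continuity, with respect to the uniform distance on \<open>\<real> \<times> [0,1]\<close>, of the map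
  \<^term>\<open>parisi_discrete \<xi>\<close>. The values of the chosen function are determined only on \<open>\<real> \<times> [0,1]\<close>.\<close>

definition parisi_solution :: "(real \<Rightarrow> real) \<Rightarrow> real measure \<Rightarrow> real \<Rightarrow> real \<Rightarrow> real" where
  "parisi_solution \<xi> \<mu> =
    (SOME \<Phi>. uniform_limit (UNIV \<times> {0..1})
      (\<lambda>\<nu> (x, u). parisi_discrete \<xi> \<nu> x u) (\<lambda>(x, u). \<Phi> x u) (discrete_near \<mu>))"

definition parisi_functional :: "(real \<Rightarrow> real) \<Rightarrow> real measure \<Rightarrow> real" where
  "parisi_functional \<xi> \<mu> = parisi_solution \<xi> \<mu> 0 0
    - (LINT u:{0..1}|lborel. u * deriv (deriv \<xi>) u * dist_fun \<mu> u) / 2"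

definition parisi_measure :: "(real \<Rightarrow> real) \<Rightarrow> real measure \<Rightarrow> bool" where
  "parisi_measure \<xi> \<mu> \<longleftrightarrow>
    is_arg_min (parisi_functional \<xi>) (\<lambda>\<nu>. \<nu> \<in> prob_measures01) \<mu>"

text \<open>Derivatives are taken within the set, hence one-sided at an endpoint belonging to it.\<close>

definition infinitely_differentiable_on :: "(real \<Rightarrow> real) \<Rightarrow> real set \<Rightarrow> bool" where
  "infinitely_differentiable_on f S \<longleftrightarrow>
    (\<exists>D :: nat \<Rightarrow> real \<Rightarrow> real. (\<forall>u\<in>S. D 0 u = f u) \<and>
      (\<forall>n. \<forall>u\<in>S. (D n has_real_derivative D (Suc n) u) (at u within S)))"

end

theory Submission
  imports Defs "HOL-Complex_Analysis.Great_Picard" "HOL-Real_Asymp.Real_Asymp"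
begin

text \<open>Write \<open>\<theta> = \<xi>'\<close> and \<open>\<alpha> u = \<mu> {0..u}\<close>. The law of the optimal process \<open>X\<close> of the Parisi equation is
  replaced by expectation functionals \<open>E\<close>, compositions of Gaussian kernels. For discrete \<open>\<mu>\<close> the
  expectations \<open>H\<^sub>w u = E w\<close> of monomials \<open>w\<close> in the derivatives \<open>\<partial>\<^sub>x\<^bsup>j\<^esup>\<Phi>(X\<^sub>u, u)\<close>, \<open>j \<ge> 1\<close>, satisfy a closed system
  \<open>H\<^sub>w' = \<theta>' (H(L\<^sub>0 w) - \<alpha> H(L\<^sub>1 w))\<close> with bounds uniform in \<open>\<mu>\<close>, so the system passes to general \<open>\<mu>\<close> along
  discretisations. If \<open>\<Phi>\<close>, \<open>\<Psi>\<close> belong to \<open>\<alpha>\<close>, \<open>\<gamma>\<close>, then at the starting point of \<open>X\<close>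
  \<open>\<Psi> - \<Phi> = \<integral> \<theta>' E[(\<gamma> - \<alpha>) (\<partial>\<^sub>x\<Psi>)\<^sup>2 + \<alpha> (\<partial>\<^sub>x\<Psi> - \<partial>\<^sub>x\<Phi>)\<^sup>2] / 2\<close>; this gives Lipschitz continuity and a first
  order expansion of the functional with error \<open>o(d)\<close>.

  Moving the mass of a small window to one of its ends shows \<open>E[(\<partial>\<^sub>x\<Phi>)\<^sup>2] = u\<close> on the support of a
  minimiser, hence by Rolle \<open>\<theta>' E[(\<partial>\<^sub>x\<^sup>2\<Phi>)\<^sup>2] = 1\<close> at accumulation points of the support. The one-sided
  derivatives of \<open>E[(\<partial>\<^sub>x\<^sup>2\<Phi>)\<^sup>2]\<close> contain \<open>-2 \<theta>' \<alpha>(u\<plusminus>) E[(\<partial>\<^sub>x\<^sup>2\<Phi>)\<^sup>3]\<close> with a positive expectation, so the two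
  one-sided limits of \<open>\<alpha>\<close> agree. On an interval in the support the same identity expresses \<open>\<alpha>\<close> through
  the \<open>H\<^sub>w\<close>, and smoothness follows by bootstrapping.\<close>

section \<open>Gaussian smoothing\<close>

text \<open>For a general measure the solution exists only as a uniform limit of discrete solutions,
  so neither its space derivatives nor an optimal process are at hand there. All that is used about
  such a measure is carried by countably many functions of time, one per monomial: uniform bounds
  make them equi-Lipschitz, and one diagonal subsequence serves all of them. The distribution
  function may jump, hence their equations are kept in integrated form and differentiated only along
  intervals on which it has a limit.

  Two points decide the form of the estimates. The generator sends each space derivative to a
  Leibniz remainder in which the slope itself does not occur as a factor; this closes the monomial
  system and gives every order a linear Gronwall bound. The comparison identity contains the square
  of a difference of slopes, while the distance \<open>d\<close> controls only the values of the
  solutions; three bounded derivatives bring the slopes within a multiple of \<open>d\<close> to the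
  power 2/3, whose square is negligible against \<open>d\<close>.\<close>

abbreviation gaussian :: "real measure" where "gaussian \<equiv> std_normal_distribution"

lemma prob_space_gaussian: "prob_space gaussian"
  by (rule prob_space_normal_density) simp

lemma integrable_gaussian_exp: "integrable gaussian (\<lambda>z. exp (c * z))"
  and integral_gaussian_exp: "(LINT z|gaussian. exp (c * z)) = exp (c\<^sup>2 / 2)"
proof -
  \<comment> \<open>Completing the square: the exponential weight shifts the mean of the normal
    density to \<open>c\<close>, so integrability and value come from total mass one.\<close>
  have eq: "std_normal_density z * exp (c * z) = exp (c\<^sup>2 / 2) * normal_density c 1 z" for z
    unfolding normal_density_def
    by (simp add: exp_add[symmetric] exp_diff[symmetric] power2_eq_square field_simps flip: exp_add)
  show "integrable gaussian (\<lambda>z. exp (c * z))"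
    by (subst integrable_density) (auto simp: eq)
  show "(LINT z|gaussian. exp (c * z)) = exp (c\<^sup>2 / 2)"
    by (subst integral_density) (auto simp: eq)
qed

lemma integrable_gaussian_exp_abs: "integrable gaussian (\<lambda>z. exp (c * \<bar>z\<bar>))"
proof (rule Bochner_Integration.integrable_bound)
  show "integrable gaussian (\<lambda>z. exp (c * z) + exp ((-c) * z))"
    by (intro Bochner_Integration.integrable_add integrable_gaussian_exp)
  show "AE z in gaussian. norm (exp (c * \<bar>z\<bar>)) \<le> norm (exp (c * z) + exp ((-c) * z))"
  proof (rule AE_I2)
    fix z
    have "exp (c * \<bar>z\<bar>) \<le> exp (c * z) + exp ((-c) * z)" by (simp add: abs_if)
    also have "\<dots> = norm \<dots>" by (simp add: add_pos_pos)
    finally show "norm (exp (c * \<bar>z\<bar>)) \<le> norm (exp (c * z) + exp ((-c) * z))" by simp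
  qed
qed simp

lemma integrable_gaussian_bound:
  fixes g :: "real \<Rightarrow> real"
  assumes "g \<in> borel_measurable borel" "\<And>z. \<bar>g z\<bar> \<le> C * exp (c * \<bar>z\<bar>)"
  shows "integrable gaussian g"
proof (rule Bochner_Integration.integrable_bound)
  show "integrable gaussian (\<lambda>z. C * exp (c * \<bar>z\<bar>))"
    by (intro integrable_mult_right integrable_gaussian_exp_abs)
  show "AE z in gaussian. norm (g z) \<le> norm (C * exp (c * \<bar>z\<bar>))"
    by (rule AE_I2) (metis assms(2) abs_ge_self order_trans real_norm_def)
qed (use assms(1) in simp)

lemma abs_le_exp_abs: "\<bar>z\<bar> \<le> exp \<bar>z::real\<bar>"
  using exp_ge_add_one_self[of "\<bar>z\<bar>"] by linarith

lemma tendsto_exp_neg_square: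
  "((\<lambda>z::real. exp (c * \<bar>z\<bar>) * std_normal_density z) \<longlongrightarrow> 0) at_top"
  "((\<lambda>z::real. exp (c * \<bar>z\<bar>) * std_normal_density z) \<longlongrightarrow> 0) at_bot"
proof -
  have *: "((\<lambda>z::real. exp (c * z) * (1 / sqrt (2 * pi) * exp (- z\<^sup>2 / 2))) \<longlongrightarrow> 0) at_top"
  proof (cases c "0::real" rule: linorder_cases)
    case less then show ?thesis by real_asymp
  next
    case equal then show ?thesis by real_asymp
  next
    case greater then show ?thesis by real_asymp
  qed
  have "((\<lambda>z::real. exp (c * \<bar>z\<bar>) * std_normal_density z) \<longlongrightarrow> 0) at_top"
    by (rule Lim_transform_eventually[OF *], rule eventually_mono[OF eventually_gt_at_top[of 0]])
       (simp add: std_normal_density_def)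
  then show "((\<lambda>z::real. exp (c * \<bar>z\<bar>) * std_normal_density z) \<longlongrightarrow> 0) at_top" .
  then show "((\<lambda>z::real. exp (c * \<bar>z\<bar>) * std_normal_density z) \<longlongrightarrow> 0) at_bot"
    by (subst filterlim_at_bot_mirror) (simp add: std_normal_density_def)
qed

text \<open>Stein's identity. The derivative of \<open>g\<close> times the density is the difference
  of the two integrands, and exponential growth of \<open>g\<close> is beaten by the density at both
  ends, so the boundary terms vanish.\<close>

lemma gaussian_by_parts:
  fixes g g' :: "real \<Rightarrow> real"
  assumes g: "\<And>z. (g has_real_derivative g' z) (at z)" and g': "continuous_on UNIV g'"
    and b: "\<And>z. \<bar>g z\<bar> \<le> C * exp (c * \<bar>z\<bar>)" and b': "\<And>z. \<bar>g' z\<bar> \<le> C' * exp (c' * \<bar>z\<bar>)"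
  shows "(LINT z|gaussian. z * g z) = (LINT z|gaussian. g' z)"
proof -
  let ?p = std_normal_density
  have gc: "continuous_on UNIV g"
    by (rule DERIV_continuous_on[OF has_field_derivative_at_within[OF g]])
  have [measurable]: "g \<in> borel_measurable borel" "g' \<in> borel_measurable borel"
    using gc g' by (auto intro: borel_measurable_continuous_onI)
  have pd: "(?p has_real_derivative (- z * ?p z)) (at z)" for z
    unfolding std_normal_density_def
    by (rule derivative_eq_intros refl | simp add: field_simps power2_eq_square)+
  have C: "C \<ge> 0" using order_trans[OF abs_ge_zero b[of 0]] by simp
  have i1: "integrable gaussian (\<lambda>z. z * g z)"
  proof (rule integrable_gaussian_bound)
    fix z
    have "\<bar>z * g z\<bar> \<le> exp \<bar>z\<bar> * (C * exp (c * \<bar>z\<bar>))"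
      unfolding abs_mult by (intro mult_mono abs_le_exp_abs b) auto
    then show "\<bar>z * g z\<bar> \<le> C * exp ((c + 1) * \<bar>z\<bar>)"
      by (simp add: exp_add algebra_simps)
  qed measurable
  have i2: "integrable gaussian g'"
    by (rule integrable_gaussian_bound[OF _ b']) measurable
  have j1: "integrable lborel (\<lambda>z. ?p z * (z * g z))"
    using i1 by (subst (asm) integrable_density) auto
  have j2: "integrable lborel (\<lambda>z. ?p z * g' z)"
    using i2 by (subst (asm) integrable_density) auto
  have lim: "((\<lambda>z. g z * ?p z) \<longlongrightarrow> 0) at_top" "((\<lambda>z. g z * ?p z) \<longlongrightarrow> 0) at_bot"
  proof -
    have "\<bar>g z * ?p z\<bar> \<le> C * (exp (c * \<bar>z\<bar>) * ?p z)" for z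
      using mult_right_mono[OF b[of z] normal_density_nonneg[of 0 1 z]]
      by (simp add: abs_mult mult.assoc)
    then have *: "norm (g z * ?p z) \<le> C * (exp (c * \<bar>z\<bar>) * ?p z)" for z by simp
    show "((\<lambda>z. g z * ?p z) \<longlongrightarrow> 0) at_top"
      by (rule Lim_null_comparison[OF always_eventually[OF allI[OF *]] tendsto_mult_right_zero[OF tendsto_exp_neg_square(1)]])
    show "((\<lambda>z. g z * ?p z) \<longlongrightarrow> 0) at_bot"
      by (rule Lim_null_comparison[OF always_eventually[OF allI[OF *]] tendsto_mult_right_zero[OF tendsto_exp_neg_square(2)]])
  qed
  have F: "((\<lambda>z. g z * ?p z) has_vector_derivative (?p z * g' z - ?p z * (z * g z))) (at z)" for z
    unfolding has_real_derivative_iff_has_vector_derivative[symmetric]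
    by (rule DERIV_cong[OF DERIV_mult[OF g pd]]) (simp add: algebra_simps)
  have cp: "continuous_on UNIV ?p"
    by (rule DERIV_continuous_on[OF has_field_derivative_at_within[OF pd]])
  have ji: "integrable lborel (\<lambda>z. ?p z * g' z - ?p z * (z * g z))"
    using j1 j2 by simp
  have cc: "continuous_on UNIV (\<lambda>z. ?p z * g' z - ?p z * (z * g z))"
    by (intro continuous_intros cp g' gc)
  have "(LBINT z=-\<infinity>..\<infinity>. (?p z * g' z - ?p z * (z * g z))) = 0 - 0"
  proof (rule interval_integral_FTC_integrable[where F="\<lambda>z. g z * ?p z"])
    show "set_integrable lborel (einterval (-\<infinity>) \<infinity>) (\<lambda>z. ?p z * g' z - ?p z * (z * g z))"
      using ji by (simp add: set_integrable_def)
    show "isCont (\<lambda>z. ?p z * g' z - ?p z * (z * g z)) x" for x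
      using cc by (simp add: continuous_on_eq_continuous_at)
    show "(((\<lambda>z. g z * ?p z) \<circ> real_of_ereal) \<longlongrightarrow> 0) (at_right (-\<infinity>))"
      using lim(2) unfolding at_right_MInf by (simp add: filterlim_filtermap comp_def)
    show "(((\<lambda>z. g z * ?p z) \<circ> real_of_ereal) \<longlongrightarrow> 0) (at_left \<infinity>)"
      using lim(1) unfolding at_left_PInf by (simp add: filterlim_filtermap comp_def)
  qed (use F in auto)
  then have "(LINT z|lborel. (?p z * g' z - ?p z * (z * g z))) = 0"
    by (simp add: interval_lebesgue_integral_def set_lebesgue_integral_def)
  then have "(LINT z|lborel. ?p z * g' z) = (LINT z|lborel. ?p z * (z * g z))"
    using j1 j2 by simp
  then show ?thesis
    by (subst (1 2) integral_density) (auto simp: )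
qed

section \<open>Differentiation under the integral sign\<close>

lemma has_real_derivative_integral:
  fixes f f' :: "real \<Rightarrow> 'a \<Rightarrow> real"
  assumes I: "open I" "r0 \<in> I"
    and int: "\<And>r. r \<in> I \<Longrightarrow> integrable M (f r)"
    and der: "\<And>z r. z \<in> space M \<Longrightarrow> r \<in> I \<Longrightarrow> ((\<lambda>r. f r z) has_real_derivative f' r z) (at r)"
    and bd: "\<And>z r. z \<in> space M \<Longrightarrow> r \<in> I \<Longrightarrow> \<bar>f' r z\<bar> \<le> g z" and g: "integrable M g"
    and meas: "f' r0 \<in> borel_measurable M"
  shows "((\<lambda>r. LINT z|M. f r z) has_real_derivative (LINT z|M. f' r0 z)) (at r0)"
proof -
  obtain e where e: "e > 0" "ball r0 e \<subseteq> I" using I open_contains_ball by blast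
  have "((\<lambda>r. ((LINT z|M. f r z) - (LINT z|M. f r0 z)) / (r - r0)) \<longlongrightarrow> (LINT z|M. f' r0 z)) (at r0 within ball r0 e)"
    unfolding tendsto_at_iff_sequentially comp_def
  proof (intro allI impI)
    fix X assume X: "\<forall>i. X i \<in> ball r0 e - {r0}" "X \<longlonglongrightarrow> r0"
    have XI: "X n \<in> I" "X n \<noteq> r0" for n using X e by auto
    have "(\<lambda>n. LINT z|M. (f (X n) z - f r0 z) / (X n - r0)) \<longlonglongrightarrow> (LINT z|M. f' r0 z)"
    proof (rule integral_dominated_convergence[where w=g])
      show "AE z in M. (\<lambda>n. (f (X n) z - f r0 z) / (X n - r0)) \<longlonglongrightarrow> f' r0 z"
      proof (rule AE_I2)
        fix z assume "z \<in> space M"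
        from der[OF this I(2)] have "((\<lambda>r. (f r z - f r0 z) / (r - r0)) \<longlongrightarrow> f' r0 z) (at r0)"
          by (simp add: has_field_derivative_iff)
        then show "(\<lambda>n. (f (X n) z - f r0 z) / (X n - r0)) \<longlonglongrightarrow> f' r0 z"
          using X XI unfolding tendsto_at_iff_sequentially comp_def by auto
      qed
      show "AE z in M. norm ((f (X n) z - f r0 z) / (X n - r0)) \<le> g z" for n
      proof (rule AE_I2)
        fix z assume z: "z \<in> space M"
        \<comment> \<open>The mean value inequality turns the bound on the derivative into a
          majorant for the difference quotients.\<close>
        have "norm (f (X n) z - f r0 z) \<le> g z * norm (X n - r0)"
        proof (rule field_differentiable_bound[where S="ball r0 e" and f'="\<lambda>r. f' r z"])
          show "((\<lambda>r. f r z) has_field_derivative f' r z) (at r within ball r0 e)" if "r \<in> ball r0 e" for r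
            using der[OF z] that e by (blast intro: has_field_derivative_at_within)
          show "norm (f' r z) \<le> g z" if "r \<in> ball r0 e" for r
            using bd[OF z] that e by auto
        qed (use X e in auto)
        then show "norm ((f (X n) z - f r0 z) / (X n - r0)) \<le> g z"
          using XI[of n] by (simp add: field_simps)
      qed
    qed (use g int XI I meas in \<open>auto intro!: borel_measurable_integrable borel_measurable_divide borel_measurable_diff\<close>)
    then show "(\<lambda>n. ((LINT z|M. f (X n) z) - (LINT z|M. f r0 z)) / (X n - r0)) \<longlonglongrightarrow> (LINT z|M. f' r0 z)"
      using int XI I by simp
  qed
  then show ?thesis
    using e by (simp add: has_field_derivative_iff at_within_open[of r0 "ball r0 e"])
qed

text \<open>The second argument is a parameter, and the bound is uniform over it. Bounded functions
  would be too narrow a class, since the exponentials of solutions that serve as weights later grow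
  exponentially; such growth is still integrable against every Gaussian. The one-point parameter set
  in \<open>egrow1\<close> covers functions without a parameter.\<close>

definition egrow :: "'a set \<Rightarrow> (real \<Rightarrow> 'a \<Rightarrow> real) \<Rightarrow> bool" where
  "egrow I h \<longleftrightarrow> (\<exists>C c. 0 \<le> C \<and> 0 \<le> c \<and> (\<forall>y. \<forall>r\<in>I. \<bar>h y r\<bar> \<le> C * exp (c * \<bar>y\<bar>)))"

abbreviation egrow1 :: "(real \<Rightarrow> real) \<Rightarrow> bool" where
  "egrow1 g \<equiv> egrow {()} (\<lambda>y _. g y)"

lemma egrowI:
  assumes "\<And>y r. r \<in> I \<Longrightarrow> \<bar>h y r\<bar> \<le> C * exp (c * \<bar>y\<bar>)"
  shows "egrow I h"
proof -
  have "\<bar>h y r\<bar> \<le> \<bar>C\<bar> * exp (\<bar>c\<bar> * \<bar>y\<bar>)" if "r \<in> I" for y r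
  proof -
    have "C * exp (c * \<bar>y\<bar>) \<le> \<bar>C\<bar> * exp (\<bar>c\<bar> * \<bar>y\<bar>)"
      by (intro mult_mono) (auto intro!: mult_right_mono)
    then show ?thesis using assms[OF that, of y] by linarith
  qed
  then show ?thesis unfolding egrow_def by (intro exI[of _ "\<bar>C\<bar>"] exI[of _ "\<bar>c\<bar>"]) auto
qed

lemma egrowE:
  assumes "egrow I h"
  obtains C c where "0 \<le> C" "0 \<le> c" "\<And>y r. r \<in> I \<Longrightarrow> \<bar>h y r\<bar> \<le> C * exp (c * \<bar>y\<bar>)"
  using assms unfolding egrow_def by blast

lemma egrow_bounded: "(\<And>y r. r \<in> I \<Longrightarrow> \<bar>h y r\<bar> \<le> C) \<Longrightarrow> egrow I h"
  by (rule egrowI[of _ _ C 0]) auto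

lemma egrow_slice: "egrow I h \<Longrightarrow> r \<in> I \<Longrightarrow> egrow1 (\<lambda>y. h y r)"
  unfolding egrow_def by blast

lemma egrow_mult:
  assumes "egrow I h" "egrow I k" shows "egrow I (\<lambda>y r. h y r * k y r)"
proof -
  obtain C c where C: "0 \<le> C" "0 \<le> c" "\<And>y r. r \<in> I \<Longrightarrow> \<bar>h y r\<bar> \<le> C * exp (c * \<bar>y\<bar>)"
    using assms(1) by (rule egrowE) blast
  obtain D d where D: "0 \<le> D" "0 \<le> d" "\<And>y r. r \<in> I \<Longrightarrow> \<bar>k y r\<bar> \<le> D * exp (d * \<bar>y\<bar>)"
    using assms(2) by (rule egrowE) blast
  show ?thesis
  proof (rule egrowI[of _ _ "C * D" "c + d"])
    fix y r assume r: "r \<in> I"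
    have "\<bar>h y r * k y r\<bar> \<le> (C * exp (c * \<bar>y\<bar>)) * (D * exp (d * \<bar>y\<bar>))"
      unfolding abs_mult using C D r by (intro mult_mono) auto
    then show "\<bar>h y r * k y r\<bar> \<le> C * D * exp ((c + d) * \<bar>y\<bar>)"
      by (simp add: algebra_simps exp_add)
  qed
qed

lemma egrow_const: "egrow I (\<lambda>y r. C)"
  by (rule egrow_bounded[of _ _ "\<bar>C\<bar>"]) auto

lemma egrow_time:
  assumes "\<And>r. r \<in> I \<Longrightarrow> \<bar>k r\<bar> \<le> C" "egrow I h" shows "egrow I (\<lambda>y r. k r * h y r)"
  by (rule egrow_mult[OF egrow_bounded assms(2)]) (rule assms(1))

lemma shift_growth:
  fixes \<sigma> :: real
  assumes g: "\<And>y. \<bar>g y\<bar> \<le> C * exp (c * \<bar>y\<bar>)" and C: "0 \<le> C" "0 \<le> c"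
    and X: "\<bar>x\<bar> \<le> X" and S: "\<bar>\<sigma>\<bar> \<le> S"
  shows "\<bar>g (x + z * \<sigma>)\<bar> \<le> (C * exp (c * X)) * exp ((c * S) * \<bar>z\<bar>)"
proof -
  have "\<bar>x + z * \<sigma>\<bar> \<le> X + S * \<bar>z\<bar>"
    using X mult_right_mono[OF S, of "\<bar>z\<bar>"] abs_triangle_ineq[of x "z * \<sigma>"]
    by (simp add: abs_mult mult.commute)
  then have "c * \<bar>x + z * \<sigma>\<bar> \<le> c * (X + S * \<bar>z\<bar>)"
    using C by (intro mult_left_mono)
  then have "C * exp (c * \<bar>x + z * \<sigma>\<bar>) \<le> C * exp (c * (X + S * \<bar>z\<bar>))"
    using C by (intro mult_left_mono) auto
  also have "\<dots> = (C * exp (c * X)) * exp ((c * S) * \<bar>z\<bar>)"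
    by (simp add: algebra_simps exp_add)
  finally show ?thesis using g[of "x + z * \<sigma>"] by linarith
qed

lemma integrable_shift:
  assumes "continuous_on UNIV g" "egrow1 g"
  shows "integrable gaussian (\<lambda>z. g (x + z * \<sigma>))"
proof -
  obtain C c where C: "0 \<le> C" "0 \<le> c" "\<And>y. \<bar>g y\<bar> \<le> C * exp (c * \<bar>y\<bar>)"
    using assms(2) by (rule egrowE) blast
  have "continuous_on UNIV (\<lambda>z. g (x + z * \<sigma>))"
    by (intro continuous_on_compose2[OF assms(1)] continuous_intros) auto
  then have m: "(\<lambda>z. g (x + z * \<sigma>)) \<in> borel_measurable borel"
    by (rule borel_measurable_continuous_onI)
  show ?thesis
    by (rule integrable_gaussian_bound[OF m shift_growth[OF C(3) C(1,2) order_refl order_refl]])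
qed

text \<open>Ito's formula for a Gaussian whose standard deviation depends on \<open>r\<close>. The
  chain rule produces a factor \<open>z\<close> in front of the first space derivative, and
  integration by parts trades it for a second space derivative times \<sigma>.\<close>

lemma gauss_deriv:
  fixes h h1 hr :: "real \<Rightarrow> real \<Rightarrow> real"
  assumes I: "open I" "r0 \<in> I"
    and \<sigma>: "\<And>r. r \<in> I \<Longrightarrow> (\<sigma> has_real_derivative \<sigma>' r) (at r)" "continuous_on I \<sigma>'"
    and d0: "\<And>y r. r \<in> I \<Longrightarrow> ((\<lambda>y. h y r) has_real_derivative h1 y r) (at y)"
    and d1: "\<And>y. ((\<lambda>y. h1 y r0) has_real_derivative h2 y) (at y)"
    and dr: "\<And>y r. r \<in> I \<Longrightarrow> ((\<lambda>r. h y r) has_real_derivative hr y r) (at r)"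
    and c1: "continuous_on (UNIV \<times> I) (\<lambda>(y, r). h1 y r)"
    and cr: "continuous_on (UNIV \<times> I) (\<lambda>(y, r). hr y r)"
    and c2: "continuous_on UNIV h2"
    and g: "egrow I h" "egrow I h1" "egrow I hr" "egrow1 h2"
  shows "((\<lambda>r. LINT z|gaussian. h (x + z * \<sigma> r) r) has_real_derivative
    (\<sigma> r0 * \<sigma>' r0 * (LINT z|gaussian. h2 (x + z * \<sigma> r0)) + (LINT z|gaussian. hr (x + z * \<sigma> r0) r0))) (at r0)"
proof -
  obtain e where e: "e > 0" "cball r0 e \<subseteq> I" using I open_contains_cball by blast
  have \<sigma>c: "continuous_on I \<sigma>"
    by (rule DERIV_continuous_on[OF has_field_derivative_at_within[OF \<sigma>(1)]])
  have "\<exists>S. \<forall>r\<in>cball r0 e. \<bar>\<sigma> r\<bar> \<le> S"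
    using compact_imp_bounded[OF compact_continuous_image[OF continuous_on_subset[OF \<sigma>c e(2)] compact_cball]]
    unfolding bounded_iff by auto
  then obtain S1 where S1: "\<And>r. r \<in> cball r0 e \<Longrightarrow> \<bar>\<sigma> r\<bar> \<le> S1" by blast
  have "\<exists>S. \<forall>r\<in>cball r0 e. \<bar>\<sigma>' r\<bar> \<le> S"
    using compact_imp_bounded[OF compact_continuous_image[OF continuous_on_subset[OF \<sigma>(2) e(2)] compact_cball]]
    unfolding bounded_iff by auto
  then obtain S2 where S2: "\<And>r. r \<in> cball r0 e \<Longrightarrow> \<bar>\<sigma>' r\<bar> \<le> S2" by blast
  have S2p: "0 \<le> S2" using S2[of r0] e by auto
  let ?J = "ball r0 e"
  have JI: "r \<in> I" "\<bar>\<sigma> r\<bar> \<le> S1" "\<bar>\<sigma>' r\<bar> \<le> S2" if "r \<in> ?J" for r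
    using e S1 S2 that by auto
  have sl: "continuous_on UNIV (\<lambda>y. k y r)" if "continuous_on (UNIV \<times> I) (\<lambda>(y, r). k y r)" "r \<in> I"
    for k :: "real \<Rightarrow> real \<Rightarrow> real" and r
  proof -
    have "continuous_on UNIV (\<lambda>y. (y, r))" by (intro continuous_intros)
    from continuous_on_compose2[OF that(1) this] that(2) show ?thesis by auto
  qed
  have h0c: "continuous_on UNIV (\<lambda>y. h y r)" if "r \<in> I" for r
    by (rule DERIV_continuous_on[OF has_field_derivative_at_within[OF d0[OF that]]])
  obtain C1 a1 where C1: "0 \<le> C1" "0 \<le> a1" "\<And>y r. r \<in> I \<Longrightarrow> \<bar>h1 y r\<bar> \<le> C1 * exp (a1 * \<bar>y\<bar>)"
    using g(2) by (rule egrowE) blast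
  obtain C3 a3 where C3: "0 \<le> C3" "0 \<le> a3" "\<And>y r. r \<in> I \<Longrightarrow> \<bar>hr y r\<bar> \<le> C3 * exp (a3 * \<bar>y\<bar>)"
    using g(3) by (rule egrowE) blast
  obtain C2 a2 where C2: "0 \<le> C2" "0 \<le> a2" "\<And>y. \<bar>h2 y\<bar> \<le> C2 * exp (a2 * \<bar>y\<bar>)"
    using g(4) by (rule egrowE) blast
  \<comment> \<open>\<open>f'\<close> is the plain chain-rule derivative in \<open>r\<close>. In the
    majorant \<open>G\<close> the stray factor \<open>z\<close> is bounded by
    \<open>exp \<bar>z\<bar>\<close>, whence the \<open>+ 1\<close> in the exponent.\<close>
  define f' where "f' = (\<lambda>r z. z * (\<sigma>' r * h1 (x + z * \<sigma> r) r) + hr (x + z * \<sigma> r) r)"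
  define G where "G = (\<lambda>z. S2 * (C1 * exp (a1 * \<bar>x\<bar>)) * exp ((a1 * S1 + 1) * \<bar>z\<bar>) + (C3 * exp (a3 * \<bar>x\<bar>)) * exp ((a3 * S1) * \<bar>z\<bar>))"
  have "((\<lambda>r. LINT z|gaussian. h (x + z * \<sigma> r) r) has_real_derivative (LINT z|gaussian. f' r0 z)) (at r0)"
  proof (rule has_real_derivative_integral[of ?J _ _ _ f' G])
    show "integrable gaussian (\<lambda>z. h (x + z * \<sigma> r) r)" if "r \<in> ?J" for r
      by (rule integrable_shift[OF h0c egrow_slice[OF g(1)]]) (use JI that in auto)
    show "integrable gaussian G"
      unfolding G_def by (intro Bochner_Integration.integrable_add integrable_mult_right integrable_gaussian_exp_abs)
    show "\<bar>f' r z\<bar> \<le> G z" if "r \<in> ?J" for r z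
    proof -
      have A: "\<bar>h1 (x + z * \<sigma> r) r\<bar> \<le> (C1 * exp (a1 * \<bar>x\<bar>)) * exp ((a1 * S1) * \<bar>z\<bar>)"
        by (rule shift_growth[of "\<lambda>y. h1 y r"]) (use C1 JI that in auto)
      have B: "\<bar>hr (x + z * \<sigma> r) r\<bar> \<le> (C3 * exp (a3 * \<bar>x\<bar>)) * exp ((a3 * S1) * \<bar>z\<bar>)"
        by (rule shift_growth[of "\<lambda>y. hr y r"]) (use C3 JI that in auto)
      have "\<bar>z * (\<sigma>' r * h1 (x + z * \<sigma> r) r)\<bar> \<le> exp \<bar>z\<bar> * (S2 * ((C1 * exp (a1 * \<bar>x\<bar>)) * exp ((a1 * S1) * \<bar>z\<bar>)))"
        unfolding abs_mult by (intro mult_mono abs_le_exp_abs A JI that) (use S2p in auto)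
      also have "\<dots> = S2 * (C1 * exp (a1 * \<bar>x\<bar>)) * exp ((a1 * S1 + 1) * \<bar>z\<bar>)"
        by (simp add: algebra_simps exp_add)
      finally show ?thesis using B unfolding f'_def G_def by linarith
    qed
    show "((\<lambda>r. h (x + z * \<sigma> r) r) has_real_derivative f' r z) (at r)" if rJ: "r \<in> ?J" for r z
    proof -
      \<comment> \<open>Both arguments of \<open>h\<close> move with \<open>r\<close>. Joint
        differentiability follows from the two partial derivatives once the one in \<open>y\<close>
        is jointly continuous.\<close>
      have "((\<lambda>(r, y). h y r) has_derivative (\<lambda>(tr, ty). (hr (x + z * \<sigma> r) r) * tr + blinfun_mult_right (h1 (x + z * \<sigma> r) r) ty))
          (at (r, x + z * \<sigma> r) within ?J \<times> UNIV)"
      proof (rule has_derivative_partialsI)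
        have dr': "((\<lambda>r'. h (x + z * \<sigma> r) r') has_derivative (\<lambda>t. hr (x + z * \<sigma> r) r * t)) (at r)"
          using dr[OF JI(1)[OF rJ]] by (simp add: has_field_derivative_def)
        then show "((\<lambda>r'. h (x + z * \<sigma> r) r') has_derivative (\<lambda>t. hr (x + z * \<sigma> r) r * t)) (at r within ?J)"
          by (rule has_derivative_at_withinI)
        show "((\<lambda>y. h y r') has_derivative blinfun_apply (blinfun_mult_right (h1 y r'))) (at y within UNIV)"
          if "r' \<in> ?J" for r' y
          using d0[OF JI(1)[OF that]] by (simp add: has_field_derivative_def)
        have "continuous_on (?J \<times> UNIV) (\<lambda>(r, y). h1 y r)"
        proof -
          have "continuous_on (?J \<times> (UNIV :: real set)) (\<lambda>p. (snd p, fst p))" by (intro continuous_intros)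
          moreover have "(\<lambda>p. (snd p, fst p)) ` (?J \<times> (UNIV :: real set)) \<subseteq> UNIV \<times> I" using JI(1) by auto
          ultimately show ?thesis using continuous_on_compose2[OF c1] by (fastforce simp: case_prod_beta)
        qed
        then have "continuous_on (?J \<times> UNIV) (\<lambda>p. blinfun_mult_right (h1 (snd p) (fst p)))"
          by (intro continuous_intros) (simp add: case_prod_beta)
        then show "continuous (at (r, x + z * \<sigma> r) within ?J \<times> UNIV) (\<lambda>(r, y). blinfun_mult_right (h1 y r))"
          using rJ unfolding case_prod_beta continuous_on_eq_continuous_within by auto
      qed auto
      then have D: "((\<lambda>(r, y). h y r) has_derivative (\<lambda>(tr, ty). (hr (x + z * \<sigma> r) r) * tr + h1 (x + z * \<sigma> r) r * ty))
          (at (r, x + z * \<sigma> r))"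
        using rJ by (simp add: at_within_open[of _ "?J \<times> UNIV"] open_Times)
      have E: "((\<lambda>r. (r, x + z * \<sigma> r)) has_derivative (\<lambda>t. (t, z * (\<sigma>' r * t)))) (at r)"
        using \<sigma>(1)[OF JI(1)[OF rJ]]
        by (auto simp: has_field_derivative_def intro!: derivative_eq_intros)
      have "(\<lambda>t. (hr (x + z * \<sigma> r) r) * t + h1 (x + z * \<sigma> r) r * (z * (\<sigma>' r * t))) = (\<lambda>t. f' r z * t)"
        by (auto simp: f'_def algebra_simps)
      with has_derivative_compose[OF E D] show ?thesis
        by (simp add: has_field_derivative_def)
    qed
    show "f' r0 \<in> borel_measurable gaussian"
    proof -
      have "continuous_on UNIV (f' r0)"
        unfolding f'_def
        by (intro continuous_intros continuous_on_compose2[OF sl[OF c1 I(2)]] continuous_on_compose2[OF sl[OF cr I(2)]]) auto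
      then show ?thesis by (simp add: borel_measurable_continuous_onI)
    qed
  qed (use e in auto)
  moreover have "(LINT z|gaussian. f' r0 z) = \<sigma> r0 * \<sigma>' r0 * (LINT z|gaussian. h2 (x + z * \<sigma> r0)) + (LINT z|gaussian. hr (x + z * \<sigma> r0) r0)"
  proof -
    have S: "(LINT z|gaussian. z * (\<sigma>' r0 * h1 (x + z * \<sigma> r0) r0)) = (LINT z|gaussian. \<sigma>' r0 * (h2 (x + z * \<sigma> r0) * \<sigma> r0))"
    proof (rule gaussian_by_parts)
      show "((\<lambda>z. \<sigma>' r0 * h1 (x + z * \<sigma> r0) r0) has_real_derivative \<sigma>' r0 * (h2 (x + z * \<sigma> r0) * \<sigma> r0)) (at z)" for z
        by (intro DERIV_cmult DERIV_chain2[OF d1]) (auto intro!: derivative_eq_intros)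
      show "continuous_on UNIV (\<lambda>z. \<sigma>' r0 * (h2 (x + z * \<sigma> r0) * \<sigma> r0))"
        by (intro continuous_intros continuous_on_compose2[OF c2]) auto
      show "\<bar>\<sigma>' r0 * h1 (x + z * \<sigma> r0) r0\<bar> \<le> (\<bar>\<sigma>' r0\<bar> * (C1 * exp (a1 * \<bar>x\<bar>))) * exp ((a1 * \<bar>\<sigma> r0\<bar>) * \<bar>z\<bar>)" for z
        using mult_left_mono[OF shift_growth[of "\<lambda>y. h1 y r0", OF C1(3)[OF I(2)] C1(1,2) order_refl order_refl], of "\<bar>\<sigma>' r0\<bar>" x z "\<sigma> r0"]
        by (simp add: abs_mult mult.assoc)
      show "\<bar>\<sigma>' r0 * (h2 (x + z * \<sigma> r0) * \<sigma> r0)\<bar> \<le> (\<bar>\<sigma>' r0 * \<sigma> r0\<bar> * (C2 * exp (a2 * \<bar>x\<bar>))) * exp ((a2 * \<bar>\<sigma> r0\<bar>) * \<bar>z\<bar>)" for z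
        using mult_left_mono[OF shift_growth[of h2, OF C2(3) C2(1,2) order_refl order_refl], of "\<bar>\<sigma>' r0 * \<sigma> r0\<bar>" x z "\<sigma> r0"]
        by (simp add: abs_mult mult_ac)
    qed
    have i1: "integrable gaussian (\<lambda>z. z * (\<sigma>' r0 * h1 (x + z * \<sigma> r0) r0))"
    proof (rule integrable_gaussian_bound)
      have "continuous_on UNIV (\<lambda>z. z * (\<sigma>' r0 * h1 (x + z * \<sigma> r0) r0))"
        by (intro continuous_intros continuous_on_compose2[OF sl[OF c1 I(2)]]) auto
      then show "(\<lambda>z. z * (\<sigma>' r0 * h1 (x + z * \<sigma> r0) r0)) \<in> borel_measurable borel"
        by (rule borel_measurable_continuous_onI)
      fix z
      have A: "\<bar>h1 (x + z * \<sigma> r0) r0\<bar> \<le> (C1 * exp (a1 * \<bar>x\<bar>)) * exp ((a1 * \<bar>\<sigma> r0\<bar>) * \<bar>z\<bar>)"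
        by (rule shift_growth[of "\<lambda>y. h1 y r0", OF C1(3)[OF I(2)] C1(1,2) order_refl order_refl])
      have "\<bar>z * (\<sigma>' r0 * h1 (x + z * \<sigma> r0) r0)\<bar> \<le> exp \<bar>z\<bar> * (\<bar>\<sigma>' r0\<bar> * ((C1 * exp (a1 * \<bar>x\<bar>)) * exp ((a1 * \<bar>\<sigma> r0\<bar>) * \<bar>z\<bar>)))"
        unfolding abs_mult by (intro mult_mono abs_le_exp_abs A) auto
      then show "\<bar>z * (\<sigma>' r0 * h1 (x + z * \<sigma> r0) r0)\<bar> \<le> (\<bar>\<sigma>' r0\<bar> * (C1 * exp (a1 * \<bar>x\<bar>))) * exp ((a1 * \<bar>\<sigma> r0\<bar> + 1) * \<bar>z\<bar>)"
        by (simp add: algebra_simps exp_add)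
    qed
    have i2: "integrable gaussian (\<lambda>z. hr (x + z * \<sigma> r0) r0)"
      by (rule integrable_shift[OF sl[OF cr I(2)] egrow_slice[OF g(3) I(2)]])
    have "(LINT z|gaussian. f' r0 z) = (LINT z|gaussian. \<sigma>' r0 * (h2 (x + z * \<sigma> r0) * \<sigma> r0)) + (LINT z|gaussian. hr (x + z * \<sigma> r0) r0)"
      unfolding f'_def by (subst Bochner_Integration.integral_add[OF i1 i2]) (simp only: S)
    then show ?thesis by (simp add: mult_ac)
  qed
  ultimately show ?thesis by simp
qed

section \<open>The heat semigroup, with time as the variance\<close>

definition heat :: "real \<Rightarrow> (real \<Rightarrow> real) \<Rightarrow> real \<Rightarrow> real" where
  "heat \<tau> g x = (LINT z|gaussian. g (x + z * sqrt \<tau>))"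

lemma heat_0 [simp]: "heat 0 g x = g x"
  using prob_space.prob_space[OF prob_space_gaussian] by (simp add: heat_def)

lemma heat_const [simp]: "heat \<tau> (\<lambda>_. c) x = c"
  using prob_space.prob_space[OF prob_space_gaussian] by (simp add: heat_def)

lemma heat_add:
  assumes "continuous_on UNIV f" "egrow1 f" "continuous_on UNIV g" "egrow1 g"
  shows "heat \<tau> (\<lambda>y. a * f y + b * g y) x = a * heat \<tau> f x + b * heat \<tau> g x"
  unfolding heat_def using integrable_shift[OF assms(1,2)] integrable_shift[OF assms(3,4)] by simp

lemma heat_mono:
  assumes "continuous_on UNIV f" "egrow1 f" "continuous_on UNIV g" "egrow1 g" "\<And>y. f y \<le> g y"
  shows "heat \<tau> f x \<le> heat \<tau> g x"
  unfolding heat_def by (intro integral_mono integrable_shift assms)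

lemma heat_cmult: "heat \<tau> (\<lambda>y. c * f y) x = c * heat \<tau> f x"
  unfolding heat_def by simp

lemma heat_pos:
  assumes "continuous_on UNIV f" "egrow1 f" "\<And>y. 0 < f y"
  shows "0 < heat \<tau> f x"
proof -
  interpret prob_space gaussian by (rule prob_space_gaussian)
  have i: "integrable gaussian (\<lambda>z. f (x + z * sqrt \<tau>))" by (intro integrable_shift assms)
  have "0 \<le> heat \<tau> f x" unfolding heat_def using assms(3) by (intro Bochner_Integration.integral_nonneg) (auto simp: less_imp_le)
  moreover have "heat \<tau> f x \<noteq> 0"
  proof
    assume "heat \<tau> f x = 0"
    then have "AE z in gaussian. f (x + z * sqrt \<tau>) = 0"
      unfolding heat_def using integral_nonneg_eq_0_iff_AE[OF i] assms(3) by (auto simp: less_imp_le)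
    then have "AE z in gaussian. False" using assms(3) by (auto elim!: eventually_mono simp: less_le)
    then show False by simp
  qed
  ultimately show ?thesis by simp
qed

text \<open>The integrands are evaluated at points that move with \<open>n\<close>, so the
  convergence asked for in \<open>lim\<close> is continuous convergence. Convergent sequences are
  bounded, which yields one majorant for all \<open>n\<close>.\<close>

lemma heat_tendsto:
  assumes c: "\<And>n. continuous_on UNIV (F n)" "continuous_on UNIV f"
    and b: "\<And>n y. \<bar>F n y\<bar> \<le> C * exp (c * \<bar>y\<bar>)" and C: "0 \<le> C" "0 \<le> c"
    and \<tau>: "t \<longlonglongrightarrow> \<tau>" and x: "X \<longlonglongrightarrow> x"
    and lim: "\<And>y z. y \<longlonglongrightarrow> z \<Longrightarrow> (\<lambda>n. F n (y n)) \<longlonglongrightarrow> f z"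
  shows "(\<lambda>n. heat (t n) (F n) (X n)) \<longlonglongrightarrow> heat \<tau> f x"
proof -
  have st: "(\<lambda>n. sqrt (t n)) \<longlonglongrightarrow> sqrt \<tau>" by (intro tendsto_intros \<tau>)
  obtain S where S: "\<And>n. \<bar>sqrt (t n)\<bar> \<le> S" using convergent_imp_Bseq[OF convergentI[OF st]] unfolding Bseq_def by auto
  obtain B where B: "\<And>n. \<bar>X n\<bar> \<le> B" using convergent_imp_Bseq[OF convergentI[OF x]] unfolding Bseq_def by auto
  show ?thesis unfolding heat_def
  proof (rule integral_dominated_convergence[where w="\<lambda>z. (C * exp (c * B)) * exp ((c * S) * \<bar>z\<bar>)"])
    show "integrable gaussian (\<lambda>z. (C * exp (c * B)) * exp ((c * S) * \<bar>z\<bar>))"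
      by (intro integrable_mult_right integrable_gaussian_exp_abs)
    show "AE z in gaussian. (\<lambda>n. F n (X n + z * sqrt (t n))) \<longlonglongrightarrow> f (x + z * sqrt \<tau>)"
      by (intro AE_I2 lim tendsto_intros x st)
    show "AE z in gaussian. norm (F n (X n + z * sqrt (t n))) \<le> (C * exp (c * B)) * exp ((c * S) * \<bar>z\<bar>)" for n
      using shift_growth[of "F n", OF b C B S] by (intro AE_I2) simp
    show "(\<lambda>z. f (x + z * sqrt \<tau>)) \<in> borel_measurable gaussian"
      using continuous_on_compose2[OF c(2), of UNIV "\<lambda>z. x + z * sqrt \<tau>"]
      by (simp add: borel_measurable_continuous_onI continuous_intros)
    show "(\<lambda>z. F n (X n + z * sqrt (t n))) \<in> borel_measurable gaussian" for n
      using continuous_on_compose2[OF c(1)[of n], of UNIV "\<lambda>z. X n + z * sqrt (t n)"]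
      by (simp add: borel_measurable_continuous_onI continuous_intros)
  qed
qed

text \<open>Continuity holds on the whole plane because \<open>sqrt\<close> is extended to negative
  arguments as an odd continuous function.\<close>

lemma heat_continuous:
  assumes "continuous_on UNIV g" "egrow1 g"
  shows "continuous_on UNIV (\<lambda>(x, \<tau>). heat \<tau> g x)"
proof -
  obtain C c where C: "0 \<le> C" "0 \<le> c" "\<And>y. \<bar>g y\<bar> \<le> C * exp (c * \<bar>y\<bar>)"
    using assms(2) by (rule egrowE) blast
  show ?thesis
    unfolding continuous_on_sequentially comp_def
  proof (intro ballI allI impI)
    fix X :: "nat \<Rightarrow> real \<times> real" and a assume "(\<forall>n. X n \<in> UNIV) \<and> X \<longlonglongrightarrow> a"
    then have X: "(\<lambda>n. fst (X n)) \<longlonglongrightarrow> fst a" "(\<lambda>n. snd (X n)) \<longlonglongrightarrow> snd a"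
      by (auto intro: tendsto_intros)
    show "(\<lambda>n. case X n of (x, \<tau>) \<Rightarrow> heat \<tau> g x) \<longlonglongrightarrow> (case a of (x, \<tau>) \<Rightarrow> heat \<tau> g x)"
      unfolding case_prod_beta
      by (rule heat_tendsto[OF assms(1) assms(1) C(3) C(1,2) X(2,1)])
         (use assms(1) in \<open>auto intro: isCont_tendsto_compose simp: continuous_on_eq_continuous_at\<close>)
  qed
qed

lemma heat_deriv:
  assumes "\<And>y. (g has_real_derivative g' y) (at y)" "continuous_on UNIV g'" "egrow1 g" "egrow1 g'"
  shows "(heat \<tau> g has_real_derivative heat \<tau> g' x) (at x)"
proof -
  have gc: "continuous_on UNIV g"
    by (rule DERIV_continuous_on[OF has_field_derivative_at_within[OF assms(1)]])
  obtain C c where C: "0 \<le> C" "0 \<le> c" "\<And>y. \<bar>g' y\<bar> \<le> C * exp (c * \<bar>y\<bar>)"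
    using assms(4) by (rule egrowE) blast
  define B where "B = \<bar>x\<bar> + 1"
  have "((\<lambda>x. LINT z|gaussian. g (x + z * sqrt \<tau>)) has_real_derivative (LINT z|gaussian. g' (x + z * sqrt \<tau>))) (at x)"
  proof (rule has_real_derivative_integral[of "ball x 1" _ _ _ "\<lambda>x z. g' (x + z * sqrt \<tau>)" "\<lambda>z. (C * exp (c * B)) * exp ((c * \<bar>sqrt \<tau>\<bar>) * \<bar>z\<bar>)"])
    show "integrable gaussian (\<lambda>z. g (r + z * sqrt \<tau>))" for r
      by (intro integrable_shift gc assms)
    show "integrable gaussian (\<lambda>z. (C * exp (c * B)) * exp ((c * \<bar>sqrt \<tau>\<bar>) * \<bar>z\<bar>))"
      by (intro integrable_mult_right integrable_gaussian_exp_abs)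
    show "((\<lambda>r. g (r + z * sqrt \<tau>)) has_real_derivative g' (r + z * sqrt \<tau>)) (at r)" for r z
      by (rule DERIV_cong[OF DERIV_chain2[OF assms(1), where g="\<lambda>r. r + z * sqrt \<tau>" and Db=1]]) (auto intro!: derivative_eq_intros)
    show "\<bar>g' (r + z * sqrt \<tau>)\<bar> \<le> (C * exp (c * B)) * exp ((c * \<bar>sqrt \<tau>\<bar>) * \<bar>z\<bar>)" if "r \<in> ball x 1" for r z
      by (rule shift_growth[OF C(3) C(1,2)]) (use that in \<open>auto simp: B_def dist_real_def\<close>)
    show "(\<lambda>z. g' (x + z * sqrt \<tau>)) \<in> borel_measurable gaussian"
      using integrable_shift[OF assms(2,4)] by (rule borel_measurable_integrable)
  qed auto
  then show ?thesis unfolding heat_def .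
qed

lemma distributed_gaussian_scale:
  assumes "\<sigma> > 0"
  shows "distributed gaussian lborel (\<lambda>z. z * \<sigma>) (normal_density 0 \<sigma>)"
proof -
  interpret prob_space gaussian by (rule prob_space_gaussian)
  have "distributed gaussian lborel (\<lambda>z. z) std_normal_density"
    by (auto simp: distributed_def distr_id2)
  from normal_density_affine[OF this, of \<sigma> 0] assms show ?thesis by (simp add: mult.commute)
qed

text \<open>A sum of independent centred Gaussians with variances \<open>s\<close> and
  \<open>t\<close> is centred Gaussian with variance \<open>s + t\<close>. The argument runs through
  densities, so vanishing variances are split off first.\<close>

lemma heat_heat:
  assumes g: "continuous_on UNIV g" "egrow1 g" and st: "0 \<le> s" "0 \<le> t"
  shows "heat s (heat t g) x = heat (s + t) g x"
proof (cases "s = 0 \<or> t = 0")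
  case True
  moreover have "heat 0 g = g" by (rule ext) simp
  ultimately show ?thesis by auto
next
  case False
  then have pos: "0 < sqrt s" "0 < sqrt t" using st by auto
  interpret G: prob_space gaussian by (rule prob_space_gaussian)
  interpret GG: pair_prob_space gaussian gaussian ..
  let ?P = "gaussian \<Otimes>\<^sub>M gaussian"
  let ?X = "\<lambda>w::real \<times> real. fst w * sqrt s" and ?Y = "\<lambda>w::real \<times> real. snd w * sqrt t"
  have dX: "distr ?P borel ?X = distr gaussian borel (\<lambda>z. z * sqrt s)"
  proof -
    have "distr ?P borel ?X = distr (distr ?P gaussian fst) borel (\<lambda>z. z * sqrt s)"
      by (subst distr_distr) (auto simp: comp_def)
    then show ?thesis by (simp add: G.distr_pair_fst)
  qed
  have dY: "distr ?P borel ?Y = distr gaussian borel (\<lambda>z. z * sqrt t)"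
  proof -
    have "distr ?P borel ?Y = distr (distr ?P ?P (\<lambda>(x, y). (y, x))) borel ?Y"
      by (subst GG.distr_pair_swap) simp
    also have "\<dots> = distr (distr ?P gaussian fst) borel (\<lambda>z. z * sqrt t)"
      by (subst (1 2) distr_distr) (auto simp: comp_def case_prod_beta)
    finally show ?thesis by (simp add: G.distr_pair_fst)
  qed
  have db: "distributed ?P lborel V d"
    if "distr ?P borel V = distr gaussian borel v" "distributed gaussian lborel v d" "V \<in> borel_measurable ?P" for V v d
    using that by (auto simp: distributed_def cong: distr_cong)
  have "GG.indep_var borel ?X borel ?Y"
    unfolding GG.indep_var_distribution_eq
  proof (intro conjI)
    show "distr ?P borel ?X \<Otimes>\<^sub>M distr ?P borel ?Y = distr ?P (borel \<Otimes>\<^sub>M borel) (\<lambda>w. (?X w, ?Y w))"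
      unfolding dX dY
    proof (subst pair_measure_distr)
      show "sigma_finite_measure (distr gaussian borel (\<lambda>z. z * sqrt t))"
        by (intro finite_measure.sigma_finite_measure prob_space.finite_measure G.prob_space_distr) simp
    qed (auto simp: case_prod_beta')
  qed auto
  then have "distributed ?P lborel (\<lambda>w. ?X w + ?Y w) (normal_density (0 + 0) (sqrt ((sqrt s)\<^sup>2 + (sqrt t)\<^sup>2)))"
    using pos
    by (intro GG.add_indep_normal db[OF dX distributed_gaussian_scale] db[OF dY distributed_gaussian_scale]) auto
  then have D: "distributed ?P lborel (\<lambda>w. ?X w + ?Y w) (normal_density 0 (sqrt (s + t)))"
    using st by simp
  have D': "distributed gaussian lborel (\<lambda>z. z * sqrt (s + t)) (normal_density 0 (sqrt (s + t)))"
    by (rule distributed_gaussian_scale) (use pos st in \<open>auto simp: add_pos_nonneg\<close>)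
  have [measurable]: "(\<lambda>y. g (x + y)) \<in> borel_measurable borel"
    by (intro borel_measurable_continuous_onI continuous_on_compose2[OF g(1)] continuous_intros) auto
  have "heat (s + t) g x = (LINT y|lborel. normal_density 0 (sqrt (s + t)) y * g (x + y))"
    unfolding heat_def by (subst distributed_integral[OF D']) auto
  also have "\<dots> = (LINT w|?P. g (x + (?X w + ?Y w)))"
    by (subst distributed_integral[OF D]) auto
  also have "\<dots> = (LINT z|gaussian. LINT w|gaussian. g (x + (z * sqrt s + w * sqrt t)))"
  proof -
    obtain C c where C: "0 \<le> C" "0 \<le> c" "\<And>y. \<bar>g y\<bar> \<le> C * exp (c * \<bar>y\<bar>)"
      using g(2) by (rule egrowE) blast
    \<comment> \<open>A majorant on the product space for Fubini: the exponential of a sum of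
      absolute values factorises into one-variable exponentials.\<close>
    have "integrable ?P (\<lambda>w. g (x + (?X w + ?Y w)))"
    proof (rule Bochner_Integration.integrable_bound)
      show "integrable ?P (\<lambda>(z, w). (C * exp (c * \<bar>x\<bar>) * exp ((c * sqrt s) * \<bar>z\<bar>)) * exp ((c * sqrt t) * \<bar>w\<bar>))"
        by (rule GG.Fubini_integrable)
           (auto simp: abs_mult C intro!: integrable_mult_right integrable_mult_left integrable_gaussian_exp_abs)
      have "continuous_on UNIV (\<lambda>w. g (x + (?X w + ?Y w)))"
        by (intro continuous_on_compose2[OF g(1)] continuous_intros) auto
      then have "(\<lambda>w. g (x + (?X w + ?Y w))) \<in> borel_measurable (borel :: (real \<times> real) measure)"
        by (rule borel_measurable_continuous_onI)
      then show "(\<lambda>w. g (x + (?X w + ?Y w))) \<in> borel_measurable ?P"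
        by (simp add: borel_prod[symmetric] cong: measurable_cong_sets)
    next
      show "AE p in ?P. norm (g (x + (?X p + ?Y p))) \<le> norm (case p of (z, w) \<Rightarrow> (C * exp (c * \<bar>x\<bar>) * exp ((c * sqrt s) * \<bar>z\<bar>)) * exp ((c * sqrt t) * \<bar>w\<bar>))"
      proof (rule AE_I2)
        fix p :: "real \<times> real"
        obtain z w where p: "p = (z, w)" by (cases p)
        have A: "\<bar>g (x + (z * sqrt s + w * sqrt t))\<bar> \<le> C * exp (c * \<bar>x + (z * sqrt s + w * sqrt t)\<bar>)" by (rule C)
        have "\<bar>x + (z * sqrt s + w * sqrt t)\<bar> \<le> \<bar>x\<bar> + \<bar>z\<bar> * sqrt s + \<bar>w\<bar> * sqrt t"
          using st abs_triangle_ineq[of x "z * sqrt s + w * sqrt t"] abs_triangle_ineq[of "z * sqrt s" "w * sqrt t"]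
          by (simp add: abs_mult)
        then have "c * \<bar>x + (z * sqrt s + w * sqrt t)\<bar> \<le> c * (\<bar>x\<bar> + \<bar>z\<bar> * sqrt s + \<bar>w\<bar> * sqrt t)"
          using C by (intro mult_left_mono)
        then have "C * exp (c * \<bar>x + (z * sqrt s + w * sqrt t)\<bar>) \<le> C * exp (c * (\<bar>x\<bar> + \<bar>z\<bar> * sqrt s + \<bar>w\<bar> * sqrt t))"
          using C by (intro mult_left_mono) auto
        also have "\<dots> = (C * exp (c * \<bar>x\<bar>) * exp ((c * sqrt s) * \<bar>z\<bar>)) * exp ((c * sqrt t) * \<bar>w\<bar>)"
          by (simp add: algebra_simps exp_add)
        finally show "norm (g (x + (?X p + ?Y p))) \<le> norm (case p of (z, w) \<Rightarrow> (C * exp (c * \<bar>x\<bar>) * exp ((c * sqrt s) * \<bar>z\<bar>)) * exp ((c * sqrt t) * \<bar>w\<bar>))"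
          using order_trans[OF A] C(1) by (simp add: p)
      qed
    qed
    then show ?thesis by (subst GG.integral_fst'[symmetric]) auto
  qed
  also have "\<dots> = heat s (heat t g) x"
    unfolding heat_def by (simp add: add.assoc)
  finally show ?thesis ..
qed

section \<open>Bounded smooth functions of space with a time parameter\<close>

definition bcont :: "real set \<Rightarrow> (real \<Rightarrow> real \<Rightarrow> real) \<Rightarrow> bool" where
  "bcont U g \<longleftrightarrow> continuous_on (UNIV \<times> U) (\<lambda>(x, u). g x u) \<and> (\<exists>C. \<forall>x. \<forall>u\<in>U. \<bar>g x u\<bar> \<le> C)"

lemma bcontI:
  "continuous_on (UNIV \<times> U) (\<lambda>(x, u). g x u) \<Longrightarrow> (\<And>x u. u \<in> U \<Longrightarrow> \<bar>g x u\<bar> \<le> C) \<Longrightarrow> bcont U g"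
  unfolding bcont_def by blast

lemma bcontE:
  assumes "bcont U g"
  obtains C where "0 \<le> C" "\<And>x u. u \<in> U \<Longrightarrow> \<bar>g x u\<bar> \<le> C"
proof -
  obtain C where "\<forall>x. \<forall>u\<in>U. \<bar>g x u\<bar> \<le> C" using assms unfolding bcont_def by blast
  then have "\<And>x u. u \<in> U \<Longrightarrow> \<bar>g x u\<bar> \<le> \<bar>C\<bar>" by (meson abs_ge_self order_trans)
  then show ?thesis using that[of "\<bar>C\<bar>"] by auto
qed

lemma bcont_cont: "bcont U g \<Longrightarrow> continuous_on (UNIV \<times> U) (\<lambda>(x, u). g x u)"
  unfolding bcont_def by blast

lemma bcont_cong:
  assumes "bcont U g" "\<And>x u. u \<in> U \<Longrightarrow> g x u = h x u" shows "bcont U h"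
proof -
  have "continuous_on (UNIV \<times> U) (\<lambda>(x, u). h x u)"
    by (rule continuous_on_eq[OF bcont_cont[OF assms(1)]]) (use assms(2) in auto)
  with assms show ?thesis unfolding bcont_def by auto
qed

lemma bcont_add:
  assumes "bcont U g" "bcont U h" shows "bcont U (\<lambda>x u. g x u + h x u)"
proof -
  obtain C where C: "\<And>x u. u \<in> U \<Longrightarrow> \<bar>g x u\<bar> \<le> C" using assms(1) by (rule bcontE) blast
  obtain D where D: "\<And>x u. u \<in> U \<Longrightarrow> \<bar>h x u\<bar> \<le> D" using assms(2) by (rule bcontE) blast
  show ?thesis
  proof (rule bcontI[of _ _ "C + D"])
    show "continuous_on (UNIV \<times> U) (\<lambda>(x, u). g x u + h x u)"
      using continuous_on_add[OF bcont_cont[OF assms(1)] bcont_cont[OF assms(2)]] by (simp add: case_prod_beta)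
    show "\<bar>g x u + h x u\<bar> \<le> C + D" if "u \<in> U" for x u
      using C[OF that, of x] D[OF that, of x] by linarith
  qed
qed

lemma bcont_mult:
  assumes "bcont U g" "bcont U h" shows "bcont U (\<lambda>x u. g x u * h x u)"
proof -
  obtain C where C: "0 \<le> C" "\<And>x u. u \<in> U \<Longrightarrow> \<bar>g x u\<bar> \<le> C" using assms(1) by (rule bcontE) blast
  obtain D where D: "\<And>x u. u \<in> U \<Longrightarrow> \<bar>h x u\<bar> \<le> D" using assms(2) by (rule bcontE) blast
  show ?thesis
  proof (rule bcontI[of _ _ "C * D"])
    show "continuous_on (UNIV \<times> U) (\<lambda>(x, u). g x u * h x u)"
      using continuous_on_mult[OF bcont_cont[OF assms(1)] bcont_cont[OF assms(2)]] by (simp add: case_prod_beta)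
    show "\<bar>g x u * h x u\<bar> \<le> C * D" if "u \<in> U" for x u
      unfolding abs_mult using C D that by (intro mult_mono) auto
  qed
qed

lemma bcont_const: "bcont U (\<lambda>x u. c)"
  by (rule bcontI[of _ _ "\<bar>c\<bar>"]) (auto simp: case_prod_beta intro: continuous_intros)

lemma bcont_subset:
  assumes "bcont U g" "V \<subseteq> U" shows "bcont V g"
proof -
  have "continuous_on (UNIV \<times> V) (\<lambda>(x, u). g x u)"
    by (rule continuous_on_subset[OF bcont_cont[OF assms(1)]]) (use assms(2) in auto)
  with assms show ?thesis unfolding bcont_def by blast
qed

lemma bcont_slice:
  assumes "bcont U g" "u \<in> U"
  shows "continuous_on UNIV (\<lambda>x. g x u)"
proof -
  have c: "continuous_on UNIV (\<lambda>x::real. (x, u))" by (intro continuous_intros)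
  have i: "range (\<lambda>x::real. (x, u)) \<subseteq> UNIV \<times> U" using assms(2) by auto
  show ?thesis using continuous_on_compose2[OF bcont_cont[OF assms(1)] c i] by simp
qed

text \<open>The time set \<open>{0}\<close> is a dummy, which lets functions of space alone share
  the closure lemmas of \<open>bcont\<close>.\<close>

abbreviation bcont1 :: "(real \<Rightarrow> real) \<Rightarrow> bool" where
  "bcont1 g \<equiv> bcont {0} (\<lambda>x _. g x)"

lemma bcont1_iff: "bcont1 g \<longleftrightarrow> continuous_on UNIV g \<and> (\<exists>C. \<forall>x. \<bar>g x\<bar> \<le> C)"
proof
  assume "bcont1 g"
  then show "continuous_on UNIV g \<and> (\<exists>C. \<forall>x. \<bar>g x\<bar> \<le> C)"
    using bcont_slice[of "{0}" "\<lambda>x _. g x" 0] unfolding bcont_def by auto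
next
  assume *: "continuous_on UNIV g \<and> (\<exists>C. \<forall>x. \<bar>g x\<bar> \<le> C)"
  have "continuous_on (UNIV \<times> {0::real}) (\<lambda>p. g (fst p))"
    by (rule continuous_on_compose2[OF conjunct1[OF *]]) (auto intro: continuous_intros)
  with * show "bcont1 g" unfolding bcont_def by (auto simp: case_prod_beta)
qed

lemma bcont1_slice: "bcont U g \<Longrightarrow> u \<in> U \<Longrightarrow> bcont1 (\<lambda>x. g x u)"
  unfolding bcont1_iff using bcont_slice unfolding bcont_def by blast

lemma bcont1_egrow: "bcont1 g \<Longrightarrow> egrow1 g"
  unfolding bcont1_iff using egrow_bounded[of "{()}" "\<lambda>y _. g y"] by auto

text \<open>Space derivatives up to order \<open>n\<close> exist and are jointly continuous and
  bounded. Quantifying over the derivative at each level keeps inductions free of a named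
  derivative; \<open>bsm_family_ex\<close> recovers a coherent family afterwards.\<close>

primrec bsm :: "real set \<Rightarrow> nat \<Rightarrow> (real \<Rightarrow> real \<Rightarrow> real) \<Rightarrow> bool" where
  "bsm U 0 g = bcont U g"
| "bsm U (Suc n) g = (bcont U g \<and>
    (\<exists>g'. (\<forall>x. \<forall>u\<in>U. ((\<lambda>x. g x u) has_real_derivative g' x u) (at x)) \<and> bsm U n g'))"

lemma bsm_bcont: "bsm U n g \<Longrightarrow> bcont U g"
  by (cases n) auto

lemma bsm_SucI:
  "bcont U g \<Longrightarrow> (\<And>x u. u \<in> U \<Longrightarrow> ((\<lambda>x. g x u) has_real_derivative g' x u) (at x)) \<Longrightarrow> bsm U n g' \<Longrightarrow> bsm U (Suc n) g"
  by auto

lemma bsm_cong: "bsm U n g \<Longrightarrow> (\<And>x u. u \<in> U \<Longrightarrow> g x u = h x u) \<Longrightarrow> bsm U n h"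
proof (cases n)
  case 0 then show "bsm U n g \<Longrightarrow> (\<And>x u. u \<in> U \<Longrightarrow> g x u = h x u) \<Longrightarrow> bsm U n h" using bcont_cong by auto
next
  case (Suc k)
  assume g: "bsm U n g" and e: "\<And>x u. u \<in> U \<Longrightarrow> g x u = h x u"
  then obtain g' where g': "\<forall>x. \<forall>u\<in>U. ((\<lambda>x. g x u) has_real_derivative g' x u) (at x)" "bsm U k g'" and b: "bcont U g"
    using Suc by auto
  have "((\<lambda>x. h x u) has_real_derivative g' x u) (at x)" if "u \<in> U" for x u
  proof -
    have "(\<lambda>x. g x u) = (\<lambda>x. h x u)" using e that by auto
    with g'(1) that show ?thesis by metis
  qed
  with Suc g'(2) bcont_cong[OF b e] show ?thesis by auto
qed

lemma bsm_dec: "bsm U (Suc n) g \<Longrightarrow> bsm U n g"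
proof (induction n arbitrary: g)
  case (Suc n)
  then obtain g' where g': "\<forall>x. \<forall>u\<in>U. ((\<lambda>x. g x u) has_real_derivative g' x u) (at x)" "bsm U (Suc n) g'" "bcont U g"
    by auto
  with Suc.IH[OF g'(2)] show ?case by auto
qed auto

lemma bsm_add: "bsm U n g \<Longrightarrow> bsm U n h \<Longrightarrow> bsm U n (\<lambda>x u. g x u + h x u)"
proof (induction n arbitrary: g h)
  case (Suc n)
  then obtain g' h' where g': "\<forall>x. \<forall>u\<in>U. ((\<lambda>x. g x u) has_real_derivative g' x u) (at x)" "bsm U n g'" "bcont U g"
    and h': "\<forall>x. \<forall>u\<in>U. ((\<lambda>x. h x u) has_real_derivative h' x u) (at x)" "bsm U n h'" "bcont U h"
    by auto
  show ?case
    by (rule bsm_SucI[OF bcont_add[OF g'(3) h'(3)] DERIV_add Suc.IH[OF g'(2) h'(2)]]) (use g' h' in auto)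
qed (auto intro: bcont_add)

lemma bsm_mult: "bsm U n g \<Longrightarrow> bsm U n h \<Longrightarrow> bsm U n (\<lambda>x u. g x u * h x u)"
proof (induction n arbitrary: g h)
  case (Suc n)
  then obtain g' h' where g': "\<forall>x. \<forall>u\<in>U. ((\<lambda>x. g x u) has_real_derivative g' x u) (at x)" "bsm U n g'" "bcont U g"
    and h': "\<forall>x. \<forall>u\<in>U. ((\<lambda>x. h x u) has_real_derivative h' x u) (at x)" "bsm U n h'" "bcont U h"
    by auto
  have *: "bsm U n (\<lambda>x u. g' x u * h x u + h' x u * g x u)"
    by (intro bsm_add Suc.IH g'(2) h'(2) bsm_dec[OF Suc.prems(1)] bsm_dec[OF Suc.prems(2)])
  show ?case
    by (rule bsm_SucI[OF bcont_mult[OF g'(3) h'(3)] DERIV_mult *]) (use g' h' in auto)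
qed (auto intro: bcont_mult)

lemma bsm_const: "bsm U n (\<lambda>x u. c)"
proof (induction n arbitrary: c)
  case (Suc n)
  show ?case by (rule bsm_SucI[OF bcont_const _ Suc.IH[of 0]]) auto
qed (auto intro: bcont_const)

lemma bsm_family:
  assumes "\<And>j x u. u \<in> U \<Longrightarrow> ((\<lambda>x. F j x u) has_real_derivative F (Suc j) x u) (at x)" "\<And>j. bcont U (F j)"
  shows "bsm U n (F j)"
proof (induction n arbitrary: j)
  case (Suc n)
  show ?case by (rule bsm_SucI[OF assms(2) assms(1) Suc.IH])
qed (auto intro: assms)

text \<open>The witnesses obtained for different orders have to agree. Taking \<open>deriv\<close>
  at each level makes the choice canonical, since a derivative is unique.\<close>

lemma bsm_family_ex:
  assumes "\<And>n. bsm U n g"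
  obtains F where "\<And>x u. u \<in> U \<Longrightarrow> F 0 x u = g x u"
    "\<And>j x u. u \<in> U \<Longrightarrow> ((\<lambda>x. F j x u) has_real_derivative F (Suc j) x u) (at x)" "\<And>j. bcont U (F j)"
proof -
  define d where "d = (\<lambda>g x (u::real). deriv (\<lambda>x::real. g x u :: real) x)"
  have d: "bsm U n (d g)" "u \<in> U \<Longrightarrow> ((\<lambda>x. g x u) has_real_derivative d g x u) (at x)" if g: "\<And>n. bsm U n g" for g n u x
  proof -
    from g[of "Suc n"] obtain g' where g': "\<forall>x. \<forall>u\<in>U. ((\<lambda>x. g x u) has_real_derivative g' x u) (at x)" "bsm U n g'"
      by auto
    have e: "g' x u = d g x u" if "u \<in> U" for x u
      unfolding d_def using g'(1) that by (metis DERIV_imp_deriv)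
    show "bsm U n (d g)" by (rule bsm_cong[OF g'(2) e])
    show "u \<in> U \<Longrightarrow> ((\<lambda>x. g x u) has_real_derivative d g x u) (at x)"
      using g'(1) e by metis
  qed
  have F: "bsm U n ((d ^^ j) g)" for n j
    by (induction j arbitrary: n) (auto intro: assms d)
  show ?thesis
    by (rule that[of "\<lambda>j. (d ^^ j) g"]) (use d(2)[OF F] bsm_bcont[OF F] in auto)
qed

text \<open>The heat equation. For the square root, the product of \<sigma> and its derivative is
  1/2, so \<open>gauss_deriv\<close> leaves half the second derivative.\<close>

lemma heat_time_deriv:
  assumes g: "\<And>y. (g has_real_derivative g' y) (at y)" "\<And>y. (g' has_real_derivative g'' y) (at y)" "continuous_on UNIV g''"
    and e: "egrow1 g" "egrow1 g'" "egrow1 g''" and \<tau>: "0 < \<tau>"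
  shows "((\<lambda>\<tau>. heat \<tau> g x) has_real_derivative heat \<tau> g'' x / 2) (at \<tau>)"
proof -
  have gc: "continuous_on UNIV g'"
    by (rule DERIV_continuous_on[OF has_field_derivative_at_within[OF g(2)]])
  have c2: "continuous_on (UNIV \<times> {0<..}) (\<lambda>(y, r). g' y)"
    using continuous_on_compose2[OF gc continuous_on_fst[OF continuous_on_id], of "UNIV \<times> {0<..}"] by (simp add: case_prod_beta)
  have eg: "egrow {0<..} (\<lambda>y r. k y)" if "egrow1 k" for k
    using that unfolding egrow_def by auto
  have "((\<lambda>r. LINT z|gaussian. g (x + z * sqrt r)) has_real_derivative
    (sqrt \<tau> * (inverse (sqrt \<tau>) / 2) * (LINT z|gaussian. g'' (x + z * sqrt \<tau>)) + (LINT z|gaussian. 0))) (at \<tau>)"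
  proof (rule gauss_deriv[where I="{0<..}" and h="\<lambda>y r. g y" and ?h1.0="\<lambda>y r. g' y" and hr="\<lambda>y r. 0"])
    show "continuous_on {0<..} (\<lambda>r. inverse (sqrt r) / 2)"
      by (intro continuous_intros) auto
    show "(sqrt has_real_derivative inverse (sqrt r) / 2) (at r)" if "r \<in> {0<..}" for r
      using DERIV_real_sqrt[of r] that by simp
  qed (use g c2 e \<tau> in \<open>auto intro: eg egrow_const simp: case_prod_beta\<close>)
  then show ?thesis using \<tau> by (simp add: heat_def)
qed

section \<open>The Gaussian steps of the recursion\<close>

text \<open>Expectation of \<open>g\<close> over one Gaussian step reweighted by
  \<open>exp (m * f)\<close>. It is the transition kernel of the optimal process across a time
  interval on which the distribution function equals \<open>m\<close> and at whose end the solution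
  is \<open>f\<close>.\<close>

definition tilt :: "real \<Rightarrow> (real \<Rightarrow> real) \<Rightarrow> (real \<Rightarrow> real) \<Rightarrow> real \<Rightarrow> real \<Rightarrow> real" where
  "tilt m f g \<tau> x = heat \<tau> (\<lambda>y. g y * exp (m * f y)) x / heat \<tau> (\<lambda>y. exp (m * f y)) x"

lemma tilt_0: "tilt 0 f g \<tau> x = heat \<tau> g x"
  by (simp add: tilt_def)

lemma glm_0: "gauss_log_mean 0 f \<tau> x = heat \<tau> f x"
  by (simp add: gauss_log_mean_def heat_def)

lemma lipschitz_growth:
  assumes "\<And>y. (f has_real_derivative f' y) (at y)" "\<And>y. \<bar>f' y\<bar> \<le> C"
  shows "\<bar>f y\<bar> \<le> \<bar>f 0\<bar> + C * \<bar>y\<bar>"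
proof -
  have "norm (f y - f 0) \<le> C * norm (y - 0)"
    by (rule field_differentiable_bound[of UNIV f f']) (use assms in \<open>auto intro: has_field_derivative_at_within\<close>)
  then show ?thesis by auto
qed

lemma egrow_exp_lipschitz:
  assumes "\<And>y. \<bar>f y\<bar> \<le> c + C * \<bar>y::real\<bar>"
  shows "egrow1 (\<lambda>y. exp (m * f y))"
proof (rule egrowI)
  fix y
  have "m * f y \<le> \<bar>m\<bar> * \<bar>f y\<bar>" by (metis abs_ge_self abs_mult)
  also have "\<dots> \<le> \<bar>m\<bar> * (c + C * \<bar>y\<bar>)" using assms by (intro mult_left_mono) auto
  finally show "\<bar>exp (m * f y)\<bar> \<le> exp (\<bar>m\<bar> * c) * exp ((\<bar>m\<bar> * C) * \<bar>y\<bar>)"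
    by (simp add: algebra_simps flip: exp_add)
qed

lemma egrow_lipschitz:
  assumes "\<And>y. \<bar>f y\<bar> \<le> c + C * \<bar>y::real\<bar>"
  shows "egrow1 f"
proof (rule egrowI)
  fix y
  have "\<bar>f y\<bar> \<le> \<bar>c\<bar> * exp \<bar>y\<bar> + \<bar>C\<bar> * exp \<bar>y\<bar>"
  proof -
    have "c \<le> \<bar>c\<bar> * exp \<bar>y\<bar>" using mult_left_mono[of 1 "exp \<bar>y\<bar>" "\<bar>c\<bar>"] by auto
    moreover have "C * \<bar>y\<bar> \<le> \<bar>C\<bar> * exp \<bar>y\<bar>" by (intro mult_mono abs_le_exp_abs) auto
    ultimately show ?thesis using assms[of y] by linarith
  qed
  then show "\<bar>f y\<bar> \<le> (\<bar>c\<bar> + \<bar>C\<bar>) * exp (1 * \<bar>y\<bar>)" by (simp add: algebra_simps)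
qed

text \<open>Data at the right end of a Gaussian step. Like \<open>ln (cosh x)\<close>, the function
  itself may be unbounded, so boundedness is demanded only from the slope onwards; linear growth of
  \<open>f\<close> follows and keeps \<open>exp (m * f)\<close> integrable.\<close>

locale terminal =
  fixes m :: real and f f' :: "real \<Rightarrow> real"
  assumes f: "\<And>y. (f has_real_derivative f' y) (at y)" and f': "\<And>n. bsm {0} n (\<lambda>x _. f' x)"
begin

lemma f_cont: "continuous_on UNIV f"
  by (rule DERIV_continuous_on[OF has_field_derivative_at_within[OF f]])

lemma f'_bcont: "bcont1 f'"
  using bsm_bcont[OF f'] .

lemma f_growth: obtains C where "\<And>y. \<bar>f y\<bar> \<le> \<bar>f 0\<bar> + C * \<bar>y\<bar>"
  using f'_bcont lipschitz_growth[OF f] unfolding bcont1_iff by metis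

lemma f_egrow: "egrow1 f"
  by (rule f_growth) (rule egrow_lipschitz)

lemma W_egrow: "egrow1 (\<lambda>y. exp (m * f y))"
  by (rule f_growth) (rule egrow_exp_lipschitz)

lemma W_cont: "continuous_on UNIV (\<lambda>y. exp (m * f y))"
  by (intro continuous_intros f_cont)

lemma gW:
  assumes "bcont1 g"
  shows "continuous_on UNIV (\<lambda>y. g y * exp (m * f y))" "egrow1 (\<lambda>y. g y * exp (m * f y))"
  using assms bcont1_egrow[OF assms] egrow_mult W_egrow W_cont unfolding bcont1_iff
  by (auto intro!: continuous_intros f_cont)

lemma W_pos: "0 < heat \<tau> (\<lambda>y. exp (m * f y)) x"
  by (intro heat_pos W_cont W_egrow) auto

lemma tilt_le:
  assumes "bcont1 g" "\<And>y. \<bar>g y\<bar> \<le> C"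
  shows "\<bar>tilt m f g \<tau> x\<bar> \<le> C"
proof -
  let ?W = "heat \<tau> (\<lambda>y. exp (m * f y)) x"
  have "heat \<tau> (\<lambda>y. g y * exp (m * f y)) x \<le> heat \<tau> (\<lambda>y. C * exp (m * f y)) x"
    by (intro heat_mono gW assms gW[OF bcont_const]) (use assms in \<open>auto simp: abs_le_iff\<close>)
  moreover have "heat \<tau> (\<lambda>y. (- C) * exp (m * f y)) x \<le> heat \<tau> (\<lambda>y. g y * exp (m * f y)) x"
  proof (intro heat_mono gW assms gW[OF bcont_const])
    show "- C * exp (m * f y) \<le> g y * exp (m * f y)" for y
      using assms(2)[of y] by (intro mult_right_mono) auto
  qed (auto intro: bcont_const)
  ultimately have "\<bar>heat \<tau> (\<lambda>y. g y * exp (m * f y)) x\<bar> \<le> C * ?W"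
    unfolding heat_cmult by auto
  then show ?thesis unfolding tilt_def using W_pos[of \<tau> x] by (simp add: field_simps)
qed

lemma tilt_bcont:
  assumes "bcont1 g" shows "bcont {0..} (\<lambda>x \<tau>. tilt m f g \<tau> x)"
proof -
  obtain C where C: "\<And>x. \<bar>g x\<bar> \<le> C" using assms bcont1_iff by auto
  have "continuous_on UNIV (\<lambda>p. (\<lambda>(x, \<tau>). heat \<tau> (\<lambda>y. g y * exp (m * f y)) x) p / (\<lambda>(x, \<tau>). heat \<tau> (\<lambda>y. exp (m * f y)) x) p)"
    using W_pos by (intro continuous_on_divide heat_continuous gW assms W_cont W_egrow) (auto simp: less_le)
  then have "continuous_on (UNIV \<times> {0..}) (\<lambda>(x, \<tau>). tilt m f g \<tau> x)"
    unfolding tilt_def case_prod_beta by (rule continuous_on_subset) auto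
  then show ?thesis by (rule bcontI) (rule tilt_le[OF assms C])
qed

lemma tilt_deriv:
  assumes g: "\<And>y. (g has_real_derivative g' y) (at y)" "bcont1 g" "bcont1 g'"
  shows "((\<lambda>x. tilt m f g \<tau> x) has_real_derivative
    (tilt m f (\<lambda>y. g' y + m * g y * f' y) \<tau> x - tilt m f g \<tau> x * tilt m f (\<lambda>y. m * f' y) \<tau> x)) (at x)"
proof -
  have b1: "bcont1 (\<lambda>y. g' y + m * g y * f' y)"
    using bcont_add[OF g(3) bcont_mult[OF bcont_mult[OF bcont_const[of _ m] g(2)] f'_bcont]] by simp
  have b2: "bcont1 (\<lambda>y. m * f' y)"
    using bcont_mult[OF bcont_const[of _ m] f'_bcont] by simp
  have d1: "(heat \<tau> (\<lambda>y. g y * exp (m * f y)) has_real_derivative heat \<tau> (\<lambda>y. (g' y + m * g y * f' y) * exp (m * f y)) x) (at x)"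
    by (rule heat_deriv[OF _ gW(1)[OF b1] gW(2)[OF g(2)] gW(2)[OF b1]])
       (auto intro!: derivative_eq_intros g f simp: algebra_simps)
  have d2: "(heat \<tau> (\<lambda>y. exp (m * f y)) has_real_derivative heat \<tau> (\<lambda>y. (m * f' y) * exp (m * f y)) x) (at x)"
    by (rule heat_deriv[OF _ gW(1)[OF b2] W_egrow gW(2)[OF b2]])
       (auto intro!: derivative_eq_intros g f simp: algebra_simps)
  show ?thesis
    unfolding tilt_def using W_pos[of \<tau> x]
    by (intro DERIV_cong[OF DERIV_divide[OF d1 d2]]) (auto simp: field_simps)
qed

text \<open>By \<open>tilt_deriv\<close> the space derivative of a tilt is a polynomial in tilts of
  functions of the same class, so induction on the order closes with \<open>g\<close>
  arbitrary.\<close>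

lemma tilt_bsm:
  assumes "\<And>n. bsm {0} n (\<lambda>x _. g x)"
  shows "bsm {0..} n (\<lambda>x \<tau>. tilt m f g \<tau> x)"
  using assms
proof (induction n arbitrary: g)
  case 0
  then show ?case using tilt_bcont[OF bsm_bcont] by simp
next
  case (Suc n)
  obtain F where F: "\<And>x u. u \<in> {0} \<Longrightarrow> F 0 x u = g x"
    "\<And>j x u. u \<in> {0} \<Longrightarrow> ((\<lambda>x. F j x u) has_real_derivative F (Suc j) x u) (at x)" "\<And>j. bcont {0} (F j)"
    using bsm_family_ex[OF Suc.prems] by blast
  define g' where "g' = (\<lambda>x. F 1 x 0)"
  have g': "\<And>y. (g has_real_derivative g' y) (at y)"
    using F(2)[of 0 0] F(1)[of 0] by (simp add: g'_def)
  have sg': "bsm {0} n (\<lambda>x _. g' x)" for n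
    by (rule bsm_cong[OF bsm_family[of "{0}" F n 1, OF F(2,3)]]) (auto simp: g'_def)
  have b1: "bsm {0} n (\<lambda>y _. g' y + m * g y * f' y)" for n
    by (intro bsm_add bsm_mult bsm_const sg' f' Suc.prems)
  have b2: "bsm {0} n (\<lambda>y _. m * f' y)" for n
    by (intro bsm_add bsm_mult bsm_const f')
  have "bsm {0..} n (\<lambda>x \<tau>. tilt m f (\<lambda>y. g' y + m * g y * f' y) \<tau> x + tilt m f g \<tau> x * ((-1) * tilt m f (\<lambda>y. m * f' y) \<tau> x))"
    by (intro bsm_add bsm_mult bsm_const Suc.IH b1 b2 Suc.prems)
  then show ?case
    by (rule bsm_SucI[OF tilt_bcont[OF bsm_bcont[OF Suc.prems]], rotated])
       (rule DERIV_cong[OF tilt_deriv[OF g' bsm_bcont[OF Suc.prems] bsm_bcont[OF sg']]], simp)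
qed

lemma glm_deriv:
  "((\<lambda>x. gauss_log_mean m f \<tau> x) has_real_derivative tilt m f f' \<tau> x) (at x)"
proof (cases "m = 0")
  case True
  have "(heat \<tau> f has_real_derivative heat \<tau> f' x) (at x)"
    using heat_deriv[OF f _ f_egrow bcont1_egrow[OF f'_bcont]] f'_bcont unfolding bcont1_iff by auto
  then show ?thesis using True by (simp add: glm_0 tilt_0)
next
  case False
  have b2: "bcont1 (\<lambda>y. m * f' y)"
    using bcont_mult[OF bcont_const[of _ m] f'_bcont] by simp
  have d2: "(heat \<tau> (\<lambda>y. exp (m * f y)) has_real_derivative heat \<tau> (\<lambda>y. (m * f' y) * exp (m * f y)) x) (at x)"
    by (rule heat_deriv[OF _ gW(1)[OF b2] W_egrow gW(2)[OF b2]])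
       (auto intro!: derivative_eq_intros f simp: algebra_simps)
  have e: "gauss_log_mean m f \<tau> = (\<lambda>x. ln (heat \<tau> (\<lambda>y. exp (m * f y)) x) / m)"
    using False by (auto simp: gauss_log_mean_def heat_def)
  have "((\<lambda>x. ln (heat \<tau> (\<lambda>y. exp (m * f y)) x) / m) has_real_derivative
      (heat \<tau> (\<lambda>y. (m * f' y) * exp (m * f y)) x / heat \<tau> (\<lambda>y. exp (m * f y)) x / m)) (at x)"
    using W_pos[of \<tau> x] by (intro DERIV_cdivide) (auto intro!: derivative_eq_intros d2)
  then show ?thesis unfolding e tilt_def using False by (simp add: heat_cmult mult.assoc)
qed

lemma glm_cont: "continuous_on UNIV (\<lambda>(x, \<tau>). gauss_log_mean m f \<tau> x)"
proof (cases "m = 0")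
  case True
  then show ?thesis using heat_continuous[OF f_cont f_egrow] by (simp add: glm_0)
next
  case False
  have "continuous_on UNIV (\<lambda>p. ln ((\<lambda>(x, \<tau>). heat \<tau> (\<lambda>y. exp (m * f y)) x) p) / m)"
    using False W_pos by (intro continuous_intros heat_continuous W_cont W_egrow) (auto simp: less_le)
  then show ?thesis using False by (simp add: gauss_log_mean_def heat_def case_prod_beta)
qed

text \<open>Cole-Hopf: the Gaussian average of \<open>exp (m * f)\<close> evolves by the heat
  equation, and taking the logarithm makes the equation nonlinear. The squared slope comes from the
  second derivative of the weight.\<close>

lemma glm_time_deriv:
  assumes f'': "\<And>y. (f' has_real_derivative f'' y) (at y)" "bcont1 f''" and \<tau>: "0 < \<tau>"
  shows "((\<lambda>\<tau>. gauss_log_mean m f \<tau> x) has_real_derivative tilt m f (\<lambda>y. f'' y + m * (f' y)\<^sup>2) \<tau> x / 2) (at \<tau>)"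
proof (cases "m = 0")
  case True
  have "((\<lambda>\<tau>. heat \<tau> f x) has_real_derivative heat \<tau> f'' x / 2) (at \<tau>)"
    using f''(2) by (intro heat_time_deriv[OF f f''(1)] f_egrow bcont1_egrow f'_bcont \<tau>) (auto simp: bcont1_iff)
  then show ?thesis using True by (simp add: glm_0 tilt_0)
next
  case False
  have b1: "bcont1 (\<lambda>y. m * f' y)"
    using bcont_mult[OF bcont_const[of _ m] f'_bcont] by simp
  have b2: "bcont1 (\<lambda>y. m * (f'' y + m * (f' y)\<^sup>2))"
    using bcont_mult[OF bcont_const[of _ m] bcont_add[OF f''(2) bcont_mult[OF bcont_const[of _ m] bcont_mult[OF f'_bcont f'_bcont]]]]
    by (simp add: power2_eq_square)
  have d2: "((\<lambda>\<tau>. heat \<tau> (\<lambda>y. exp (m * f y)) x) has_real_derivative heat \<tau> (\<lambda>y. (m * (f'' y + m * (f' y)\<^sup>2)) * exp (m * f y)) x / 2) (at \<tau>)"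
  proof (rule heat_time_deriv[OF _ _ gW(1)[OF b2] W_egrow gW(2)[OF b1] gW(2)[OF b2] \<tau>])
    show "((\<lambda>y. exp (m * f y)) has_real_derivative m * f' y * exp (m * f y)) (at y)" for y
      by (auto intro!: derivative_eq_intros f simp: algebra_simps)
    show "((\<lambda>y. m * f' y * exp (m * f y)) has_real_derivative (m * (f'' y + m * (f' y)\<^sup>2)) * exp (m * f y)) (at y)" for y
      by (auto intro!: derivative_eq_intros f f'' simp: algebra_simps power2_eq_square)
  qed
  have e: "gauss_log_mean m f \<tau> x = ln (heat \<tau> (\<lambda>y. exp (m * f y)) x) / m" for \<tau>
    using False by (auto simp: gauss_log_mean_def heat_def)
  have "((\<lambda>\<tau>. ln (heat \<tau> (\<lambda>y. exp (m * f y)) x) / m) has_real_derivative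
      ((heat \<tau> (\<lambda>y. (m * (f'' y + m * (f' y)\<^sup>2)) * exp (m * f y)) x / 2) / heat \<tau> (\<lambda>y. exp (m * f y)) x / m)) (at \<tau>)"
    using W_pos[of \<tau> x] by (intro DERIV_cdivide) (auto intro!: derivative_eq_intros d2)
  then show ?thesis unfolding e tilt_def using False by (simp add: heat_cmult mult.assoc mult.commute[of 2])
qed

end

text \<open>A list \<open>[j\<^sub>1, \<dots>, j\<^sub>k]\<close> encodes the monomial \<open>\<Prod>\<^sub>i \<partial>\<^sub>x\<^bsup>j\<^sub>i + 1\<^esup>\<Phi>\<close>, and a list of such lists the sum
  of its entries.\<close>

primrec mono_val :: "(nat \<Rightarrow> real) \<Rightarrow> nat list \<Rightarrow> real" where
  "mono_val \<phi> [] = 1"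
| "mono_val \<phi> (j # w) = \<phi> j * mono_val \<phi> w"

definition poly_val :: "(nat \<Rightarrow> real) \<Rightarrow> nat list list \<Rightarrow> real" where
  "poly_val \<phi> P = sum_list (map (mono_val \<phi>) P)"

primrec mono_deriv :: "nat list \<Rightarrow> nat list list" where
  "mono_deriv [] = []"
| "mono_deriv (j # w) = (Suc j # w) # map ((#) j) (mono_deriv w)"

text \<open>Leibniz remainder: \<open>\<partial>\<^sub>x\<^bsup>j + 1\<^esup>((\<partial>\<^sub>x\<Phi>)\<^sup>2) / 2\<close> without its top order term \<open>\<partial>\<^sub>x\<Phi> \<partial>\<^sub>x\<^bsup>j + 2\<^esup>\<Phi>\<close>.\<close>

primrec leib :: "nat \<Rightarrow> nat list list" where
  "leib 0 = []"
| "leib (Suc j) = concat (map mono_deriv (leib j)) @ [[1, Suc j]]"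

lemma poly_val_simps [simp]:
  "poly_val \<phi> [] = 0" "poly_val \<phi> (w # P) = mono_val \<phi> w + poly_val \<phi> P"
  "poly_val \<phi> (P @ Q) = poly_val \<phi> P + poly_val \<phi> Q"
  by (auto simp: poly_val_def)

lemma mono_val_append: "mono_val \<phi> (v @ w) = mono_val \<phi> v * mono_val \<phi> w"
  by (induction v) auto

lemma poly_val_Cons: "poly_val \<phi> (map ((#) j) P) = \<phi> j * poly_val \<phi> P"
  by (induction P) (auto simp: algebra_simps)

lemma poly_val_append: "poly_val \<phi> (map (\<lambda>v. v @ w) P) = poly_val \<phi> P * mono_val \<phi> w"
  by (induction P) (auto simp: algebra_simps mono_val_append)

lemma mono_val_deriv:
  assumes "\<And>j. ((\<lambda>x. \<phi> j x) has_real_derivative \<phi> (Suc j) x) (at x)"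
  shows "((\<lambda>x. mono_val (\<lambda>j. \<phi> j x) w) has_real_derivative poly_val (\<lambda>j. \<phi> j x) (mono_deriv w)) (at x)"
proof (induction w)
  case (Cons j w)
  have "((\<lambda>x. \<phi> j x * mono_val (\<lambda>j. \<phi> j x) w) has_real_derivative
      (\<phi> (Suc j) x * mono_val (\<lambda>j. \<phi> j x) w + poly_val (\<lambda>j. \<phi> j x) (mono_deriv w) * \<phi> j x)) (at x)"
    by (rule DERIV_mult[OF assms Cons.IH])
  then show ?case by (simp add: poly_val_Cons algebra_simps)
qed auto

lemma poly_val_deriv:
  assumes "\<And>j. ((\<lambda>x. \<phi> j x) has_real_derivative \<phi> (Suc j) x) (at x)"
  shows "((\<lambda>x. poly_val (\<lambda>j. \<phi> j x) P) has_real_derivative poly_val (\<lambda>j. \<phi> j x) (concat (map mono_deriv P))) (at x)"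
proof (induction P)
  case (Cons w P)
  have "((\<lambda>x. mono_val (\<lambda>j. \<phi> j x) w) has_real_derivative poly_val (\<lambda>j. \<phi> j x) (mono_deriv w)) (at x)"
    by (rule mono_val_deriv) (rule assms)
  from DERIV_add[OF this Cons.IH] show ?case by simp
qed auto

lemma bcont_mono_val:
  assumes "\<And>j. bcont U (\<phi> j)" shows "bcont U (\<lambda>x u. mono_val (\<lambda>j. \<phi> j x u) w)"
  by (induction w) (auto intro: bcont_const bcont_mult assms)

lemma bcont_poly_val:
  assumes "\<And>j. bcont U (\<phi> j)" shows "bcont U (\<lambda>x u. poly_val (\<lambda>j. \<phi> j x u) P)"
  by (induction P) (simp_all add: bcont_const bcont_add bcont_mono_val assms)

text \<open>Entry \<open>j\<close> stands for the derivative of order \<open>j + 1\<close>. The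
  factors of the Leibniz remainder are thus at least second derivatives, and positive indices with
  sum \<open>j + 1\<close> cannot exceed \<open>j\<close>. Both facts carry the uniform
  bounds.\<close>

lemma leib_pairs: "w \<in> set (leib j) \<Longrightarrow> \<exists>i k. w = [i, k] \<and> 1 \<le> i \<and> 1 \<le> k \<and> i + k = Suc j"
proof (induction j arbitrary: w)
  case (Suc j)
  then consider v where "v \<in> set (leib j)" "w \<in> set (mono_deriv v)" | "w = [1, Suc j]" by auto
  then show ?case
  proof cases
    case 1
    then obtain i k where "v = [i, k]" "1 \<le> i" "1 \<le> k" "i + k = Suc j" using Suc.IH by blast
    with 1 show ?thesis by auto
  qed auto
qed auto

context terminal
begin

text \<open>One Gaussian step with all its space derivatives and their time derivatives. Only the
  equation for \<open>V 0\<close> comes from a direct computation; for the higher ones space and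
  time derivatives have to be interchanged.\<close>

lemma glm_family:
  obtains V where "\<And>x \<tau>. 0 \<le> \<tau> \<Longrightarrow> V 0 x \<tau> = gauss_log_mean m f \<tau> x"
    "\<And>j x \<tau>. 0 \<le> \<tau> \<Longrightarrow> ((\<lambda>x. V j x \<tau>) has_real_derivative V (Suc j) x \<tau>) (at x)"
    "\<And>j. bcont {0..} (V (Suc j))"
    "continuous_on (UNIV \<times> {0..}) (\<lambda>(x, \<tau>). V 0 x \<tau>)"
    "\<And>x \<tau>. 0 < \<tau> \<Longrightarrow> ((\<lambda>\<tau>. V 0 x \<tau>) has_real_derivative (V 2 x \<tau> + m * (V 1 x \<tau>)\<^sup>2) / 2) (at \<tau>)"
    "\<And>j x \<tau>. 0 < \<tau> \<Longrightarrow> ((\<lambda>\<tau>. V (Suc j) x \<tau>) has_real_derivative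
       (V (j + 3) x \<tau> / 2 + m * (poly_val (\<lambda>i. V (Suc i) x \<tau>) (leib j) + V 1 x \<tau> * V (j + 2) x \<tau>))) (at \<tau>)"
proof -
  obtain F where F: "\<And>x u. u \<in> {0..} \<Longrightarrow> F 0 x u = tilt m f f' u x"
    "\<And>j x u. u \<in> {0..} \<Longrightarrow> ((\<lambda>x. F j x u) has_real_derivative F (Suc j) x u) (at x)" "\<And>j. bcont {0..} (F j)"
    using bsm_family_ex[OF tilt_bsm[OF f']] by blast
  define V where "V = (\<lambda>j. case j of 0 \<Rightarrow> (\<lambda>x \<tau>. gauss_log_mean m f \<tau> x) | Suc i \<Rightarrow> F i)"
  have V0: "V 0 x \<tau> = gauss_log_mean m f \<tau> x" for x \<tau> by (simp add: V_def)
  have VS: "V (Suc i) = F i" for i by (simp add: V_def)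
  have Vd: "((\<lambda>x. V j x \<tau>) has_real_derivative V (Suc j) x \<tau>) (at x)" if "0 \<le> \<tau>" for j x \<tau>
    using that F(1,2) glm_deriv[of \<tau> x] by (cases j) (auto simp: V0 VS)
  have Vb: "bcont {0..} (V (Suc j))" for j using F(3) VS by simp
  obtain G where G: "\<And>x u. u \<in> {0} \<Longrightarrow> G 0 x u = f' x"
    "\<And>j x u. u \<in> {0::real} \<Longrightarrow> ((\<lambda>x. G j x u) has_real_derivative G (Suc j) x u) (at x)" "\<And>j. bcont {0} (G j)"
    using bsm_family_ex[OF f'] by blast
  define f'' where "f'' = (\<lambda>x. G 1 x 0)"
  have f'': "(f' has_real_derivative f'' y) (at y)" "bcont1 f''" for y
    using G(2)[of 0 0] G(1)[of 0] bcont1_slice[OF G(3), of 0 1] by (auto simp: f''_def)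
  have base: "((\<lambda>\<tau>. V 0 x \<tau>) has_real_derivative (V 2 x \<tau> + m * (V 1 x \<tau>)\<^sup>2) / 2) (at \<tau>)" if \<tau>: "0 < \<tau>" for x \<tau>
  proof -
    \<comment> \<open>At order zero the known right side is a tilt. Differentiating the slope once
      in space expresses it through \<open>V 1\<close> and \<open>V 2\<close>.\<close>
    have "V 2 x \<tau> = tilt m f (\<lambda>y. f'' y + m * f' y * f' y) \<tau> x - tilt m f f' \<tau> x * tilt m f (\<lambda>y. m * f' y) \<tau> x"
    proof (rule DERIV_unique)
      show "((\<lambda>x. tilt m f f' \<tau> x) has_real_derivative V 2 x \<tau>) (at x)"
        using Vd[of \<tau> 1 x] F(1)[of \<tau>] \<tau> by (simp add: VS numeral_2_eq_2)
    qed (rule tilt_deriv[OF f''(1) f'_bcont f''(2)])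
    moreover have "tilt m f (\<lambda>y. m * f' y) \<tau> x = m * tilt m f f' \<tau> x"
      by (simp add: tilt_def heat_cmult mult.assoc)
    ultimately have "tilt m f (\<lambda>y. f'' y + m * (f' y)\<^sup>2) \<tau> x = V 2 x \<tau> + m * (V 1 x \<tau>)\<^sup>2"
      using F(1)[of \<tau> x] \<tau> by (simp add: VS power2_eq_square algebra_simps)
    then show ?thesis using glm_time_deriv[OF f'' \<tau>, of x] by (simp add: V0)
  qed
  \<comment> \<open>\<open>Q j\<close> is the expected time derivative of \<open>V j\<close>,
    obtained by differentiating the equation for \<open>V 0\<close> formally in space.\<close>
  define Q where "Q = (\<lambda>j x \<tau>. case j of 0 \<Rightarrow> (V 2 x \<tau> + m * (V 1 x \<tau>)\<^sup>2) / 2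
     | Suc j \<Rightarrow> (V (j + 3) x \<tau> / 2 + m * (poly_val (\<lambda>i. V (Suc i) x \<tau>) (leib j) + V 1 x \<tau> * V (j + 2) x \<tau>)))"
  have Qd: "((\<lambda>x. Q j x \<tau>) has_real_derivative Q (Suc j) x \<tau>) (at x)" if "0 \<le> \<tau>" for j x \<tau>
  proof (cases j)
    case 0
    show ?thesis
      unfolding 0 Q_def using Vd[OF that, of 1] Vd[OF that, of 2]
      by (auto intro!: derivative_eq_intros simp: numeral_2_eq_2 numeral_3_eq_3 algebra_simps)
  next
    case (Suc k)
    have d: "((\<lambda>x. poly_val (\<lambda>i. V (Suc i) x \<tau>) (leib k)) has_real_derivative
       poly_val (\<lambda>j. V (Suc j) x \<tau>) (concat (map mono_deriv (leib k)))) (at x)"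
      by (rule poly_val_deriv) (rule Vd[OF that])
    have d1: "((\<lambda>x. V 1 x \<tau>) has_real_derivative V 2 x \<tau>) (at x)"
      "((\<lambda>x. V (k + 2) x \<tau>) has_real_derivative V (k + 3) x \<tau>) (at x)"
      "((\<lambda>x. V (k + 3) x \<tau>) has_real_derivative V (k + 4) x \<tau>) (at x)"
      using Vd[OF that, of 1] Vd[OF that, of "k + 2"] Vd[OF that, of "k + 3"]
      by (simp_all add: numeral_2_eq_2 numeral_3_eq_3 eval_nat_numeral)
    show ?thesis
      unfolding Suc Q_def nat.case
      by (rule DERIV_cong[OF DERIV_add[OF DERIV_cdivide[OF d1(3)] DERIV_cmult[OF DERIV_add[OF d DERIV_mult[OF d1(1,2)]]]]])
         (simp add: eval_nat_numeral algebra_simps)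
  qed
  have Qb: "bcont {0..} (Q j)" for j
  proof (cases j)
    case 0
    have "bcont {0..} (\<lambda>x \<tau>. (1/2) * (V (Suc 1) x \<tau> + m * (V (Suc 0) x \<tau> * V (Suc 0) x \<tau>)))"
      by (intro bcont_add bcont_mult bcont_const Vb)
    then show ?thesis unfolding 0 Q_def by (rule bcont_cong) (simp add: power2_eq_square eval_nat_numeral)
  next
    case (Suc k)
    have "bcont {0..} (\<lambda>x \<tau>. (1/2) * V (Suc (k + 2)) x \<tau> + m * (poly_val (\<lambda>i. V (Suc i) x \<tau>) (leib k) + V (Suc 0) x \<tau> * V (Suc (k + 1)) x \<tau>))"
      by (intro bcont_add bcont_mult bcont_const bcont_poly_val Vb)
    then show ?thesis unfolding Suc Q_def by (rule bcont_cong) (simp add: eval_nat_numeral)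
  qed
  have Qc: "continuous_on {a..b} (\<lambda>\<tau>. Q j x \<tau>)" if "0 < a" for j x a b
  proof -
    have c: "continuous_on {a..b} (\<lambda>\<tau>. (x, \<tau>))" by (intro continuous_intros)
    have i: "(\<lambda>\<tau>. (x, \<tau>)) ` {a..b} \<subseteq> UNIV \<times> {0..}" using that by auto
    show ?thesis using continuous_on_compose2[OF bcont_cont[OF Qb] c i] by simp
  qed
  \<comment> \<open>The interchange in integrated form: given the identity at order
    \<open>j\<close>, both sides are differentiated in \<open>x\<close>, on the right under the
    integral. Positive times only, since no time derivative is known at \<tau> = 0.\<close>
  have int: "V j x b - V j x a = integral {a..b} (\<lambda>\<tau>. Q j x \<tau>)" if ab: "0 < a" "a \<le> b" for j x a b
  proof (induction j arbitrary: x)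
    case 0
    have "((\<lambda>\<tau>. Q 0 x \<tau>) has_integral V 0 x b - V 0 x a) {a..b}"
    proof (rule fundamental_theorem_of_calculus[OF ab(2)])
      fix \<tau> assume "\<tau> \<in> {a..b}"
      then show "((\<lambda>\<tau>. V 0 x \<tau>) has_vector_derivative Q 0 x \<tau>) (at \<tau> within {a..b})"
        using base[of \<tau> x] ab unfolding Q_def
        by (auto simp: has_real_derivative_iff_has_vector_derivative[symmetric] intro: has_field_derivative_at_within)
    qed
    then show ?case by (rule integral_unique[symmetric])
  next
    case (Suc j)
    have "((\<lambda>x. integral (cbox a b) (Q j x)) has_real_derivative integral (cbox a b) (Q (Suc j) x)) (at x within UNIV)"
    proof (rule leibniz_rule_field_derivative)
      show "((\<lambda>x. Q j x t) has_field_derivative Q (Suc j) x t) (at x within UNIV)" if "t \<in> cbox a b" for x t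
        using Qd[of t] that ab by auto
      show "Q j x integrable_on cbox a b" for x
        using integrable_continuous_real[OF Qc[OF ab(1)]] by simp
      show "continuous_on (UNIV \<times> cbox a b) (\<lambda>(x, t). Q (Suc j) x t)"
        by (rule continuous_on_subset[OF bcont_cont[OF Qb]]) (use ab in auto)
    qed auto
    then have "((\<lambda>x. V j x b - V j x a) has_real_derivative integral {a..b} (Q (Suc j) x)) (at x)"
      using Suc.IH by simp
    moreover have "((\<lambda>x. V j x b - V j x a) has_real_derivative V (Suc j) x b - V (Suc j) x a) (at x)"
      using ab by (intro DERIV_diff Vd) auto
    ultimately show ?case by (rule DERIV_unique[symmetric])
  qed
  have td: "((\<lambda>\<tau>. V j x \<tau>) has_real_derivative Q j x \<tau>) (at \<tau>)" if \<tau>: "0 < \<tau>" for j x \<tau>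
  proof -
    let ?S = "{\<tau>/2..2*\<tau>}"
    have "((\<lambda>t. integral {\<tau>/2..t} (\<lambda>\<tau>. Q j x \<tau>)) has_real_derivative Q j x \<tau>) (at \<tau> within ?S)"
      by (rule integral_has_real_derivative[OF Qc]) (use \<tau> in auto)
    then have "((\<lambda>t. V j x (\<tau>/2) + integral {\<tau>/2..t} (\<lambda>\<tau>. Q j x \<tau>)) has_real_derivative 0 + Q j x \<tau>) (at \<tau> within ?S)"
      by (intro DERIV_add DERIV_const)
    then have "((\<lambda>t. V j x t) has_real_derivative 0 + Q j x \<tau>) (at \<tau> within ?S)"
      by (rule has_field_derivative_transform_within[where d=1]) (use \<tau> int[of "\<tau>/2" _ j x, symmetric] in auto)
    moreover have "at \<tau> within ?S = at \<tau>"
      by (rule at_within_interior) (use \<tau> in auto)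
    ultimately show ?thesis by simp
  qed
  show ?thesis
  proof (rule that[of V])
    show "continuous_on (UNIV \<times> {0..}) (\<lambda>(x, \<tau>). V 0 x \<tau>)"
      unfolding V0 by (rule continuous_on_subset[OF glm_cont]) auto
    show "((\<lambda>\<tau>. V (Suc j) x \<tau>) has_real_derivative
       (V (j + 3) x \<tau> / 2 + m * (poly_val (\<lambda>i. V (Suc i) x \<tau>) (leib j) + V 1 x \<tau> * V (j + 2) x \<tau>))) (at \<tau>)"
      if "0 < \<tau>" for j x \<tau>
      using td[OF that, of "Suc j"] by (simp add: Q_def)
  qed (use V0 Vd Vb base in auto)
qed

end

lemma bcont_Un:
  assumes "bcont {a..b} g" "bcont {b..c} g" "a \<le> b" "b \<le> c"
  shows "bcont {a..c} g"
proof -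
  obtain C where C: "\<And>x u. u \<in> {a..b} \<Longrightarrow> \<bar>g x u\<bar> \<le> C" using assms(1) by (rule bcontE) blast
  obtain D where D: "\<And>x u. u \<in> {b..c} \<Longrightarrow> \<bar>g x u\<bar> \<le> D" using assms(2) by (rule bcontE) blast
  have e: "UNIV \<times> {a..c} = UNIV \<times> {a..b} \<union> (UNIV::real set) \<times> {b..c}" using assms by auto
  show ?thesis
  proof (rule bcontI[of _ _ "max C D"])
    show "continuous_on (UNIV \<times> {a..c}) (\<lambda>(x, u). g x u)"
      unfolding e by (intro continuous_on_closed_Un bcont_cont assms closed_Times) auto
    show "\<bar>g x u\<bar> \<le> max C D" if "u \<in> {a..c}" for x u
      using C[of u x] D[of u x] that by (cases "u \<le> b") (auto simp: le_max_iff_disj)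
  qed
qed

section \<open>Functions with smooth bounded slope, a class stable under Gaussian steps\<close>

definition slope_smooth :: "(real \<Rightarrow> real) \<Rightarrow> bool" where
  "slope_smooth f \<longleftrightarrow> (\<exists>f'. terminal f f')"

lemma bsm1_family:
  assumes "\<And>j x. (F j has_real_derivative F (Suc j) x) (at x)" "\<And>j. bcont1 (F j)"
  shows "bsm {0} n (\<lambda>x _. F j x)"
  using bsm_family[of "{0}" "\<lambda>j x _. F j x" n j] assms by blast

lemma slope_smooth_family:
  assumes "\<And>j x. (F j has_real_derivative F (Suc j) x) (at x)" "\<And>j. bcont1 (F (Suc j))"
  shows "slope_smooth (F 0)"
  unfolding slope_smooth_def
  by (rule exI[of _ "F 1"], unfold_locales)
     (use assms bsm1_family[of "\<lambda>j. F (Suc j)" _ 0] in auto)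

lemma slope_smooth_ex:
  assumes "slope_smooth f"
  shows "((deriv ^^ j) f has_real_derivative (deriv ^^ Suc j) f x) (at x)" "bcont1 ((deriv ^^ Suc j) f)"
proof -
  obtain f' where "terminal f f'" using assms slope_smooth_def by auto
  then interpret terminal 0 f f' .
  obtain F where F: "\<And>x u. u \<in> {0} \<Longrightarrow> F 0 x u = f' x"
    "\<And>j x u. u \<in> {0::real} \<Longrightarrow> ((\<lambda>x. F j x u) has_real_derivative F (Suc j) x u) (at x)" "\<And>j. bcont {0} (F j)"
    using bsm_family_ex[OF f'] by blast
  have e: "(deriv ^^ Suc j) f = (\<lambda>x. F j x 0)" for j
  proof (induction j)
    case 0
    show ?case using f F(1)[of 0] by (auto intro: DERIV_imp_deriv)
  next
    case (Suc j)
    have "(deriv ^^ Suc (Suc j)) f = deriv (\<lambda>x. F j x 0)" using Suc by simp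
    also have "\<dots> = (\<lambda>x. F (Suc j) x 0)" using F(2)[of 0 j] by (auto intro: DERIV_imp_deriv)
    finally show ?case .
  qed
  show "((deriv ^^ j) f has_real_derivative (deriv ^^ Suc j) f x) (at x)"
  proof (cases j)
    case 0
    have "(deriv ^^ Suc 0) f x = f' x" unfolding e using F(1)[of 0] by simp
    with f[of x] 0 show ?thesis by simp
  next
    case (Suc i)
    show ?thesis unfolding Suc e using F(2) by simp
  qed
  show "bcont1 ((deriv ^^ Suc j) f)"
    unfolding e using bcont1_slice[OF F(3), of 0] by simp
qed

lemma deriv_funpow_eq:
  assumes "\<And>j x. (F j has_real_derivative F (Suc j) x) (at x)"
  shows "(deriv ^^ j) (F 0) = F j"
proof (induction j)
  case (Suc j)
  have "(deriv ^^ Suc j) (F 0) = deriv (F j)" using Suc by simp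
  also have "\<dots> = F (Suc j)" using assms by (auto intro: DERIV_imp_deriv)
  finally show ?case .
qed simp

lemma slope_smooth_terminal: "slope_smooth f \<Longrightarrow> terminal f (deriv f)"
proof -
  assume "slope_smooth f"
  then obtain f' where f': "terminal f f'" using slope_smooth_def by auto
  then have "deriv f = f'" using terminal.f by (intro ext DERIV_imp_deriv) auto
  with f' show ?thesis by simp
qed

lemma slope_smooth_add_const:
  assumes "slope_smooth f" shows "slope_smooth (\<lambda>x. f x + c)"
proof -
  obtain f' where f': "terminal f f'" using assms slope_smooth_def by auto
  have "terminal (\<lambda>x. f x + c) f'"
    by unfold_locales (use terminal.f[OF f'] terminal.f'[OF f'] in \<open>auto intro!: derivative_eq_intros\<close>)
  then show ?thesis unfolding slope_smooth_def by auto
qed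

text \<open>The derivative \<open>1 - tanh\<^sup>2\<close> is a polynomial in the function itself,
  so the induction on the order closes.\<close>

lemma bsm_tanh: "bsm {0} n (\<lambda>x _. tanh x)"
proof -
  have b: "bcont1 (tanh :: real \<Rightarrow> real)"
    unfolding bcont1_iff by (auto intro!: continuous_intros exI[of _ 1] simp: abs_le_iff less_imp_le[OF tanh_real_lt_1] minus_le_iff less_imp_le[OF tanh_real_gt_neg1])
  show ?thesis
  proof (induction n)
    case (Suc n)
    have "bsm {0} n (\<lambda>x _. 1 + (-1) * (tanh x * tanh x))"
      by (intro bsm_add bsm_mult bsm_const Suc)
    then show ?case
      by (rule bsm_SucI[OF b, rotated]) (auto intro!: derivative_eq_intros simp: power2_eq_square)
  qed (use b in simp)
qed

lemma DERIV_ln_cosh: "((\<lambda>x::real. ln (cosh x)) has_real_derivative tanh x) (at x)"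
  by (auto intro!: derivative_eq_intros simp: tanh_def field_simps)

lemma slope_smooth_ln_cosh: "slope_smooth (\<lambda>x. ln (cosh x))"
  unfolding slope_smooth_def
  by (rule exI[of _ tanh], unfold_locales) (auto intro: DERIV_ln_cosh bsm_tanh)

lemma slope_smooth_glm:
  assumes "slope_smooth f" "0 \<le> \<tau>" shows "slope_smooth (gauss_log_mean m f \<tau>)"
proof -
  interpret terminal m f "deriv f" by (rule slope_smooth_terminal[OF assms(1)])
  obtain V where V: "\<And>x \<tau>. 0 \<le> \<tau> \<Longrightarrow> V 0 x \<tau> = gauss_log_mean m f \<tau> x"
    "\<And>j x \<tau>. 0 \<le> \<tau> \<Longrightarrow> ((\<lambda>x. V j x \<tau>) has_real_derivative V (Suc j) x \<tau>) (at x)"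
    "\<And>j. bcont {0..} (V (Suc j))"
    using glm_family by metis
  have "slope_smooth (\<lambda>x. V 0 x \<tau>)"
    by (rule slope_smooth_family) (use V(2) assms(2) bcont1_slice[OF V(3)] in auto)
  then show ?thesis using V(1)[OF assms(2)] by simp
qed

lemma glm_at_0 [simp]: "gauss_log_mean m f 0 x = f x"
  using heat_0[of "\<lambda>y. exp (m * f y)" x] heat_0[of f x] unfolding heat_def by (simp add: gauss_log_mean_def)

lemma exp_glm:
  assumes "slope_smooth f"
  shows "exp (m * gauss_log_mean m f \<tau> x) = heat \<tau> (\<lambda>y. exp (m * f y)) x"
proof -
  interpret terminal m f "deriv f" by (rule slope_smooth_terminal[OF assms(1)])
  show ?thesis using W_pos[of \<tau> x] by (cases "m = 0") (auto simp: gauss_log_mean_def heat_def)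
qed

text \<open>After exponentiation this is the semigroup property of \<open>heat\<close>. It allows a
  step of the recursion to be split at any intermediate time.\<close>

lemma glm_glm:
  assumes fs: "slope_smooth f" "0 \<le> s" "0 \<le> t"
  shows "gauss_log_mean m (gauss_log_mean m f t) s x = gauss_log_mean m f (s + t) x"
proof -
  interpret terminal m f "deriv f" by (rule slope_smooth_terminal[OF assms(1)])
  show ?thesis
  proof (cases "m = 0")
    case True
    have "gauss_log_mean 0 f t = heat t f" by (rule ext) (rule glm_0)
    then show ?thesis using True heat_heat[OF f_cont f_egrow assms(2,3)] by (simp add: glm_0)
  next
    case False
    have "exp (m * gauss_log_mean m (gauss_log_mean m f t) s x) = heat s (\<lambda>y. exp (m * gauss_log_mean m f t y)) x"
      by (rule exp_glm[OF slope_smooth_glm[OF fs(1,3)]])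
    also have "\<dots> = heat s (heat t (\<lambda>y. exp (m * f y))) x"
      by (simp add: exp_glm[OF fs(1)])
    also have "\<dots> = exp (m * gauss_log_mean m f (s + t) x)"
      by (simp add: exp_glm[OF fs(1)] heat_heat[OF W_cont W_egrow fs(2,3)])
    finally show ?thesis using False by simp
  qed
qed

text \<open>The hyperbolic cosine is an eigenfunction of the heat semigroup with eigenvalue
  \<open>exp (\<tau> / 2)\<close>. Hence the closed formula beyond the last atom is itself a
  Gaussian step with \<open>m = 1\<close>, and all intervals can be treated alike.\<close>

lemma glm_ln_cosh:
  assumes "0 \<le> \<tau>"
  shows "gauss_log_mean 1 (\<lambda>y. ln (cosh y) + c) \<tau> x = ln (cosh x) + c + \<tau> / 2"
proof -
  interpret prob_space gaussian by (rule prob_space_gaussian)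
  have i: "integrable gaussian (\<lambda>z. exp ((k * sqrt \<tau>) * z))" for k by (rule integrable_gaussian_exp)
  have "(LINT z|gaussian. exp (ln (cosh (x + z * sqrt \<tau>)) + c)) = (LINT z|gaussian. exp c / 2 * (exp x * exp ((1 * sqrt \<tau>) * z) + exp (- x) * exp (((-1) * sqrt \<tau>) * z)))"
  proof (rule Bochner_Integration.integral_cong)
    fix z
    have "exp (ln (cosh (x + z * sqrt \<tau>)) + c) = exp c * cosh (x + z * sqrt \<tau>)"
      by (simp add: exp_add)
    also have "\<dots> = exp c / 2 * (exp x * exp ((1 * sqrt \<tau>) * z) + exp (- x) * exp (((-1) * sqrt \<tau>) * z))"
      by (simp add: cosh_def exp_add[symmetric] algebra_simps)
    finally show "exp (ln (cosh (x + z * sqrt \<tau>)) + c) = exp c / 2 * (exp x * exp ((1 * sqrt \<tau>) * z) + exp (- x) * exp (((-1) * sqrt \<tau>) * z))" .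
  qed simp
  also have "\<dots> = exp c / 2 * (exp x * exp (\<tau> / 2) + exp (- x) * exp (\<tau> / 2))"
    using i[of 1] i[of "-1"] assms
    by (subst integral_mult_right_zero, subst Bochner_Integration.integral_add)
       (auto intro!: integrable_mult_right simp: integral_gaussian_exp[of "sqrt \<tau>"] integral_gaussian_exp[of "- sqrt \<tau>", simplified])
  also have "\<dots> = exp c * cosh x * exp (\<tau> / 2)"
    by (simp add: cosh_def field_simps)
  also have "\<dots> = exp (c + ln (cosh x) + \<tau> / 2)"
    by (simp add: exp_add)
  finally show ?thesis by (simp add: gauss_log_mean_def)
qed

section \<open>Solutions for discrete measures\<close>

text \<open>Propagation from time 1 downwards, each step crossing an interval whose interior
  contains no point of \<open>A\<close>. The induction is on the number of such points between
  \<open>s\<close> and 1.\<close>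

lemma back_induct [consumes 3, case_names one step]:
  fixes A :: "real set"
  assumes A: "finite A" and s: "0 \<le> s" "s \<le> 1"
    and one: "P 1" and step: "\<And>s t. 0 \<le> s \<Longrightarrow> s < t \<Longrightarrow> t \<le> 1 \<Longrightarrow> A \<inter> {s<..<t} = {} \<Longrightarrow> P t \<Longrightarrow> P s"
  shows "P s"
  using s
proof (induction "card (A \<inter> {s<..<1})" arbitrary: s rule: less_induct)
  case less
  show ?case
  proof (cases "s = 1 \<or> A \<inter> {s<..<1} = {}")
    case True
    then show ?thesis using one step[of s 1] less.prems by force
  next
    case False
    let ?B = "A \<inter> {s<..<1}"
    have B: "finite ?B" "?B \<noteq> {}" using A False by auto
    define t where "t = Min ?B"
    have t: "t \<in> ?B" "\<And>b. b \<in> ?B \<Longrightarrow> t \<le> b" using Min_in[OF B] B unfolding t_def by auto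
    have "A \<inter> {t<..<1} \<subset> ?B" using t by auto
    then have "P t" using less.hyps[of t] psubset_card_mono[OF B(1)] t less.prems by auto
    moreover have "A \<inter> {s<..<t} = {}" using t by force
    ultimately show ?thesis using step[of s t] t less.prems by auto
  qed
qed

text \<open>Each step starts at \<open>s0\<close> or at a point of \<open>A\<close>. A junction of
  two pieces in the interior is therefore always a point of \<open>A\<close>, where no derivative
  will have to be matched.\<close>

lemma forward_induct [consumes 4, case_names start step]:
  fixes A :: "real set"
  assumes A: "finite A" and s: "s0 \<le> t" "t \<le> 1" "0 \<le> s0"
    and one: "P s0" and step: "\<And>s t. s = s0 \<or> s \<in> A \<Longrightarrow> s0 \<le> s \<Longrightarrow> s < t \<Longrightarrow> t \<le> 1 \<Longrightarrow> A \<inter> {s<..<t} = {} \<Longrightarrow> P s \<Longrightarrow> P t"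
  shows "P t"
  using s(1,2)
proof (induction "card (A \<inter> {s0<..<t})" arbitrary: t rule: less_induct)
  case less
  show ?case
  proof (cases "t = s0 \<or> A \<inter> {s0<..<t} = {}")
    case True
    then show ?thesis using one step[of s0 t] less.prems by force
  next
    case False
    let ?B = "A \<inter> {s0<..<t}"
    have B: "finite ?B" "?B \<noteq> {}" using A False by auto
    define s where "s = Max ?B"
    have t: "s \<in> ?B" "\<And>b. b \<in> ?B \<Longrightarrow> b \<le> s" using Max_in[OF B] B unfolding s_def by auto
    have "A \<inter> {s0<..<s} \<subset> ?B" using t by auto
    then have "P s" using less.hyps[of s] psubset_card_mono[OF B(1)] t less.prems by auto
    moreover have "A \<inter> {s<..<t} = {}" using t by force
    ultimately show ?thesis using step[of s t] t less.prems by auto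
  qed
qed

section \<open>Measures on the unit interval and their distribution functions\<close>

lemma prob01:
  assumes "\<mu> \<in> prob_measures01"
  shows "prob_space \<mu>" "space \<mu> = {0..1}" "A \<subseteq> {0..1} \<Longrightarrow> A \<in> sets borel \<Longrightarrow> A \<in> sets \<mu>"
proof -
  have s: "sets \<mu> = sets (restrict_space borel {0..1})" and p: "prob_space \<mu>"
    using assms by (auto simp: prob_measures01_def)
  show "prob_space \<mu>" by fact
  show "space \<mu> = {0..1}" using sets_eq_imp_space_eq[OF s] by (simp add: space_restrict_space)
  show "A \<subseteq> {0..1} \<Longrightarrow> A \<in> sets borel \<Longrightarrow> A \<in> sets \<mu>"
    unfolding s by (simp add: sets_restrict_space_iff)
qed

lemma dist_fun_diff:
  assumes "\<mu> \<in> prob_measures01" "0 \<le> s" "s \<le> t" "t \<le> 1"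
  shows "dist_fun \<mu> t - dist_fun \<mu> s = measure \<mu> {s<..t}"
proof -
  interpret prob_space \<mu> using prob01(1)[OF assms(1)] .
  have m: "{0..s} \<in> sets \<mu>" "{s<..t} \<in> sets \<mu>"
    by (rule prob01(3)[OF assms(1)]; use assms in auto)+
  have "{0..t} = {0..s} \<union> {s<..t}" using assms by auto
  then have "dist_fun \<mu> t = measure \<mu> {0..s} + measure \<mu> {s<..t}"
    unfolding dist_fun_def using m by (subst finite_measure_Union[symmetric]) auto
  then show ?thesis by (simp add: dist_fun_def)
qed

lemma dist_fun_mono:
  "\<mu> \<in> prob_measures01 \<Longrightarrow> 0 \<le> s \<Longrightarrow> s \<le> t \<Longrightarrow> t \<le> 1 \<Longrightarrow> dist_fun \<mu> s \<le> dist_fun \<mu> t"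
  using dist_fun_diff[of \<mu> s t] measure_nonneg[of \<mu> "{s<..t}"] by linarith

lemma dist_fun_bounds:
  assumes "\<mu> \<in> prob_measures01" shows "0 \<le> dist_fun \<mu> u" "dist_fun \<mu> u \<le> 1" "dist_fun \<mu> 1 = 1"
proof -
  interpret prob_space \<mu> using prob01(1)[OF assms(1)] .
  show "0 \<le> dist_fun \<mu> u" "dist_fun \<mu> u \<le> 1" by (auto simp: dist_fun_def)
  show "dist_fun \<mu> 1 = 1" using prob_space prob01(2)[OF assms] by (simp add: dist_fun_def)
qed

lemma discrete_atoms:
  assumes "\<mu> \<in> discrete_measures01"
  shows "finite (atoms \<mu>)" "atoms \<mu> \<subseteq> {0..1}" "measure \<mu> (atoms \<mu>) = 1"
proof -
  have \<mu>: "\<mu> \<in> prob_measures01" using assms by (simp add: discrete_measures01_def)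
  interpret prob_space \<mu> using prob01(1)[OF \<mu>] .
  obtain S where S: "finite S" "S \<subseteq> {0..1}" "measure \<mu> S = 1"
    using assms by (auto simp: discrete_measures01_def)
  have fin: "A \<subseteq> S \<Longrightarrow> A \<in> sets \<mu>" for A
    by (rule prob01(3)[OF \<mu>]) (use S finite_subset in \<open>auto intro!: borel_closed finite_imp_closed\<close>)
  have z: "measure \<mu> (space \<mu> - S) = 0" using prob_compl[OF fin[OF order_refl]] S by simp
  have sub: "atoms \<mu> \<subseteq> S"
  proof
    fix q assume q: "q \<in> atoms \<mu>"
    show "q \<in> S"
    proof (rule ccontr)
      assume "q \<notin> S"
      then have "{q} \<subseteq> space \<mu> - S" using q prob01(2)[OF \<mu>] by (auto simp: atoms_def)
      then have "measure \<mu> {q} \<le> measure \<mu> (space \<mu> - S)"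
        by (rule finite_measure_mono) (use fin in auto)
      with z q show False by (auto simp: atoms_def)
    qed
  qed
  show "finite (atoms \<mu>)" using sub S(1) finite_subset by auto
  show "atoms \<mu> \<subseteq> {0..1}" by (auto simp: atoms_def)
  have sum: "measure \<mu> A = (\<Sum>q\<in>A. measure \<mu> {q})" if "A \<subseteq> S" for A
    using that fin finite_subset[OF that S(1)] by (intro finite_measure_eq_sum_singleton) auto
  have "measure \<mu> S = measure \<mu> (atoms \<mu>)"
    unfolding sum[OF order_refl] sum[OF sub]
    by (rule sum.mono_neutral_right[OF S(1) sub])
       (use S measure_nonneg[of \<mu>] in \<open>force simp: atoms_def less_le\<close>)
  then show "measure \<mu> (atoms \<mu>) = 1" using S by simp
qed

lemma discrete_null:
  assumes "\<mu> \<in> discrete_measures01" "A \<subseteq> {0..1}" "A \<in> sets borel" "A \<inter> atoms \<mu> = {}"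
  shows "measure \<mu> A = 0"
proof -
  have \<mu>: "\<mu> \<in> prob_measures01" using assms by (simp add: discrete_measures01_def)
  interpret prob_space \<mu> using prob01(1)[OF \<mu>] .
  note a = discrete_atoms[OF assms(1)]
  have m: "atoms \<mu> \<in> sets \<mu>"
    by (rule prob01(3)[OF \<mu>]) (use a in \<open>auto intro!: borel_closed finite_imp_closed\<close>)
  have "measure \<mu> A \<le> measure \<mu> (space \<mu> - atoms \<mu>)"
    by (rule finite_measure_mono[OF _ sets.compl_sets[OF m]]) (use assms prob01(2)[OF \<mu>] in auto)
  also have "\<dots> = 0" using prob_compl[OF m] a by simp
  finally show ?thesis using measure_nonneg[of \<mu> A] by linarith
qed

lemma dist_fun_const:
  assumes "\<mu> \<in> discrete_measures01" "0 \<le> s" "s \<le> t" "t \<le> 1" "atoms \<mu> \<inter> {s<..t} = {}"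
  shows "dist_fun \<mu> t = dist_fun \<mu> s"
proof -
  have "measure \<mu> {s<..t} = 0"
    by (rule discrete_null[OF assms(1)]) (use assms in auto)
  then show ?thesis using dist_fun_diff[of \<mu> s t] assms by (auto simp: discrete_measures01_def)
qed

text \<open>The second derivative vanishes at 0 when the quadratic coefficient is zero, so
  positivity is assumed only to the right of 0. The derivative of \<open>deriv \<xi>\<close> is
  two-sided even at 0 and 1.\<close>

locale parisi_setup =
  fixes \<xi> :: "real \<Rightarrow> real"
  assumes theta_deriv: "0 \<le> u \<Longrightarrow> u \<le> 1 \<Longrightarrow> (deriv \<xi> has_real_derivative deriv (deriv \<xi>) u) (at u)"
    and theta'_cont: "continuous_on {0..1} (deriv (deriv \<xi>))"
    and theta'_pos: "0 < u \<Longrightarrow> u \<le> 1 \<Longrightarrow> 0 < deriv (deriv \<xi>) u"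
begin

abbreviation \<theta> :: "real \<Rightarrow> real" where "\<theta> \<equiv> deriv \<xi>"
abbreviation \<theta>' :: "real \<Rightarrow> real" where "\<theta>' \<equiv> deriv (deriv \<xi>)"

lemma theta_cont: "continuous_on {0..1} \<theta>"
  by (rule DERIV_continuous_on[OF has_field_derivative_at_within[OF theta_deriv]]) auto

lemma theta_strict:
  assumes "0 \<le> s" "s < t" "t \<le> 1" shows "\<theta> s < \<theta> t"
proof (rule DERIV_pos_imp_increasing_open[OF assms(2)])
  show "\<exists>y. DERIV \<theta> x :> y \<and> 0 < y" if "s < x" "x < t" for x
    using theta_deriv[of x] theta'_pos[of x] that assms by auto
  show "continuous_on {s..t} \<theta>"
    by (rule continuous_on_subset[OF theta_cont]) (use assms in auto)
qed

lemma theta_mono: "0 \<le> s \<Longrightarrow> s \<le> t \<Longrightarrow> t \<le> 1 \<Longrightarrow> \<theta> s \<le> \<theta> t"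
  using theta_strict[of s t] by (cases "s = t") auto

lemma theta'_nonneg:
  assumes "0 \<le> u" "u \<le> 1" shows "0 \<le> \<theta>' u"
proof (cases "u = 0")
  case True
  have "((\<lambda>n. \<theta>' (1 / real (Suc n))) \<longlongrightarrow> \<theta>' 0) sequentially"
    by (rule continuous_on_tendsto_compose[OF theta'_cont LIMSEQ_Suc[OF lim_1_over_n]]) (auto simp: divide_le_eq)
  then show ?thesis unfolding True
    by (rule LIMSEQ_le_const) (auto intro!: less_imp_le[OF theta'_pos] exI[of _ 0] simp: divide_le_eq)
next
  case False then show ?thesis using theta'_pos[of u] assms by auto
qed

text \<open>The exponent in force at time \<open>s\<close> when the recursion carries mass
  \<open>m\<close> and has the atoms \<open>qs\<close> ahead. The value 1 for the empty list is the
  total mass reached after the last atom, in accordance with \<open>glm_ln_cosh\<close>.\<close>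

fun cur :: "real measure \<Rightarrow> real \<Rightarrow> real list \<Rightarrow> real \<Rightarrow> real" where
  "cur \<mu> m [] s = 1"
| "cur \<mu> m (q # qs) s = (if s < q then m else cur \<mu> (dist_fun \<mu> q) qs s)"

lemma rec_smooth:
  assumes "0 \<le> u" "u \<le> 1" "set qs \<subseteq> {0..1}"
  shows "slope_smooth (\<lambda>x. parisi_rec \<xi> \<mu> m qs x u)"
  using assms
proof (induction qs arbitrary: m u)
  case Nil
  then show ?case by (auto intro: slope_smooth_add_const slope_smooth_ln_cosh)
next
  case (Cons q qs)
  show ?case
  proof (cases "u < q")
    case True
    then show ?thesis
      using slope_smooth_glm[OF Cons.IH[of q], of "\<theta> q - \<theta> u"] theta_mono[of u q] Cons.prems by auto
  next
    case False
    then show ?thesis using Cons by auto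
  qed
qed

text \<open>The recursion runs to the next atom in one go, whereas \<open>t\<close> may stop short
  of it. The semigroup property splits the step at \<open>t\<close>; beyond the last atom the
  eigenfunction identity takes over.\<close>

lemma rec_step:
  assumes "0 \<le> s" "s < t" "t \<le> 1" "set qs \<subseteq> {0..1}" "set qs \<inter> {s<..<t} = {}"
  shows "parisi_rec \<xi> \<mu> m qs x s = gauss_log_mean (cur \<mu> m qs s) (\<lambda>y. parisi_rec \<xi> \<mu> m qs y t) (\<theta> t - \<theta> s) x"
  using assms(4,5)
proof (induction qs arbitrary: m)
  case Nil
  have "0 \<le> \<theta> t - \<theta> s" using theta_mono[of s t] assms by auto
  from glm_ln_cosh[OF this, of "(\<theta> 1 - \<theta> t) / 2" x] show ?case by (simp add: field_simps)
next
  case (Cons q qs)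
  show ?case
  proof (cases "s < q")
    case False
    then show ?thesis using Cons assms by auto
  next
    case True
    with Cons.prems assms have tq: "t \<le> q" by auto
    have sm: "slope_smooth (\<lambda>y. parisi_rec \<xi> \<mu> (dist_fun \<mu> q) qs y q)"
      by (rule rec_smooth) (use Cons.prems in auto)
    show ?thesis
    proof (cases "t = q")
      case True
      then show ?thesis using \<open>s < q\<close> by simp
    next
      case False
      then have "t < q" using tq by simp
      then have "gauss_log_mean m (\<lambda>y. parisi_rec \<xi> \<mu> m (q # qs) y t) (\<theta> t - \<theta> s) x =
        gauss_log_mean m (gauss_log_mean m (\<lambda>y. parisi_rec \<xi> \<mu> (dist_fun \<mu> q) qs y q) (\<theta> q - \<theta> t)) (\<theta> t - \<theta> s) x"
        by simp
      also have "\<dots> = gauss_log_mean m (\<lambda>y. parisi_rec \<xi> \<mu> (dist_fun \<mu> q) qs y q) ((\<theta> t - \<theta> s) + (\<theta> q - \<theta> t)) x"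
        by (rule glm_glm[OF sm]) (use theta_mono[of s t] theta_mono[of t q] assms \<open>t < q\<close> Cons.prems in auto)
      finally show ?thesis using \<open>s < q\<close> \<open>t < q\<close> by simp
    qed
  qed
qed

text \<open>\<open>p\<close> is the last atom passed. A negative \<open>p\<close> encodes the start
  with mass 0, so that an atom at 0 still counts as lying ahead; it is passed at once, as
  \<open>s\<close> is nonnegative.\<close>

lemma cur_eq:
  assumes \<mu>: "\<mu> \<in> discrete_measures01" and s: "0 \<le> s" "s \<le> 1"
    and "sorted_wrt (<) qs" "set qs \<subseteq> atoms \<mu>" "atoms \<mu> \<inter> {p<..} = set qs"
    and "(p < 0 \<and> m = 0) \<or> (0 \<le> p \<and> p \<le> 1 \<and> m = dist_fun \<mu> p)" "p \<le> s"
  shows "cur \<mu> m qs s = dist_fun \<mu> s"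
  using assms(4-)
proof (induction qs arbitrary: m p)
  case Nil
  have pm: "\<mu> \<in> prob_measures01" using \<mu> by (simp add: discrete_measures01_def)
  have "dist_fun \<mu> 1 = dist_fun \<mu> s"
    by (rule dist_fun_const[OF \<mu>]) (use Nil s in auto)
  then show ?case using dist_fun_bounds[OF pm] by simp
next
  case (Cons q qs)
  have q01: "q \<in> {0..1}" using discrete_atoms(2)[OF \<mu>] Cons.prems by auto
  show ?case
  proof (cases "s < q")
    case True
    have no: "atoms \<mu> \<inter> {p<..s} = {}"
    proof (rule ccontr)
      assume "atoms \<mu> \<inter> {p<..s} \<noteq> {}"
      then obtain r where r: "r \<in> atoms \<mu>" "p < r" "r \<le> s" by auto
      then have "r \<in> atoms \<mu> \<inter> {p<..}" by simp
      then have "r \<in> set (q # qs)" unfolding Cons.prems(3) .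
      then show False using Cons.prems(1) True r by auto
    qed
    have "dist_fun \<mu> s = m"
    proof (cases "p < 0")
      case True
      then have "measure \<mu> {0..s} = 0"
        by (intro discrete_null[OF \<mu>]) (use no s in auto)
      then show ?thesis using True Cons.prems by (auto simp: dist_fun_def)
    next
      case False
      then show ?thesis using dist_fun_const[OF \<mu>, of p s] no s Cons.prems by auto
    qed
    then show ?thesis using True by simp
  next
    case False
    have eq: "atoms \<mu> \<inter> {q<..} = set qs"
    proof -
      have "q \<in> atoms \<mu> \<inter> {p<..}" unfolding Cons.prems(3) by simp
      then have "{q<..} = {p<..} \<inter> {q<..}" by auto
      then have "atoms \<mu> \<inter> {q<..} = set (q # qs) \<inter> {q<..}" unfolding Cons.prems(3)[symmetric] by blast
      also have "\<dots> = set qs" using Cons.prems(1) by auto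
      finally show ?thesis .
    qed
    have "cur \<mu> (dist_fun \<mu> q) qs s = dist_fun \<mu> s"
    proof (rule Cons.IH[OF _ _ eq])
      show "sorted_wrt (<) qs" "set qs \<subseteq> atoms \<mu>" using Cons.prems(1,2) by simp_all
    qed (use False q01 in simp_all)
    then show ?thesis using False by simp
  qed
qed

definition Phi :: "real measure \<Rightarrow> real \<Rightarrow> real \<Rightarrow> real" where
  "Phi \<mu> x u = parisi_discrete \<xi> \<mu> x u"

lemma Phi_smooth:
  assumes "\<mu> \<in> discrete_measures01" "0 \<le> u" "u \<le> 1"
  shows "slope_smooth (\<lambda>x. Phi \<mu> x u)"
  unfolding Phi_def parisi_discrete_def
  by (rule rec_smooth) (use assms discrete_atoms[OF assms(1)] in auto)

lemma Phi_step:
  assumes \<mu>: "\<mu> \<in> discrete_measures01" and "0 \<le> s" "s < t" "t \<le> 1" "atoms \<mu> \<inter> {s<..<t} = {}"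
  shows "Phi \<mu> x s = gauss_log_mean (dist_fun \<mu> s) (\<lambda>y. Phi \<mu> y t) (\<theta> t - \<theta> s) x"
proof -
  note a = discrete_atoms[OF \<mu>]
  have "cur \<mu> 0 (sorted_list_of_set (atoms \<mu>)) s = dist_fun \<mu> s"
    by (rule cur_eq[OF \<mu>, where p="-1"]) (use assms a in \<open>auto\<close>)
  then show ?thesis
    unfolding Phi_def parisi_discrete_def
    by (subst rec_step[OF assms(2-4)]) (use assms a in auto)
qed

lemma Phi_1:
  assumes \<mu>: "\<mu> \<in> discrete_measures01"
  shows "Phi \<mu> x 1 = ln (cosh x)"
proof -
  have "parisi_rec \<xi> \<mu> m qs x 1 = ln (cosh x)" if "set qs \<subseteq> {0..1}" for m qs
    using that by (induction qs arbitrary: m) auto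
  then show ?thesis unfolding Phi_def parisi_discrete_def using discrete_atoms[OF \<mu>] by simp
qed

definition dPhi :: "real measure \<Rightarrow> nat \<Rightarrow> real \<Rightarrow> real \<Rightarrow> real" where
  "dPhi \<mu> j x u = (deriv ^^ j) (\<lambda>x. Phi \<mu> x u) x"

lemma dPhi_0 [simp]: "dPhi \<mu> 0 x u = Phi \<mu> x u" by (simp add: dPhi_def)

lemma dPhi_deriv:
  assumes "\<mu> \<in> discrete_measures01" "0 \<le> u" "u \<le> 1"
  shows "((\<lambda>x. dPhi \<mu> j x u) has_real_derivative dPhi \<mu> (Suc j) x u) (at x)"
  using slope_smooth_ex(1)[OF Phi_smooth[OF assms]] unfolding dPhi_def .

text \<open>On an atom-free interval the solution is one Gaussian step run for the variance
  \<open>e u\<close>, which decreases in \<open>u\<close> at rate \<open>\<theta>' u\<close>. The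
  equations of \<open>glm_family\<close> are transported by this change of time.\<close>

lemma dPhi_piece:
  assumes \<mu>: "\<mu> \<in> discrete_measures01" and st: "0 \<le> s" "s < t" "t \<le> 1" "atoms \<mu> \<inter> {s<..<t} = {}"
  shows "bcont {s..t} (dPhi \<mu> (Suc j))" "continuous_on (UNIV \<times> {s..t}) (\<lambda>(x, u). Phi \<mu> x u)"
    "s < u \<Longrightarrow> u < t \<Longrightarrow> ((\<lambda>u. Phi \<mu> x u) has_real_derivative
       - \<theta>' u * ((dPhi \<mu> 2 x u + dist_fun \<mu> u * (dPhi \<mu> 1 x u)\<^sup>2) / 2)) (at u)"
    "s < u \<Longrightarrow> u < t \<Longrightarrow> ((\<lambda>u. dPhi \<mu> (Suc j) x u) has_real_derivative
       - \<theta>' u * (dPhi \<mu> (j + 3) x u / 2 + dist_fun \<mu> u *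
         (poly_val (\<lambda>i. dPhi \<mu> (Suc i) x u) (leib j) + dPhi \<mu> 1 x u * dPhi \<mu> (j + 2) x u))) (at u)"
proof -
  let ?f = "\<lambda>y. Phi \<mu> y t" and ?m = "dist_fun \<mu> s"
  have sm: "slope_smooth ?f" by (rule Phi_smooth) (use \<mu> st in auto)
  interpret terminal ?m ?f "deriv ?f" by (rule slope_smooth_terminal[OF sm])
  obtain V where V: "\<And>x \<tau>. 0 \<le> \<tau> \<Longrightarrow> V 0 x \<tau> = gauss_log_mean ?m ?f \<tau> x"
    "\<And>j x \<tau>. 0 \<le> \<tau> \<Longrightarrow> ((\<lambda>x. V j x \<tau>) has_real_derivative V (Suc j) x \<tau>) (at x)"
    "\<And>j. bcont {0..} (V (Suc j))"
    "continuous_on (UNIV \<times> {0..}) (\<lambda>(x, \<tau>). V 0 x \<tau>)"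
    "\<And>x \<tau>. 0 < \<tau> \<Longrightarrow> ((\<lambda>\<tau>. V 0 x \<tau>) has_real_derivative (V 2 x \<tau> + ?m * (V 1 x \<tau>)\<^sup>2) / 2) (at \<tau>)"
    "\<And>j x \<tau>. 0 < \<tau> \<Longrightarrow> ((\<lambda>\<tau>. V (Suc j) x \<tau>) has_real_derivative
       (V (j + 3) x \<tau> / 2 + ?m * (poly_val (\<lambda>i. V (Suc i) x \<tau>) (leib j) + V 1 x \<tau> * V (j + 2) x \<tau>))) (at \<tau>)"
    using glm_family by blast
  define e where "e = (\<lambda>u. \<theta> t - \<theta> u)"
  have e0: "0 \<le> e u" if "u \<in> {s..t}" for u using that theta_mono[of u t] st by (auto simp: e_def)
  have e1: "0 < e u" if "s < u" "u < t" for u using that theta_strict[of u t] st by (auto simp: e_def)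
  have ec: "continuous_on {s..t} e"
    unfolding e_def by (intro continuous_intros continuous_on_subset[OF theta_cont]) (use st in auto)
  have m: "dist_fun \<mu> u = ?m" if "s \<le> u" "u < t" for u
    by (rule dist_fun_const[OF \<mu>]) (use that st in auto)
  have Pe: "Phi \<mu> x u = V 0 x (e u)" if u: "u \<in> {s..t}" for x u
  proof (cases "u = t")
    case True then show ?thesis using V(1)[of 0 x] by (simp add: e_def)
  next
    case False
    have "atoms \<mu> \<inter> {u<..<t} = {}" using st(4) u by force
    then show ?thesis using False Phi_step[OF \<mu>, of u t x] m[of u] V(1)[OF e0[OF u]] u st by (auto simp: e_def)
  qed
  have De: "dPhi \<mu> j x u = V j x (e u)" if u: "u \<in> {s..t}" for j x u
  proof -
    have "(deriv ^^ j) (\<lambda>x. V 0 x (e u)) = (\<lambda>x. V j x (e u))"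
      by (rule deriv_funpow_eq[of "\<lambda>j x. V j x (e u)"]) (rule V(2)[OF e0[OF u]])
    then show ?thesis using Pe[OF u] by (simp add: dPhi_def)
  qed
  have co: "continuous_on (UNIV \<times> {s..t}) (\<lambda>(x, u). W x (e u))"
    if W: "continuous_on (UNIV \<times> {0..}) (\<lambda>(x, \<tau>). W x \<tau>)" for W :: "real \<Rightarrow> real \<Rightarrow> real"
  proof -
    have c: "continuous_on (UNIV \<times> {s..t}) (\<lambda>p. (fst p :: real, e (snd p)))"
      by (intro continuous_intros continuous_on_compose2[OF ec]) auto
    have i: "(\<lambda>p. (fst p :: real, e (snd p))) ` (UNIV \<times> {s..t}) \<subseteq> UNIV \<times> {0..}" using e0 by auto
    show ?thesis using continuous_on_compose2[OF W c i] by (simp add: case_prod_beta)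
  qed
  show "bcont {s..t} (dPhi \<mu> (Suc j))"
  proof -
    obtain C where C: "\<And>x \<tau>. \<tau> \<in> {0..} \<Longrightarrow> \<bar>V (Suc j) x \<tau>\<bar> \<le> C" using V(3)[of j] by (rule bcontE) blast
    have "bcont {s..t} (\<lambda>x u. V (Suc j) x (e u))"
      by (rule bcontI[OF co[OF bcont_cont[OF V(3)]]]) (use C e0 in auto)
    then show ?thesis by (rule bcont_cong) (simp add: De)
  qed
  show "continuous_on (UNIV \<times> {s..t}) (\<lambda>(x, u). Phi \<mu> x u)"
    by (rule continuous_on_eq[OF co[OF V(4)]]) (auto simp: Pe)
  have ed: "(e has_real_derivative - \<theta>' u) (at u)" if "s < u" "u < t"
    unfolding e_def using theta_deriv[of u] that st by (auto intro!: derivative_eq_intros)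
  have tr: "((\<lambda>u. g x u) has_real_derivative - \<theta>' u * d) (at u)"
    if u: "s < u" "u < t" and W: "((\<lambda>\<tau>. W x \<tau>) has_real_derivative d) (at (e u))"
      and eq: "\<And>u. u \<in> {s..t} \<Longrightarrow> g x u = W x (e u)" for g W :: "real \<Rightarrow> real \<Rightarrow> real" and x d
  proof -
    have "((\<lambda>u. W x (e u)) has_real_derivative - \<theta>' u * d) (at u)"
      by (rule DERIV_cong[OF DERIV_chain2[OF W ed[OF u]]]) simp
    then show ?thesis
      by (rule has_field_derivative_transform_within_open[where S="{s<..<t}"]) (use u eq in auto)
  qed
  show "((\<lambda>u. Phi \<mu> x u) has_real_derivative
       - \<theta>' u * ((dPhi \<mu> 2 x u + dist_fun \<mu> u * (dPhi \<mu> 1 x u)\<^sup>2) / 2)) (at u)" if u: "s < u" "u < t"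
    using tr[OF u, of "V 0" x _ "Phi \<mu>", OF V(5)[OF e1[OF u]] Pe] De[of u] u m[of u] by simp
  show "((\<lambda>u. dPhi \<mu> (Suc j) x u) has_real_derivative
       - \<theta>' u * (dPhi \<mu> (j + 3) x u / 2 + dist_fun \<mu> u *
         (poly_val (\<lambda>i. dPhi \<mu> (Suc i) x u) (leib j) + dPhi \<mu> 1 x u * dPhi \<mu> (j + 2) x u))) (at u)" if u: "s < u" "u < t"
    using tr[OF u, of "V (Suc j)" x _ "dPhi \<mu> (Suc j)", OF V(6)[OF e1[OF u]] De] De[of u] u m[of u] by simp
qed

end

lemma bcont_at:
  assumes "bcont1 (\<lambda>x. g x a)" shows "bcont {a..a} g"
proof -
  have c: "continuous_on UNIV (\<lambda>x. g x a)" and b: "\<exists>C. \<forall>x. \<bar>g x a\<bar> \<le> C" using assms bcont1_iff by auto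
  have "continuous_on (UNIV \<times> {a..a}) (\<lambda>p. g (fst p) a)"
    by (rule continuous_on_compose2[OF c]) (auto intro: continuous_intros)
  then have "continuous_on (UNIV \<times> {a..a}) (\<lambda>(x, u). g x u)"
    by (rule continuous_on_eq) auto
  with b show ?thesis unfolding bcont_def by auto
qed

context parisi_setup
begin

lemma theta'_bound: obtains M where "0 \<le> M" "\<And>u. u \<in> {0..1} \<Longrightarrow> \<bar>\<theta>' u\<bar> \<le> M"
proof -
  obtain M where M: "\<forall>u\<in>{0..1}. \<bar>\<theta>' u\<bar> \<le> M"
    using compact_imp_bounded[OF compact_continuous_image[OF theta'_cont compact_Icc]] unfolding bounded_iff by auto
  show ?thesis by (rule that[of M]) (use M order_trans[OF abs_ge_zero, of "\<theta>' 0" M] in auto)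
qed

lemma dPhi_bcont:
  assumes \<mu>: "\<mu> \<in> discrete_measures01"
  shows "bcont {0..1} (dPhi \<mu> (Suc j))"
proof -
  have "0 \<le> (0::real)" "0 \<le> (1::real)" by auto
  from discrete_atoms(1)[OF \<mu>] this show ?thesis
  proof (induction rule: back_induct)
    case one
    show ?case
      by (rule bcont_at) (use slope_smooth_ex(2)[OF Phi_smooth[OF \<mu>, of 1], of j] in \<open>simp add: dPhi_def[abs_def]\<close>)
  next
    case (step s t)
    then show ?case using bcont_Un[OF dPhi_piece(1)[OF \<mu>, of s t j]] by auto
  qed
qed

text \<open>The solution itself is unbounded, so its terminal value is subtracted. On each piece the
  time derivative is bounded by \<open>K\<close>, and pieces have length at most 1.\<close>

lemma Phi_bcont:
  assumes \<mu>: "\<mu> \<in> discrete_measures01"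
  shows "bcont {0..1} (\<lambda>x u. Phi \<mu> x u - ln (cosh x))"
proof -
  have lc: "continuous_on UNIV (\<lambda>x::real. ln (cosh x))"
    by (intro continuous_intros) (auto simp: less_le)
  have "0 \<le> (0::real)" "0 \<le> (1::real)" by auto
  from discrete_atoms(1)[OF \<mu>] this show ?thesis
  proof (induction rule: back_induct)
    case one
    show ?case
      by (rule bcont_at) (use bcont_const[of "{0}" 0] in \<open>simp add: Phi_1[OF \<mu>]\<close>)
  next
    case (step s t)
    note P = dPhi_piece[OF \<mu> step(1-4)]
    obtain C where C: "\<And>x u. u \<in> {t..1} \<Longrightarrow> \<bar>Phi \<mu> x u - ln (cosh x)\<bar> \<le> C"
      using step(5) by (rule bcontE) blast
    obtain D1 where D1: "\<And>x u. u \<in> {s..t} \<Longrightarrow> \<bar>dPhi \<mu> (Suc 0) x u\<bar> \<le> D1" using P(1) by (rule bcontE) blast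
    obtain D2 where D2: "0 \<le> D2" "\<And>x u. u \<in> {s..t} \<Longrightarrow> \<bar>dPhi \<mu> (Suc 1) x u\<bar> \<le> D2" using P(1) by (rule bcontE) blast
    obtain M where M: "\<And>u. u \<in> {0..1} \<Longrightarrow> \<bar>\<theta>' u\<bar> \<le> M"
      using theta'_bound by blast
    define K where "K = M * ((D2 + D1\<^sup>2) / 2)"
    have pm: "\<mu> \<in> prob_measures01" using \<mu> by (simp add: discrete_measures01_def)
    have d: "\<bar>Phi \<mu> x t - Phi \<mu> x u\<bar> \<le> K" if u: "u \<in> {s..t}" for x u
    proof (cases "u = t")
      case True
      have "0 \<le> M" using M[of 0] by auto
      then show ?thesis using True D2 by (auto simp: K_def)
    next
      case False
      have "\<exists>l z. u < z \<and> z < t \<and> DERIV (\<lambda>u. Phi \<mu> x u) z :> l \<and> Phi \<mu> x t - Phi \<mu> x u = (t - u) * l"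
      proof (rule MVT)
        show "u < t" using u False by auto
        have c: "continuous_on {u..t} (\<lambda>u. (x, u))" by (intro continuous_intros)
        have i: "(\<lambda>u. (x, u)) ` {u..t} \<subseteq> UNIV \<times> {s..t}" using u by auto
        show "continuous_on {u..t} (\<lambda>u. Phi \<mu> x u)" using continuous_on_compose2[OF P(2) c i] by simp
        show "(\<lambda>u. Phi \<mu> x u) differentiable at z" if "u < z" "z < t" for z
          using P(3)[of z x] that u by (auto simp: real_differentiable_def)
      qed
      then obtain l z where z: "u < z" "z < t" "DERIV (\<lambda>u. Phi \<mu> x u) z :> l" "Phi \<mu> x t - Phi \<mu> x u = (t - u) * l"
        by blast
      have "l = - \<theta>' z * ((dPhi \<mu> 2 x z + dist_fun \<mu> z * (dPhi \<mu> 1 x z)\<^sup>2) / 2)"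
        by (rule DERIV_unique[OF z(3) P(3)]) (use z u in auto)
      moreover have "\<bar>dPhi \<mu> 2 x z + dist_fun \<mu> z * (dPhi \<mu> 1 x z)\<^sup>2\<bar> \<le> D2 + D1\<^sup>2"
      proof -
        have "\<bar>dPhi \<mu> 1 x z\<bar> \<le> D1" "\<bar>dPhi \<mu> 2 x z\<bar> \<le> D2" using D1[of z x] D2(2)[of z x] z u by (auto simp: numeral_2_eq_2)
        moreover from this have "(dPhi \<mu> 1 x z)\<^sup>2 \<le> D1\<^sup>2" by (metis abs_ge_zero power2_abs power_mono)
        moreover have "dist_fun \<mu> z * (dPhi \<mu> 1 x z)\<^sup>2 \<le> 1 * (dPhi \<mu> 1 x z)\<^sup>2"
          by (intro mult_right_mono dist_fun_bounds[OF pm]) auto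
        moreover have "0 \<le> dist_fun \<mu> z * (dPhi \<mu> 1 x z)\<^sup>2" using dist_fun_bounds[OF pm] by auto
        ultimately show ?thesis by linarith
      qed
      ultimately have "\<bar>l\<bar> \<le> K"
        unfolding K_def using M[of z] z u step
        by (auto simp: abs_mult intro!: mult_mono divide_right_mono)
      moreover have "\<bar>t - u\<bar> \<le> 1" using u step by auto
      ultimately have "\<bar>t - u\<bar> * \<bar>l\<bar> \<le> 1 * K" by (intro mult_mono) auto
      then show ?thesis using z(4) by (simp add: abs_mult)
    qed
    have "bcont {s..t} (\<lambda>x u. Phi \<mu> x u - ln (cosh x))"
    proof (rule bcontI[of _ _ "C + K"])
      have "continuous_on (UNIV \<times> {s..t}) (\<lambda>p. (\<lambda>(x, u). Phi \<mu> x u) p - ln (cosh (fst p)))"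
        by (intro continuous_on_diff P(2) continuous_on_compose2[OF lc]) (auto intro: continuous_intros)
      then show "continuous_on (UNIV \<times> {s..t}) (\<lambda>(x, u). Phi \<mu> x u - ln (cosh x))"
        by (simp add: case_prod_beta)
      show "\<bar>Phi \<mu> x u - ln (cosh x)\<bar> \<le> C + K" if "u \<in> {s..t}" for x u
        using C[of t x] d[OF that, of x] step by auto
    qed
    then show ?case using bcont_Un step by auto
  qed
qed

lemma dPhi_time:
  assumes \<mu>: "\<mu> \<in> discrete_measures01" and u: "0 < u" "u < 1" "u \<notin> atoms \<mu>"
  shows "((\<lambda>u. Phi \<mu> x u) has_real_derivative
       - \<theta>' u * ((dPhi \<mu> 2 x u + dist_fun \<mu> u * (dPhi \<mu> 1 x u)\<^sup>2) / 2)) (at u)"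
    "((\<lambda>u. dPhi \<mu> (Suc j) x u) has_real_derivative
       - \<theta>' u * (dPhi \<mu> (j + 3) x u / 2 + dist_fun \<mu> u *
         (poly_val (\<lambda>i. dPhi \<mu> (Suc i) x u) (leib j) + dPhi \<mu> 1 x u * dPhi \<mu> (j + 2) x u))) (at u)"
proof -
  have "open ({0<..<1} - atoms \<mu>)"
    using discrete_atoms(1)[OF \<mu>] by (intro open_Diff finite_imp_closed) auto
  then obtain e where e: "e > 0" "ball u e \<subseteq> {0<..<1} - atoms \<mu>"
    using u open_contains_ball by (metis Diff_iff greaterThanLessThan_iff)
  then have "v \<in> ball u e \<Longrightarrow> 0 < v \<and> v < 1 \<and> v \<notin> atoms \<mu>" for v by auto
  from this[of "u - e/2"] this[of "u + e/2"] have b: "0 \<le> u - e/2" "u + e/2 \<le> 1"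
    using e(1) by (auto simp: dist_real_def)
  have n: "atoms \<mu> \<inter> {u - e/2<..<u + e/2} = {}"
  proof -
    have "{u - e/2<..<u + e/2} \<subseteq> ball u e" using e(1) by (auto simp: dist_real_def)
    with e show ?thesis by auto
  qed
  note P = dPhi_piece[OF \<mu> b(1) _ b(2) n]
  show "((\<lambda>u. Phi \<mu> x u) has_real_derivative
       - \<theta>' u * ((dPhi \<mu> 2 x u + dist_fun \<mu> u * (dPhi \<mu> 1 x u)\<^sup>2) / 2)) (at u)"
    by (rule P(3)) (use e in auto)
  show "((\<lambda>u. dPhi \<mu> (Suc j) x u) has_real_derivative
       - \<theta>' u * (dPhi \<mu> (j + 3) x u / 2 + dist_fun \<mu> u *
         (poly_val (\<lambda>i. dPhi \<mu> (Suc i) x u) (leib j) + dPhi \<mu> 1 x u * dPhi \<mu> (j + 2) x u))) (at u)"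
    by (rule P(4)) (use e in auto)
qed

end

section \<open>Expectations along the dynamics\<close>

text \<open>Expectation functionals, characterised by what survives composition with the Gaussian kernels
  below; no underlying probability measure on the line has to be constructed.\<close>

definition state :: "((real \<Rightarrow> real) \<Rightarrow> real) \<Rightarrow> bool" where
  "state \<Lambda> \<longleftrightarrow>
    (\<forall>f g a b. bcont1 f \<longrightarrow> bcont1 g \<longrightarrow> \<Lambda> (\<lambda>x. a * f x + b * g x) = a * \<Lambda> f + b * \<Lambda> g) \<and>
    (\<forall>f. bcont1 f \<longrightarrow> (\<forall>x. 0 \<le> f x) \<longrightarrow> 0 \<le> \<Lambda> f) \<and> \<Lambda> (\<lambda>_. 1) = 1 \<and>
    (\<forall>F f C. (\<forall>n. bcont1 (F n)) \<longrightarrow> bcont1 f \<longrightarrow> (\<forall>n x. \<bar>F n x\<bar> \<le> C) \<longrightarrow>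
      (\<forall>x. (\<lambda>n. F n x) \<longlonglongrightarrow> f x) \<longrightarrow> (\<lambda>n. \<Lambda> (F n)) \<longlonglongrightarrow> \<Lambda> f)"

lemma state_lin: "state \<Lambda> \<Longrightarrow> bcont1 f \<Longrightarrow> bcont1 g \<Longrightarrow> \<Lambda> (\<lambda>x. a * f x + b * g x) = a * \<Lambda> f + b * \<Lambda> g"
  and state_nonneg: "state \<Lambda> \<Longrightarrow> bcont1 f \<Longrightarrow> (\<And>x. 0 \<le> f x) \<Longrightarrow> 0 \<le> \<Lambda> f"
  and state_1: "state \<Lambda> \<Longrightarrow> \<Lambda> (\<lambda>_. 1) = 1"
  and state_lim: "state \<Lambda> \<Longrightarrow> (\<And>n. bcont1 (F n)) \<Longrightarrow> bcont1 f \<Longrightarrow> (\<And>n x. \<bar>F n x\<bar> \<le> C) \<Longrightarrow>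
      (\<And>x. (\<lambda>n. F n x) \<longlonglongrightarrow> f x) \<Longrightarrow> (\<lambda>n. \<Lambda> (F n)) \<longlonglongrightarrow> \<Lambda> f"
  unfolding state_def by blast+

lemma bcont1_const: "bcont1 (\<lambda>_. c)" by (rule bcont_const)

lemma state_cmult: "state \<Lambda> \<Longrightarrow> bcont1 f \<Longrightarrow> \<Lambda> (\<lambda>x. a * f x) = a * \<Lambda> f"
  using state_lin[of \<Lambda> f f a 0] by simp

lemma state_add: "state \<Lambda> \<Longrightarrow> bcont1 f \<Longrightarrow> bcont1 g \<Longrightarrow> \<Lambda> (\<lambda>x. f x + g x) = \<Lambda> f + \<Lambda> g"
  using state_lin[of \<Lambda> f g 1 1] by simp

lemma state_diff: "state \<Lambda> \<Longrightarrow> bcont1 f \<Longrightarrow> bcont1 g \<Longrightarrow> \<Lambda> (\<lambda>x. f x - g x) = \<Lambda> f - \<Lambda> g"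
  using state_lin[of \<Lambda> f g 1 "-1"] by simp

lemma state_const: "state \<Lambda> \<Longrightarrow> \<Lambda> (\<lambda>_. c) = c"
  using state_cmult[of \<Lambda> "\<lambda>_. 1" c] state_1 bcont1_const by simp

lemma state_mono:
  assumes "state \<Lambda>" "bcont1 f" "bcont1 g" "\<And>x. f x \<le> g x" shows "\<Lambda> f \<le> \<Lambda> g"
proof -
  have "bcont1 (\<lambda>x. g x + (-1) * f x)" by (intro bcont_add bcont_mult bcont_const assms)
  then have "0 \<le> \<Lambda> (\<lambda>x. g x - f x)" by (intro state_nonneg[OF assms(1)]) (use assms in auto)
  then show ?thesis using state_diff[OF assms(1,3,2)] by simp
qed

lemma state_bound:
  assumes "state \<Lambda>" "bcont1 f" "\<And>x. \<bar>f x\<bar> \<le> C" shows "\<bar>\<Lambda> f\<bar> \<le> C"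
proof -
  have "\<Lambda> f \<le> \<Lambda> (\<lambda>_. C)" "\<Lambda> (\<lambda>_. - C) \<le> \<Lambda> f"
    by (rule state_mono[OF assms(1)]; use assms bcont1_const in \<open>auto simp: abs_le_iff minus_le_iff\<close>)+
  then show ?thesis using state_const[OF assms(1)] by auto
qed

lemma state_eval: "state (\<lambda>g. g x)"
  unfolding state_def by auto

lemma state_comp:
  assumes \<Lambda>: "state \<Lambda>" and T: "\<And>x. state (\<lambda>g. T g x)" and b: "\<And>g. bcont1 g \<Longrightarrow> bcont1 (T g)"
  shows "state (\<lambda>g. \<Lambda> (T g))"
  unfolding state_def
proof (intro conjI allI impI)
  fix f g a c assume fg: "bcont1 f" "bcont1 g"
  have "T (\<lambda>x. a * f x + c * g x) = (\<lambda>x. a * T f x + c * T g x)"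
    by (rule ext) (rule state_lin[OF T fg])
  then show "\<Lambda> (T (\<lambda>x. a * f x + c * g x)) = a * \<Lambda> (T f) + c * \<Lambda> (T g)"
    using state_lin[OF \<Lambda> b[OF fg(1)] b[OF fg(2)]] by simp
next
  fix f :: "real \<Rightarrow> real" assume f: "bcont1 f" "\<forall>x. 0 \<le> f x"
  then show "0 \<le> \<Lambda> (T f)" by (intro state_nonneg[OF \<Lambda> b] state_nonneg[OF T]) auto
next
  have "T (\<lambda>_. 1) = (\<lambda>_. 1)" by (rule ext) (rule state_1[OF T])
  then show "\<Lambda> (T (\<lambda>_. 1)) = 1" using state_1[OF \<Lambda>] by simp
next
  fix F :: "nat \<Rightarrow> real \<Rightarrow> real" and f C
  assume F: "\<forall>n. bcont1 (F n)" "bcont1 f" "\<forall>n x. \<bar>F n x\<bar> \<le> C" "\<forall>x. (\<lambda>n. F n x) \<longlonglongrightarrow> f x"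
  show "(\<lambda>n. \<Lambda> (T (F n))) \<longlonglongrightarrow> \<Lambda> (T f)"
  proof (rule state_lim[OF \<Lambda>, where C=C])
    show "(\<lambda>n. T (F n) x) \<longlonglongrightarrow> T f x" for x
      by (rule state_lim[OF T, where C=C]) (use F in auto)
  qed (use F in \<open>auto intro: b state_bound[OF T]\<close>)
qed

text \<open>Differentiation under an abstract expectation: bounded pointwise convergence, which is
  part of \<open>state\<close>, takes the place of dominated convergence.\<close>

lemma state_deriv:
  assumes \<Lambda>: "state \<Lambda>" and J: "open J" "r0 \<in> J"
    and b: "\<And>r. r \<in> J \<Longrightarrow> bcont1 (\<lambda>x. w x r)" "bcont1 (\<lambda>x. w' x r0)"
    and d: "\<And>x r. r \<in> J \<Longrightarrow> ((\<lambda>r. w x r) has_real_derivative w' x r) (at r)"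
    and C: "\<And>x r. r \<in> J \<Longrightarrow> \<bar>w' x r\<bar> \<le> C"
  shows "((\<lambda>r. \<Lambda> (\<lambda>x. w x r)) has_real_derivative \<Lambda> (\<lambda>x. w' x r0)) (at r0)"
proof -
  obtain e where e: "e > 0" "ball r0 e \<subseteq> J" using J open_contains_ball by blast
  have "((\<lambda>r. (\<Lambda> (\<lambda>x. w x r) - \<Lambda> (\<lambda>x. w x r0)) / (r - r0)) \<longlongrightarrow> \<Lambda> (\<lambda>x. w' x r0)) (at r0 within ball r0 e)"
    unfolding tendsto_at_iff_sequentially comp_def
  proof (intro allI impI)
    fix X assume X: "\<forall>i. X i \<in> ball r0 e - {r0}" "X \<longlonglongrightarrow> r0"
    have XI: "X n \<in> J" "X n \<noteq> r0" for n using X e by auto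
    define F where "F = (\<lambda>n x. (1 / (X n - r0)) * w x (X n) + (- 1 / (X n - r0)) * w x r0)"
    have Fe: "F n x = (w x (X n) - w x r0) / (X n - r0)" for n x
      unfolding F_def by (simp add: diff_divide_distrib)
    have "(\<lambda>n. \<Lambda> (F n)) \<longlonglongrightarrow> \<Lambda> (\<lambda>x. w' x r0)"
    proof (rule state_lim[OF \<Lambda> _ b(2), where C=C])
      show "bcont1 (F n)" for n
        unfolding F_def by (intro bcont_add bcont_mult bcont_const b XI J)
      show "(\<lambda>n. F n x) \<longlonglongrightarrow> w' x r0" for x
      proof -
        from d[OF J(2)] have "((\<lambda>r. (w x r - w x r0) / (r - r0)) \<longlongrightarrow> w' x r0) (at r0)"
          by (simp add: has_field_derivative_iff)
        then show ?thesis
          using X XI unfolding tendsto_at_iff_sequentially comp_def Fe by auto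
      qed
      show "\<bar>F n x\<bar> \<le> C" for n x
      proof -
        have "norm (w x (X n) - w x r0) \<le> C * norm (X n - r0)"
        proof (rule field_differentiable_bound[where S="ball r0 e" and f'="\<lambda>r. w' x r"])
          show "((\<lambda>r. w x r) has_field_derivative w' x r) (at r within ball r0 e)" if "r \<in> ball r0 e" for r
            using d that e by (blast intro: has_field_derivative_at_within)
          show "norm (w' x r) \<le> C" if "r \<in> ball r0 e" for r
            using C that e by auto
        qed (use X e in auto)
        then show ?thesis unfolding Fe using XI[of n] by (simp add: field_simps)
      qed
    qed
    moreover have "\<Lambda> (F n) = (\<Lambda> (\<lambda>x. w x (X n)) - \<Lambda> (\<lambda>x. w x r0)) / (X n - r0)" for n
      unfolding F_def using state_lin[OF \<Lambda> b(1)[OF XI(1)] b(1)[OF J(2)], of "1 / (X n - r0)" n "- 1 / (X n - r0)"]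
      by (simp add: diff_divide_distrib)
    ultimately show "(\<lambda>n. (\<Lambda> (\<lambda>x. w x (X n)) - \<Lambda> (\<lambda>x. w x r0)) / (X n - r0)) \<longlonglongrightarrow> \<Lambda> (\<lambda>x. w' x r0)" by simp
  qed
  then show ?thesis
    using e by (simp add: has_field_derivative_iff at_within_open[of r0 "ball r0 e"])
qed

context terminal
begin

lemma state_tilt: "state (\<lambda>g. tilt m f g \<tau> x)"
  unfolding state_def
proof (intro conjI allI impI)
  let ?W = "heat \<tau> (\<lambda>y. exp (m * f y)) x"
  have W: "?W > 0" by (rule W_pos)
  fix g h :: "real \<Rightarrow> real" and a b :: real assume gh: "bcont1 g" "bcont1 h"
  have "heat \<tau> (\<lambda>y. (a * g y + b * h y) * exp (m * f y)) x = a * heat \<tau> (\<lambda>y. g y * exp (m * f y)) x + b * heat \<tau> (\<lambda>y. h y * exp (m * f y)) x"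
    using heat_add[OF gW[OF gh(1)] gW[OF gh(2)], of \<tau> a b x] by (simp add: algebra_simps)
  then show "tilt m f (\<lambda>x. a * g x + b * h x) \<tau> x = a * tilt m f g \<tau> x + b * tilt m f h \<tau> x"
    unfolding tilt_def by (simp add: add_divide_distrib)
next
  fix g :: "real \<Rightarrow> real" assume g: "bcont1 g" "\<forall>x. 0 \<le> g x"
  have "0 \<le> heat \<tau> (\<lambda>y. g y * exp (m * f y)) x"
    unfolding heat_def using g by (intro Bochner_Integration.integral_nonneg) auto
  then show "0 \<le> tilt m f g \<tau> x" unfolding tilt_def using W_pos[of \<tau> x] by auto
next
  show "tilt m f (\<lambda>_. 1) \<tau> x = 1" unfolding tilt_def using W_pos[of \<tau> x] by simp
next
  fix F :: "nat \<Rightarrow> real \<Rightarrow> real" and g C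
  assume F: "\<forall>n. bcont1 (F n)" "bcont1 g" "\<forall>n x. \<bar>F n x\<bar> \<le> C" "\<forall>x. (\<lambda>n. F n x) \<longlonglongrightarrow> g x"
  have "(\<lambda>n. heat \<tau> (\<lambda>y. F n y * exp (m * f y)) x) \<longlonglongrightarrow> heat \<tau> (\<lambda>y. g y * exp (m * f y)) x"
    unfolding heat_def
  proof (rule integral_dominated_convergence[where w="\<lambda>z. C * exp (m * f (x + z * sqrt \<tau>))"])
    show "integrable gaussian (\<lambda>z. C * exp (m * f (x + z * sqrt \<tau>)))"
      by (intro integrable_mult_right integrable_shift[OF W_cont W_egrow])
    show "(\<lambda>z. g (x + z * sqrt \<tau>) * exp (m * f (x + z * sqrt \<tau>))) \<in> borel_measurable gaussian"
      using integrable_shift[OF gW[OF F(2)]] by (rule borel_measurable_integrable)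
    show "(\<lambda>z. F n (x + z * sqrt \<tau>) * exp (m * f (x + z * sqrt \<tau>))) \<in> borel_measurable gaussian" for n
      using integrable_shift[OF gW[OF spec[OF F(1)]]] by (rule borel_measurable_integrable)
  qed (use F in \<open>auto intro!: tendsto_intros mult_right_mono simp: abs_mult\<close>)
  then show "(\<lambda>n. tilt m f (F n) \<tau> x) \<longlonglongrightarrow> tilt m f g \<tau> x"
    unfolding tilt_def using W_pos[of \<tau> x] by (intro tendsto_intros) auto
qed

lemma bcont1_tilt: "bcont1 g \<Longrightarrow> 0 \<le> \<tau> \<Longrightarrow> bcont1 (tilt m f g \<tau>)"
  using bcont1_slice[OF tilt_bcont, of g \<tau>] by simp

end

lemma egrow_exp_ln_cosh:
  assumes "\<And>y r. r \<in> I \<Longrightarrow> \<bar>P y r - ln (cosh y)\<bar> \<le> C"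
  shows "egrow I (\<lambda>y r. exp (m * P y r))"
proof (rule egrowI)
  fix y :: real and r assume r: "r \<in> I"
  have "\<bar>tanh y\<bar> \<le> 1" for y :: real
    by (simp add: abs_le_iff minus_le_iff less_imp_le[OF tanh_real_lt_1] less_imp_le[OF tanh_real_gt_neg1])
  then have "\<bar>(\<lambda>y. ln (cosh y)) y\<bar> \<le> \<bar>(\<lambda>y. ln (cosh y)) 0\<bar> + 1 * \<bar>y\<bar>"
    using lipschitz_growth[of "\<lambda>y. ln (cosh y)" tanh 1 y] DERIV_ln_cosh by blast
  then have "\<bar>P y r\<bar> \<le> \<bar>C\<bar> + \<bar>y\<bar>" using assms[OF r, of y] by simp
  then have "\<bar>m\<bar> * \<bar>P y r\<bar> \<le> \<bar>m\<bar> * (\<bar>C\<bar> + \<bar>y\<bar>)" by (intro mult_left_mono) auto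
  moreover have "m * P y r \<le> \<bar>m\<bar> * \<bar>P y r\<bar>" by (metis abs_ge_self abs_mult)
  ultimately have "m * P y r \<le> \<bar>m\<bar> * \<bar>C\<bar> + \<bar>m\<bar> * \<bar>y\<bar>" by (simp add: algebra_simps)
  then show "\<bar>exp (m * P y r)\<bar> \<le> exp (\<bar>m\<bar> * \<bar>C\<bar>) * exp (\<bar>m\<bar> * \<bar>y\<bar>)"
    by (simp flip: exp_add)
qed

section \<open>Generator and evolution of the optimal process\<close>

context parisi_setup
begin

text \<open>Test functions to which the generator applies off a finite set of times. With \<theta>
  as the clock, \<open>Lp\<close> is \<open>\<partial>\<^sub>t p + \<partial>\<^sub>x\<^sup>2 p / 2
  + \<alpha> \<partial>\<^sub>x\<Phi> \<partial>\<^sub>x p\<close>. The slope \<open>p1\<close> is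
  kept as an argument because it enters the product rule.\<close>

definition regular :: "real measure \<Rightarrow> real set \<Rightarrow> (real \<Rightarrow> real \<Rightarrow> real) \<Rightarrow> (real \<Rightarrow> real \<Rightarrow> real) \<Rightarrow> (real \<Rightarrow> real \<Rightarrow> real) \<Rightarrow> bool" where
  "regular \<mu> A p p1 Lp \<longleftrightarrow> finite A \<and> atoms \<mu> \<subseteq> A \<and> bcont {0..1} p \<and>
    (\<exists>p2 pt. bcont ({0<..<1} - A) p1 \<and> bcont ({0<..<1} - A) p2 \<and> bcont ({0<..<1} - A) pt \<and>
      (\<forall>y. \<forall>r\<in>{0<..<1} - A. ((\<lambda>y. p y r) has_real_derivative p1 y r) (at y) \<and>
        ((\<lambda>y. p1 y r) has_real_derivative p2 y r) (at y) \<and>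
        ((\<lambda>r. p y r) has_real_derivative \<theta>' r * pt y r) (at r) \<and>
        Lp y r = pt y r + p2 y r / 2 + dist_fun \<mu> r * dPhi \<mu> 1 y r * p1 y r))"

lemma regular_L:
  assumes "regular \<mu> A p p1 Lp" "\<mu> \<in> discrete_measures01"
  shows "\<exists>C. \<forall>y. \<forall>r\<in>{0<..<1} - A. \<bar>Lp y r\<bar> \<le> C" "r \<in> {0<..<1} - A \<Longrightarrow> bcont1 (\<lambda>y. Lp y r)"
proof -
  let ?I = "{0<..<1} - A"
  obtain p2 pt where P: "bcont ?I p1" "bcont ?I p2" "bcont ?I pt"
    "\<And>y r. r \<in> ?I \<Longrightarrow> Lp y r = pt y r + p2 y r / 2 + dist_fun \<mu> r * dPhi \<mu> 1 y r * p1 y r"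
    using assms(1) unfolding regular_def by blast
  have pm: "\<mu> \<in> prob_measures01" using assms by (simp add: discrete_measures01_def)
  have "?I \<subseteq> {0..1}" by (rule subsetI) auto
  then have b1: "bcont ?I (dPhi \<mu> 1)" using bcont_subset[OF dPhi_bcont[OF assms(2), of 0], of ?I] by simp
  have s: "bcont1 (\<lambda>y. pt y r + (1/2) * p2 y r + dist_fun \<mu> r * (dPhi \<mu> 1 y r * p1 y r))" if "r \<in> ?I" for r
    by (intro bcont_add bcont_mult bcont_const bcont1_slice[OF _ that] P b1)
  show "r \<in> ?I \<Longrightarrow> bcont1 (\<lambda>y. Lp y r)"
    by (rule bcont_cong[OF s]) (auto simp: P(4))
  obtain C1 where C1: "\<And>x u. u \<in> ?I \<Longrightarrow> \<bar>dPhi \<mu> 1 x u * p1 x u\<bar> \<le> C1" using bcont_mult[OF b1 P(1)] by (rule bcontE) blast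
  obtain C2 where C2: "\<And>x u. u \<in> ?I \<Longrightarrow> \<bar>p2 x u\<bar> \<le> C2" using P(2) by (rule bcontE) blast
  obtain C3 where C3: "\<And>x u. u \<in> ?I \<Longrightarrow> \<bar>pt x u\<bar> \<le> C3" using P(3) by (rule bcontE) blast
  have "\<bar>Lp y r\<bar> \<le> C3 + C2 + C1" if r: "r \<in> ?I" for y r
  proof -
    have "\<bar>dist_fun \<mu> r * (dPhi \<mu> 1 y r * p1 y r)\<bar> \<le> 1 * C1"
      unfolding abs_mult[of "dist_fun \<mu> r"] using dist_fun_bounds(1,2)[OF pm, of r] C1[OF r, of y] by (intro mult_mono) auto
    then show ?thesis using C2[OF r, of y] C3[OF r, of y] unfolding P(4)[OF r] by (auto simp: mult.assoc)
  qed
  then show "\<exists>C. \<forall>y. \<forall>r\<in>?I. \<bar>Lp y r\<bar> \<le> C" by blast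
qed

text \<open>The normalising factor of a tilt started at \<open>(x, s)\<close> is the weight of the
  solution at time \<open>s\<close>. It does not depend on \<open>r\<close>, so only the numerator
  of the tilt has to be differentiated in \<open>r\<close>.\<close>

lemma heat_weight:
  assumes "\<mu> \<in> discrete_measures01" "0 \<le> s" "s \<le> r" "r \<le> 1" "atoms \<mu> \<inter> {s<..<r} = {}"
  shows "heat (\<theta> r - \<theta> s) (\<lambda>y. exp (dist_fun \<mu> s * Phi \<mu> y r)) x = exp (dist_fun \<mu> s * Phi \<mu> x s)"
proof (cases "s = r")
  case False
  have sm: "slope_smooth (\<lambda>y. Phi \<mu> y r)" by (rule Phi_smooth) (use assms in auto)
  have "Phi \<mu> x s = gauss_log_mean (dist_fun \<mu> s) (\<lambda>y. Phi \<mu> y r) (\<theta> r - \<theta> s) x"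
    by (rule Phi_step) (use assms False in auto)
  then show ?thesis using exp_glm[OF sm] by simp
qed simp

text \<open>In the numerator both the weight and \<open>p\<close> evolve. The contributions that
  contain \<open>p\<close> undifferentiated cancel by the equation of the weight, and the mixed term
  of the second derivative becomes the drift, so that the generator remains.\<close>

lemma tilt_time_deriv:
  assumes \<mu>: "\<mu> \<in> discrete_measures01" and st: "0 \<le> s" "t \<le> 1" "atoms \<mu> \<inter> {s<..<t} = {}"
    and p: "regular \<mu> A p p1 Lp" and r0: "s < r0" "r0 < t" "r0 \<notin> A"
  shows "((\<lambda>r. tilt (dist_fun \<mu> s) (\<lambda>y. Phi \<mu> y r) (\<lambda>y. p y r) (\<theta> r - \<theta> s) x) has_real_derivative
    \<theta>' r0 * tilt (dist_fun \<mu> s) (\<lambda>y. Phi \<mu> y r0) (\<lambda>y. Lp y r0) (\<theta> r0 - \<theta> s) x) (at r0)"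
proof -
  let ?I = "{0<..<1} - A"
  obtain p2 pt where P: "bcont ?I p1" "bcont ?I p2" "bcont ?I pt"
    "\<And>y r. r \<in> ?I \<Longrightarrow> ((\<lambda>y. p y r) has_real_derivative p1 y r) (at y)"
    "\<And>y r. r \<in> ?I \<Longrightarrow> ((\<lambda>y. p1 y r) has_real_derivative p2 y r) (at y)"
    "\<And>y r. r \<in> ?I \<Longrightarrow> ((\<lambda>r. p y r) has_real_derivative \<theta>' r * pt y r) (at r)"
    "\<And>y r. r \<in> ?I \<Longrightarrow> Lp y r = pt y r + p2 y r / 2 + dist_fun \<mu> r * dPhi \<mu> 1 y r * p1 y r"
    "finite A" "bcont {0..1} p" "atoms \<mu> \<subseteq> A"
    using p unfolding regular_def by blast
  define J where "J = {s<..<t} \<inter> ?I"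
  have J: "open J" "r0 \<in> J" "J \<subseteq> ?I" "J \<subseteq> {0..1}"
    unfolding J_def using P(8) r0 st by (auto intro!: open_Int open_Diff finite_imp_closed)
  have Js: "0 < r" "r < 1" "r \<notin> atoms \<mu>" "s < r" "r < t" "r \<in> ?I" "0 \<le> r" "r \<le> 1" if "r \<in> J" for r
    using that P(10) unfolding J_def by auto
  define m where "m = dist_fun \<mu> s"
  have m: "dist_fun \<mu> r = m" if "r \<in> J" for r
    unfolding m_def by (rule dist_fun_const[OF \<mu>]) (use Js[OF that] st in auto)
  define W where "W = (\<lambda>y r. exp (m * Phi \<mu> y r))"
  let ?d = "dPhi \<mu>"
  \<comment> \<open>\<open>k1\<close> and \<open>k2\<close> are the first two space derivatives of
    the weighted function and \<open>kr\<close> is its time derivative per unit of \<theta>, each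
    divided by the weight \<open>W\<close>.\<close>
  define k1 where "k1 = (\<lambda>y r. m * ?d 1 y r * p y r + p1 y r)"
  define k2 where "k2 = (\<lambda>y r. m * (m * (?d 1 y r * ?d 1 y r) * p y r) + (m * (?d 2 y r * p y r) + (m * (2 * ?d 1 y r * p1 y r) + p2 y r)))"
  define kr where "kr = (\<lambda>y r. (- 1/2) * (m * ((?d 2 y r + m * (?d 1 y r * ?d 1 y r)) * p y r)) + pt y r)"
  have bp: "bcont J p" "bcont J p1" "bcont J p2" "bcont J pt"
    using bcont_subset[OF P(9) J(4)] bcont_subset[OF _ J(3)] P(1-3) by auto
  have bd: "bcont J (?d 1)" "bcont J (?d 2)"
    using bcont_subset[OF dPhi_bcont[OF \<mu>, of 0] J(4)] bcont_subset[OF dPhi_bcont[OF \<mu>, of 1] J(4)] by (auto simp: numeral_2_eq_2)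
  have bk: "bcont J k1" "bcont J k2" "bcont J kr"
    unfolding k1_def k2_def kr_def by (intro bcont_add bcont_mult bcont_const bp bd)+
  obtain CP where CP: "\<And>x u. u \<in> {0..1} \<Longrightarrow> \<bar>Phi \<mu> x u - ln (cosh x)\<bar> \<le> CP"
    using Phi_bcont[OF \<mu>] by (rule bcontE) blast
  have eW: "egrow J W" unfolding W_def by (rule egrow_exp_ln_cosh[where C=CP]) (use CP J(4) in blast)
  have ebc: "egrow J k" if "bcont J k" for k
    using that by (rule bcontE) (rule egrow_bounded)
  have cW: "continuous_on (UNIV \<times> J) (\<lambda>(y, r). W y r)"
  proof -
    have lc: "continuous_on UNIV (\<lambda>x::real. ln (cosh x))"
      by (intro continuous_intros) (auto simp: less_le)
    have "continuous_on (UNIV \<times> J) (\<lambda>q. exp (m * ((\<lambda>(x, u). Phi \<mu> x u - ln (cosh x)) q + ln (cosh (fst q)))))"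
      by (intro continuous_intros continuous_on_compose2[OF lc] bcont_cont bcont_subset[OF Phi_bcont[OF \<mu>] J(4)]) auto
    then show ?thesis by (simp add: W_def case_prod_beta)
  qed
  have cWk: "continuous_on (UNIV \<times> J) (\<lambda>(y, r). W y r * k y r)" if "bcont J k" for k
    using continuous_on_mult[OF cW bcont_cont[OF that]] by (simp add: case_prod_beta)
  have Wy: "((\<lambda>y. W y r) has_real_derivative W y r * (m * ?d 1 y r)) (at y)" if "r \<in> J" for y r
    unfolding W_def using dPhi_deriv[OF \<mu> Js(7,8)[OF that], of 0 y] by (auto intro!: derivative_eq_intros)
  have d1y: "((\<lambda>y. ?d 1 y r) has_real_derivative ?d 2 y r) (at y)" if "r \<in> J" for y r
    using dPhi_deriv[OF \<mu> Js(7,8)[OF that], of 1 y] by (simp add: numeral_2_eq_2)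
  define \<sigma> where "\<sigma> = (\<lambda>r. sqrt (\<theta> r - \<theta> s))"
  have pos: "0 < \<theta> r - \<theta> s" if "r \<in> J" for r using theta_strict[of s r] Js[OF that] st by auto
  define \<sigma>' where "\<sigma>' = (\<lambda>r. (inverse (sqrt (\<theta> r - \<theta> s)) / 2) * \<theta>' r)"
  have \<sigma>d: "(\<sigma> has_real_derivative \<sigma>' r) (at r)" if "r \<in> J" for r
    unfolding \<sigma>_def \<sigma>'_def using pos[OF that] theta_deriv[OF Js(7,8)[OF that]]
    by (intro DERIV_chain2[OF DERIV_real_sqrt]) (auto intro!: derivative_eq_intros)
  have \<sigma>c: "continuous_on J \<sigma>'"
    unfolding \<sigma>'_def
    using pos by (intro continuous_intros continuous_on_subset[OF theta_cont J(4)] continuous_on_subset[OF theta'_cont J(4)]) (auto simp: less_le)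
  have c\<theta>': "continuous_on (UNIV \<times> J) (\<lambda>(y::real, r). \<theta>' r)"
  proof -
    have "continuous_on (UNIV \<times> J) (\<lambda>q::real \<times> real. \<theta>' (snd q))"
      by (rule continuous_on_compose2[OF continuous_on_subset[OF theta'_cont J(4)]]) (auto intro: continuous_intros)
    then show ?thesis by (simp add: case_prod_beta)
  qed
  obtain M where M: "\<And>u. u \<in> {0..1} \<Longrightarrow> \<bar>\<theta>' u\<bar> \<le> M"
      using theta'_bound by blast
  have G: "((\<lambda>r. LINT z|gaussian. W (x + z * \<sigma> r) r * p (x + z * \<sigma> r) r) has_real_derivative
    (\<sigma> r0 * \<sigma>' r0 * (LINT z|gaussian. W (x + z * \<sigma> r0) r0 * k2 (x + z * \<sigma> r0) r0) +
      (LINT z|gaussian. \<theta>' r0 * (W (x + z * \<sigma> r0) r0 * kr (x + z * \<sigma> r0) r0)))) (at r0)"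
  proof (rule gauss_deriv[where I=J and h="\<lambda>y r. W y r * p y r" and ?h1.0="\<lambda>y r. W y r * k1 y r"
        and ?h2.0="\<lambda>y. W y r0 * k2 y r0" and hr="\<lambda>y r. \<theta>' r * (W y r * kr y r)"])
    show "((\<lambda>y. W y r * p y r) has_real_derivative W y r * k1 y r) (at y)" if "r \<in> J" for y r
      by (rule DERIV_cong[OF DERIV_mult[OF Wy[OF that] P(4)[OF Js(6)[OF that]]]]) (simp add: k1_def algebra_simps)
    show "((\<lambda>y. W y r0 * k1 y r0) has_real_derivative W y r0 * k2 y r0) (at y)" for y
    proof -
      have "((\<lambda>y. k1 y r0) has_real_derivative m * (?d 2 y r0 * p y r0) + m * (p1 y r0 * ?d 1 y r0) + p2 y r0) (at y)"
        unfolding k1_def using d1y[OF J(2), of y] P(4)[OF Js(6)[OF J(2)], of y] P(5)[OF Js(6)[OF J(2)], of y]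
        by (auto intro!: derivative_eq_intros simp: algebra_simps)
      from DERIV_mult[OF Wy[OF J(2)] this] show ?thesis
        by (rule DERIV_cong) (simp add: k1_def k2_def algebra_simps)
    qed
    show "((\<lambda>r. W y r * p y r) has_real_derivative \<theta>' r * (W y r * kr y r)) (at r)" if r: "r \<in> J" for y r
    proof -
      have "((\<lambda>r. W y r) has_real_derivative W y r * (m * (- \<theta>' r * ((?d 2 y r + m * (?d 1 y r)\<^sup>2) / 2)))) (at r)"
        unfolding W_def using dPhi_time(1)[OF \<mu> Js(1-3)[OF r], of y] m[OF r] by (auto intro!: derivative_eq_intros)
      from DERIV_mult[OF this P(6)[OF Js(6)[OF r]]] show ?thesis
        by (rule DERIV_cong) (simp add: kr_def field_simps power2_eq_square)
    qed
    show "continuous_on (UNIV \<times> J) (\<lambda>(y, r). \<theta>' r * (W y r * kr y r))"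
      using continuous_on_mult[OF c\<theta>' cWk[OF bk(3)]] by (simp add: case_prod_beta)
    show "continuous_on UNIV (\<lambda>y. W y r0 * k2 y r0)"
    proof -
      have c: "continuous_on UNIV (\<lambda>y::real. (y, r0))" by (intro continuous_intros)
      have i: "range (\<lambda>y::real. (y, r0)) \<subseteq> UNIV \<times> J" using J by auto
      show ?thesis using continuous_on_compose2[OF cWk[OF bk(2)] c i] by simp
    qed
    show "egrow1 (\<lambda>y. W y r0 * k2 y r0)"
      by (rule egrow_slice[OF egrow_mult[OF eW ebc[OF bk(2)]] J(2)])
    show "egrow J (\<lambda>y r. \<theta>' r * (W y r * kr y r))"
      by (rule egrow_time[OF _ egrow_mult[OF eW ebc[OF bk(3)]]]) (use M J in blast)
  qed (use J \<sigma>d \<sigma>c cWk[OF bk(1)] egrow_mult[OF eW ebc] bp(1) bk(1) in auto)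
  have e2: "continuous_on UNIV (\<lambda>y. W y r0 * k y r0)" "egrow1 (\<lambda>y. W y r0 * k y r0)" if "bcont J k" for k
  proof -
    have c: "continuous_on UNIV (\<lambda>y::real. (y, r0))" by (intro continuous_intros)
    have i: "range (\<lambda>y::real. (y, r0)) \<subseteq> UNIV \<times> J" using J by auto
    show "continuous_on UNIV (\<lambda>y. W y r0 * k y r0)" using continuous_on_compose2[OF cWk[OF that] c i] by simp
    show "egrow1 (\<lambda>y. W y r0 * k y r0)" by (rule egrow_slice[OF egrow_mult[OF eW ebc[OF that]] J(2)])
  qed
  have ss: "\<sigma> r0 * \<sigma>' r0 = \<theta>' r0 / 2" using pos[OF J(2)] by (simp add: \<sigma>_def \<sigma>'_def)
  have D: "((\<lambda>r. heat (\<theta> r - \<theta> s) (\<lambda>y. W y r * p y r) x) has_real_derivative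
     (\<theta>' r0 / 2) * heat (\<theta> r0 - \<theta> s) (\<lambda>y. W y r0 * k2 y r0) x + \<theta>' r0 * heat (\<theta> r0 - \<theta> s) (\<lambda>y. W y r0 * kr y r0) x) (at r0)"
    using G[unfolded ss] by (simp add: heat_def \<sigma>_def)
  have "(\<theta>' r0 / 2) * heat (\<theta> r0 - \<theta> s) (\<lambda>y. W y r0 * k2 y r0) x + \<theta>' r0 * heat (\<theta> r0 - \<theta> s) (\<lambda>y. W y r0 * kr y r0) x
    = heat (\<theta> r0 - \<theta> s) (\<lambda>y. (\<theta>' r0 / 2) * (W y r0 * k2 y r0) + \<theta>' r0 * (W y r0 * kr y r0)) x"
    by (rule heat_add[OF e2[OF bk(2)] e2[OF bk(3)], symmetric])
  also have "(\<lambda>y. (\<theta>' r0 / 2) * (W y r0 * k2 y r0) + \<theta>' r0 * (W y r0 * kr y r0)) = (\<lambda>y. \<theta>' r0 * (Lp y r0 * W y r0))"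
    unfolding P(7)[OF Js(6)[OF J(2)]] m[OF J(2)] k2_def kr_def
    by (rule ext) (simp add: algebra_simps)
  also have "heat (\<theta> r0 - \<theta> s) (\<lambda>y. \<theta>' r0 * (Lp y r0 * W y r0)) x = \<theta>' r0 * heat (\<theta> r0 - \<theta> s) (\<lambda>y. Lp y r0 * W y r0) x"
    by (rule heat_cmult)
  finally have D': "((\<lambda>r. heat (\<theta> r - \<theta> s) (\<lambda>y. W y r * p y r) x / exp (m * Phi \<mu> x s)) has_real_derivative
      (\<theta>' r0 * heat (\<theta> r0 - \<theta> s) (\<lambda>y. Lp y r0 * W y r0) x) / exp (m * Phi \<mu> x s)) (at r0)"
    using D by (intro DERIV_cdivide) simp
  have nr: "heat (\<theta> r - \<theta> s) (\<lambda>y. W y r) x = exp (m * Phi \<mu> x s)" if "r \<in> J" for r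
  proof -
    have "atoms \<mu> \<inter> {s<..<r} = {}" using st(3) Js[OF that] by force
    then show ?thesis unfolding W_def m_def using heat_weight[OF \<mu> st(1)] Js[OF that] by auto
  qed
  have "((\<lambda>r. tilt m (\<lambda>y. Phi \<mu> y r) (\<lambda>y. p y r) (\<theta> r - \<theta> s) x) has_real_derivative
      (\<theta>' r0 * heat (\<theta> r0 - \<theta> s) (\<lambda>y. Lp y r0 * W y r0) x) / exp (m * Phi \<mu> x s)) (at r0)"
    by (rule has_field_derivative_transform_within_open[OF D' J(1,2)])
       (use nr in \<open>auto simp: tilt_def W_def mult.commute\<close>)
  moreover have "(\<theta>' r0 * heat (\<theta> r0 - \<theta> s) (\<lambda>y. Lp y r0 * W y r0) x) / exp (m * Phi \<mu> x s)
     = \<theta>' r0 * tilt m (\<lambda>y. Phi \<mu> y r0) (\<lambda>y. Lp y r0) (\<theta> r0 - \<theta> s) x"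
    using nr[OF J(2)] by (simp add: tilt_def W_def)
  ultimately show ?thesis unfolding m_def by simp
qed

text \<open>Continuity has to include the left end, where the variance vanishes. With a denominator
  constant in \<open>r\<close> it reduces to continuous convergence of the numerators.\<close>

lemma state_tilt_cont:
  assumes \<mu>: "\<mu> \<in> discrete_measures01" and st: "0 \<le> s" "s < t" "t \<le> 1" "atoms \<mu> \<inter> {s<..<t} = {}"
    and \<Lambda>: "state \<Lambda>" and p: "bcont {0..1} p"
  shows "continuous_on {s..t} (\<lambda>r. \<Lambda> (\<lambda>x. tilt (dist_fun \<mu> s) (\<lambda>y. Phi \<mu> y r) (\<lambda>y. p y r) (\<theta> r - \<theta> s) x))"
    (is "continuous_on _ (\<lambda>r. \<Lambda> (?T r))")
proof -
  let ?m = "dist_fun \<mu> s"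
  obtain C where C: "\<And>x u. u \<in> {0..1} \<Longrightarrow> \<bar>p x u\<bar> \<le> C" using p by (rule bcontE) blast
  have ter: "terminal (\<lambda>y. Phi \<mu> y r) (deriv (\<lambda>y. Phi \<mu> y r))" if "r \<in> {s..t}" for r
    by (rule slope_smooth_terminal[OF Phi_smooth[OF \<mu>]]) (use that st in auto)
  have pb: "bcont1 (\<lambda>y. p y r)" if "r \<in> {s..t}" for r
    by (rule bcont1_slice[OF p]) (use that st in auto)
  have \<tau>: "0 \<le> \<theta> r - \<theta> s" if "r \<in> {s..t}" for r using theta_mono[of s r] that st by auto
  have b: "bcont1 (?T r)" if "r \<in> {s..t}" for r
    by (rule terminal.bcont1_tilt[OF ter[OF that] pb[OF that] \<tau>[OF that]])
  obtain CP where CP: "\<And>x u. u \<in> {0..1} \<Longrightarrow> \<bar>Phi \<mu> x u - ln (cosh x)\<bar> \<le> CP"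
    using Phi_bcont[OF \<mu>] by (rule bcontE) blast
  define W where "W = (\<lambda>y r. exp (?m * Phi \<mu> y r))"
  have eW: "egrow {s..t} (\<lambda>y r. p y r * W y r)"
    unfolding W_def
    by (rule egrow_mult[OF egrow_bounded[where C=C] egrow_exp_ln_cosh[where C=CP]]) (use C CP st in auto)
  obtain D d where D: "0 \<le> D" "0 \<le> d" "\<And>y r. r \<in> {s..t} \<Longrightarrow> \<bar>p y r * W y r\<bar> \<le> D * exp (d * \<bar>y\<bar>)"
    using eW by (rule egrowE) blast
  have lc: "continuous_on UNIV (\<lambda>x::real. ln (cosh x))"
    by (intro continuous_intros) (auto simp: less_le)
  have sub: "UNIV \<times> {s..t} \<subseteq> (UNIV::real set) \<times> {0..1}" using st by auto
  have cW: "continuous_on (UNIV \<times> {s..t}) (\<lambda>q. p (fst q) (snd q) * W (fst q) (snd q))"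
  proof -
    have "continuous_on (UNIV \<times> {s..t}) (\<lambda>q. (\<lambda>(x, u). p x u) q * exp (?m * ((\<lambda>(x, u). Phi \<mu> x u - ln (cosh x)) q + ln (cosh (fst q)))))"
      by (intro continuous_intros continuous_on_compose2[OF lc] continuous_on_subset[OF bcont_cont[OF Phi_bcont[OF \<mu>]] sub]
        continuous_on_subset[OF bcont_cont[OF p] sub]) auto
    then show ?thesis by (simp add: W_def case_prod_beta)
  qed
  have Te: "?T r x = heat (\<theta> r - \<theta> s) (\<lambda>y. p y r * W y r) x / exp (?m * Phi \<mu> x s)" if "r \<in> {s..t}" for r x
  proof -
    have "atoms \<mu> \<inter> {s<..<r} = {}" using st(4) that by force
    then show ?thesis using heat_weight[OF \<mu> st(1), of r x] that st by (simp add: tilt_def W_def)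
  qed
  show ?thesis unfolding continuous_on_sequentially comp_def
  proof (intro ballI allI impI)
    fix X a assume a: "a \<in> {s..t}" and X: "(\<forall>n. X n \<in> {s..t}) \<and> X \<longlonglongrightarrow> a"
    then have XI: "X n \<in> {s..t}" and Xl: "X \<longlonglongrightarrow> a" for n by auto
    show "(\<lambda>n. \<Lambda> (?T (X n))) \<longlonglongrightarrow> \<Lambda> (?T a)"
    proof (rule state_lim[OF \<Lambda> b[OF XI] b[OF a], where C=C])
      show "\<bar>?T (X n) x\<bar> \<le> C" for n x
        by (rule terminal.tilt_le[OF ter[OF XI] pb[OF XI]]) (use C XI[of n] st in auto)
      fix x
      have \<theta>l: "(\<lambda>n. \<theta> (X n) - \<theta> s) \<longlonglongrightarrow> \<theta> a - \<theta> s"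
        by (intro tendsto_intros continuous_on_tendsto_compose[OF theta_cont Xl]) (use a XI st in \<open>auto intro!: always_eventually order_trans[OF st(1)] order_trans[OF _ st(3)]\<close>)
      have "(\<lambda>n. heat (\<theta> (X n) - \<theta> s) (\<lambda>y. p y (X n) * W y (X n)) x) \<longlonglongrightarrow> heat (\<theta> a - \<theta> s) (\<lambda>y. p y a * W y a) x"
      proof (rule heat_tendsto[OF _ _ D(3) D(1,2) \<theta>l tendsto_const])
        have sl: "continuous_on UNIV (\<lambda>y. p y r * W y r)" if "r \<in> {s..t}" for r
        proof -
          have c: "continuous_on UNIV (\<lambda>y::real. (y, r))" by (intro continuous_intros)
          have i: "range (\<lambda>y::real. (y, r)) \<subseteq> UNIV \<times> {s..t}" using that by auto
          show ?thesis using continuous_on_compose2[OF cW c i] by simp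
        qed
        show "continuous_on UNIV (\<lambda>y. p y (X n) * W y (X n))" for n by (rule sl[OF XI])
        show "continuous_on UNIV (\<lambda>y. p y a * W y a)" by (rule sl[OF a])
        show "X n \<in> {s..t}" for n by (rule XI)
        fix y z assume "y \<longlonglongrightarrow> (z::real)"
        then have "(\<lambda>n. (y n, X n)) \<longlonglongrightarrow> (z, a)" by (intro tendsto_intros Xl)
        from continuous_on_tendsto_compose[OF cW this] show "(\<lambda>n. p (y n) (X n) * W (y n) (X n)) \<longlonglongrightarrow> p z a * W z a"
          using a XI by auto
      qed
      then show "(\<lambda>n. ?T (X n) x) \<longlonglongrightarrow> ?T a x"
        unfolding Te[OF XI] Te[OF a] by (intro tendsto_intros) auto
    qed
  qed
qed

text \<open>The martingale problem for the optimal process started at \<open>x0\<close> at time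
  \<open>s0\<close>, stated for expectations: Dynkin's formula for every regular test function, in
  differential form off its exceptional times.\<close>

definition evolution :: "real measure \<Rightarrow> real \<Rightarrow> real \<Rightarrow> real \<Rightarrow> (real \<Rightarrow> (real \<Rightarrow> real) \<Rightarrow> real) \<Rightarrow> bool" where
  "evolution \<mu> x0 s0 t \<Lambda> \<longleftrightarrow> (\<forall>u\<in>{s0..t}. state (\<Lambda> u)) \<and> (\<forall>g. bcont1 g \<longrightarrow> \<Lambda> s0 g = g x0) \<and>
    (\<forall>A p p1 Lp. regular \<mu> A p p1 Lp \<longrightarrow> continuous_on {s0..t} (\<lambda>r. \<Lambda> r (\<lambda>y. p y r)) \<and>
      (\<forall>r\<in>{s0<..<t} - A. ((\<lambda>r. \<Lambda> r (\<lambda>y. p y r)) has_real_derivative \<theta>' r * \<Lambda> r (\<lambda>y. Lp y r)) (at r)))"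

text \<open>Across a new atom-free interval the functional at its left end is composed with the tilt
  kernel, and continuity glues the two parts.\<close>

lemma evolution_exists:
  assumes \<mu>: "\<mu> \<in> discrete_measures01" and s0: "0 \<le> s0" "s0 \<le> 1"
  shows "\<exists>\<Lambda>. evolution \<mu> x0 s0 1 \<Lambda>"
  using discrete_atoms(1)[OF \<mu>] s0(2) order_refl s0(1)
proof (induction rule: forward_induct)
  case start
  show ?case
    by (rule exI[of _ "\<lambda>_ g. g x0"]) (auto simp: evolution_def state_eval)
next
  case (step s t)
  then obtain \<Lambda> where "evolution \<mu> x0 s0 s \<Lambda>" by blast
  then have L: "\<And>u. u \<in> {s0..s} \<Longrightarrow> state (\<Lambda> u)" "\<And>g. bcont1 g \<Longrightarrow> \<Lambda> s0 g = g x0"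
    "\<And>A p p1 Lp. regular \<mu> A p p1 Lp \<Longrightarrow> continuous_on {s0..s} (\<lambda>r. \<Lambda> r (\<lambda>y. p y r))"
    "\<And>A p p1 Lp r. regular \<mu> A p p1 Lp \<Longrightarrow> r \<in> {s0<..<s} - A \<Longrightarrow>
      ((\<lambda>r. \<Lambda> r (\<lambda>y. p y r)) has_real_derivative \<theta>' r * \<Lambda> r (\<lambda>y. Lp y r)) (at r)"
    unfolding evolution_def by blast+
  let ?m = "dist_fun \<mu> s"
  define T where "T = (\<lambda>r g x. tilt ?m (\<lambda>y. Phi \<mu> y r) g (\<theta> r - \<theta> s) x)"
  define \<Lambda>' where "\<Lambda>' = (\<lambda>r g. if r \<le> s then \<Lambda> r g else \<Lambda> s (T r g))"
  have st: "0 \<le> s" "s < t" "t \<le> 1" "atoms \<mu> \<inter> {s<..<t} = {}" "s0 \<le> s" using step(2-5) s0(1) by auto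
  have Ls: "state (\<Lambda> s)" using L(1) st by auto
  have ter: "terminal (\<lambda>y. Phi \<mu> y r) (deriv (\<lambda>y. Phi \<mu> y r))" if "r \<in> {s..t}" for r
    by (rule slope_smooth_terminal[OF Phi_smooth[OF \<mu>]]) (use that st in auto)
  have \<tau>: "0 \<le> \<theta> r - \<theta> s" if "r \<in> {s..t}" for r using theta_mono[of s r] that st by auto
  have Tb: "bcont1 (T r g)" if "r \<in> {s..t}" "bcont1 g" for r g
    unfolding T_def by (rule terminal.bcont1_tilt[OF ter[OF that(1)] that(2) \<tau>[OF that(1)]])
  have Tst: "state (\<lambda>g. T r g x)" if "r \<in> {s..t}" for r x
    unfolding T_def by (rule terminal.state_tilt[OF ter[OF that]])
  \<comment> \<open>A step of zero variance is the identity, so both branches of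
    \<open>\<Lambda>'\<close> agree at the junction.\<close>
  have Ts: "T s g = g" for g by (rule ext) (simp add: T_def tilt_def)
  have eq1: "\<Lambda>' r = \<Lambda> r" if "r \<in> {s0..s}" for r using that by (auto simp: \<Lambda>'_def)
  have eq2: "\<Lambda>' r = (\<lambda>g. \<Lambda> s (T r g))" if "r \<in> {s..t}" for r
    by (rule ext, cases "r = s") (use that Ts in \<open>auto simp: \<Lambda>'_def\<close>)
  have "evolution \<mu> x0 s0 t \<Lambda>'"
    unfolding evolution_def
  proof (intro conjI ballI allI impI)
    fix u assume u: "u \<in> {s0..t}"
    show "state (\<Lambda>' u)"
    proof (cases "u \<le> s")
      case True then show ?thesis using eq1 L(1) u by auto
    next
      case False
      then have u': "u \<in> {s..t}" using u by auto
      show ?thesis unfolding eq2[OF u'] by (rule state_comp[OF Ls Tst[OF u'] Tb[OF u']])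
    qed
  next
    show "\<Lambda>' s0 g = g x0" if "bcont1 g" for g using eq1[of s0] L(2)[OF that] st by auto
  next
    fix A p p1 Lp assume R: "regular \<mu> A p p1 Lp"
    have pb: "bcont {0..1} p" and A: "finite A" "atoms \<mu> \<subseteq> A" using R by (auto simp: regular_def)
    have e: "{s0..t} = {s0..s} \<union> {s..t}" using st by auto
    show "continuous_on {s0..t} (\<lambda>r. \<Lambda>' r (\<lambda>y. p y r))"
      unfolding e
    proof (rule continuous_on_closed_Un)
      show "continuous_on {s0..s} (\<lambda>r. \<Lambda>' r (\<lambda>y. p y r))"
        by (rule continuous_on_eq[OF L(3)[OF R]]) (simp add: eq1)
      show "continuous_on {s..t} (\<lambda>r. \<Lambda>' r (\<lambda>y. p y r))"
        by (rule continuous_on_eq[OF state_tilt_cont[OF \<mu> st(1-4) Ls pb]]) (simp add: eq2 T_def)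
    qed auto
    fix r assume r: "r \<in> {s0<..<t} - A"
    consider "r < s" | "r = s" | "s < r" by linarith
    then show "((\<lambda>r. \<Lambda>' r (\<lambda>y. p y r)) has_real_derivative \<theta>' r * \<Lambda>' r (\<lambda>y. Lp y r)) (at r)"
    proof cases
      case 1
      then have "((\<lambda>r. \<Lambda> r (\<lambda>y. p y r)) has_real_derivative \<theta>' r * \<Lambda> r (\<lambda>y. Lp y r)) (at r)"
        using L(4)[OF R, of r] r by auto
      then have "((\<lambda>r. \<Lambda>' r (\<lambda>y. p y r)) has_real_derivative \<theta>' r * \<Lambda> r (\<lambda>y. Lp y r)) (at r)"
        by (rule has_field_derivative_transform_within_open[where S="{s0<..<s}"]) (use 1 r eq1 in auto)
      then show ?thesis using eq1[of r] 1 r by auto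
    next
      \<comment> \<open>The junction is the starting time or an atom, hence outside the range of
        \<open>r\<close>.\<close>
      case 2
      with r step(1) A show ?thesis by auto
    next
      case 3
      define J where "J = {s<..<t} - A"
      have J: "open J" "r \<in> J" using A 3 r by (auto simp: J_def intro!: open_Diff finite_imp_closed)
      have JI: "q \<in> {s..t}" "q \<in> {0<..<1} - A" "s < q" "q < t" "q \<notin> A" if "q \<in> J" for q using that st by (auto simp: J_def)
      obtain C where C: "\<And>y q. q \<in> {0<..<1} - A \<Longrightarrow> \<bar>Lp y q\<bar> \<le> C"
        using regular_L(1)[OF R \<mu>] by blast
      obtain M where M: "0 \<le> M" "\<And>u. u \<in> {0..1} \<Longrightarrow> \<bar>\<theta>' u\<bar> \<le> M" using theta'_bound by blast
      have LpT: "\<bar>T q (\<lambda>y. Lp y q) x\<bar> \<le> C" if "q \<in> J" for q x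
        unfolding T_def by (rule terminal.tilt_le[OF ter[OF JI(1)[OF that]] regular_L(2)[OF R \<mu> JI(2)[OF that]] C[OF JI(2)[OF that]]])
      have "((\<lambda>r. \<Lambda> s (\<lambda>x. T r (\<lambda>y. p y r) x)) has_real_derivative \<Lambda> s (\<lambda>x. \<theta>' r * T r (\<lambda>y. Lp y r) x)) (at r)"
      proof (rule state_deriv[OF Ls J, where C="M * C"])
        show "bcont1 (\<lambda>x. T q (\<lambda>y. p y q) x)" if "q \<in> J" for q
          using Tb[OF JI(1)[OF that] bcont1_slice[OF pb]] JI[OF that] st by auto
        show "bcont1 (\<lambda>x. \<theta>' r * T r (\<lambda>y. Lp y r) x)"
          by (intro bcont_mult bcont_const Tb JI(1) J regular_L(2)[OF R \<mu>] JI(2))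
        show "((\<lambda>q. T q (\<lambda>y. p y q) x) has_real_derivative \<theta>' q * T q (\<lambda>y. Lp y q) x) (at q)" if "q \<in> J" for q x
          unfolding T_def by (rule tilt_time_deriv[OF \<mu> st(1,3,4) R JI(3-5)[OF that]])
        show "\<bar>\<theta>' q * T q (\<lambda>y. Lp y q) x\<bar> \<le> M * C" if "q \<in> J" for q x
          unfolding abs_mult using M LpT[OF that] JI(2)[OF that] by (intro mult_mono) auto
      qed
      also have "\<Lambda> s (\<lambda>x. \<theta>' r * T r (\<lambda>y. Lp y r) x) = \<theta>' r * \<Lambda> s (T r (\<lambda>y. Lp y r))"
        by (rule state_cmult[OF Ls Tb[OF JI(1)[OF J(2)] regular_L(2)[OF R \<mu> JI(2)[OF J(2)]]]])
      finally have "((\<lambda>r. \<Lambda>' r (\<lambda>y. p y r)) has_real_derivative \<theta>' r * \<Lambda> s (T r (\<lambda>y. Lp y r))) (at r)"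
        by (rule has_field_derivative_transform_within_open[OF _ J]) (use JI eq2 in auto)
      then show ?thesis using eq2[OF JI(1)[OF J(2)]] by simp
    qed
  qed
  then show ?case by blast
qed

text \<open>Finitely many exceptional times are harmless in the fundamental theorem, as the
  primitive is continuous across them.\<close>

lemma dynkin:
  assumes E: "evolution \<mu> x0 s0 1 \<Lambda>" and R: "regular \<mu> A p p1 Lp" and s: "0 \<le> s0" "s0 \<le> a" "a \<le> b" "b \<le> 1"
  shows "((\<lambda>r. \<theta>' r * \<Lambda> r (\<lambda>y. Lp y r)) has_integral \<Lambda> b (\<lambda>y. p y b) - \<Lambda> a (\<lambda>y. p y a)) {a..b}"
proof (rule fundamental_theorem_of_calculus_interior_strong[where S=A])
  show "finite A" using R by (simp add: regular_def)
  show "((\<lambda>r. \<Lambda> r (\<lambda>y. p y r)) has_vector_derivative \<theta>' r * \<Lambda> r (\<lambda>y. Lp y r)) (at r)" if "r \<in> {a<..<b} - A" for r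
    unfolding has_real_derivative_iff_has_vector_derivative[symmetric]
    using E R that s unfolding evolution_def by auto
  have "continuous_on {s0..1} (\<lambda>r. \<Lambda> r (\<lambda>y. p y r))" using E R unfolding evolution_def by blast
  then show "continuous_on {a..b} (\<lambda>r. \<Lambda> r (\<lambda>y. p y r))" by (rule continuous_on_subset) (use s in auto)
qed (use s in auto)

lemma evolutionD:
  assumes "evolution \<mu> x0 s0 1 \<Lambda>"
  shows "s0 \<le> u \<Longrightarrow> u \<le> 1 \<Longrightarrow> state (\<Lambda> u)" "bcont1 g \<Longrightarrow> \<Lambda> s0 g = g x0"
  using assms unfolding evolution_def by auto

end

text \<open>The generator on monomials is \<open>gen0\<close> minus the distribution function times
  \<open>gen1\<close>. A single factor contributes only to \<open>gen1\<close>, by its Leibniz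
  remainder; \<open>gen0\<close> collects the cross terms of the product rule, which raise the order
  of both members of a pair of factors.\<close>

primrec gen0 :: "nat list \<Rightarrow> nat list list" where
  "gen0 [] = []"
| "gen0 (j # w) = map ((#) j) (gen0 w) @ map ((#) (Suc j)) (mono_deriv w)"

primrec gen1 :: "nat list \<Rightarrow> nat list list" where
  "gen1 [] = []"
| "gen1 (j # w) = map (\<lambda>v. v @ w) (leib j) @ map ((#) j) (gen1 w)"

lemma interior_subset: "{0<..<1} - A \<subseteq> {0..1::real}"
  by (rule subsetI) auto

lemma has_integral_nonneg_on:
  fixes f :: "real \<Rightarrow> real"
  assumes "(f has_integral I) {a..b}" "\<And>r. r \<in> {a..b} \<Longrightarrow> 0 \<le> f r" shows "0 \<le> I"
  using has_integral_nonneg[OF assms] .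

lemma tanh_abs_le: "\<bar>tanh (y::real)\<bar> \<le> 1"
  by (simp add: abs_le_iff minus_le_iff less_imp_le[OF tanh_real_lt_1] less_imp_le[OF tanh_real_gt_neg1])

text \<open>A pair in the remainder either has both indices below \<open>j\<close> or consists of
  \<open>j\<close> and 1. With the entry at 1 bounded by 1, the top order enters only linearly. The
  inclusion for \<open>P\<close> lets the induction run over tails of the list.\<close>

lemma poly_leib_bound:
  fixes \<phi> :: "nat \<Rightarrow> real"
  assumes K: "\<And>i. i < j \<Longrightarrow> \<bar>\<phi> i\<bar> \<le> K" and 1: "\<bar>\<phi> 1\<bar> \<le> 1" and P: "set P \<subseteq> set (leib j)"
  shows "\<bar>poly_val \<phi> P\<bar> \<le> real (length P) * (K\<^sup>2 + \<bar>\<phi> j\<bar>)"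
  using P
proof (induction P)
  case (Cons w P)
  obtain i k where w: "w = [i, k]" "1 \<le> i" "1 \<le> k" "i + k = Suc j" using leib_pairs Cons.prems by force
  have "\<bar>\<phi> i * \<phi> k\<bar> \<le> K\<^sup>2 + \<bar>\<phi> j\<bar>"
  proof -
    consider "i = j" "k = 1" | "k = j" "i = 1" | "i < j" "k < j" using w by linarith
    then show ?thesis
    proof cases
      case 1
      have "\<bar>\<phi> j\<bar> * \<bar>\<phi> 1\<bar> \<le> \<bar>\<phi> j\<bar> * 1" by (intro mult_left_mono assms) auto
      then show ?thesis using 1 by (simp add: abs_mult add_increasing)
    next
      case 2
      have "\<bar>\<phi> j\<bar> * \<bar>\<phi> 1\<bar> \<le> \<bar>\<phi> j\<bar> * 1" by (intro mult_left_mono assms) auto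
      then show ?thesis using 2 by (simp add: abs_mult mult.commute add_increasing)
    next
      case 3
      have "\<bar>\<phi> i\<bar> * \<bar>\<phi> k\<bar> \<le> K * K" using K[OF 3(1)] K[OF 3(2)] by (intro mult_mono) auto
      then show ?thesis by (simp add: abs_mult power2_eq_square add_increasing2)
    qed
  qed
  moreover have "\<bar>poly_val \<phi> P\<bar> \<le> real (length P) * (K\<^sup>2 + \<bar>\<phi> j\<bar>)" using Cons by auto
  ultimately show ?case unfolding w(1) by (simp add: distrib_right)
qed simp

context parisi_setup
begin

text \<open>Away from its atoms a discrete distribution function is locally constant.\<close>

lemma dist_fun_bcont:
  assumes \<mu>: "\<mu> \<in> discrete_measures01" and A: "finite A" "atoms \<mu> \<subseteq> A"
  shows "bcont ({0<..<1} - A) (\<lambda>x r. dist_fun \<mu> r)"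
proof (rule bcontI[where C=1])
  let ?I = "{0<..<1} - A"
  have pm: "\<mu> \<in> prob_measures01" using \<mu> by (simp add: discrete_measures01_def)
  have oI: "open ?I" using A by (intro open_Diff finite_imp_closed) auto
  have "isCont (dist_fun \<mu>) r" if r: "r \<in> ?I" for r
  proof -
    obtain e where e: "e > 0" "ball r e \<subseteq> ?I" using oI r open_contains_ball by blast
    have *: "dist_fun \<mu> q = dist_fun \<mu> r" if q: "q \<in> ball r e" for q
    proof -
      have "v \<in> ?I" if "v \<in> {min q r..max q r}" for v
      proof -
        have "v \<in> ball r e" using that q by (auto simp: dist_real_def min_def max_def split: if_splits)
        then show ?thesis using e by auto
      qed
      then have "atoms \<mu> \<inter> {min q r<..max q r} = {}" "0 \<le> min q r" "max q r \<le> 1"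
        using A by (fastforce, (auto simp: less_imp_le)[1], (auto simp: less_imp_le)[1])
      then have "dist_fun \<mu> (max q r) = dist_fun \<mu> (min q r)"
        by (intro dist_fun_const[OF \<mu>]) auto
      then show ?thesis by (auto simp: max_def min_def split: if_splits)
    qed
    have "eventually (\<lambda>q. dist_fun \<mu> q = dist_fun \<mu> r) (nhds r)"
      unfolding eventually_nhds by (intro exI[of _ "ball r e"] conjI ballI *) (use e(1) in auto)
    then show ?thesis by (subst isCont_cong) auto
  qed
  then have c: "continuous_on ?I (dist_fun \<mu>)"
    by (rule continuous_at_imp_continuous_on[OF ballI])
  have "continuous_on (UNIV \<times> ?I) (\<lambda>q::real \<times> real. dist_fun \<mu> (snd q))"
    by (rule continuous_on_compose2[OF c]) (auto intro: continuous_intros)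
  then show "continuous_on (UNIV \<times> ?I) (\<lambda>(x::real, r). dist_fun \<mu> r)" by (simp add: case_prod_beta)
  show "\<bar>dist_fun \<mu> r\<bar> \<le> 1" for r using dist_fun_bounds(1,2)[OF pm, of r] by auto
qed

lemma regularI:
  assumes "finite A" "atoms \<mu> \<subseteq> A" "bcont {0..1} p"
    "bcont ({0<..<1} - A) p1" "bcont ({0<..<1} - A) p2" "bcont ({0<..<1} - A) pt"
    "\<And>y r. r \<in> {0<..<1} - A \<Longrightarrow> ((\<lambda>y. p y r) has_real_derivative p1 y r) (at y)"
    "\<And>y r. r \<in> {0<..<1} - A \<Longrightarrow> ((\<lambda>y. p1 y r) has_real_derivative p2 y r) (at y)"
    "\<And>y r. r \<in> {0<..<1} - A \<Longrightarrow> ((\<lambda>r. p y r) has_real_derivative \<theta>' r * pt y r) (at r)"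
    "\<And>y r. r \<in> {0<..<1} - A \<Longrightarrow> Lp y r = pt y r + p2 y r / 2 + dist_fun \<mu> r * dPhi \<mu> 1 y r * p1 y r"
  shows "regular \<mu> A p p1 Lp"
  unfolding regular_def using assms by blast

lemma regularE:
  assumes "regular \<mu> A p p1 Lp"
  obtains p2 pt where "finite A" "atoms \<mu> \<subseteq> A" "bcont {0..1} p"
    "bcont ({0<..<1} - A) p1" "bcont ({0<..<1} - A) p2" "bcont ({0<..<1} - A) pt"
    "\<And>y r. r \<in> {0<..<1} - A \<Longrightarrow> ((\<lambda>y. p y r) has_real_derivative p1 y r) (at y)"
    "\<And>y r. r \<in> {0<..<1} - A \<Longrightarrow> ((\<lambda>y. p1 y r) has_real_derivative p2 y r) (at y)"
    "\<And>y r. r \<in> {0<..<1} - A \<Longrightarrow> ((\<lambda>r. p y r) has_real_derivative \<theta>' r * pt y r) (at r)"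
    "\<And>y r. r \<in> {0<..<1} - A \<Longrightarrow> Lp y r = pt y r + p2 y r / 2 + dist_fun \<mu> r * dPhi \<mu> 1 y r * p1 y r"
  using assms unfolding regular_def by blast

text \<open>The generator contains half the second derivative, so its product rule carries the extra
  term \<open>p1 * q1\<close>.\<close>

lemma regular_mult:
  assumes "regular \<mu> A p p1 Lp" "regular \<mu> A q q1 Lq"
  shows "regular \<mu> A (\<lambda>y r. p y r * q y r) (\<lambda>y r. p1 y r * q y r + p y r * q1 y r)
    (\<lambda>y r. Lp y r * q y r + p y r * Lq y r + p1 y r * q1 y r)"
proof -
  let ?I = "{0<..<1} - A"
  obtain p2 pt where P: "finite A" "atoms \<mu> \<subseteq> A" "bcont {0..1} p" "bcont ?I p1" "bcont ?I p2" "bcont ?I pt"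
    "\<And>y r. r \<in> ?I \<Longrightarrow> ((\<lambda>y. p y r) has_real_derivative p1 y r) (at y)"
    "\<And>y r. r \<in> ?I \<Longrightarrow> ((\<lambda>y. p1 y r) has_real_derivative p2 y r) (at y)"
    "\<And>y r. r \<in> ?I \<Longrightarrow> ((\<lambda>r. p y r) has_real_derivative \<theta>' r * pt y r) (at r)"
    "\<And>y r. r \<in> ?I \<Longrightarrow> Lp y r = pt y r + p2 y r / 2 + dist_fun \<mu> r * dPhi \<mu> 1 y r * p1 y r"
    using assms(1) by (rule regularE) blast
  obtain q2 qt where Q: "bcont {0..1} q" "bcont ?I q1" "bcont ?I q2" "bcont ?I qt"
    "\<And>y r. r \<in> ?I \<Longrightarrow> ((\<lambda>y. q y r) has_real_derivative q1 y r) (at y)"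
    "\<And>y r. r \<in> ?I \<Longrightarrow> ((\<lambda>y. q1 y r) has_real_derivative q2 y r) (at y)"
    "\<And>y r. r \<in> ?I \<Longrightarrow> ((\<lambda>r. q y r) has_real_derivative \<theta>' r * qt y r) (at r)"
    "\<And>y r. r \<in> ?I \<Longrightarrow> Lq y r = qt y r + q2 y r / 2 + dist_fun \<mu> r * dPhi \<mu> 1 y r * q1 y r"
    using assms(2) by (rule regularE) blast
  note b = bcont_subset[OF P(3) interior_subset] bcont_subset[OF Q(1) interior_subset]
  show ?thesis
  proof (rule regularI[OF P(1,2), where ?p2.0="\<lambda>y r. p2 y r * q y r + (2 * (p1 y r * q1 y r) + p y r * q2 y r)" and pt="\<lambda>y r. pt y r * q y r + p y r * qt y r"])
    show "((\<lambda>y. p y r * q y r) has_real_derivative p1 y r * q y r + p y r * q1 y r) (at y)" if "r \<in> ?I" for y r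
      by (rule DERIV_cong[OF DERIV_mult[OF P(7)[OF that] Q(5)[OF that]]]) (simp add: algebra_simps)
    show "((\<lambda>y. p1 y r * q y r + p y r * q1 y r) has_real_derivative p2 y r * q y r + (2 * (p1 y r * q1 y r) + p y r * q2 y r)) (at y)" if "r \<in> ?I" for y r
      by (rule DERIV_cong[OF DERIV_add[OF DERIV_mult[OF P(8)[OF that] Q(5)[OF that]] DERIV_mult[OF P(7)[OF that] Q(6)[OF that]]]]) (simp add: algebra_simps)
    show "((\<lambda>r. p y r * q y r) has_real_derivative \<theta>' r * (pt y r * q y r + p y r * qt y r)) (at r)" if "r \<in> ?I" for y r
      by (rule DERIV_cong[OF DERIV_mult[OF P(9)[OF that] Q(7)[OF that]]]) (simp add: algebra_simps)
    show "Lp y r * q y r + p y r * Lq y r + p1 y r * q1 y r = pt y r * q y r + p y r * qt y r +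
        (p2 y r * q y r + (2 * (p1 y r * q1 y r) + p y r * q2 y r)) / 2 + dist_fun \<mu> r * dPhi \<mu> 1 y r * (p1 y r * q y r + p y r * q1 y r)"
      if "r \<in> ?I" for y r
      unfolding P(10)[OF that] Q(8)[OF that] by (simp add: field_simps)
  qed (intro bcont_add bcont_mult bcont_const b P Q)+
qed

lemma regular_const:
  assumes "finite A" "atoms \<mu> \<subseteq> A"
  shows "regular \<mu> A (\<lambda>y r. c) (\<lambda>y r. 0) (\<lambda>y r. 0)"
  by (rule regularI[OF assms, where ?p2.0="\<lambda>y r. 0" and pt="\<lambda>y r. 0"]) (auto intro: bcont_const)

text \<open>The transport term in the equation for the derivative of order \<open>j + 1\<close>
  cancels against the drift of the optimal process, and the second order terms cancel as well. Only
  the Leibniz remainder is left.\<close>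

lemma regular_dPhi:
  assumes \<mu>: "\<mu> \<in> discrete_measures01"
  shows "regular \<mu> (atoms \<mu>) (dPhi \<mu> (Suc j)) (dPhi \<mu> (Suc (Suc j)))
    (\<lambda>y r. - dist_fun \<mu> r * poly_val (\<lambda>i. dPhi \<mu> (Suc i) y r) (leib j))"
proof -
  let ?I = "{0<..<1} - atoms \<mu>"
  note a = discrete_atoms(1)[OF \<mu>]
  have bd: "bcont ?I (dPhi \<mu> (Suc i))" for i by (rule bcont_subset[OF dPhi_bcont[OF \<mu>] interior_subset])
  show ?thesis
  proof (rule regularI[OF a order_refl dPhi_bcont[OF \<mu>], where ?p2.0="dPhi \<mu> (Suc (Suc (Suc j)))"
     and pt="\<lambda>y r. (-1/2) * dPhi \<mu> (Suc (j + 2)) y r + (-1) * (dist_fun \<mu> r *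
         (poly_val (\<lambda>i. dPhi \<mu> (Suc i) y r) (leib j) + dPhi \<mu> (Suc 0) y r * dPhi \<mu> (Suc (j + 1)) y r))"])
    show "((\<lambda>r. dPhi \<mu> (Suc j) y r) has_real_derivative
          \<theta>' r * ((-1/2) * dPhi \<mu> (Suc (j + 2)) y r + (-1) * (dist_fun \<mu> r *
         (poly_val (\<lambda>i. dPhi \<mu> (Suc i) y r) (leib j) + dPhi \<mu> (Suc 0) y r * dPhi \<mu> (Suc (j + 1)) y r)))) (at r)"
      if "r \<in> ?I" for y r
      by (rule DERIV_cong[OF dPhi_time(2)[OF \<mu>]]) (use that in \<open>auto simp: algebra_simps eval_nat_numeral\<close>)
    show "bcont ?I (\<lambda>y r. (-1/2) * dPhi \<mu> (Suc (j + 2)) y r + (-1) * (dist_fun \<mu> r *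
         (poly_val (\<lambda>i. dPhi \<mu> (Suc i) y r) (leib j) + dPhi \<mu> (Suc 0) y r * dPhi \<mu> (Suc (j + 1)) y r)))"
      by (intro bcont_add bcont_mult bcont_const bcont_poly_val bd dist_fun_bcont[OF \<mu> a order_refl])
  qed (auto intro!: bd dPhi_deriv[OF \<mu>] simp: algebra_simps eval_nat_numeral)
qed

lemma regular_mono:
  assumes \<mu>: "\<mu> \<in> discrete_measures01"
  shows "regular \<mu> (atoms \<mu>) (\<lambda>y r. mono_val (\<lambda>i. dPhi \<mu> (Suc i) y r) w) (\<lambda>y r. poly_val (\<lambda>i. dPhi \<mu> (Suc i) y r) (mono_deriv w))
    (\<lambda>y r. poly_val (\<lambda>i. dPhi \<mu> (Suc i) y r) (gen0 w) - dist_fun \<mu> r * poly_val (\<lambda>i. dPhi \<mu> (Suc i) y r) (gen1 w))"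
proof (induction w)
  case Nil
  show ?case using regular_const[OF discrete_atoms(1)[OF \<mu>] order_refl, of 1] by simp
next
  case (Cons j w)
  from regular_mult[OF regular_dPhi[OF \<mu>, of j] Cons.IH] show ?case
    by (simp add: poly_val_Cons poly_val_append algebra_simps)
qed

lemma dPhi_at_1:
  assumes \<mu>: "\<mu> \<in> discrete_measures01"
  shows "dPhi \<mu> j x 1 = (deriv ^^ j) (\<lambda>x. ln (cosh x)) x" "dPhi \<mu> (Suc 0) x 1 = tanh x" "dPhi \<mu> (Suc (Suc 0)) x 1 = 1 - (tanh x)\<^sup>2"
proof -
  have e: "(\<lambda>x. Phi \<mu> x 1) = (\<lambda>x. ln (cosh x))" using Phi_1[OF \<mu>] by auto
  show "dPhi \<mu> j x 1 = (deriv ^^ j) (\<lambda>x. ln (cosh x)) x" unfolding dPhi_def e ..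
  have d1: "deriv (\<lambda>x::real. ln (cosh x)) = tanh" using DERIV_ln_cosh by (auto intro: DERIV_imp_deriv)
  have d2: "deriv (tanh :: real \<Rightarrow> real) = (\<lambda>x. 1 - (tanh x)\<^sup>2)"
    by (auto intro!: DERIV_imp_deriv derivative_eq_intros)
  show "dPhi \<mu> (Suc 0) x 1 = tanh x" "dPhi \<mu> (Suc (Suc 0)) x 1 = 1 - (tanh x)\<^sup>2"
    unfolding dPhi_def e by (simp_all add: d1 d2)
qed

section \<open>Bounds on space derivatives, uniform in the measure\<close>

lemma dPhi_slice: "\<mu> \<in> discrete_measures01 \<Longrightarrow> 0 \<le> r \<Longrightarrow> r \<le> 1 \<Longrightarrow> bcont1 (\<lambda>y. dPhi \<mu> (Suc j) y r)"
  by (rule bcont1_slice[OF dPhi_bcont]) auto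

text \<open>The Leibniz remainder at index 0 is empty, so the slope along the optimal process is a
  martingale with terminal value \<open>tanh\<close>. Starting the process at \<open>(x, s)\<close>
  gives the bound at that point.\<close>

lemma dPhi_1_le:
  assumes \<mu>: "\<mu> \<in> discrete_measures01" and s: "0 \<le> s" "s \<le> 1"
  shows "\<bar>dPhi \<mu> (Suc 0) x s\<bar> \<le> 1"
proof -
  obtain \<Lambda> where E: "evolution \<mu> x s 1 \<Lambda>" using evolution_exists[OF \<mu> s] by blast
  have "((\<lambda>r. \<theta>' r * \<Lambda> r (\<lambda>y. - dist_fun \<mu> r * poly_val (\<lambda>i. dPhi \<mu> (Suc i) y r) (leib 0)))
     has_integral \<Lambda> 1 (\<lambda>y. dPhi \<mu> (Suc 0) y 1) - \<Lambda> s (\<lambda>y. dPhi \<mu> (Suc 0) y s)) {s..1}"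
    by (rule dynkin[OF E regular_dPhi[OF \<mu>]]) (use s in auto)
  from this have "\<Lambda> 1 (\<lambda>y. dPhi \<mu> (Suc 0) y 1) - \<Lambda> s (\<lambda>y. dPhi \<mu> (Suc 0) y s) = 0"
  proof (rule has_integral_unique)
    show "((\<lambda>r. \<theta>' r * \<Lambda> r (\<lambda>y. - dist_fun \<mu> r * poly_val (\<lambda>i. dPhi \<mu> (Suc i) y r) (leib 0))) has_integral 0) {s..1}"
      by (rule has_integral_is_0) (use state_const[OF evolutionD(1)[OF E]] in auto)
  qed
  then have "\<Lambda> 1 (\<lambda>y. dPhi \<mu> (Suc 0) y 1) = \<Lambda> s (\<lambda>y. dPhi \<mu> (Suc 0) y s)" by simp
  also have "\<dots> = dPhi \<mu> (Suc 0) x s" by (rule evolutionD(2)[OF E dPhi_slice[OF \<mu> s]])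
  finally show ?thesis
    using state_bound[OF evolutionD(1)[OF E s(2) order_refl] dPhi_slice[OF \<mu>, of 1 0], of 1] dPhi_at_1[OF \<mu>] tanh_abs_le by auto
qed

text \<open>In the clock \<theta>, the expectation of the second derivative decreases at rate
  \<open>dist_fun \<mu> r * S r\<close> and that of the squared slope increases at rate
  \<open>S r\<close>, with \<open>S\<close> nonnegative. The first fact gives the lower bound. As
  the distribution function is at most 1, the sum of the two is nondecreasing, and its terminal
  value is 1.\<close>

lemma dPhi_2_bounds:
  assumes \<mu>: "\<mu> \<in> discrete_measures01" and s: "0 \<le> s" "s \<le> 1"
  shows "0 \<le> dPhi \<mu> (Suc (Suc 0)) x s" "dPhi \<mu> (Suc (Suc 0)) x s \<le> 1"
proof -
  have pm: "\<mu> \<in> prob_measures01" using \<mu> by (simp add: discrete_measures01_def)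
  obtain \<Lambda> where E: "evolution \<mu> x s 1 \<Lambda>" using evolution_exists[OF \<mu> s] by blast
  let ?d = "dPhi \<mu>"
  define S where "S = (\<lambda>r. \<Lambda> r (\<lambda>y. ?d 2 y r * ?d 2 y r))"
  have sl: "bcont1 (\<lambda>y. ?d 1 y r)" "bcont1 (\<lambda>y. ?d 2 y r)" "bcont1 (\<lambda>y. ?d 2 y r * ?d 2 y r)" "bcont1 (\<lambda>y. ?d 1 y r * ?d 1 y r)" if "s \<le> r" "r \<le> 1" for r
    using dPhi_slice[OF \<mu>, of r 0] dPhi_slice[OF \<mu>, of r 1] that s by (auto intro!: bcont_mult simp: numeral_2_eq_2)
  have S0: "0 \<le> S r" if "s \<le> r" "r \<le> 1" for r
    unfolding S_def by (rule state_nonneg[OF evolutionD(1)[OF E that] sl(3)[OF that]]) auto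
  have "((\<lambda>r. \<theta>' r * \<Lambda> r (\<lambda>y. - dist_fun \<mu> r * poly_val (\<lambda>i. ?d (Suc i) y r) (leib 1)))
     has_integral \<Lambda> 1 (\<lambda>y. ?d (Suc 1) y 1) - \<Lambda> s (\<lambda>y. ?d (Suc 1) y s)) {s..1}"
    by (rule dynkin[OF E regular_dPhi[OF \<mu>]]) (use s in auto)
  then have "((\<lambda>r. \<theta>' r * (- dist_fun \<mu> r * S r)) has_integral \<Lambda> 1 (\<lambda>y. ?d (Suc 1) y 1) - \<Lambda> s (\<lambda>y. ?d (Suc 1) y s)) {s..1}"
  proof (rule has_integral_eq[rotated])
    fix r assume "r \<in> {s..1}"
    then have r: "s \<le> r" "r \<le> 1" by auto
    have "\<Lambda> r (\<lambda>y. (- dist_fun \<mu> r) * (?d 2 y r * ?d 2 y r)) = (- dist_fun \<mu> r) * S r"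
      unfolding S_def by (rule state_cmult[OF evolutionD(1)[OF E r] sl(3)[OF r]])
    then show "\<theta>' r * \<Lambda> r (\<lambda>y. - dist_fun \<mu> r * poly_val (\<lambda>i. ?d (Suc i) y r) (leib 1)) = \<theta>' r * (- dist_fun \<mu> r * S r)"
      by (simp add: numeral_2_eq_2)
  qed
  then have I1: "((\<lambda>r. \<theta>' r * (- dist_fun \<mu> r * S r)) has_integral \<Lambda> 1 (\<lambda>y. 1 - tanh y * tanh y) - ?d 2 x s) {s..1}"
    using dPhi_at_1(3)[OF \<mu>] evolutionD(2)[OF E sl(2)[OF order_refl s(2)]] by (simp add: numeral_2_eq_2 power2_eq_square)
  have "((\<lambda>r. \<theta>' r * \<Lambda> r (\<lambda>y. poly_val (\<lambda>i. ?d (Suc i) y r) (gen0 [0,0]) - dist_fun \<mu> r * poly_val (\<lambda>i. ?d (Suc i) y r) (gen1 [0,0])))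
     has_integral \<Lambda> 1 (\<lambda>y. mono_val (\<lambda>i. ?d (Suc i) y 1) [0,0]) - \<Lambda> s (\<lambda>y. mono_val (\<lambda>i. ?d (Suc i) y s) [0,0])) {s..1}"
    by (rule dynkin[OF E regular_mono[OF \<mu>]]) (use s in auto)
  then have I2: "((\<lambda>r. \<theta>' r * S r) has_integral \<Lambda> 1 (\<lambda>y. tanh y * tanh y) - ?d 1 x s * ?d 1 x s) {s..1}"
    using dPhi_at_1(2)[OF \<mu>] evolutionD(2)[OF E sl(4)[OF order_refl s(2)]] by (simp add: S_def numeral_2_eq_2)
  have tb: "bcont1 (\<lambda>y::real. tanh y)" using bsm_bcont[OF bsm_tanh] .
  have L1: "state (\<Lambda> 1)" by (rule evolutionD(1)[OF E s(2) order_refl])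
  have t: "\<Lambda> 1 (\<lambda>y. 1 - tanh y * tanh y) = 1 - \<Lambda> 1 (\<lambda>y. tanh y * tanh y)"
    using state_diff[OF L1 bcont1_const bcont_mult[OF tb tb], of 1] state_1[OF L1] by simp
  have t2: "\<Lambda> 1 (\<lambda>y. tanh y * tanh y) \<le> 1"
  proof -
    have "tanh y * tanh y \<le> 1" for y :: real using tanh_abs_le[of y] by (simp add: abs_square_le_1[symmetric] flip: power2_eq_square)
    then have "\<Lambda> 1 (\<lambda>y. tanh y * tanh y) \<le> \<Lambda> 1 (\<lambda>_. 1)"
      by (rule state_mono[OF L1 bcont_mult[OF tb tb] bcont1_const])
    then show ?thesis using state_1[OF L1] by simp
  qed
  have "0 \<le> - (\<Lambda> 1 (\<lambda>y. 1 - tanh y * tanh y) - ?d 2 x s)"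
    by (rule has_integral_nonneg_on[OF has_integral_neg[OF I1]])
       (use theta'_nonneg dist_fun_bounds[OF pm] S0 s in \<open>auto intro!: mult_nonneg_nonneg\<close>)
  with t t2 show "0 \<le> ?d (Suc (Suc 0)) x s" by (simp add: numeral_2_eq_2)
  have "0 \<le> (\<Lambda> 1 (\<lambda>y. 1 - tanh y * tanh y) - ?d 2 x s) + (\<Lambda> 1 (\<lambda>y. tanh y * tanh y) - ?d 1 x s * ?d 1 x s)"
  proof (rule has_integral_nonneg_on[OF has_integral_add[OF I1 I2]])
    fix r assume r: "r \<in> {s..1}"
    have "0 \<le> \<theta>' r * ((1 - dist_fun \<mu> r) * S r)"
      using r theta'_nonneg[of r] dist_fun_bounds(2)[OF pm, of r] S0[of r] s by (intro mult_nonneg_nonneg) auto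
    then show "0 \<le> \<theta>' r * (- dist_fun \<mu> r * S r) + \<theta>' r * S r" by (simp add: algebra_simps)
  qed
  then have "?d 2 x s \<le> 1 - ?d 1 x s * ?d 1 x s" using t by simp
  also have "\<dots> \<le> 1" by simp
  finally show "?d (Suc (Suc 0)) x s \<le> 1" by (simp add: numeral_2_eq_2)
qed

text \<open>Gronwall by a weighted supremum norm. The weight \<open>E\<close> grows so fast towards
  time 0 that the linear term contributes at most half of the norm \<open>B\<close>, which is then
  absorbed. That \<open>B\<close> is finite comes from the bound for the individual measure; the
  resulting constant no longer depends on the measure.\<close>

lemma dPhi_bound_step:
  assumes K: "\<And>\<mu> x s i. \<mu> \<in> discrete_measures01 \<Longrightarrow> 0 \<le> s \<Longrightarrow> s \<le> 1 \<Longrightarrow> i < j \<Longrightarrow> \<bar>dPhi \<mu> (Suc i) x s\<bar> \<le> K"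
  shows "\<exists>C. \<forall>\<mu>\<in>discrete_measures01. \<forall>x. \<forall>s\<in>{0..1}. \<bar>dPhi \<mu> (Suc j) x s\<bar> \<le> C"
proof -
  obtain c where c: "\<And>x. \<bar>(deriv ^^ Suc j) (\<lambda>x::real. ln (cosh x)) x\<bar> \<le> c"
    using slope_smooth_ex(2)[OF slope_smooth_ln_cosh, of j] unfolding bcont1_iff by blast
  \<comment> \<open>\<open>n\<close> exceeds the number of terms in the remainder. With rate
    \<open>2 * n\<close>, a primitive of \<open>\<theta>' * n * B * E\<close> is
    \<open>- (B / 2) * E\<close>, the source of the factor one half.\<close>
  define n where "n = real (length (leib j)) + 1"
  define lam where "lam = 2 * n"
  define E where "E = (\<lambda>s. exp (lam * (\<theta> 1 - \<theta> s)))"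
  define c' where "c' = c + n * K\<^sup>2 * (\<theta> 1 - \<theta> 0)"
  have n: "1 \<le> n" by (simp add: n_def)
  have E1: "1 \<le> E s" if "0 \<le> s" "s \<le> 1" for s
    using theta_mono[OF that(1,2)] n by (auto simp: E_def lam_def)
  have E0: "E s \<le> E 0" if "0 \<le> s" "s \<le> 1" for s
    using theta_mono[of 0 s] that n by (auto simp: E_def lam_def)
  have "\<bar>dPhi \<mu> (Suc j) x s\<bar> \<le> 2 * c' * E 0" if \<mu>: "\<mu> \<in> discrete_measures01" and s: "0 \<le> s" "s \<le> 1" for \<mu> x s
  proof -
    have pm: "\<mu> \<in> prob_measures01" using \<mu> by (simp add: discrete_measures01_def)
    let ?p = "dPhi \<mu> (Suc j)"
    define R where "R = (\<lambda>(x, s). \<bar>?p x s\<bar> / E s)"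
    define B where "B = (SUP q\<in>UNIV \<times> {0..1}. R q)"
    obtain C0 where C0: "0 \<le> C0" "\<And>x u. u \<in> {0..1} \<Longrightarrow> \<bar>?p x u\<bar> \<le> C0" using dPhi_bcont[OF \<mu>] by (rule bcontE) blast
    have bdd: "bdd_above (R ` (UNIV \<times> {0..1}))"
    proof (rule bdd_aboveI2[where M=C0])
      fix q :: "real \<times> real" assume "q \<in> UNIV \<times> {0..1}"
      then have "\<bar>?p (fst q) (snd q)\<bar> \<le> C0" "1 \<le> E (snd q)" using C0 E1 by auto
      then have "\<bar>?p (fst q) (snd q)\<bar> / E (snd q) \<le> C0 / 1" using C0 by (intro frac_le) auto
      then show "R q \<le> C0" by (simp add: R_def case_prod_beta)
    qed
    have RB: "\<bar>?p y r\<bar> \<le> B * E r" if "0 \<le> r" "r \<le> 1" for y r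
    proof -
      have "R (y, r) \<le> B" unfolding B_def by (rule cSUP_upper[OF _ bdd]) (use that in auto)
      then show ?thesis using E1[OF that] by (simp add: R_def field_simps)
    qed
    have B0: "0 \<le> B" using order_trans[OF abs_ge_zero RB[of 1 0]] E1[of 1] by (simp add: zero_le_mult_iff)
    have main: "\<bar>?p x s\<bar> \<le> c' + B / 2 * E s" if s: "0 \<le> s" "s \<le> 1" for x s
    proof -
      obtain \<Lambda> where Ev: "evolution \<mu> x s 1 \<Lambda>" using evolution_exists[OF \<mu> s] by blast
      let ?L = "\<lambda>y r. - dist_fun \<mu> r * poly_val (\<lambda>i. dPhi \<mu> (Suc i) y r) (leib j)"
      have I: "((\<lambda>r. \<theta>' r * \<Lambda> r (\<lambda>y. ?L y r)) has_integral \<Lambda> 1 (\<lambda>y. ?p y 1) - \<Lambda> s (\<lambda>y. ?p y s)) {s..1}"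
        by (rule dynkin[OF Ev regular_dPhi[OF \<mu>]]) (use s in auto)
      have sl: "bcont1 (\<lambda>y. ?L y r)" if "0 \<le> r" "r \<le> 1" for r
        by (intro bcont_mult bcont_const bcont_poly_val dPhi_slice[OF \<mu> that])
      have Lb: "\<bar>\<Lambda> r (\<lambda>y. ?L y r)\<bar> \<le> n * (K\<^sup>2 + B * E r)" if r: "s \<le> r" "r \<le> 1" for r
      proof (rule state_bound[OF evolutionD(1)[OF Ev r] sl])
        fix y
        have "\<bar>poly_val (\<lambda>i. dPhi \<mu> (Suc i) y r) (leib j)\<bar> \<le> real (length (leib j)) * (K\<^sup>2 + \<bar>dPhi \<mu> (Suc j) y r\<bar>)"
          by (rule poly_leib_bound) (use K[OF \<mu>] dPhi_2_bounds[OF \<mu>] r s in auto)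
        also have "\<dots> \<le> n * (K\<^sup>2 + B * E r)"
          using RB[of r y] r s by (intro mult_mono) (auto simp: n_def)
        finally have "\<bar>dist_fun \<mu> r\<bar> * \<bar>poly_val (\<lambda>i. dPhi \<mu> (Suc i) y r) (leib j)\<bar> \<le> 1 * (n * (K\<^sup>2 + B * E r))"
          using dist_fun_bounds(1,2)[OF pm, of r] by (intro mult_mono) auto
        then show "\<bar>?L y r\<bar> \<le> n * (K\<^sup>2 + B * E r)" by (simp add: abs_mult)
      qed (use r s in auto)
      define G where "G = (\<lambda>r. n * K\<^sup>2 * \<theta> r - (B / 2) * E r)"
      have "((\<lambda>r. \<theta>' r * (n * (K\<^sup>2 + B * E r))) has_integral G 1 - G s) {s..1}"
      proof (rule fundamental_theorem_of_calculus[OF s(2)])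
        fix r assume r: "r \<in> {s..1}"
        have "(G has_real_derivative \<theta>' r * (n * (K\<^sup>2 + B * E r))) (at r)"
          unfolding G_def E_def using theta_deriv[of r] r s
          by (auto intro!: derivative_eq_intros simp: lam_def field_simps)
        then show "(G has_vector_derivative \<theta>' r * (n * (K\<^sup>2 + B * E r))) (at r within {s..1})"
          by (simp add: has_real_derivative_iff_has_vector_derivative[symmetric] has_field_derivative_at_within)
      qed
      note J = this
      have "\<bar>\<Lambda> 1 (\<lambda>y. ?p y 1) - \<Lambda> s (\<lambda>y. ?p y s)\<bar> \<le> G 1 - G s"
      proof -
        have le: "\<bar>\<theta>' r * \<Lambda> r (\<lambda>y. ?L y r)\<bar> \<le> \<theta>' r * (n * (K\<^sup>2 + B * E r))" if "r \<in> {s..1}" for r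
          using Lb[of r] theta'_nonneg[of r] that s by (auto simp: abs_mult intro!: mult_left_mono)
        have "\<Lambda> 1 (\<lambda>y. ?p y 1) - \<Lambda> s (\<lambda>y. ?p y s) \<le> G 1 - G s"
          by (rule has_integral_le[OF I J]) (use le in \<open>auto simp: abs_le_iff\<close>)
        moreover have "- (\<Lambda> 1 (\<lambda>y. ?p y 1) - \<Lambda> s (\<lambda>y. ?p y s)) \<le> G 1 - G s"
          by (rule has_integral_le[OF has_integral_neg[OF I] J]) (use le in \<open>auto simp: abs_le_iff\<close>)
        ultimately show ?thesis by linarith
      qed
      moreover have "\<Lambda> s (\<lambda>y. ?p y s) = ?p x s" by (rule evolutionD(2)[OF Ev dPhi_slice[OF \<mu> s]])
      moreover have "\<bar>\<Lambda> 1 (\<lambda>y. ?p y 1)\<bar> \<le> c"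
        by (rule state_bound[OF evolutionD(1)[OF Ev s(2) order_refl] dPhi_slice[OF \<mu>]]) (use dPhi_at_1(1)[OF \<mu>, of "Suc j"] c in auto)
      moreover have "G 1 - G s \<le> n * K\<^sup>2 * (\<theta> 1 - \<theta> 0) + B / 2 * E s"
      proof -
        have "G 1 - G s = n * K\<^sup>2 * (\<theta> 1 - \<theta> s) + B / 2 * E s - B / 2 * E 1" by (simp add: G_def algebra_simps)
        moreover have "n * K\<^sup>2 * (\<theta> 1 - \<theta> s) \<le> n * K\<^sup>2 * (\<theta> 1 - \<theta> 0)"
          using theta_mono[of 0 s] s n by (intro mult_left_mono) auto
        moreover have "0 \<le> B / 2 * E 1" using B0 E1[of 1] by simp
        ultimately show ?thesis by linarith
      qed
      ultimately show ?thesis unfolding c'_def by linarith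
    qed
    have c0: "0 \<le> c'"
    proof -
      have "0 \<le> c" using order_trans[OF abs_ge_zero c[of 0]] .
      moreover have "0 \<le> n * K\<^sup>2 * (\<theta> 1 - \<theta> 0)" using theta_mono[of 0 1] n by auto
      ultimately show ?thesis by (simp add: c'_def)
    qed
    have "B \<le> c' + B / 2"
      unfolding B_def
    proof (rule cSUP_least)
      fix q :: "real \<times> real" assume q: "q \<in> UNIV \<times> {0..1}"
      then have s: "0 \<le> snd q" "snd q \<le> 1" by auto
      have "R q = \<bar>?p (fst q) (snd q)\<bar> / E (snd q)" by (simp add: R_def case_prod_beta)
      also have "\<dots> \<le> (c' + B / 2 * E (snd q)) / E (snd q)"
        using main[OF s] E1[OF s] by (intro divide_right_mono) auto
      also have "\<dots> = c' / E (snd q) + B / 2" using E1[OF s] by (simp add: field_simps)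
      also have "c' / E (snd q) \<le> c' / 1" using E1[OF s] c0 by (intro divide_left_mono) auto
      finally show "R q \<le> c' + (SUP q\<in>UNIV \<times> {0..1}. R q) / 2" by (simp add: B_def)
    qed auto
    then have "B \<le> 2 * c'" by simp
    have "\<bar>?p x s\<bar> \<le> B * E s" by (rule RB[OF s])
    also have "\<dots> \<le> (2 * c') * E 0" using \<open>B \<le> 2 * c'\<close> E0[OF s] E1[OF s] c0 by (intro mult_mono) auto
    finally show ?thesis .
  qed
  then show ?thesis by (intro exI[of _ "2 * c' * E 0"]) auto
qed

lemma dPhi_bound:
  obtains C where "0 \<le> C" "\<And>\<mu> x s. \<mu> \<in> discrete_measures01 \<Longrightarrow> 0 \<le> s \<Longrightarrow> s \<le> 1 \<Longrightarrow> \<bar>dPhi \<mu> (Suc j) x s\<bar> \<le> C"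
proof -
  have "\<exists>C. \<forall>\<mu>\<in>discrete_measures01. \<forall>x. \<forall>s\<in>{0..1}. \<bar>dPhi \<mu> (Suc j) x s\<bar> \<le> C"
  proof (induction j rule: less_induct)
    case (less j)
    then have "\<forall>i. \<exists>C. i < j \<longrightarrow> (\<forall>\<mu>\<in>discrete_measures01. \<forall>x. \<forall>s\<in>{0..1}. \<bar>dPhi \<mu> (Suc i) x s\<bar> \<le> C)" by blast
    then obtain C where C: "\<And>i \<mu> x s. i < j \<Longrightarrow> \<mu> \<in> discrete_measures01 \<Longrightarrow> s \<in> {0..1} \<Longrightarrow> \<bar>dPhi \<mu> (Suc i) x s\<bar> \<le> C i"
      by metis
    show ?case
    proof (rule dPhi_bound_step[where K="\<Sum>i<j. \<bar>C i\<bar>"])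
      fix \<mu> and x s :: real and i assume a: "\<mu> \<in> discrete_measures01" "0 \<le> s" "s \<le> 1" "i < j"
      have "\<bar>dPhi \<mu> (Suc i) x s\<bar> \<le> \<bar>C i\<bar>" using C[OF a(4,1), of s x] a(2,3) by auto
      also have "\<dots> \<le> (\<Sum>i<j. \<bar>C i\<bar>)" by (rule member_le_sum) (use a in auto)
      finally show "\<bar>dPhi \<mu> (Suc i) x s\<bar> \<le> (\<Sum>i<j. \<bar>C i\<bar>)" .
    qed
  qed
  then obtain C where C: "\<forall>\<mu>\<in>discrete_measures01. \<forall>x. \<forall>s\<in>{0..1}. \<bar>dPhi \<mu> (Suc j) x s\<bar> \<le> C" by blast
  show ?thesis
  proof (rule that[of "\<bar>C\<bar>"])
    fix \<mu> and x s :: real assume a: "\<mu> \<in> discrete_measures01" "0 \<le> s" "s \<le> 1"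
    then have "\<bar>dPhi \<mu> (Suc j) x s\<bar> \<le> C" using C by auto
    then show "\<bar>dPhi \<mu> (Suc j) x s\<bar> \<le> \<bar>C\<bar>" by linarith
  qed simp
qed

end

section \<open>Comparison of solutions\<close>

abbreviation borel01 :: "real measure" where "borel01 \<equiv> restrict_space borel {0..1}"

lemma set_integrable_bdd:
  fixes f :: "real \<Rightarrow> real"
  assumes f: "f \<in> borel_measurable borel01" and ab: "0 \<le> a" "b \<le> 1" and C: "\<And>r. r \<in> {a..b} \<Longrightarrow> \<bar>f r\<bar> \<le> C"
  shows "set_integrable lborel {a..b} f"
proof -
  have m: "(\<lambda>x. indicator {0..1} x *\<^sub>R f x) \<in> borel_measurable lborel"
    using f by (subst (asm) borel_measurable_restrict_space_iff) auto
  have "integrable lborel (\<lambda>x. indicator {a..b} x *\<^sub>R (indicator {0..1} x *\<^sub>R f x))"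
    by (rule integrableI_bounded_set_indicator[OF _ m, where B=C])
       (use C ab in \<open>auto simp: emeasure_lborel_Icc_eq indicator_def\<close>)
  moreover have "(\<lambda>x. indicator {a..b} x *\<^sub>R (indicator {0..1} x *\<^sub>R f x)) = (\<lambda>x. indicator {a..b} x *\<^sub>R f x)"
    using ab by (auto simp: indicator_def fun_eq_iff)
  ultimately show ?thesis by (simp add: set_integrable_def)
qed

lemma integrable_bdd:
  fixes f :: "real \<Rightarrow> real"
  assumes "f \<in> borel_measurable borel01" "0 \<le> a" "b \<le> 1" "\<And>r. r \<in> {a..b} \<Longrightarrow> \<bar>f r\<bar> \<le> C"
  shows "f integrable_on {a..b}" "(LINT r:{a..b}|lborel. f r) = integral {a..b} f"
  using set_borel_integral_eq_integral[OF set_integrable_bdd[OF assms]] by auto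

text \<open>Dominated convergence off a countable set, the form suited to distribution functions
  that converge except at jumps.\<close>

lemma integral_limit:
  fixes f :: "nat \<Rightarrow> real \<Rightarrow> real"
  assumes f: "\<And>n. f n \<in> borel_measurable borel01" and g: "g \<in> borel_measurable borel01" and ab: "0 \<le> a" "b \<le> 1"
    and C: "\<And>n r. r \<in> {a..b} \<Longrightarrow> \<bar>f n r\<bar> \<le> C" and N: "countable N"
    and lim: "\<And>r. r \<in> {a..b} \<Longrightarrow> r \<notin> N \<Longrightarrow> (\<lambda>n. f n r) \<longlonglongrightarrow> g r"
    and Cg: "\<And>r. r \<in> {a..b} \<Longrightarrow> \<bar>g r\<bar> \<le> C"
  shows "(\<lambda>n. integral {a..b} (f n)) \<longlonglongrightarrow> integral {a..b} g"
proof -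
  have i: "set_integrable lborel {a..b} (f n)" for n by (rule set_integrable_bdd[OF f ab C])
  have ig: "set_integrable lborel {a..b} g" by (rule set_integrable_bdd[OF g ab Cg])
  have "(\<lambda>n. LINT r:{a..b}|lborel. f n r) \<longlonglongrightarrow> (LINT r:{a..b}|lborel. g r)"
    unfolding set_lebesgue_integral_def
  proof (rule integral_dominated_convergence[where w="\<lambda>x. indicator {a..b} x *\<^sub>R C"])
    show "integrable lborel (\<lambda>x. indicator {a..b} x *\<^sub>R C)"
      using set_integrable_bdd[of "\<lambda>_. C" a b "\<bar>C\<bar>", OF _ ab] by (simp add: set_integrable_def)
    have "AE r in lborel. r \<notin> N"
      using countable_imp_null_set_lborel[OF N] by (rule AE_not_in)
    then show "AE r in lborel. (\<lambda>n. indicator {a..b} r *\<^sub>R f n r) \<longlonglongrightarrow> indicator {a..b} r *\<^sub>R g r"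
    proof eventually_elim
      case (elim r) then show ?case using lim[of r] by (cases "r \<in> {a..b}") auto
    qed
    show "AE r in lborel. norm (indicator {a..b} r *\<^sub>R f n r) \<le> indicator {a..b} r *\<^sub>R C" for n
      using C by (intro AE_I2) (auto simp: indicator_def)
  qed (use i ig in \<open>auto simp: set_integrable_def dest: borel_measurable_integrable\<close>)
  then show ?thesis
    using set_borel_integral_eq_integral(2)[OF i] set_borel_integral_eq_integral(2)[OF ig] by simp
qed

lemma dist_fun_measurable [measurable (raw)]:
  assumes "\<mu> \<in> prob_measures01" shows "dist_fun \<mu> \<in> borel_measurable borel01"
  by (rule borel_measurable_mono_on_fnc) (auto intro!: mono_onI dist_fun_mono[OF assms])

lemma continuous_borel01: "continuous_on {0..1} f \<Longrightarrow> f \<in> borel_measurable borel01"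
  by (rule borel_measurable_continuous_on_restrict)

lemma measure_dist_integral:
  assumes "\<mu> \<in> prob_measures01" "\<nu> \<in> prob_measures01"
  shows "measure_dist \<mu> \<nu> = integral {0..1} (\<lambda>r. \<bar>dist_fun \<mu> r - dist_fun \<nu> r\<bar>)"
    "(\<lambda>r. \<bar>dist_fun \<mu> r - dist_fun \<nu> r\<bar>) integrable_on {0..1}"
proof -
  have m: "(\<lambda>r. \<bar>dist_fun \<mu> r - dist_fun \<nu> r\<bar>) \<in> borel_measurable borel01"
    using dist_fun_measurable[OF assms(1)] dist_fun_measurable[OF assms(2)] by measurable
  have b: "\<bar>\<bar>dist_fun \<mu> r - dist_fun \<nu> r\<bar>\<bar> \<le> 1" for r
    using dist_fun_bounds(1,2)[OF assms(1), of r] dist_fun_bounds(1,2)[OF assms(2), of r] by linarith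
  show "measure_dist \<mu> \<nu> = integral {0..1} (\<lambda>r. \<bar>dist_fun \<mu> r - dist_fun \<nu> r\<bar>)"
    unfolding measure_dist_def by (rule integrable_bdd(2)[OF m _ _ b]) auto
  show "(\<lambda>r. \<bar>dist_fun \<mu> r - dist_fun \<nu> r\<bar>) integrable_on {0..1}"
    by (rule integrable_bdd(1)[OF m _ _ b]) auto
qed

lemma measure_dist_sym: "measure_dist \<mu> \<nu> = measure_dist \<nu> \<mu>"
  by (simp add: measure_dist_def abs_minus_commute)

lemma measure_dist_bounds:
  assumes "\<mu> \<in> prob_measures01" "\<nu> \<in> prob_measures01"
  shows "0 \<le> measure_dist \<mu> \<nu>" "measure_dist \<mu> \<nu> \<le> 1"
proof -
  note m = measure_dist_integral[OF assms]
  have b: "\<bar>dist_fun \<mu> r - dist_fun \<nu> r\<bar> \<le> 1" for r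
    using dist_fun_bounds(1,2)[OF assms(1), of r] dist_fun_bounds(1,2)[OF assms(2), of r] by linarith
  show "0 \<le> measure_dist \<mu> \<nu>" unfolding m(1) by (rule integral_nonneg[OF m(2)]) auto
  have "integral {0..1} (\<lambda>r. \<bar>dist_fun \<mu> r - dist_fun \<nu> r\<bar>) \<le> integral {0..1} (\<lambda>r::real. 1)"
    by (rule integral_le[OF m(2)]) (use b in auto)
  then show "measure_dist \<mu> \<nu> \<le> 1" unfolding m(1) by simp
qed

abbreviation sum_of :: "(nat list \<Rightarrow> real) \<Rightarrow> nat list list \<Rightarrow> real" where
  "sum_of h P \<equiv> sum_list (map h P)"

text \<open>Landau--Kolmogorov interpolation; three derivatives are needed so that the square of the
  bound is of smaller order than \<open>\<epsilon>\<close> for \<open>h = \<epsilon>\<^bsup>1/3\<^esup>\<close>.\<close>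

lemma interpolation:
  fixes D :: "nat \<Rightarrow> real \<Rightarrow> real"
  assumes D: "\<And>m t. (D m has_real_derivative D (Suc m) t) (at t)"
    and b0: "\<And>t. \<bar>D 0 t\<bar> \<le> \<epsilon>" and b3: "\<And>t. \<bar>D 3 t\<bar> \<le> C" and h: "h > 0"
  shows "\<bar>D 1 x\<bar> \<le> \<epsilon> / h + C * h\<^sup>2"
proof -
  obtain t1 where t1: "D 0 (x + h) = (\<Sum>m<3. (D m x / fact m) * (x + h - x) ^ m) + (D 3 t1 / fact 3) * (x + h - x) ^ 3"
    using Taylor_up[of 3 D "D 0" x "x + h" x] D h by auto
  obtain t2 where t2: "D 0 (x - h) = (\<Sum>m<3. (D m x / fact m) * (x - h - x) ^ m) + (D 3 t2 / fact 3) * (x - h - x) ^ 3"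
    using Taylor_down[of 3 D "D 0" "x - h" x x] D h by auto
  have "D 0 (x + h) - D 0 (x - h) = 2 * h * D 1 x + (D 3 t1 + D 3 t2) * h ^ 3 / 6"
    unfolding t1 t2 by (simp add: eval_nat_numeral field_simps)
  then have e: "2 * h * D 1 x = D 0 (x + h) - D 0 (x - h) - (D 3 t1 + D 3 t2) * h ^ 3 / 6" by simp
  have "\<bar>(D 3 t1 + D 3 t2) * h ^ 3 / 6\<bar> \<le> (2 * C) * h ^ 3 / 6"
    using b3[of t1] b3[of t2] h by (auto simp: abs_mult intro!: divide_right_mono mult_right_mono)
  then have "\<bar>2 * h * D 1 x\<bar> \<le> 2 * \<epsilon> + (2 * C) * h ^ 3 / 6"
    unfolding e using b0[of "x + h"] b0[of "x - h"] by linarith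
  also have "\<dots> \<le> 2 * \<epsilon> + 2 * C * h ^ 3"
    using order_trans[OF abs_ge_zero b3[of 0]] h by (simp add: field_simps)
  also have "\<dots> = 2 * h * (\<epsilon> / h + C * h\<^sup>2)" using h by (simp add: field_simps eval_nat_numeral)
  finally have "2 * h * \<bar>D 1 x\<bar> \<le> 2 * h * (\<epsilon> / h + C * h\<^sup>2)" using h by (simp add: abs_mult)
  then show ?thesis using h by simp
qed

section \<open>Expected monomials and the comparison identity\<close>

context parisi_setup
begin

definition Lam :: "real measure \<Rightarrow> real \<Rightarrow> (real \<Rightarrow> real) \<Rightarrow> real" where
  "Lam \<mu> = (SOME \<Lambda>. evolution \<mu> 0 0 1 \<Lambda>)"

definition H :: "real measure \<Rightarrow> nat list \<Rightarrow> real \<Rightarrow> real" where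
  "H \<mu> w u = Lam \<mu> u (\<lambda>y. mono_val (\<lambda>i. dPhi \<mu> (Suc i) y u) w)"

lemma Lam: "\<mu> \<in> discrete_measures01 \<Longrightarrow> evolution \<mu> 0 0 1 (Lam \<mu>)"
  unfolding Lam_def by (rule someI_ex[OF evolution_exists]) auto

lemma mono_slice:
  "\<mu> \<in> discrete_measures01 \<Longrightarrow> 0 \<le> u \<Longrightarrow> u \<le> 1 \<Longrightarrow> bcont1 (\<lambda>y. mono_val (\<lambda>i. dPhi \<mu> (Suc i) y u) w)"
  "\<mu> \<in> discrete_measures01 \<Longrightarrow> 0 \<le> u \<Longrightarrow> u \<le> 1 \<Longrightarrow> bcont1 (\<lambda>y. poly_val (\<lambda>i. dPhi \<mu> (Suc i) y u) P)"
  by (intro bcont_mono_val bcont_poly_val dPhi_slice; assumption)+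

lemma Lam_poly:
  assumes \<mu>: "\<mu> \<in> discrete_measures01" "0 \<le> u" "u \<le> 1"
  shows "Lam \<mu> u (\<lambda>y. poly_val (\<lambda>i. dPhi \<mu> (Suc i) y u) P) = sum_of (\<lambda>w. H \<mu> w u) P"
proof (induction P)
  case Nil
  show ?case using state_const[OF evolutionD(1)[OF Lam[OF \<mu>(1)] \<mu>(2,3)], of 0] by simp
next
  case (Cons w P)
  then show ?case
    using state_add[OF evolutionD(1)[OF Lam[OF \<mu>(1)] \<mu>(2,3)] mono_slice(1)[OF \<mu>, of w] mono_slice(2)[OF \<mu>, of P]]
    by (simp add: H_def)
qed

lemma H_integral:
  assumes \<mu>: "\<mu> \<in> discrete_measures01" and ab: "0 \<le> a" "a \<le> b" "b \<le> 1"
  shows "((\<lambda>r. \<theta>' r * (sum_of (\<lambda>w. H \<mu> w r) (gen0 w) - dist_fun \<mu> r * sum_of (\<lambda>w. H \<mu> w r) (gen1 w)))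
    has_integral (H \<mu> w b - H \<mu> w a)) {a..b}"
  unfolding H_def[of \<mu> w b] H_def[of \<mu> w a]
proof (rule has_integral_eq[OF _ dynkin[OF Lam[OF \<mu>] regular_mono[OF \<mu>] order_refl ab]])
  fix r assume "r \<in> {a..b}"
  then have r: "0 \<le> r" "r \<le> 1" using ab by auto
  have "Lam \<mu> r (\<lambda>y. 1 * poly_val (\<lambda>i. dPhi \<mu> (Suc i) y r) (gen0 w) + (- dist_fun \<mu> r) * poly_val (\<lambda>i. dPhi \<mu> (Suc i) y r) (gen1 w))
    = 1 * sum_of (\<lambda>w. H \<mu> w r) (gen0 w) + (- dist_fun \<mu> r) * sum_of (\<lambda>w. H \<mu> w r) (gen1 w)"
    unfolding Lam_poly[OF \<mu> r, symmetric] by (rule state_lin[OF evolutionD(1)[OF Lam[OF \<mu>] r] mono_slice(2)[OF \<mu> r] mono_slice(2)[OF \<mu> r]])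
  then show "\<theta>' r * Lam \<mu> r (\<lambda>y. poly_val (\<lambda>i. dPhi \<mu> (Suc i) y r) (gen0 w) - dist_fun \<mu> r * poly_val (\<lambda>i. dPhi \<mu> (Suc i) y r) (gen1 w)) =
      \<theta>' r * (sum_of (\<lambda>w. H \<mu> w r) (gen0 w) - dist_fun \<mu> r * sum_of (\<lambda>w. H \<mu> w r) (gen1 w))"
    by simp
qed

lemma mono_bound:
  "\<exists>C\<ge>0. \<forall>\<mu>\<in>discrete_measures01. \<forall>y. \<forall>u\<in>{0..1}. \<bar>mono_val (\<lambda>i. dPhi \<mu> (Suc i) y u) w\<bar> \<le> C"
proof (induction w)
  case (Cons j w)
  then obtain C where C: "0 \<le> C" "\<And>\<mu> y u. \<mu> \<in> discrete_measures01 \<Longrightarrow> u \<in> {0..1} \<Longrightarrow> \<bar>mono_val (\<lambda>i. dPhi \<mu> (Suc i) y u) w\<bar> \<le> C"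
    by blast
  obtain D where D: "0 \<le> D" "\<And>\<mu> x s. \<mu> \<in> discrete_measures01 \<Longrightarrow> 0 \<le> s \<Longrightarrow> s \<le> 1 \<Longrightarrow> \<bar>dPhi \<mu> (Suc j) x s\<bar> \<le> D"
    using dPhi_bound[of j] by blast
  show ?case
    by (rule exI[of _ "D * C"]) (use C D in \<open>auto simp: abs_mult intro!: mult_mono\<close>)
qed (auto intro: exI[of _ 1])

lemma H_bound: "\<exists>C\<ge>0. \<forall>\<mu>\<in>discrete_measures01. \<forall>u\<in>{0..1}. \<bar>H \<mu> w u\<bar> \<le> C"
proof -
  obtain C where C: "0 \<le> C" "\<And>\<mu> y u. \<mu> \<in> discrete_measures01 \<Longrightarrow> u \<in> {0..1} \<Longrightarrow> \<bar>mono_val (\<lambda>i. dPhi \<mu> (Suc i) y u) w\<bar> \<le> C"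
    using mono_bound by blast
  have "\<bar>H \<mu> w u\<bar> \<le> C" if \<mu>: "\<mu> \<in> discrete_measures01" and u: "u \<in> {0..1}" for \<mu> u
    unfolding H_def
    by (rule state_bound[OF evolutionD(1)[OF Lam[OF \<mu>]] mono_slice(1)[OF \<mu>]]) (use C \<mu> u in auto)
  with C(1) show ?thesis by blast
qed

text \<open>Expanding \<open>0 \<le> E[\<partial>\<^sub>x\<^sup>2\<Phi> (\<partial>\<^sub>x\<^sup>2\<Phi> - c)\<^sup>2]\<close> at \<open>c = E[(\<partial>\<^sub>x\<^sup>2\<Phi>)\<^sup>2]\<close>, using \<open>0 \<le> \<partial>\<^sub>x\<^sup>2\<Phi> \<le> 1\<close>.\<close>

lemma H_cube:
  assumes \<mu>: "\<mu> \<in> discrete_measures01" and u: "0 \<le> u" "u \<le> 1"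
  shows "(H \<mu> [1, 1] u)\<^sup>2 \<le> H \<mu> [1, 1, 1] u"
proof -
  let ?p = "\<lambda>w y. mono_val (\<lambda>i. dPhi \<mu> (Suc i) y u) w"
  define c where "c = H \<mu> [1, 1] u"
  have st: "state (Lam \<mu> u)" by (rule evolutionD(1)[OF Lam[OF \<mu>] u])
  note b = mono_slice(1)[OF \<mu> u]
  have "0 \<le> Lam \<mu> u (\<lambda>y. 1 * ?p [1,1,1] y + 1 * ((-2 * c) * ?p [1,1] y + c\<^sup>2 * ?p [1] y))"
  proof (rule state_nonneg[OF st])
    show "bcont1 (\<lambda>y. 1 * ?p [1,1,1] y + 1 * ((-2 * c) * ?p [1,1] y + c\<^sup>2 * ?p [1] y))"
      by (intro bcont_add bcont_mult bcont_const b)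
    fix y
    have "1 * ?p [1,1,1] y + 1 * ((-2 * c) * ?p [1,1] y + c\<^sup>2 * ?p [1] y) = dPhi \<mu> (Suc 1) y u * (dPhi \<mu> (Suc 1) y u - c)\<^sup>2"
      by (simp add: power2_eq_square algebra_simps)
    then show "0 \<le> 1 * ?p [1,1,1] y + 1 * ((-2 * c) * ?p [1,1] y + c\<^sup>2 * ?p [1] y)"
      using dPhi_2_bounds(1)[OF \<mu> u, of y] by simp
  qed
  also have "\<dots> = 1 * Lam \<mu> u (?p [1,1,1]) + 1 * Lam \<mu> u (\<lambda>y. (-2 * c) * ?p [1,1] y + c\<^sup>2 * ?p [1] y)"
    by (rule state_lin[OF st b]) (intro bcont_add bcont_mult bcont_const b)
  also have "Lam \<mu> u (\<lambda>y. (-2 * c) * ?p [1,1] y + c\<^sup>2 * ?p [1] y) = (-2 * c) * Lam \<mu> u (?p [1,1]) + c\<^sup>2 * Lam \<mu> u (?p [1])"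
    by (rule state_lin[OF st b b])
  finally have "0 \<le> H \<mu> [1,1,1] u - 2 * c * c + c\<^sup>2 * H \<mu> [1] u"
    unfolding c_def H_def by simp
  moreover have "H \<mu> [1] u \<le> 1"
    using state_mono[OF st b[of "[1]"] bcont1_const[of 1]] dPhi_2_bounds(2)[OF \<mu> u] state_1[OF st] unfolding H_def by simp
  then have "c\<^sup>2 * H \<mu> [1] u \<le> c\<^sup>2 * 1" by (rule mult_left_mono) simp
  ultimately have "c\<^sup>2 \<le> H \<mu> [1,1,1] u" by (simp add: power2_eq_square)
  then show ?thesis by (simp add: c_def)
qed

text \<open>Subtracting the two equations and adding the drift of \<mu> completes a square. Each
  solution alone is unbounded, but the difference is a bounded test function; its exceptional times
  are the atoms of both measures.\<close>

lemma regular_diff: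
  assumes \<mu>: "\<mu> \<in> discrete_measures01" and \<nu>: "\<nu> \<in> discrete_measures01"
  shows "regular \<mu> (atoms \<mu> \<union> atoms \<nu>) (\<lambda>y r. Phi \<nu> y r - Phi \<mu> y r) (\<lambda>y r. dPhi \<nu> 1 y r - dPhi \<mu> 1 y r)
    (\<lambda>y r. - ((dist_fun \<nu> r - dist_fun \<mu> r) / 2 * (dPhi \<nu> 1 y r)\<^sup>2 + dist_fun \<mu> r / 2 * (dPhi \<nu> 1 y r - dPhi \<mu> 1 y r)\<^sup>2))"
proof -
  let ?A = "atoms \<mu> \<union> atoms \<nu>"
  let ?I = "{0<..<1} - ?A"
  have fA: "finite ?A" using discrete_atoms(1) \<mu> \<nu> by auto
  have bd: "bcont ?I (dPhi \<mu> 1)" "bcont ?I (dPhi \<nu> 1)" "bcont ?I (dPhi \<mu> 2)" "bcont ?I (dPhi \<nu> 2)"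
    using bcont_subset[OF dPhi_bcont[OF \<mu>, of 0] interior_subset] bcont_subset[OF dPhi_bcont[OF \<nu>, of 0] interior_subset]
      bcont_subset[OF dPhi_bcont[OF \<mu>, of 1] interior_subset] bcont_subset[OF dPhi_bcont[OF \<nu>, of 1] interior_subset]
    by (simp_all add: numeral_2_eq_2)
  note bb = dist_fun_bcont[OF \<mu> fA Un_upper1] dist_fun_bcont[OF \<nu> fA Un_upper2]
  let ?pt = "\<lambda>y r. (-1/2) * ((dPhi \<nu> 2 y r + dist_fun \<nu> r * (dPhi \<nu> 1 y r * dPhi \<nu> 1 y r)) + (-1) * (dPhi \<mu> 2 y r + dist_fun \<mu> r * (dPhi \<mu> 1 y r * dPhi \<mu> 1 y r)))"
  show ?thesis
  proof (rule regularI[OF fA Un_upper1, where ?p2.0="\<lambda>y r. dPhi \<nu> 2 y r + (-1) * dPhi \<mu> 2 y r" and pt="?pt"])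
    have "bcont {0..1} (\<lambda>x u. (Phi \<nu> x u - ln (cosh x)) + (-1) * (Phi \<mu> x u - ln (cosh x)))"
      by (intro bcont_add bcont_mult bcont_const Phi_bcont \<mu> \<nu>)
    then show "bcont {0..1} (\<lambda>y r. Phi \<nu> y r - Phi \<mu> y r)" by (rule bcont_cong) simp
    have "bcont ?I (\<lambda>y r. dPhi \<nu> 1 y r + (-1) * dPhi \<mu> 1 y r)" by (intro bcont_add bcont_mult bcont_const bd)
    then show "bcont ?I (\<lambda>y r. dPhi \<nu> 1 y r - dPhi \<mu> 1 y r)" by (rule bcont_cong) simp
    show "bcont ?I (\<lambda>y r. dPhi \<nu> 2 y r + (-1) * dPhi \<mu> 2 y r)" by (intro bcont_add bcont_mult bcont_const bd)
    show "bcont ?I ?pt" by (intro bcont_add bcont_mult bcont_const bd bb)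
    fix y r assume r: "r \<in> ?I"
    then have r': "0 \<le> r" "r \<le> 1" "0 < r" "r < 1" "r \<notin> atoms \<mu>" "r \<notin> atoms \<nu>" by auto
    show "((\<lambda>y. Phi \<nu> y r - Phi \<mu> y r) has_real_derivative dPhi \<nu> 1 y r - dPhi \<mu> 1 y r) (at y)"
      using DERIV_diff[OF dPhi_deriv[OF \<nu> r'(1,2), of 0 y] dPhi_deriv[OF \<mu> r'(1,2), of 0 y]] by simp
    show "((\<lambda>y. dPhi \<nu> 1 y r - dPhi \<mu> 1 y r) has_real_derivative dPhi \<nu> 2 y r + (-1) * dPhi \<mu> 2 y r) (at y)"
      using DERIV_diff[OF dPhi_deriv[OF \<nu> r'(1,2), of 1 y] dPhi_deriv[OF \<mu> r'(1,2), of 1 y]] by (simp add: numeral_2_eq_2)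
    show "((\<lambda>r. Phi \<nu> y r - Phi \<mu> y r) has_real_derivative \<theta>' r * ?pt y r) (at r)"
      by (rule DERIV_cong[OF DERIV_diff[OF dPhi_time(1)[OF \<nu> r'(3,4,6)] dPhi_time(1)[OF \<mu> r'(3,4,5)]]])
         (simp add: field_simps power2_eq_square)
    show "- ((dist_fun \<nu> r - dist_fun \<mu> r) / 2 * (dPhi \<nu> 1 y r)\<^sup>2 + dist_fun \<mu> r / 2 * (dPhi \<nu> 1 y r - dPhi \<mu> 1 y r)\<^sup>2)
      = ?pt y r + (dPhi \<nu> 2 y r + (-1) * dPhi \<mu> 2 y r) / 2 + dist_fun \<mu> r * dPhi \<mu> 1 y r * (dPhi \<nu> 1 y r - dPhi \<mu> 1 y r)"
      by (simp add: field_simps power2_eq_square)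
  qed
qed

text \<open>Dynkin's formula for the difference of the solutions, which vanishes at time 1.\<close>

lemma compare:
  assumes \<mu>: "\<mu> \<in> discrete_measures01" and \<nu>: "\<nu> \<in> discrete_measures01" and s: "0 \<le> s" "s \<le> 1"
    and E: "evolution \<mu> x s 1 \<Lambda>"
  shows "((\<lambda>r. \<theta>' r * \<Lambda> r (\<lambda>y. (dist_fun \<nu> r - dist_fun \<mu> r) / 2 * (dPhi \<nu> 1 y r)\<^sup>2 + dist_fun \<mu> r / 2 * (dPhi \<nu> 1 y r - dPhi \<mu> 1 y r)\<^sup>2))
    has_integral Phi \<nu> x s - Phi \<mu> x s) {s..1}"
proof -
  let ?g = "\<lambda>y r. (dist_fun \<nu> r - dist_fun \<mu> r) / 2 * (dPhi \<nu> 1 y r)\<^sup>2 + dist_fun \<mu> r / 2 * (dPhi \<nu> 1 y r - dPhi \<mu> 1 y r)\<^sup>2"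
  have gb: "bcont1 (\<lambda>y. ?g y r)" if r: "0 \<le> r" "r \<le> 1" for r
  proof -
    have d1: "bcont1 (\<lambda>y. dPhi \<mu> 1 y r)" "bcont1 (\<lambda>y. dPhi \<nu> 1 y r)"
      using dPhi_slice[OF \<mu> r, of 0] dPhi_slice[OF \<nu> r, of 0] by auto
    have "bcont1 (\<lambda>y. (dist_fun \<nu> r - dist_fun \<mu> r) / 2 * (dPhi \<nu> 1 y r * dPhi \<nu> 1 y r) +
       dist_fun \<mu> r / 2 * ((dPhi \<nu> 1 y r + (-1) * dPhi \<mu> 1 y r) * (dPhi \<nu> 1 y r + (-1) * dPhi \<mu> 1 y r)))"
      by (intro bcont_add bcont_mult bcont_const d1)
    then show ?thesis by (simp add: power2_eq_square)
  qed
  have D: "bcont1 (\<lambda>y. Phi \<nu> y s - Phi \<mu> y s)"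
    using regular_diff[OF \<mu> \<nu>] bcont1_slice[of "{0..1}" _ s] s unfolding regular_def by auto
  have "((\<lambda>r. \<theta>' r * \<Lambda> r (\<lambda>y. - ?g y r)) has_integral \<Lambda> 1 (\<lambda>y. Phi \<nu> y 1 - Phi \<mu> y 1) - \<Lambda> s (\<lambda>y. Phi \<nu> y s - Phi \<mu> y s)) {s..1}"
    by (rule dynkin[OF E regular_diff[OF \<mu> \<nu>]]) (use s in auto)
  moreover have "\<Lambda> 1 (\<lambda>y. Phi \<nu> y 1 - Phi \<mu> y 1) = 0"
    using state_const[OF evolutionD(1)[OF E s(2) order_refl], of 0] by (simp add: Phi_1[OF \<mu>] Phi_1[OF \<nu>])
  moreover have "\<Lambda> s (\<lambda>y. Phi \<nu> y s - Phi \<mu> y s) = Phi \<nu> x s - Phi \<mu> x s"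
    by (rule evolutionD(2)[OF E D])
  ultimately have "((\<lambda>r. \<theta>' r * \<Lambda> r (\<lambda>y. - ?g y r)) has_integral - (Phi \<nu> x s - Phi \<mu> x s)) {s..1}" by simp
  from has_integral_neg[OF this] have I: "((\<lambda>r. - (\<theta>' r * \<Lambda> r (\<lambda>y. - ?g y r))) has_integral Phi \<nu> x s - Phi \<mu> x s) {s..1}" by simp
  show ?thesis
  proof (rule has_integral_eq[OF _ I])
    fix r assume "r \<in> {s..1}"
    then have r: "s \<le> r" "r \<le> 1" "0 \<le> r" using s by auto
    show "- (\<theta>' r * \<Lambda> r (\<lambda>y. - ?g y r)) = \<theta>' r * \<Lambda> r (\<lambda>y. ?g y r)"
      using state_cmult[OF evolutionD(1)[OF E r(1,2)] gb[OF r(3,2)], of "-1"] by simp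
  qed
qed

text \<open>In the comparison identity the completed square carries a nonnegative weight and is
  dropped; in the remaining term the slope is at most 1 in absolute value. Exchanging the measures
  turns the lower bound into an upper one.\<close>

lemma Phi_lower:
  assumes \<mu>: "\<mu> \<in> discrete_measures01" and \<nu>: "\<nu> \<in> discrete_measures01" and s: "0 \<le> s" "s \<le> 1"
    and M: "0 \<le> M" "\<And>u. u \<in> {0..1} \<Longrightarrow> \<bar>\<theta>' u\<bar> \<le> M"
  shows "- (M / 2 * measure_dist \<mu> \<nu>) \<le> Phi \<nu> x s - Phi \<mu> x s"
proof -
  have pm: "\<mu> \<in> prob_measures01" "\<nu> \<in> prob_measures01" using \<mu> \<nu> by (auto simp: discrete_measures01_def)
  obtain \<Lambda> where E: "evolution \<mu> x s 1 \<Lambda>" using evolution_exists[OF \<mu> s] by blast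
  note d = measure_dist_integral[OF pm]
  let ?f = "\<lambda>r. \<bar>dist_fun \<mu> r - dist_fun \<nu> r\<bar>"
  have fi: "?f integrable_on {s..1}" by (rule integrable_on_subinterval[OF d(2)]) (use s in auto)
  have le: "integral {s..1} ?f \<le> integral {0..1} ?f"
    by (rule integral_subset_le[OF _ fi d(2)]) (use s in auto)
  have "- (M / 2) * integral {s..1} ?f \<le> Phi \<nu> x s - Phi \<mu> x s"
  proof (rule has_integral_le[OF has_integral_mult_right[OF integrable_integral[OF fi]] compare[OF \<mu> \<nu> s E]])
    fix r assume "r \<in> {s..1}"
    then have r: "s \<le> r" "r \<le> 1" "0 \<le> r" using s by auto
    let ?g = "\<lambda>y. (dist_fun \<nu> r - dist_fun \<mu> r) / 2 * (dPhi \<nu> 1 y r)\<^sup>2 + dist_fun \<mu> r / 2 * (dPhi \<nu> 1 y r - dPhi \<mu> 1 y r)\<^sup>2"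
    have d1: "bcont1 (\<lambda>y. dPhi \<mu> 1 y r)" "bcont1 (\<lambda>y. dPhi \<nu> 1 y r)"
      using dPhi_slice[OF \<mu> r(3,2), of 0] dPhi_slice[OF \<nu> r(3,2), of 0] by auto
    have "bcont1 (\<lambda>y. (dist_fun \<nu> r - dist_fun \<mu> r) / 2 * (dPhi \<nu> 1 y r * dPhi \<nu> 1 y r) +
       dist_fun \<mu> r / 2 * ((dPhi \<nu> 1 y r + (-1) * dPhi \<mu> 1 y r) * (dPhi \<nu> 1 y r + (-1) * dPhi \<mu> 1 y r)))"
      by (intro bcont_add bcont_mult bcont_const d1)
    then have gb: "bcont1 ?g" by (simp add: power2_eq_square)
    have "- (?f r / 2) \<le> ?g y" for y
    proof -
      have "(dPhi \<nu> 1 y r)\<^sup>2 \<le> 1" using dPhi_1_le[OF \<nu> r(3,2), of y] by (simp add: abs_square_le_1)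
      then have "?f r / 2 * (dPhi \<nu> 1 y r)\<^sup>2 \<le> ?f r / 2 * 1" by (intro mult_left_mono) auto
      moreover have "- (?f r / 2) * (dPhi \<nu> 1 y r)\<^sup>2 \<le> (dist_fun \<nu> r - dist_fun \<mu> r) / 2 * (dPhi \<nu> 1 y r)\<^sup>2"
        by (intro mult_right_mono) auto
      moreover have "0 \<le> dist_fun \<mu> r / 2 * (dPhi \<nu> 1 y r - dPhi \<mu> 1 y r)\<^sup>2"
        using dist_fun_bounds(1)[OF pm(1), of r] by simp
      ultimately show ?thesis by linarith
    qed
    then have "\<Lambda> r (\<lambda>_. - (?f r / 2)) \<le> \<Lambda> r ?g"
      by (intro state_mono[OF evolutionD(1)[OF E r(1,2)] bcont1_const gb])
    then have "- (?f r / 2) \<le> \<Lambda> r ?g" using state_const[OF evolutionD(1)[OF E r(1,2)]] by simp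
    then have "\<theta>' r * (- (?f r / 2)) \<le> \<theta>' r * \<Lambda> r ?g"
      using theta'_nonneg[OF r(3,2)] by (rule mult_left_mono)
    moreover have "\<theta>' r * (?f r / 2) \<le> M * (?f r / 2)"
      using M(2)[of r] r by (intro mult_right_mono) auto
    ultimately show "- (M / 2) * ?f r \<le> \<theta>' r * \<Lambda> r ?g" by simp
  qed
  moreover have "M / 2 * integral {s..1} ?f \<le> M / 2 * measure_dist \<mu> \<nu>"
    unfolding d(1) using le M by (intro mult_left_mono) auto
  ultimately show ?thesis by simp
qed

lemma Phi_lipschitz:
  assumes \<mu>: "\<mu> \<in> discrete_measures01" and \<nu>: "\<nu> \<in> discrete_measures01" and s: "0 \<le> s" "s \<le> 1"
    and M: "0 \<le> M" "\<And>u. u \<in> {0..1} \<Longrightarrow> \<bar>\<theta>' u\<bar> \<le> M"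
  shows "\<bar>Phi \<nu> x s - Phi \<mu> x s\<bar> \<le> M / 2 * measure_dist \<mu> \<nu>"
  using Phi_lower[OF \<mu> \<nu> s M, of x] Phi_lower[OF \<nu> \<mu> s M, of x]
  unfolding measure_dist_sym[of \<nu> \<mu>] abs_le_iff by linarith

text \<open>\<open>e\<close> bounds the difference of slopes. Replacing one slope by the other in
  the linear term costs \<open>e\<close> times the distance, because the sum of the slopes is at
  most 2 in absolute value, and the completed square costs half the square of \<open>e\<close>; both
  are multiplied by the bound \<open>M\<close> on \<theta>'.\<close>

lemma Phi_expand_aux:
  assumes \<mu>: "\<mu> \<in> discrete_measures01" and \<nu>: "\<nu> \<in> discrete_measures01"
    and M: "0 \<le> M" "\<And>u. u \<in> {0..1} \<Longrightarrow> \<bar>\<theta>' u\<bar> \<le> M"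
    and e: "\<And>y r. 0 \<le> r \<Longrightarrow> r \<le> 1 \<Longrightarrow> \<bar>dPhi \<nu> 1 y r - dPhi \<mu> 1 y r\<bar> \<le> e"
  shows "Phi \<nu> 0 0 - Phi \<mu> 0 0 \<le> integral {0..1} (\<lambda>r. \<theta>' r * ((dist_fun \<nu> r - dist_fun \<mu> r) / 2) * H \<mu> [0,0] r)
    + M * e * measure_dist \<mu> \<nu> + M * e\<^sup>2 / 2"
proof -
  have pm: "\<mu> \<in> prob_measures01" "\<nu> \<in> prob_measures01" using \<mu> \<nu> by (auto simp: discrete_measures01_def)
  note d = measure_dist_integral[OF pm]
  let ?f = "\<lambda>r. \<bar>dist_fun \<mu> r - dist_fun \<nu> r\<bar>"
  let ?q = "\<lambda>r. \<theta>' r * ((dist_fun \<nu> r - dist_fun \<mu> r) / 2) * H \<mu> [0,0] r"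
  have e0: "0 \<le> e" using order_trans[OF abs_ge_zero e[of 0 0]] by simp
  have Hc: "continuous_on {0..1} (H \<mu> [0,0])"
    using Lam[OF \<mu>] regular_mono[OF \<mu>, of "[0,0]"] unfolding evolution_def H_def by blast
  obtain CH where CH: "0 \<le> CH" "\<And>u. u \<in> {0..1} \<Longrightarrow> \<bar>H \<mu> [0,0] u\<bar> \<le> CH" using H_bound[of "[0,0]"] \<mu> by blast
  have qi: "?q integrable_on {0..1}"
  proof (rule integrable_bdd(1)[where C="M * (1/2) * CH"])
    show "?q \<in> borel_measurable borel01"
      by (intro borel_measurable_times borel_measurable_diff borel_measurable_divide borel_measurable_const
          continuous_borel01[OF theta'_cont] continuous_borel01[OF Hc] dist_fun_measurable pm)
    fix r :: real assume r: "r \<in> {0..1}"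
    have "\<bar>dist_fun \<nu> r - dist_fun \<mu> r\<bar> \<le> 1"
      using dist_fun_bounds(1,2)[OF pm(1), of r] dist_fun_bounds(1,2)[OF pm(2), of r] by linarith
    then have "\<bar>(dist_fun \<nu> r - dist_fun \<mu> r) / 2\<bar> \<le> 1/2" by simp
    with r show "\<bar>?q r\<bar> \<le> M * (1/2) * CH"
      unfolding abs_mult using M CH r by (intro mult_mono) auto
  qed auto
  have I2: "((\<lambda>r. ?q r + (M * e * ?f r + M * e\<^sup>2 / 2)) has_integral (integral {0..1} ?q + (M * e * measure_dist \<mu> \<nu> + M * e\<^sup>2 / 2))) {0..1}"
  proof (intro has_integral_add integrable_integral[OF qi])
    show "((\<lambda>r. M * e * ?f r) has_integral M * e * measure_dist \<mu> \<nu>) {0..1}"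
      unfolding d(1) by (intro has_integral_mult_right integrable_integral d(2))
    show "((\<lambda>r. M * e\<^sup>2 / 2) has_integral M * e\<^sup>2 / 2) {0..1::real}"
      using has_integral_const_real[of "M * e\<^sup>2 / 2" 0 1] by simp
  qed
  have "Phi \<nu> 0 0 - Phi \<mu> 0 0 \<le> integral {0..1} ?q + (M * e * measure_dist \<mu> \<nu> + M * e\<^sup>2 / 2)"
  proof (rule has_integral_le[OF compare[OF \<mu> \<nu> _ _ Lam[OF \<mu>]] I2])
    fix r :: real assume "r \<in> {0..1}"
    then have r: "0 \<le> r" "r \<le> 1" by auto
    let ?b = "(dist_fun \<nu> r - dist_fun \<mu> r) / 2" and ?a = "dist_fun \<mu> r / 2"
    let ?P = "\<lambda>y. dPhi \<nu> 1 y r" and ?F = "\<lambda>y. dPhi \<mu> 1 y r"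
    have st: "state (Lam \<mu> r)" by (rule evolutionD(1)[OF Lam[OF \<mu>] r])
    have d1: "bcont1 ?F" "bcont1 ?P"
      using dPhi_slice[OF \<mu> r, of 0] dPhi_slice[OF \<nu> r, of 0] by auto
    have gb: "bcont1 (\<lambda>y. ?b * (?P y)\<^sup>2 + ?a * (?P y - ?F y)\<^sup>2)"
    proof -
      have "bcont1 (\<lambda>y. ?b * (?P y * ?P y) + ?a * ((?P y + (-1) * ?F y) * (?P y + (-1) * ?F y)))"
        by (intro bcont_add bcont_mult bcont_const d1)
      then show ?thesis by (simp add: power2_eq_square)
    qed
    define c where "c = e * ?f r + e\<^sup>2 / 2"
    have le: "?b * (?P y)\<^sup>2 + ?a * (?P y - ?F y)\<^sup>2 \<le> ?b * (?F y * ?F y) + c * 1" for y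
    proof -
      have D: "\<bar>?P y - ?F y\<bar> \<le> e" by (rule e[OF r])
      have "\<bar>?P y + ?F y\<bar> \<le> 2" using dPhi_1_le[OF \<mu> r, of y] dPhi_1_le[OF \<nu> r, of y] by simp
      then have "\<bar>?b\<bar> * (\<bar>?P y - ?F y\<bar> * \<bar>?P y + ?F y\<bar>) \<le> (?f r / 2) * (e * 2)"
        using D e0 by (intro mult_mono) auto
      then have 1: "?b * ((?P y - ?F y) * (?P y + ?F y)) \<le> e * ?f r"
        using abs_ge_self[of "?b * ((?P y - ?F y) * (?P y + ?F y))"] unfolding abs_mult by (simp add: mult.commute)
      have "(?P y - ?F y)\<^sup>2 \<le> e\<^sup>2" using D by (metis abs_ge_zero power2_abs power_mono)
      then have 2: "?a * (?P y - ?F y)\<^sup>2 \<le> (1/2) * e\<^sup>2"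
        using dist_fun_bounds(1,2)[OF pm(1), of r] by (intro mult_mono) auto
      have "?b * (?P y)\<^sup>2 + ?a * (?P y - ?F y)\<^sup>2 = ?b * (?F y * ?F y) + ?b * ((?P y - ?F y) * (?P y + ?F y)) + ?a * (?P y - ?F y)\<^sup>2"
        by (simp add: power2_eq_square algebra_simps)
      also have "\<dots> \<le> ?b * (?F y * ?F y) + e * ?f r + (1/2) * e\<^sup>2"
        by (intro add_mono order_refl 1 2)
      finally show ?thesis by (simp add: c_def)
    qed
    have "Lam \<mu> r (\<lambda>y. ?b * (?P y)\<^sup>2 + ?a * (?P y - ?F y)\<^sup>2) \<le> Lam \<mu> r (\<lambda>y. ?b * (?F y * ?F y) + c * 1)"
      by (rule state_mono[OF st gb _ le]) (intro bcont_add bcont_mult bcont_const d1)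
    also have "\<dots> = ?b * Lam \<mu> r (\<lambda>y. ?F y * ?F y) + c * Lam \<mu> r (\<lambda>_. 1)"
      by (rule state_lin[OF st bcont_mult[OF d1(1) d1(1)] bcont1_const])
    also have "\<dots> = ?b * H \<mu> [0,0] r + c" by (simp add: H_def state_1[OF st])
    finally have "\<theta>' r * Lam \<mu> r (\<lambda>y. ?b * (?P y)\<^sup>2 + ?a * (?P y - ?F y)\<^sup>2) \<le> \<theta>' r * (?b * H \<mu> [0,0] r + c)"
      by (rule mult_left_mono[OF _ theta'_nonneg[OF r]])
    also have "\<dots> = ?q r + \<theta>' r * c" by (simp add: algebra_simps)
    also have "\<theta>' r * c \<le> M * c" using M(2)[of r] r e0 by (intro mult_right_mono) (auto simp: c_def)
    also have "M * c = M * e * ?f r + M * e\<^sup>2 / 2" by (simp add: c_def algebra_simps)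
    finally show "\<theta>' r * Lam \<mu> r (\<lambda>y. ?b * (?P y)\<^sup>2 + ?a * (?P y - ?F y)\<^sup>2) \<le> ?q r + (M * e * ?f r + M * e\<^sup>2 / 2)" by simp
  qed auto
  then show ?thesis by simp
qed

text \<open>Interpolation at the scale \<open>h\<close>, the cube root of the distance
  \<open>d\<close>, puts the slopes within \<open>B * h\<^sup>2\<close>. The two error terms are
  then of orders \<open>h\<^sup>2 * d\<close> and \<open>h ^ 4 = h * d\<close>, both controlled by
  \<open>h * d\<close> since \<open>h\<close> is at most 1.\<close>

lemma Phi_expand:
  obtains K where "0 \<le> K" "\<And>\<mu> \<nu>. \<mu> \<in> discrete_measures01 \<Longrightarrow> \<nu> \<in> discrete_measures01 \<Longrightarrow>
    Phi \<nu> 0 0 - Phi \<mu> 0 0 \<le> integral {0..1} (\<lambda>r. \<theta>' r * ((dist_fun \<nu> r - dist_fun \<mu> r) / 2) * H \<mu> [0,0] r)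
      + K * root 3 (measure_dist \<mu> \<nu>) * measure_dist \<mu> \<nu>"
proof -
  obtain M where M: "0 \<le> M" "\<And>u. u \<in> {0..1} \<Longrightarrow> \<bar>\<theta>' u\<bar> \<le> M" using theta'_bound by blast
  obtain C where C: "0 \<le> C" "\<And>\<mu> x s. \<mu> \<in> discrete_measures01 \<Longrightarrow> 0 \<le> s \<Longrightarrow> s \<le> 1 \<Longrightarrow> \<bar>dPhi \<mu> (Suc 2) x s\<bar> \<le> C"
    using dPhi_bound[of 2] by blast
  \<comment> \<open>\<open>M / 2\<close> comes from the Lipschitz bound on the values,
    \<open>2 * C\<close> from the third derivatives of the two solutions.\<close>
  define B where "B = M / 2 + 2 * C"
  have B0: "0 \<le> B" using M C by (simp add: B_def)
  show ?thesis
  proof (rule that[of "M * B + M * B\<^sup>2"])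
    show "0 \<le> M * B + M * B\<^sup>2" using M B0 by simp
    fix \<mu> \<nu> assume \<mu>: "\<mu> \<in> discrete_measures01" and \<nu>: "\<nu> \<in> discrete_measures01"
    have pm: "\<mu> \<in> prob_measures01" "\<nu> \<in> prob_measures01" using \<mu> \<nu> by (auto simp: discrete_measures01_def)
    define d where "d = measure_dist \<mu> \<nu>"
    define h where "h = root 3 d"
    have d: "0 \<le> d" "d \<le> 1" using measure_dist_bounds[OF pm] by (auto simp: d_def)
    have h: "0 \<le> h" "h \<le> 1" "h ^ 3 = d" using d by (auto simp: h_def)
    have e: "\<bar>dPhi \<nu> 1 y r - dPhi \<mu> 1 y r\<bar> \<le> M / 2 * d / k + 2 * C * k\<^sup>2" if r: "0 \<le> r" "r \<le> 1" and k: "k > 0" for y r k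
    proof (rule interpolation[of "\<lambda>j y. dPhi \<nu> j y r - dPhi \<mu> j y r", OF _ _ _ k])
      show "((\<lambda>y. dPhi \<nu> m y r - dPhi \<mu> m y r) has_real_derivative dPhi \<nu> (Suc m) t r - dPhi \<mu> (Suc m) t r) (at t)" for m t
        by (intro DERIV_diff dPhi_deriv \<mu> \<nu> r)
      show "\<bar>dPhi \<nu> 0 t r - dPhi \<mu> 0 t r\<bar> \<le> M / 2 * d" for t
        using Phi_lipschitz[OF \<mu> \<nu> r M, of t] by (simp add: d_def)
      show "\<bar>dPhi \<nu> 3 t r - dPhi \<mu> 3 t r\<bar> \<le> 2 * C" for t
        using C(2)[OF \<mu> r, of t] C(2)[OF \<nu> r, of t] by (simp add: eval_nat_numeral)
    qed
    have E: "\<bar>dPhi \<nu> 1 y r - dPhi \<mu> 1 y r\<bar> \<le> B * h\<^sup>2" if r: "0 \<le> r" "r \<le> 1" for y r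
    proof (cases "h = 0")
      case False
      then have hp: "h > 0" using h by simp
      have "M / 2 * d / h + 2 * C * h\<^sup>2 = B * h\<^sup>2"
        using hp unfolding h(3)[symmetric] B_def by (simp add: eval_nat_numeral field_simps)
      then show ?thesis using e[OF r hp, of y] by simp
    next
      \<comment> \<open>Interpolation takes a positive scale; at distance zero the scale is sent to
        0.\<close>
      case True
      then have "d = 0" using h(3) by simp
      have lim: "((\<lambda>k. 2 * C * k\<^sup>2) \<longlongrightarrow> 2 * C * 0\<^sup>2) (at_right 0)"
        by (intro tendsto_intros)
      have "\<bar>dPhi \<nu> 1 y r - dPhi \<mu> 1 y r\<bar> \<le> 2 * C * 0\<^sup>2"
        by (rule tendsto_lowerbound[OF lim]) (use e[OF r] \<open>d = 0\<close> in \<open>auto intro!: eventually_at_right_less[THEN eventually_mono]\<close>)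
      then show ?thesis using B0 True by simp
    qed
    have "Phi \<nu> 0 0 - Phi \<mu> 0 0 \<le> integral {0..1} (\<lambda>r. \<theta>' r * ((dist_fun \<nu> r - dist_fun \<mu> r) / 2) * H \<mu> [0,0] r)
      + M * (B * h\<^sup>2) * d + M * (B * h\<^sup>2)\<^sup>2 / 2"
      using Phi_expand_aux[OF \<mu> \<nu> M E] unfolding d_def by simp
    moreover have "M * (B * h\<^sup>2) * d \<le> M * B * h * d"
    proof -
      have "h\<^sup>2 \<le> h" using h by (simp add: power2_eq_square mult_left_le)
      then have "M * B * d * h\<^sup>2 \<le> M * B * d * h" using M B0 d by (intro mult_left_mono) auto
      then show ?thesis by (simp add: mult_ac)
    qed
    moreover have "M * (B * h\<^sup>2)\<^sup>2 / 2 \<le> M * B\<^sup>2 * h * d"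
    proof -
      have "(B * h\<^sup>2)\<^sup>2 = B\<^sup>2 * (h * d)" unfolding h(3)[symmetric] by (simp add: eval_nat_numeral)
      moreover have "0 \<le> M * (B\<^sup>2 * (h * d))" using M h d by simp
      ultimately show ?thesis by (simp add: mult_ac)
    qed
    ultimately show "Phi \<nu> 0 0 - Phi \<mu> 0 0 \<le> integral {0..1} (\<lambda>r. \<theta>' r * ((dist_fun \<nu> r - dist_fun \<mu> r) / 2) * H \<mu> [0,0] r)
      + (M * B + M * B\<^sup>2) * root 3 (measure_dist \<mu> \<nu>) * measure_dist \<mu> \<nu>"
      unfolding h_def[symmetric] d_def[symmetric] by (simp add: algebra_simps)
  qed
qed

end

section \<open>Passage to general measures\<close>

lemma distr_prob01:
  assumes \<nu>: "\<nu> \<in> prob_measures01" and g: "g \<in> borel_measurable borel" "\<And>x. x \<in> {0..1} \<Longrightarrow> g x \<in> {0..1}"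
  shows "distr \<nu> borel01 g \<in> prob_measures01"
    and "A \<subseteq> {0..1} \<Longrightarrow> A \<in> sets borel \<Longrightarrow> measure (distr \<nu> borel01 g) A = measure \<nu> {x \<in> {0..1}. g x \<in> A}"
proof -
  interpret prob_space \<nu> by (rule prob01(1)[OF \<nu>])
  have s: "sets \<nu> = sets borel01" using \<nu> by (simp add: prob_measures01_def)
  have "g \<in> borel01 \<rightarrow>\<^sub>M borel01"
    using g by (intro measurable_restrict_space2 measurable_restrict_space1) (auto simp: space_restrict_space)
  then have m: "g \<in> \<nu> \<rightarrow>\<^sub>M borel01" using measurable_cong_sets[OF s refl] by blast
  show "distr \<nu> borel01 g \<in> prob_measures01"
    using prob_space_distr[OF m] by (simp add: prob_measures01_def)
  show "A \<subseteq> {0..1} \<Longrightarrow> A \<in> sets borel \<Longrightarrow> measure (distr \<nu> borel01 g) A = measure \<nu> {x \<in> {0..1}. g x \<in> A}"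
    by (subst measure_distr[OF m]) (auto simp: sets_restrict_space_iff prob01(2)[OF \<nu>] intro!: arg_cong[where f="measure \<nu>"])
qed

text \<open>Points are rounded up to multiples of \<open>1 / Suc n\<close>. Because of the direction
  of rounding, the mass of \<open>{0..u}\<close> becomes that of the interval up to the last grid
  point not beyond \<open>u\<close>: the new distribution function is the old one sampled on the
  grid.\<close>

definition disc :: "nat \<Rightarrow> real measure \<Rightarrow> real measure" where
  "disc n \<nu> = distr \<nu> borel01 (\<lambda>x. of_int \<lceil>real (Suc n) * x\<rceil> / real (Suc n))"

lemma disc_map: "x \<in> {0..1} \<Longrightarrow> of_int \<lceil>real (Suc n) * x\<rceil> / real (Suc n) \<in> {0..1}"
proof -
  assume x: "x \<in> {0..1}"
  have "real (Suc n) * x \<le> of_int (int (Suc n))" using x by (simp add: mult_left_le)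
  then have "\<lceil>real (Suc n) * x\<rceil> \<le> int (Suc n)" by (rule ceiling_le)
  then have "real_of_int \<lceil>real (Suc n) * x\<rceil> \<le> real (Suc n)" by linarith
  moreover have "0 \<le> real (Suc n) * x" using x by simp
  then have "0 \<le> \<lceil>real (Suc n) * x\<rceil>" by linarith
  ultimately show ?thesis by (simp add: divide_le_eq)
qed

lemma disc_map_measurable: "(\<lambda>x. of_int \<lceil>real (Suc n) * x\<rceil> / real (Suc n)) \<in> borel_measurable borel"
  by measurable

lemma disc_prob: "\<nu> \<in> prob_measures01 \<Longrightarrow> disc n \<nu> \<in> prob_measures01"
  unfolding disc_def by (rule distr_prob01(1)[OF _ disc_map_measurable disc_map])

lemma disc_measure:
  "\<nu> \<in> prob_measures01 \<Longrightarrow> A \<subseteq> {0..1} \<Longrightarrow> A \<in> sets borel \<Longrightarrow>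
    measure (disc n \<nu>) A = measure \<nu> {x \<in> {0..1}. of_int \<lceil>real (Suc n) * x\<rceil> / real (Suc n) \<in> A}"
  unfolding disc_def by (rule distr_prob01(2)[OF _ disc_map_measurable disc_map])

lemma disc_discrete:
  assumes \<nu>: "\<nu> \<in> prob_measures01" shows "disc n \<nu> \<in> discrete_measures01"
proof -
  interpret prob_space \<nu> by (rule prob01(1)[OF \<nu>])
  define S where "S = (\<lambda>k. real k / real (Suc n)) ` {..Suc n}"
  have S: "finite S" "S \<subseteq> {0..1}" by (auto simp: S_def divide_le_eq)
  have "of_int \<lceil>real (Suc n) * x\<rceil> / real (Suc n) \<in> S" if x: "x \<in> {0..1}" for x
  proof -
    have "0 \<le> real (Suc n) * x" using x by simp
    then have 0: "0 \<le> \<lceil>real (Suc n) * x\<rceil>" by linarith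
    have "real (Suc n) * x \<le> of_int (int (Suc n))" using x by (simp add: mult_left_le)
    then have 1: "\<lceil>real (Suc n) * x\<rceil> \<le> int (Suc n)" by (rule ceiling_le)
    show ?thesis unfolding S_def
    proof (rule image_eqI)
      show "nat \<lceil>real (Suc n) * x\<rceil> \<in> {..Suc n}" using 1 by (simp only: atMost_iff nat_le_iff)
      show "of_int \<lceil>real (Suc n) * x\<rceil> / real (Suc n) = real (nat \<lceil>real (Suc n) * x\<rceil>) / real (Suc n)"
        by (simp only: of_nat_nat[OF 0])
    qed
  qed
  then have "{x \<in> {0..1}. of_int \<lceil>real (Suc n) * x\<rceil> / real (Suc n) \<in> S} = space \<nu>"
    using prob01(2)[OF \<nu>] by auto
  then have "measure (disc n \<nu>) S = 1"
    using disc_measure[OF \<nu> S(2), of n] S(1) prob_space by (simp add: borel_closed finite_imp_closed)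
  with S disc_prob[OF \<nu>] show ?thesis unfolding discrete_measures01_def by blast
qed

lemma disc_dist_fun:
  assumes \<nu>: "\<nu> \<in> prob_measures01" and u: "u \<in> {0..1}"
  shows "dist_fun (disc n \<nu>) u = dist_fun \<nu> (of_int \<lfloor>real (Suc n) * u\<rfloor> / real (Suc n))"
proof -
  let ?N = "real (Suc n)"
  have "{x \<in> {0..1}. of_int \<lceil>?N * x\<rceil> / ?N \<in> {0..u}} = {0..of_int \<lfloor>?N * u\<rfloor> / ?N}"
  proof (rule set_eqI)
    fix x
    have "of_int \<lceil>?N * x\<rceil> / ?N \<le> u \<longleftrightarrow> of_int \<lceil>?N * x\<rceil> \<le> ?N * u"
      by (subst pos_divide_le_eq) (auto simp: mult.commute)
    also have "\<dots> \<longleftrightarrow> \<lceil>?N * x\<rceil> \<le> \<lfloor>?N * u\<rfloor>" by (simp add: le_floor_iff)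
    also have "\<dots> \<longleftrightarrow> ?N * x \<le> of_int \<lfloor>?N * u\<rfloor>" by (simp add: ceiling_le_iff)
    also have "\<dots> \<longleftrightarrow> x \<le> of_int \<lfloor>?N * u\<rfloor> / ?N"
      by (subst pos_le_divide_eq) (auto simp: mult.commute)
    finally have e: "of_int \<lceil>?N * x\<rceil> / ?N \<le> u \<longleftrightarrow> x \<le> of_int \<lfloor>?N * u\<rfloor> / ?N" .
    have "of_int \<lfloor>?N * u\<rfloor> \<le> ?N * u" by linarith
    then have "of_int \<lfloor>?N * u\<rfloor> / ?N \<le> u" by (subst pos_divide_le_eq) (auto simp: mult.commute)
    then show "x \<in> {x \<in> {0..1}. of_int \<lceil>?N * x\<rceil> / ?N \<in> {0..u}} \<longleftrightarrow> x \<in> {0..of_int \<lfloor>?N * u\<rfloor> / ?N}"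
      using e u disc_map[of x n] by auto
  qed
  then show ?thesis
    unfolding dist_fun_def using disc_measure[OF \<nu>, of "{0..u}" n] u by auto
qed

text \<open>The sampling point is within one mesh width of \<open>u\<close>, so convergence holds
  wherever the distribution function is continuous, and a monotone function has only countably many
  discontinuities.\<close>

lemma disc_tendsto:
  assumes \<nu>: "\<nu> \<in> prob_measures01"
  obtains N where "countable N" "\<And>u. u \<in> {0..1} \<Longrightarrow> u \<notin> N \<Longrightarrow> (\<lambda>n. dist_fun (disc n \<nu>) u) \<longlonglongrightarrow> dist_fun \<nu> u"
proof -
  let ?N = "{u \<in> {0..1}. \<not> continuous (at u within {0..1}) (dist_fun \<nu>)}"
  show ?thesis
  proof (rule that)
    show "countable ?N"
      by (rule mono_on_ctble_discont) (auto intro!: mono_onI dist_fun_mono[OF \<nu>])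
    fix u :: real assume u: "u \<in> {0..1}" "u \<notin> ?N"
    let ?v = "\<lambda>n. of_int \<lfloor>real (Suc n) * u\<rfloor> / real (Suc n)"
    have vl: "?v n \<le> u" "u - 1 / real (Suc n) \<le> ?v n" "0 \<le> ?v n" for n
    proof -
      have "of_int \<lfloor>real (Suc n) * u\<rfloor> \<le> real (Suc n) * u" by linarith
      then show "?v n \<le> u" by (subst pos_divide_le_eq) (auto simp: mult.commute)
      have "real (Suc n) * u - 1 \<le> of_int \<lfloor>real (Suc n) * u\<rfloor>" by linarith
      moreover have "u - 1 / real (Suc n) = (real (Suc n) * u - 1) / real (Suc n)" by (simp add: field_simps)
      ultimately show "u - 1 / real (Suc n) \<le> ?v n" by (simp only: divide_right_mono of_nat_0_le_iff)
      have "0 \<le> real (Suc n) * u" using u by simp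
      then have "0 \<le> \<lfloor>real (Suc n) * u\<rfloor>" by linarith
      then show "0 \<le> ?v n" by simp
    qed
    have "(\<lambda>n. u - 1 / real (Suc n)) \<longlonglongrightarrow> u - 0"
      by (intro tendsto_intros LIMSEQ_Suc[OF lim_1_over_n])
    then have vlim: "?v \<longlonglongrightarrow> u"
      using tendsto_sandwich[of "\<lambda>n. u - 1 / real (Suc n)" ?v sequentially "\<lambda>_. u" u] vl by simp
    have "continuous (at u within {0..1}) (dist_fun \<nu>)" using u by auto
    then have seq: "\<forall>x. (\<forall>n. x n \<in> {0..1}) \<and> x \<longlonglongrightarrow> u \<longrightarrow> (\<lambda>n. dist_fun \<nu> (x n)) \<longlonglongrightarrow> dist_fun \<nu> u"
      unfolding continuous_within_sequentially comp_def .
    have vI: "?v n \<in> {0..1}" for n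
      using vl(3)[of n] order_trans[OF vl(1)[of n]] u(1) unfolding atLeastAtMost_iff by blast
    have "(\<lambda>n. dist_fun \<nu> (?v n)) \<longlonglongrightarrow> dist_fun \<nu> u"
      by (rule mp[OF spec[OF seq, of ?v]]) (intro conjI allI vI vlim)
    then show "(\<lambda>n. dist_fun (disc n \<nu>) u) \<longlonglongrightarrow> dist_fun \<nu> u"
      unfolding disc_dist_fun[OF \<nu> u(1)] .
  qed
qed

lemma disc_measure_dist:
  assumes \<mu>: "\<mu> \<in> prob_measures01" and \<nu>: "\<nu> \<in> prob_measures01"
  shows "(\<lambda>n. measure_dist (disc n \<mu>) (disc n \<nu>)) \<longlonglongrightarrow> measure_dist \<mu> \<nu>" (is ?A)
    and "(\<lambda>n. measure_dist (disc n \<mu>) \<mu>) \<longlonglongrightarrow> 0" (is ?B)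
proof -
  obtain N1 where N1: "countable N1" "\<And>u. u \<in> {0..1} \<Longrightarrow> u \<notin> N1 \<Longrightarrow> (\<lambda>n. dist_fun (disc n \<mu>) u) \<longlonglongrightarrow> dist_fun \<mu> u"
    using disc_tendsto[OF \<mu>] by blast
  obtain N2 where N2: "countable N2" "\<And>u. u \<in> {0..1} \<Longrightarrow> u \<notin> N2 \<Longrightarrow> (\<lambda>n. dist_fun (disc n \<nu>) u) \<longlonglongrightarrow> dist_fun \<nu> u"
    using disc_tendsto[OF \<nu>] by blast
  have m: "(\<lambda>r. \<bar>dist_fun \<kappa> r - dist_fun \<kappa>' r\<bar>) \<in> borel_measurable borel01" if "\<kappa> \<in> prob_measures01" "\<kappa>' \<in> prob_measures01" for \<kappa> \<kappa>'
    using dist_fun_measurable[OF that(1)] dist_fun_measurable[OF that(2)] by measurable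
  have b: "\<bar>\<bar>dist_fun \<kappa> r - dist_fun \<kappa>' r\<bar>\<bar> \<le> 1" if "\<kappa> \<in> prob_measures01" "\<kappa>' \<in> prob_measures01" for \<kappa> \<kappa>' r
    using dist_fun_bounds(1,2)[OF that(1), of r] dist_fun_bounds(1,2)[OF that(2), of r] by linarith
  show ?A
    unfolding measure_dist_integral(1)[OF disc_prob[OF \<mu>] disc_prob[OF \<nu>]] measure_dist_integral(1)[OF \<mu> \<nu>]
    by (rule integral_limit[where N="N1 \<union> N2" and C=1, OF m[OF disc_prob[OF \<mu>] disc_prob[OF \<nu>]] m[OF \<mu> \<nu>]])
       (use N1 N2 b[OF disc_prob[OF \<mu>] disc_prob[OF \<nu>]] b[OF \<mu> \<nu>] in \<open>auto intro!: tendsto_intros\<close>)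
  have "(\<lambda>n. integral {0..1} (\<lambda>r. \<bar>dist_fun (disc n \<mu>) r - dist_fun \<mu> r\<bar>)) \<longlonglongrightarrow> integral {0..1} (\<lambda>r. \<bar>dist_fun \<mu> r - dist_fun \<mu> r\<bar>)"
  proof (rule integral_limit[where N="N1" and C=1, OF m[OF disc_prob[OF \<mu>] \<mu>] m[OF \<mu> \<mu>]])
    show "(\<lambda>n. \<bar>dist_fun (disc n \<mu>) r - dist_fun \<mu> r\<bar>) \<longlonglongrightarrow> \<bar>dist_fun \<mu> r - dist_fun \<mu> r\<bar>" if "r \<in> {0..1}" "r \<notin> N1" for r
      by (intro tendsto_intros N1 that)
  qed (use N1 b[OF disc_prob[OF \<mu>] \<mu>] b[OF \<mu> \<mu>] in auto)
  then show ?B unfolding measure_dist_integral(1)[OF disc_prob[OF \<mu>] \<mu>] by simp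
qed

lemma measure_dist_triangle:
  assumes "\<mu> \<in> prob_measures01" "\<nu> \<in> prob_measures01" "\<kappa> \<in> prob_measures01"
  shows "measure_dist \<mu> \<kappa> \<le> measure_dist \<mu> \<nu> + measure_dist \<nu> \<kappa>"
proof -
  note d = measure_dist_integral[OF assms(1,3)] measure_dist_integral[OF assms(1,2)] measure_dist_integral[OF assms(2,3)]
  have "integral {0..1} (\<lambda>r. \<bar>dist_fun \<mu> r - dist_fun \<kappa> r\<bar>) \<le> integral {0..1} (\<lambda>r. \<bar>dist_fun \<mu> r - dist_fun \<nu> r\<bar> + \<bar>dist_fun \<nu> r - dist_fun \<kappa> r\<bar>)"
    by (rule integral_le[OF d(2) integrable_add[OF d(4,6)]]) auto
  also have "\<dots> = measure_dist \<mu> \<nu> + measure_dist \<nu> \<kappa>"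
    unfolding d(3,5) by (rule integral_add[OF d(4,6)])
  finally show ?thesis unfolding d(1) .
qed

lemma eventually_discrete_near:
  "eventually P (discrete_near \<mu>) \<longleftrightarrow> (\<exists>\<delta>>0. \<forall>\<nu>\<in>discrete_measures01. measure_dist \<nu> \<mu> < \<delta> \<longrightarrow> P \<nu>)"
proof -
  have "eventually P (discrete_near \<mu>) \<longleftrightarrow> (\<exists>\<delta>\<in>{0<..}. eventually P (principal {\<nu> \<in> discrete_measures01. measure_dist \<nu> \<mu> < \<delta>}))"
    unfolding discrete_near_def
  proof (rule eventually_INF_base)
    fix a b :: real assume "a \<in> {0<..}" "b \<in> {0<..}"
    then show "\<exists>x\<in>{0<..}. principal {\<nu> \<in> discrete_measures01. measure_dist \<nu> \<mu> < x}
        \<le> inf (principal {\<nu> \<in> discrete_measures01. measure_dist \<nu> \<mu> < a}) (principal {\<nu> \<in> discrete_measures01. measure_dist \<nu> \<mu> < b})"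
      by (intro bexI[of _ "min a b"]) auto
  qed (auto intro: exI[of _ 1])
  then show ?thesis by (auto simp: eventually_principal)
qed

lemma sum_of_bound:
  assumes "\<And>w. 0 \<le> C w \<and> \<bar>h w\<bar> \<le> C w" shows "\<bar>sum_of h P\<bar> \<le> sum_of C P"
proof (induction P)
  case (Cons w P) then show ?case using assms[of w] by auto
qed auto

lemma sum_of_tendsto:
  "(\<And>w. (\<lambda>n. h n w) \<longlonglongrightarrow> (l w :: real)) \<Longrightarrow> (\<lambda>n. sum_of (h n) P) \<longlonglongrightarrow> sum_of l P"
  by (induction P) (auto intro: tendsto_intros)

lemma sum_of_continuous:
  "(\<And>w. continuous_on S (h w)) \<Longrightarrow> continuous_on S (\<lambda>r. sum_of (\<lambda>w. h w r :: real) P)"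
  by (induction P) (auto intro: continuous_intros)

section \<open>The limit system and the first order expansion\<close>

context parisi_setup
begin

text \<open>\<open>parisi_solution\<close> is a choice, so a limit has to be exhibited. By the
  Lipschitz bound discretisations form a Cauchy sequence at each point, and the bound survives in
  the limit against every discrete measure; it does not depend on the point, which gives
  uniformity.\<close>

lemma parisi_solution_exists:
  assumes \<mu>: "\<mu> \<in> prob_measures01"
  shows "\<exists>\<Phi>. uniform_limit (UNIV \<times> {0..1}) (\<lambda>\<nu> (x, u). parisi_discrete \<xi> \<nu> x u) (\<lambda>(x, u). \<Phi> x u) (discrete_near \<mu>)"
proof -
  obtain M where M: "0 \<le> M" "\<And>u. u \<in> {0..1} \<Longrightarrow> \<bar>\<theta>' u\<bar> \<le> M" using theta'_bound by blast
  define e where "e = (\<lambda>n. M / 2 * measure_dist (disc n \<mu>) \<mu>)"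
  have e: "e \<longlonglongrightarrow> 0" using tendsto_mult_right_zero[OF disc_measure_dist(2)[OF \<mu> \<mu>]] by (simp add: e_def)
  have pd: "\<nu> \<in> prob_measures01" if "\<nu> \<in> discrete_measures01" for \<nu> using that by (simp add: discrete_measures01_def)
  have L: "\<bar>Phi \<nu> x u - Phi (disc n \<mu>) x u\<bar> \<le> M / 2 * measure_dist \<nu> \<mu> + e n" if \<nu>: "\<nu> \<in> discrete_measures01" and u: "u \<in> {0..1}" for \<nu> x u n
  proof -
    have "\<bar>Phi \<nu> x u - Phi (disc n \<mu>) x u\<bar> \<le> M / 2 * measure_dist (disc n \<mu>) \<nu>"
      by (rule Phi_lipschitz[OF disc_discrete[OF \<mu>] \<nu> _ _ M]) (use u in auto)
    also have "\<dots> \<le> M / 2 * (measure_dist (disc n \<mu>) \<mu> + measure_dist \<mu> \<nu>)"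
      using M by (intro mult_left_mono measure_dist_triangle disc_prob \<mu> pd \<nu>) auto
    finally show ?thesis by (simp add: e_def measure_dist_sym[of \<mu> \<nu>] algebra_simps)
  qed
  have conv: "convergent (\<lambda>n. Phi (disc n \<mu>) x u)" if u: "u \<in> {0..1}" for x u
  proof (rule Cauchy_convergent, rule metric_CauchyI)
    fix \<epsilon> :: real assume "0 < \<epsilon>"
    then obtain n0 where n0: "\<And>n. n \<ge> n0 \<Longrightarrow> \<bar>e n\<bar> < \<epsilon> / 2"
      using LIMSEQ_D[OF e, of "\<epsilon> / 2"] by auto
    show "\<exists>M. \<forall>m\<ge>M. \<forall>n\<ge>M. dist (Phi (disc m \<mu>) x u) (Phi (disc n \<mu>) x u) < \<epsilon>"
    proof (intro exI allI impI)
      fix m n assume mn: "n0 \<le> m" "n0 \<le> n"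
      have "\<bar>Phi (disc m \<mu>) x u - Phi (disc n \<mu>) x u\<bar> \<le> e m + e n"
        using L[OF disc_discrete[OF \<mu>] u, of m x n] by (simp add: e_def)
      then show "dist (Phi (disc m \<mu>) x u) (Phi (disc n \<mu>) x u) < \<epsilon>"
        using n0[OF mn(1)] n0[OF mn(2)] by (simp add: dist_real_def)
    qed
  qed
  define \<Psi> where "\<Psi> = (\<lambda>x u. lim (\<lambda>n. Phi (disc n \<mu>) x u))"
  have \<Psi>: "\<bar>Phi \<nu> x u - \<Psi> x u\<bar> \<le> M / 2 * measure_dist \<nu> \<mu>" if \<nu>: "\<nu> \<in> discrete_measures01" and u: "u \<in> {0..1}" for \<nu> x u
  proof -
    have "(\<lambda>n. Phi (disc n \<mu>) x u) \<longlonglongrightarrow> \<Psi> x u"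
      unfolding \<Psi>_def by (rule convergent_LIMSEQ_iff[THEN iffD1, OF conv[OF u]])
    then have A: "(\<lambda>n. \<bar>Phi \<nu> x u - Phi (disc n \<mu>) x u\<bar>) \<longlonglongrightarrow> \<bar>Phi \<nu> x u - \<Psi> x u\<bar>"
      by (intro tendsto_intros)
    have B: "(\<lambda>n. M / 2 * measure_dist \<nu> \<mu> + e n) \<longlonglongrightarrow> M / 2 * measure_dist \<nu> \<mu> + 0"
      by (intro tendsto_intros e)
    show ?thesis using LIMSEQ_le[OF A B] L[OF \<nu> u] by simp
  qed
  show ?thesis
    unfolding uniform_limit_iff eventually_discrete_near
  proof (intro exI[of _ \<Psi>] allI impI)
    fix \<epsilon> :: real assume \<epsilon>: "0 < \<epsilon>"
    show "\<exists>\<delta>>0. \<forall>\<nu>\<in>discrete_measures01. measure_dist \<nu> \<mu> < \<delta> \<longrightarrow>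
        (\<forall>p\<in>UNIV \<times> {0..1}. dist (case p of (x, u) \<Rightarrow> parisi_discrete \<xi> \<nu> x u) (case p of (x, u) \<Rightarrow> \<Psi> x u) < \<epsilon>)"
    proof (intro exI[of _ "\<epsilon> / (M / 2 + 1)"] conjI ballI impI)
      show "0 < \<epsilon> / (M / 2 + 1)" using \<epsilon> M by (intro divide_pos_pos) auto
      fix \<nu> p assume \<nu>: "\<nu> \<in> discrete_measures01" "measure_dist \<nu> \<mu> < \<epsilon> / (M / 2 + 1)" and p: "p \<in> (UNIV :: real set) \<times> {0..1::real}"
      obtain x u where pe: "p = (x, u)" "u \<in> {0..1}" using p by auto
      have "M / 2 * measure_dist \<nu> \<mu> \<le> (M / 2 + 1) * measure_dist \<nu> \<mu>"
        using measure_dist_bounds(1)[OF pd[OF \<nu>(1)] \<mu>] by (simp add: algebra_simps)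
      also have "\<dots> < \<epsilon>" using \<nu>(2) M by (simp add: field_simps)
      finally show "dist (case p of (x, u) \<Rightarrow> parisi_discrete \<xi> \<nu> x u) (case p of (x, u) \<Rightarrow> \<Psi> x u) < \<epsilon>"
        using \<Psi>[OF \<nu>(1) pe(2), of x] unfolding pe(1) by (simp add: dist_real_def Phi_def)
    qed
  qed
qed

lemma parisi_solution_limit:
  assumes \<mu>: "\<mu> \<in> prob_measures01"
  shows "(\<lambda>n. Phi (disc n \<mu>) 0 0) \<longlonglongrightarrow> parisi_solution \<xi> \<mu> 0 0"
proof -
  have U: "uniform_limit (UNIV \<times> {0..1}) (\<lambda>\<nu> (x, u). parisi_discrete \<xi> \<nu> x u) (\<lambda>(x, u). parisi_solution \<xi> \<mu> x u) (discrete_near \<mu>)"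
    unfolding parisi_solution_def by (rule someI_ex[OF parisi_solution_exists[OF \<mu>]])
  show ?thesis
  proof (rule tendstoI)
    fix \<epsilon> :: real assume "0 < \<epsilon>"
    then obtain \<delta> where \<delta>: "\<delta> > 0" "\<And>\<nu>. \<nu> \<in> discrete_measures01 \<Longrightarrow> measure_dist \<nu> \<mu> < \<delta> \<Longrightarrow>
        (\<forall>p\<in>UNIV \<times> {0..1}. dist (case p of (x, u) \<Rightarrow> parisi_discrete \<xi> \<nu> x u) (case p of (x, u) \<Rightarrow> parisi_solution \<xi> \<mu> x u) < \<epsilon>)"
      using U unfolding uniform_limit_iff eventually_discrete_near by meson
    have "\<forall>\<^sub>F n in sequentially. measure_dist (disc n \<mu>) \<mu> < \<delta>"
      by (rule order_tendstoD(2)[OF disc_measure_dist(2)[OF \<mu> \<mu>] \<delta>(1)])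
    then show "\<forall>\<^sub>F n in sequentially. dist (Phi (disc n \<mu>) 0 0) (parisi_solution \<xi> \<mu> 0 0) < \<epsilon>"
    proof (rule eventually_mono)
      fix n assume "measure_dist (disc n \<mu>) \<mu> < \<delta>"
      from \<delta>(2)[OF disc_discrete[OF \<mu>] this] have "\<forall>p\<in>UNIV \<times> {0..1}. dist (case p of (x, u) \<Rightarrow> parisi_discrete \<xi> (disc n \<mu>) x u) (case p of (x, u) \<Rightarrow> parisi_solution \<xi> \<mu> x u) < \<epsilon>" .
      from bspec[OF this, of "(0, 0)"] show "dist (Phi (disc n \<mu>) 0 0) (parisi_solution \<xi> \<mu> 0 0) < \<epsilon>"
        by (simp add: Phi_def)
    qed
  qed
qed

lemma H_cont: "\<mu> \<in> discrete_measures01 \<Longrightarrow> continuous_on {0..1} (H \<mu> w)"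
  using Lam[of \<mu>] regular_mono[of \<mu> w] unfolding evolution_def H_def by blast

text \<open>An Arzela-Ascoli argument for countably many functions at once. The integral equations
  give Lipschitz constants independent of the discretisation; convergence on words times rational
  times then extends to all times, and dominated convergence carries the equations over.\<close>

lemma limit_system:
  assumes \<mu>: "\<mu> \<in> prob_measures01"
  obtains k h where "strict_mono (k :: nat \<Rightarrow> nat)"
    "\<And>w u. u \<in> {0..1} \<Longrightarrow> (\<lambda>n. H (disc (k n) \<mu>) w u) \<longlonglongrightarrow> h w u"
    "\<And>w. continuous_on {0..1} (h w)"
    "\<And>w a b. 0 \<le> a \<Longrightarrow> a \<le> b \<Longrightarrow> b \<le> 1 \<Longrightarrow>
      ((\<lambda>r. \<theta>' r * (sum_of (\<lambda>w. h w r) (gen0 w) - dist_fun \<mu> r * sum_of (\<lambda>w. h w r) (gen1 w))) has_integral h w b - h w a) {a..b}"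
proof -
  define h\<^sub>n where "h\<^sub>n = (\<lambda>n. H (disc n \<mu>))"
  note dd = disc_discrete[OF \<mu>]
  have "\<forall>w. \<exists>C. 0 \<le> C \<and> (\<forall>\<mu>\<in>discrete_measures01. \<forall>u\<in>{0..1}. \<bar>H \<mu> w u\<bar> \<le> C)" using H_bound by blast
  then obtain C where C: "\<And>w. 0 \<le> C w" "\<And>w u n. u \<in> {0..1} \<Longrightarrow> \<bar>h\<^sub>n n w u\<bar> \<le> C w"
    unfolding h\<^sub>n_def using dd by metis
  obtain M where M: "0 \<le> M" "\<And>u. u \<in> {0..1} \<Longrightarrow> \<bar>\<theta>' u\<bar> \<le> M" using theta'_bound by blast
  define f where "f = (\<lambda>n w r. \<theta>' r * (sum_of (\<lambda>w. h\<^sub>n n w r) (gen0 w) - dist_fun (disc n \<mu>) r * sum_of (\<lambda>w. h\<^sub>n n w r) (gen1 w)))"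
  define L where "L = (\<lambda>w. M * (sum_of C (gen0 w) + sum_of C (gen1 w)))"
  have sumC: "0 \<le> sum_of C P" for P using C(1) by (induction P) auto
  have bound: "\<bar>t * (x - a * y)\<bar> \<le> M * (X + Y)" if "\<bar>t\<bar> \<le> M" "\<bar>x\<bar> \<le> X" "\<bar>y\<bar> \<le> Y" "0 \<le> a" "a \<le> 1" for t x a y X Y :: real
  proof -
    have "\<bar>a * y\<bar> \<le> 1 * Y" unfolding abs_mult using that by (intro mult_mono) auto
    then have "\<bar>x - a * y\<bar> \<le> X + Y" using that by linarith
    then show ?thesis unfolding abs_mult using that by (intro mult_mono) auto
  qed
  have fL: "\<bar>f n w r\<bar> \<le> L w" if r: "r \<in> {0..1}" for n w r
    unfolding f_def L_def
    by (rule bound) (use M r C dist_fun_bounds[OF disc_prob[OF \<mu>]] in \<open>auto intro!: sum_of_bound\<close>)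
  have L0: "0 \<le> L w" for w using order_trans[OF abs_ge_zero fL[of 0]] by simp
  have fi: "(f n w has_integral h\<^sub>n n w b - h\<^sub>n n w a) {a..b}" if "0 \<le> a" "a \<le> b" "b \<le> 1" for n w a b
    unfolding f_def h\<^sub>n_def by (rule H_integral[OF dd that])
  have lip: "\<bar>h\<^sub>n n w u - h\<^sub>n n w s\<bar> \<le> L w * \<bar>u - s\<bar>" if "u \<in> {0..1}" "s \<in> {0..1}" for n w u s
  proof -
    have *: "\<bar>h\<^sub>n n w b - h\<^sub>n n w a\<bar> \<le> L w * (b - a)" if "0 \<le> a" "a \<le> b" "b \<le> 1" for a b
      using has_integral_bound_real[OF L0, of "{}" "f n w" _ a b, OF _ fi[OF that]] fL that by auto
    show ?thesis using *[of u s] *[of s u] that by (cases "u \<le> s") (auto simp: abs_minus_commute)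
  qed
  define S where "S = (UNIV :: nat list set) \<times> (\<rat> \<inter> {0..1::real})"
  have cS: "countable S" unfolding S_def by (intro countable_SIGMA countable_Int1 countable_rat) auto
  \<comment> \<open>Division by \<open>C w + 1\<close> brings all words under the common bound 1
    that the diagonal argument asks for.\<close>
  obtain k where k: "strict_mono (k :: nat \<Rightarrow> nat)" "\<And>p. p \<in> S \<Longrightarrow> \<exists>l. (\<lambda>n. (case p of (w, q) \<Rightarrow> h\<^sub>n (k n) w q / (C w + 1))) \<longlonglongrightarrow> l"
  proof (rule function_convergent_subsequence[OF cS, of "\<lambda>n (w, q). h\<^sub>n n w q / (C w + 1)" 1])
    fix n p assume "p \<in> S"
    then obtain w q where p: "p = (w, q)" "q \<in> {0..1}" by (auto simp: S_def)
    show "norm (case p of (w, q) \<Rightarrow> h\<^sub>n n w q / (C w + 1)) \<le> 1"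
      using C(1)[of w] C(2)[OF p(2), of n w] by (simp add: p(1) divide_le_eq)
  qed blast
  have convq: "convergent (\<lambda>n. h\<^sub>n (k n) w q)" if q: "q \<in> \<rat> \<inter> {0..1}" for w q
  proof -
    obtain l where "(\<lambda>n. h\<^sub>n (k n) w q / (C w + 1)) \<longlonglongrightarrow> l" using k(2)[of "(w, q)"] q by (auto simp: S_def)
    from tendsto_mult_left[OF this, of "C w + 1"] have "(\<lambda>n. h\<^sub>n (k n) w q) \<longlonglongrightarrow> (C w + 1) * l"
      using C(1)[of w] by simp
    then show ?thesis by (rule convergentI)
  qed
  have conv: "convergent (\<lambda>n. h\<^sub>n (k n) w u)" if u: "u \<in> {0..1}" for w u
  proof (rule Cauchy_convergent, rule metric_CauchyI)
    fix \<epsilon> :: real assume \<epsilon>: "0 < \<epsilon>"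
    \<comment> \<open>Three errors of a third of \<epsilon>: two from moving \<open>u\<close> to a
      rational time, one from convergence at that time.\<close>
    define \<delta> where "\<delta> = \<epsilon> / (3 * (L w + 1))"
    have \<delta>: "\<delta> > 0" using \<epsilon> L0[of w] by (simp add: \<delta>_def)
    have "\<exists>q\<in>\<rat>. max 0 (u - \<delta>) < q \<and> q < min 1 (u + \<delta>)"
      by (rule Rats_dense_in_real) (use u \<delta> in auto)
    then obtain q where q: "q \<in> \<rat>" "max 0 (u - \<delta>) < q" "q < min 1 (u + \<delta>)" by blast
    have qI: "q \<in> \<rat> \<inter> {0..1}" "\<bar>u - q\<bar> < \<delta>" using q by auto
    obtain n0 where n0: "\<And>m n. m \<ge> n0 \<Longrightarrow> n \<ge> n0 \<Longrightarrow> \<bar>h\<^sub>n (k m) w q - h\<^sub>n (k n) w q\<bar> < \<epsilon> / 3"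
    proof -
      have "0 < \<epsilon> / 3" using \<epsilon> by simp
      from metric_CauchyD[OF convergent_Cauchy[OF convq[OF qI(1), of w]] this] show ?thesis
        using that unfolding dist_real_def by blast
    qed
    have near: "\<bar>h\<^sub>n (k n) w u - h\<^sub>n (k n) w q\<bar> \<le> \<epsilon> / 3" for n
    proof -
      have "\<bar>h\<^sub>n (k n) w u - h\<^sub>n (k n) w q\<bar> \<le> L w * \<bar>u - q\<bar>" by (rule lip) (use u qI in auto)
      also have "\<dots> \<le> (L w + 1) * \<delta>" using qI(2) L0[of w] by (intro mult_mono) auto
      also have "\<dots> = \<epsilon> / 3" using L0[of w] by (simp add: \<delta>_def field_simps)
      finally show ?thesis .
    qed
    show "\<exists>M. \<forall>m\<ge>M. \<forall>n\<ge>M. dist (h\<^sub>n (k m) w u) (h\<^sub>n (k n) w u) < \<epsilon>"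
    proof (intro exI allI impI)
      fix m n assume "n0 \<le> m" "n0 \<le> n"
      then show "dist (h\<^sub>n (k m) w u) (h\<^sub>n (k n) w u) < \<epsilon>"
        using n0[of m n] near[of m] near[of n] unfolding dist_real_def by linarith
    qed
  qed
  define h where "h = (\<lambda>w u. lim (\<lambda>n. h\<^sub>n (k n) w u))"
  have lim: "(\<lambda>n. h\<^sub>n (k n) w u) \<longlonglongrightarrow> h w u" if "u \<in> {0..1}" for w u
    unfolding h_def by (rule convergent_LIMSEQ_iff[THEN iffD1, OF conv[OF that]])
  have hC: "\<bar>h w u\<bar> \<le> C w" if u: "u \<in> {0..1}" for w u
    by (rule LIMSEQ_le_const2[OF tendsto_rabs[OF lim[OF u]]]) (use C(2)[OF u] in auto)
  have hlip: "\<bar>h w u - h w s\<bar> \<le> L w * \<bar>u - s\<bar>" if "u \<in> {0..1}" "s \<in> {0..1}" for w u s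
    by (rule LIMSEQ_le_const2[OF tendsto_rabs[OF tendsto_diff[OF lim[OF that(1)] lim[OF that(2)]]]]) (use lip[OF that] in auto)
  have hc: "continuous_on {0..1} (h w)" for w
    by (rule lipschitz_on_continuous_on[of "L w"], rule lipschitz_onI) (use hlip L0 in \<open>auto simp: dist_real_def\<close>)
  obtain N where N: "countable N" "\<And>u. u \<in> {0..1} \<Longrightarrow> u \<notin> N \<Longrightarrow> (\<lambda>n. dist_fun (disc n \<mu>) u) \<longlonglongrightarrow> dist_fun \<mu> u"
    using disc_tendsto[OF \<mu>] by blast
  define g where "g = (\<lambda>w r. \<theta>' r * (sum_of (\<lambda>w. h w r) (gen0 w) - dist_fun \<mu> r * sum_of (\<lambda>w. h w r) (gen1 w)))"
  have gL: "\<bar>g w r\<bar> \<le> L w" if r: "r \<in> {0..1}" for w r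
    unfolding g_def L_def
    by (rule bound) (use M r C hC dist_fun_bounds[OF \<mu>] in \<open>auto intro!: sum_of_bound\<close>)
  have gm: "g w \<in> borel_measurable borel01" for w
    unfolding g_def
    by (intro borel_measurable_times borel_measurable_diff continuous_borel01[OF theta'_cont]
       continuous_borel01[OF sum_of_continuous[OF hc]] dist_fun_measurable \<mu>)
  have fm: "f n w \<in> borel_measurable borel01" for n w
    unfolding f_def h\<^sub>n_def
    by (intro borel_measurable_times borel_measurable_diff continuous_borel01[OF theta'_cont]
       continuous_borel01[OF sum_of_continuous[OF H_cont[OF dd]]] dist_fun_measurable disc_prob \<mu>)
  show ?thesis
  proof (rule that[OF k(1)])
    show "(\<lambda>n. H (disc (k n) \<mu>) w u) \<longlonglongrightarrow> h w u" if "u \<in> {0..1}" for w u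
      using lim[OF that] by (simp add: h\<^sub>n_def)
    show "continuous_on {0..1} (h w)" for w by (rule hc)
    fix w and a b :: real assume ab: "0 \<le> a" "a \<le> b" "b \<le> 1"
    then have sub: "r \<in> {0..1}" if "r \<in> {a..b}" for r using that by auto
    have "(\<lambda>n. integral {a..b} (f (k n) w)) \<longlonglongrightarrow> integral {a..b} (g w)"
    proof (rule integral_limit[OF fm gm ab(1,3) fL[OF sub] N(1) _ gL[OF sub]])
      fix r assume r: "r \<in> {a..b}" "r \<notin> N"
      have "(\<lambda>n. dist_fun (disc (k n) \<mu>) r) \<longlonglongrightarrow> dist_fun \<mu> r"
        using LIMSEQ_subseq_LIMSEQ[OF N(2)[OF sub[OF r(1)] r(2)] k(1)] by (simp add: comp_def)
      then show "(\<lambda>n. f (k n) w r) \<longlonglongrightarrow> g w r"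
        unfolding f_def g_def by (intro tendsto_intros sum_of_tendsto lim[OF sub[OF r(1)]])
    qed
    moreover have "integral {a..b} (f (k n) w) = h\<^sub>n (k n) w b - h\<^sub>n (k n) w a" for n
      by (rule integral_unique[OF fi[OF ab]])
    moreover have "(\<lambda>n. h\<^sub>n (k n) w b - h\<^sub>n (k n) w a) \<longlonglongrightarrow> h w b - h w a"
      by (intro tendsto_intros lim) (use ab in auto)
    ultimately have "integral {a..b} (g w) = h w b - h w a" using LIMSEQ_unique by auto
    moreover have "g w integrable_on {a..b}" by (rule integrable_bdd(1)[OF gm ab(1,3) gL[OF sub]])
    ultimately have "(g w has_integral h w b - h w a) {a..b}" using integrable_integral by metis
    then show "((\<lambda>r. \<theta>' r * (sum_of (\<lambda>w. h w r) (gen0 w) - dist_fun \<mu> r * sum_of (\<lambda>w. h w r) (gen1 w))) has_integral h w b - h w a) {a..b}"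
      unfolding g_def .
  qed
qed

text \<open>The expansion for discrete measures is applied to discretisations of both measures along
  the same subsequence. The term of the functional that is linear in the distribution function
  supplies \<open>- r\<close>, so the first variation is governed by \<open>h r - r\<close>.\<close>

lemma parisi_expand:
  assumes \<mu>: "\<mu> \<in> prob_measures01" and k: "strict_mono (k :: nat \<Rightarrow> nat)"
    and lim: "\<And>u. u \<in> {0..1} \<Longrightarrow> (\<lambda>n. H (disc (k n) \<mu>) [0,0] u) \<longlonglongrightarrow> h u" and hc: "continuous_on {0..1} h"
  obtains K where "0 \<le> K" "\<And>\<nu>. \<nu> \<in> prob_measures01 \<Longrightarrow>
    parisi_functional \<xi> \<nu> - parisi_functional \<xi> \<mu> \<le>
      integral {0..1} (\<lambda>r. \<theta>' r * ((dist_fun \<nu> r - dist_fun \<mu> r) / 2) * (h r - r))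
      + K * root 3 (measure_dist \<mu> \<nu>) * measure_dist \<mu> \<nu>"
proof -
  obtain M where M: "0 \<le> M" "\<And>u. u \<in> {0..1} \<Longrightarrow> \<bar>\<theta>' u\<bar> \<le> M" using theta'_bound by blast
  obtain K where K: "0 \<le> K" "\<And>\<mu> \<nu>. \<mu> \<in> discrete_measures01 \<Longrightarrow> \<nu> \<in> discrete_measures01 \<Longrightarrow>
    Phi \<nu> 0 0 - Phi \<mu> 0 0 \<le> integral {0..1} (\<lambda>r. \<theta>' r * ((dist_fun \<nu> r - dist_fun \<mu> r) / 2) * H \<mu> [0,0] r)
      + K * root 3 (measure_dist \<mu> \<nu>) * measure_dist \<mu> \<nu>"
    using Phi_expand by blast
  obtain C where C: "0 \<le> C" "\<And>\<mu> u. \<mu> \<in> discrete_measures01 \<Longrightarrow> u \<in> {0..1} \<Longrightarrow> \<bar>H \<mu> [0,0] u\<bar> \<le> C"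
    using H_bound[of "[0,0]"] by blast
  have dm: "(\<lambda>r. \<theta>' r * ((dist_fun \<nu> r - dist_fun \<mu> r) / 2) * h r) \<in> borel_measurable borel01"
    if "\<mu> \<in> prob_measures01" "\<nu> \<in> prob_measures01" "continuous_on {0..1} h" for \<mu> \<nu> h
    by (intro borel_measurable_times borel_measurable_diff borel_measurable_divide borel_measurable_const
          continuous_borel01[OF theta'_cont] continuous_borel01[OF that(3)] dist_fun_measurable that)
  have db: "\<bar>\<theta>' r * ((dist_fun \<nu> r - dist_fun \<mu> r) / 2) * x\<bar> \<le> M * 1 * B"
    if "\<mu> \<in> prob_measures01" "\<nu> \<in> prob_measures01" "r \<in> {0..1}" "\<bar>x\<bar> \<le> B" for \<mu> \<nu> r x B
  proof -
    have "\<bar>dist_fun \<nu> r - dist_fun \<mu> r\<bar> \<le> 1"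
      using dist_fun_bounds(1,2)[OF that(1), of r] dist_fun_bounds(1,2)[OF that(2), of r] by linarith
    then have "\<bar>(dist_fun \<nu> r - dist_fun \<mu> r) / 2\<bar> \<le> 1" by simp
    then show ?thesis unfolding abs_mult using M that by (intro mult_mono) auto
  qed
  show ?thesis
  proof (rule that[OF K(1)])
    fix \<nu> assume \<nu>: "\<nu> \<in> prob_measures01"
    obtain N1 where N1: "countable N1" "\<And>u. u \<in> {0..1} \<Longrightarrow> u \<notin> N1 \<Longrightarrow> (\<lambda>n. dist_fun (disc n \<mu>) u) \<longlonglongrightarrow> dist_fun \<mu> u"
      using disc_tendsto[OF \<mu>] by blast
    obtain N2 where N2: "countable N2" "\<And>u. u \<in> {0..1} \<Longrightarrow> u \<notin> N2 \<Longrightarrow> (\<lambda>n. dist_fun (disc n \<nu>) u) \<longlonglongrightarrow> dist_fun \<nu> u"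
      using disc_tendsto[OF \<nu>] by blast
    have sub: "(\<lambda>n. X (k n)) \<longlonglongrightarrow> l" if "X \<longlonglongrightarrow> l" for X and l :: real
      using LIMSEQ_subseq_LIMSEQ[OF that k] by (simp add: comp_def)
    have hC: "\<bar>h u\<bar> \<le> C" if u: "u \<in> {0..1}" for u
      by (rule LIMSEQ_le_const2[OF tendsto_rabs[OF lim[OF u]]]) (use C(2)[OF disc_discrete[OF \<mu>] u] in auto)
    let ?I = "integral {0..1} (\<lambda>r. \<theta>' r * ((dist_fun \<nu> r - dist_fun \<mu> r) / 2) * h r)"
    have int: "(\<lambda>n. integral {0..1} (\<lambda>r. \<theta>' r * ((dist_fun (disc (k n) \<nu>) r - dist_fun (disc (k n) \<mu>) r) / 2) * H (disc (k n) \<mu>) [0,0] r)) \<longlonglongrightarrow> ?I"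
    proof (rule integral_limit[where N="N1 \<union> N2" and C="M * 1 * C"])
      show "(\<lambda>r. \<theta>' r * ((dist_fun (disc (k n) \<nu>) r - dist_fun (disc (k n) \<mu>) r) / 2) * H (disc (k n) \<mu>) [0,0] r) \<in> borel_measurable borel01" for n
        by (rule dm[OF disc_prob[OF \<mu>] disc_prob[OF \<nu>] H_cont[OF disc_discrete[OF \<mu>]]])
      show "(\<lambda>r. \<theta>' r * ((dist_fun \<nu> r - dist_fun \<mu> r) / 2) * h r) \<in> borel_measurable borel01"
        by (rule dm[OF \<mu> \<nu> hc])
      show "countable (N1 \<union> N2)" using N1 N2 by auto
      show "\<bar>\<theta>' r * ((dist_fun (disc (k n) \<nu>) r - dist_fun (disc (k n) \<mu>) r) / 2) * H (disc (k n) \<mu>) [0,0] r\<bar> \<le> M * 1 * C" if "r \<in> {0..1}" for r n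
        by (rule db[OF disc_prob[OF \<mu>] disc_prob[OF \<nu>] that C(2)[OF disc_discrete[OF \<mu>] that]])
      show "\<bar>\<theta>' r * ((dist_fun \<nu> r - dist_fun \<mu> r) / 2) * h r\<bar> \<le> M * 1 * C" if "r \<in> {0..1}" for r
        by (rule db[OF \<mu> \<nu> that hC[OF that]])
      show "(\<lambda>n. \<theta>' r * ((dist_fun (disc (k n) \<nu>) r - dist_fun (disc (k n) \<mu>) r) / 2) * H (disc (k n) \<mu>) [0,0] r) \<longlonglongrightarrow> \<theta>' r * ((dist_fun \<nu> r - dist_fun \<mu> r) / 2) * h r"
        if "r \<in> {0..1}" "r \<notin> N1 \<union> N2" for r
        using that by (intro tendsto_intros lim sub[OF N1(2)] sub[OF N2(2)]) auto
    qed auto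
    have dl: "(\<lambda>n. measure_dist (disc (k n) \<mu>) (disc (k n) \<nu>)) \<longlonglongrightarrow> measure_dist \<mu> \<nu>"
      by (rule sub[OF disc_measure_dist(1)[OF \<mu> \<nu>]])
    have main: "parisi_solution \<xi> \<nu> 0 0 - parisi_solution \<xi> \<mu> 0 0 \<le> ?I + K * root 3 (measure_dist \<mu> \<nu>) * measure_dist \<mu> \<nu>"
    proof (rule LIMSEQ_le)
      show "(\<lambda>n. Phi (disc (k n) \<nu>) 0 0 - Phi (disc (k n) \<mu>) 0 0) \<longlonglongrightarrow> parisi_solution \<xi> \<nu> 0 0 - parisi_solution \<xi> \<mu> 0 0"
        by (intro tendsto_diff sub[OF parisi_solution_limit[OF \<nu>]] sub[OF parisi_solution_limit[OF \<mu>]])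
      show "(\<lambda>n. integral {0..1} (\<lambda>r. \<theta>' r * ((dist_fun (disc (k n) \<nu>) r - dist_fun (disc (k n) \<mu>) r) / 2) * H (disc (k n) \<mu>) [0,0] r)
          + K * root 3 (measure_dist (disc (k n) \<mu>) (disc (k n) \<nu>)) * measure_dist (disc (k n) \<mu>) (disc (k n) \<nu>)) \<longlonglongrightarrow> ?I + K * root 3 (measure_dist \<mu> \<nu>) * measure_dist \<mu> \<nu>"
        by (intro tendsto_add tendsto_mult tendsto_const tendsto_real_root int dl)
      show "\<exists>N. \<forall>n\<ge>N. Phi (disc (k n) \<nu>) 0 0 - Phi (disc (k n) \<mu>) 0 0 \<le> integral {0..1} (\<lambda>r. \<theta>' r * ((dist_fun (disc (k n) \<nu>) r - dist_fun (disc (k n) \<mu>) r) / 2) * H (disc (k n) \<mu>) [0,0] r)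
          + K * root 3 (measure_dist (disc (k n) \<mu>) (disc (k n) \<nu>)) * measure_dist (disc (k n) \<mu>) (disc (k n) \<nu>)"
        using K(2)[OF disc_discrete[OF \<mu>] disc_discrete[OF \<nu>]] by blast
    qed
    let ?J = "\<lambda>\<nu> u. u * \<theta>' u * dist_fun \<nu> u"
    have J: "?J \<nu> integrable_on {0..1}" "(LINT u:{0..1}|lborel. ?J \<nu> u) = integral {0..1} (?J \<nu>)" if "\<nu> \<in> prob_measures01" for \<nu>
    proof -
      have m: "?J \<nu> \<in> borel_measurable borel01"
        by (intro borel_measurable_times continuous_borel01[OF theta'_cont] continuous_borel01[OF continuous_on_id] dist_fun_measurable that)
      have b: "\<bar>?J \<nu> r\<bar> \<le> 1 * M * 1" if r: "r \<in> {0..1}" for r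
        unfolding abs_mult using M r dist_fun_bounds(1,2)[OF \<open>\<nu> \<in> prob_measures01\<close>, of r] by (intro mult_mono) auto
      show "?J \<nu> integrable_on {0..1}" "(LINT u:{0..1}|lborel. ?J \<nu> u) = integral {0..1} (?J \<nu>)"
        using integrable_bdd[OF m _ _ b] by auto
    qed
    have i1: "(\<lambda>r. \<theta>' r * ((dist_fun \<nu> r - dist_fun \<mu> r) / 2) * h r) integrable_on {0..1}"
      by (rule integrable_bdd(1)[OF dm[OF \<mu> \<nu> hc] _ _ db[OF \<mu> \<nu> _ hC]]) auto
    have hi: "((\<lambda>r. 1/2 * (?J \<nu> r - ?J \<mu> r)) has_integral 1/2 * (integral {0..1} (?J \<nu>) - integral {0..1} (?J \<mu>))) {0..1}"
      by (intro has_integral_mult_right has_integral_diff integrable_integral J \<mu> \<nu>)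
    have i2: "(\<lambda>r. 1/2 * (?J \<nu> r - ?J \<mu> r)) integrable_on {0..1}" using hi by (rule has_integral_integrable)
    have "integral {0..1} (\<lambda>r. \<theta>' r * ((dist_fun \<nu> r - dist_fun \<mu> r) / 2) * (h r - r))
       = integral {0..1} (\<lambda>r. \<theta>' r * ((dist_fun \<nu> r - dist_fun \<mu> r) / 2) * h r - 1/2 * (?J \<nu> r - ?J \<mu> r))"
      by (rule integral_cong) (simp add: field_simps)
    also have "\<dots> = ?I - integral {0..1} (\<lambda>r. 1/2 * (?J \<nu> r - ?J \<mu> r))" by (rule integral_diff[OF i1 i2])
    also have "integral {0..1} (\<lambda>r. 1/2 * (?J \<nu> r - ?J \<mu> r)) = 1/2 * (integral {0..1} (?J \<nu>) - integral {0..1} (?J \<mu>))"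
      by (rule integral_unique[OF hi])
    finally show "parisi_functional \<xi> \<nu> - parisi_functional \<xi> \<mu> \<le>
      integral {0..1} (\<lambda>r. \<theta>' r * ((dist_fun \<nu> r - dist_fun \<mu> r) / 2) * (h r - r))
      + K * root 3 (measure_dist \<mu> \<nu>) * measure_dist \<mu> \<nu>"
      unfolding parisi_functional_def J(2)[OF \<mu>] J(2)[OF \<nu>] using main by (simp add: field_simps)
  qed
qed

text \<open>The change of the distribution function is confined to a window and has the favourable
  sign there. The first order term then gains at least \<open>m * c / 2\<close> times the distance,
  while the error is at most \<open>K * root 3 (r - l)\<close> times the distance, because the
  distance is at most the window length. Hypothesis \<open>pos\<close> makes the distance positive
  and thereby the inequality strict.\<close>

lemma window_variation:
  assumes \<mu>: "\<mu> \<in> prob_measures01" and \<nu>: "\<nu> \<in> prob_measures01"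
    and exp: "parisi_functional \<xi> \<nu> - parisi_functional \<xi> \<mu> \<le>
      integral {0..1} (\<lambda>r. \<theta>' r * ((dist_fun \<nu> r - dist_fun \<mu> r) / 2) * (h r - r))
      + K * root 3 (measure_dist \<mu> \<nu>) * measure_dist \<mu> \<nu>" and hc: "continuous_on {0..1} h"
    and w: "0 < l" "l < q'" "q' < r" "r < 1"
    and out: "\<And>u. u \<in> {0..1} \<Longrightarrow> u \<notin> {l..<r} \<Longrightarrow> dist_fun \<nu> u = dist_fun \<mu> u"
    and sgn: "\<And>u. u \<in> {l..<r} \<Longrightarrow> (dist_fun \<nu> u - dist_fun \<mu> u) * (h u - u) \<le> - (c * \<bar>dist_fun \<nu> u - dist_fun \<mu> u\<bar>)"
    and m: "0 < m" "\<And>u. u \<in> {l..<r} \<Longrightarrow> m \<le> \<theta>' u" and c: "0 < c" and K: "0 \<le> K" "K * root 3 (r - l) < m * c / 2"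
    and pos: "0 < p" "(\<forall>u\<in>{q'..<r}. p \<le> \<bar>dist_fun \<nu> u - dist_fun \<mu> u\<bar>) \<or> (\<forall>u\<in>{l..<q'}. p \<le> \<bar>dist_fun \<nu> u - dist_fun \<mu> u\<bar>)"
  shows "parisi_functional \<xi> \<nu> < parisi_functional \<xi> \<mu>"
proof -
  let ?d = "measure_dist \<mu> \<nu>"
  note md = measure_dist_integral[OF \<mu> \<nu>]
  let ?f = "\<lambda>u. \<bar>dist_fun \<mu> u - dist_fun \<nu> u\<bar>"
  have ind: "((\<lambda>x. if x \<in> {a..b} then y else 0) has_integral (b - a) * y) {0..1}" if "0 \<le> a" "a \<le> b" "b \<le> 1" for a b y :: real
    using has_integral_const_real[of y a b] that by (subst has_integral_restrict) auto
  have f1: "?f u \<le> 1" for u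
    using dist_fun_bounds(1,2)[OF \<mu>, of u] dist_fun_bounds(1,2)[OF \<nu>, of u] by linarith
  have "?d \<le> (r - l) * 1"
    unfolding md(1)
    by (rule has_integral_le[OF integrable_integral[OF md(2)] ind[of l r]]) (use w out f1 in auto)
  then have dle: "?d \<le> r - l" by simp
  have d0: "0 < ?d"
  proof -
    obtain a b where ab: "0 \<le> a" "a < b" "b \<le> 1" "\<And>u. u \<in> {a..<b} \<Longrightarrow> p \<le> ?f u"
    proof (cases "\<forall>u\<in>{q'..<r}. p \<le> \<bar>dist_fun \<nu> u - dist_fun \<mu> u\<bar>")
      case True then show ?thesis using that[of q' r] w by (auto simp: abs_minus_commute)
    next
      case False then show ?thesis using that[of l q'] w pos by (auto simp: abs_minus_commute)
    qed
    \<comment> \<open>The lower bound holds on a half-open interval; the midpoint yields a closed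
      one inside it.\<close>
    define b' where "b' = (a + b) / 2"
    have b': "a < b'" "b' < b" using ab by (auto simp: b'_def)
    have "(b' - a) * p \<le> ?d"
      unfolding md(1)
      by (rule has_integral_le[OF ind[of a b'] integrable_integral[OF md(2)]]) (use ab b' in auto)
    moreover have "0 < (b' - a) * p" using b' pos by simp
    ultimately show ?thesis by linarith
  qed
  let ?g = "\<lambda>u. \<theta>' u * ((dist_fun \<nu> u - dist_fun \<mu> u) / 2) * (h u - u)"
  have gi: "?g integrable_on {0..1}"
  proof -
    obtain M where M: "0 \<le> M" "\<And>u. u \<in> {0..1} \<Longrightarrow> \<bar>\<theta>' u\<bar> \<le> M" using theta'_bound by blast
    have hc': "continuous_on {0..1} (\<lambda>u. h u - u)" by (intro continuous_intros hc)
    obtain B where B: "\<forall>u\<in>{0..1}. \<bar>h u - u\<bar> \<le> B"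
      using compact_imp_bounded[OF compact_continuous_image[OF hc' compact_Icc]] unfolding bounded_iff by auto
    have "?g \<in> borel_measurable borel01"
      by (intro borel_measurable_times borel_measurable_diff[OF dist_fun_measurable[OF \<nu>] dist_fun_measurable[OF \<mu>]] borel_measurable_divide borel_measurable_const
          continuous_borel01[OF theta'_cont] continuous_borel01[OF hc'])
    then show ?thesis
    proof (rule integrable_bdd(1)[where C="M * 1 * B"])
      fix u :: real assume u: "u \<in> {0..1}"
      have "\<bar>(dist_fun \<nu> u - dist_fun \<mu> u) / 2\<bar> \<le> 1" using f1[of u] by (simp add: abs_minus_commute)
      then show "\<bar>?g u\<bar> \<le> M * 1 * B" unfolding abs_mult using M B u by (intro mult_mono) auto
    qed auto
  qed
  have "integral {0..1} ?g \<le> - (m * c / 2) * ?d"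
    unfolding md(1)
  proof (rule has_integral_le[OF integrable_integral[OF gi] has_integral_mult_right[OF integrable_integral[OF md(2)]]])
    fix u :: real assume u: "u \<in> {0..1}"
    show "?g u \<le> - (m * c / 2) * ?f u"
    proof (cases "u \<in> {l..<r}")
      case False then show ?thesis using out[OF u] by simp
    next
      case True
      have "?g u = \<theta>' u / 2 * ((dist_fun \<nu> u - dist_fun \<mu> u) * (h u - u))" by simp
      also have "\<dots> \<le> \<theta>' u / 2 * (- (c * ?f u))"
        using sgn[OF True] theta'_nonneg[of u] u by (intro mult_left_mono) (auto simp: abs_minus_commute)
      also have "\<dots> \<le> m / 2 * (- (c * ?f u))"
      proof -
        have "m / 2 * (c * ?f u) \<le> \<theta>' u / 2 * (c * ?f u)" using m(2)[OF True] c by (intro mult_right_mono) auto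
        then show ?thesis by linarith
      qed
      finally show ?thesis by simp
    qed
  qed
  moreover have "K * root 3 ?d * ?d < m * c / 2 * ?d"
  proof (rule mult_strict_right_mono[OF _ d0])
    have "root 3 ?d \<le> root 3 (r - l)" using dle by simp
    then have "K * root 3 ?d \<le> K * root 3 (r - l)" using K by (intro mult_left_mono) auto
    then show "K * root 3 ?d < m * c / 2" using K by linarith
  qed
  ultimately have "integral {0..1} ?g + K * root 3 ?d * ?d < 0" by linarith
  with exp show ?thesis by linarith
qed

text \<open>Mass near \<open>q\<close> is moved against the defect: if \<open>h q\<close> exceeds
  \<open>q\<close>, lowering the distribution function helps and the mass of the window goes to its
  right end, otherwise to its left end. Membership in the support makes the moved mass
  positive.\<close>

lemma support_critical:
  assumes \<mu>: "\<mu> \<in> prob_measures01" and min: "\<And>\<nu>. \<nu> \<in> prob_measures01 \<Longrightarrow> parisi_functional \<xi> \<mu> \<le> parisi_functional \<xi> \<nu>"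
    and k: "strict_mono (k :: nat \<Rightarrow> nat)"
    and lim: "\<And>u. u \<in> {0..1} \<Longrightarrow> (\<lambda>n. H (disc (k n) \<mu>) [0,0] u) \<longlonglongrightarrow> h u" and hc: "continuous_on {0..1} h"
    and q: "q \<in> measure_supp \<mu>" "0 < q" "q < 1"
  shows "h q = q"
proof (rule ccontr)
  assume ne: "h q \<noteq> q"
  interpret prob_space \<mu> by (rule prob01(1)[OF \<mu>])
  obtain K where K: "0 \<le> K" and expand: "\<And>\<nu>. \<nu> \<in> prob_measures01 \<Longrightarrow>
    parisi_functional \<xi> \<nu> - parisi_functional \<xi> \<mu> \<le>
      integral {0..1} (\<lambda>r. \<theta>' r * ((dist_fun \<nu> r - dist_fun \<mu> r) / 2) * (h r - r))
      + K * root 3 (measure_dist \<mu> \<nu>) * measure_dist \<mu> \<nu>"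
    using parisi_expand[OF \<mu> k lim hc] by blast
  \<comment> \<open>\<open>c\<close> and \<open>m\<close> are halves of the values at
    \<open>q\<close>, so that by continuity they remain lower bounds on a whole window.\<close>
  define c where "c = \<bar>h q - q\<bar> / 2"
  define m where "m = \<theta>' q / 2"
  have c: "0 < c" using ne by (simp add: c_def)
  have m: "0 < m" using theta'_pos[of q] q by (simp add: m_def)
  have op: "open {0<..<1::real}" "q \<in> {0<..<1}" using q by auto
  have ch: "isCont (\<lambda>u. h u - u) q"
    by (intro continuous_intros continuous_on_interior[OF hc]) (use q in auto)
  have ct: "isCont \<theta>' q" by (rule continuous_on_interior[OF theta'_cont]) (use q in auto)
  \<comment> \<open>The error coefficient tends to 0 with the window length, while the coefficient
    of the gain is fixed.\<close>
  have "((\<lambda>\<delta>. K * root 3 (2 * \<delta>)) \<longlongrightarrow> K * root 3 (2 * 0)) (at_right 0)" by (intro tendsto_intros)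
  then have e1: "\<forall>\<^sub>F \<delta> in at_right 0. K * root 3 (2 * \<delta>) < m * c / 2"
    by (rule order_tendstoD(2)) (use m c in auto)
  have "\<forall>\<^sub>F u in nhds q. dist (h u - u) (h q - q) < c \<and> dist (\<theta>' u) (\<theta>' q) < m"
    using tendstoD[OF iffD1[OF tendsto_at_iff_tendsto_nhds[of "\<lambda>u. h u - u"] ch[unfolded isCont_def]] c] tendstoD[OF ct[unfolded isCont_def tendsto_at_iff_tendsto_nhds] m]
    by (rule eventually_conj)
  then obtain e where e: "e > 0" "\<And>u. dist u q < e \<Longrightarrow> dist (h u - u) (h q - q) < c \<and> dist (\<theta>' u) (\<theta>' q) < m"
    unfolding eventually_nhds_metric by auto
  have "\<forall>\<^sub>F \<delta> in at_right 0. \<delta> < e \<and> \<delta> < q \<and> \<delta> < 1 - q"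
    using e(1) q by (intro eventually_conj) (auto intro: order_tendstoD(2)[OF tendsto_ident_at])
  then have "\<forall>\<^sub>F \<delta> in at_right 0. 0 < \<delta> \<and> (\<delta> < e \<and> \<delta> < q \<and> \<delta> < 1 - q) \<and> K * root 3 (2 * \<delta>) < m * c / 2"
    using e1 eventually_at_right_less[of "0::real"] by eventually_elim auto
  then obtain \<delta> where \<delta>: "0 < \<delta>" "\<delta> < e" "\<delta> < q" "\<delta> < 1 - q" "K * root 3 (2 * \<delta>) < m * c / 2"
    using eventually_happens'[OF trivial_limit_at_right_real] by blast
  define l where "l = q - \<delta>"
  define r where "r = q + \<delta>"
  have lr: "0 < l" "l < q" "q < r" "r < 1" using \<delta> by (auto simp: l_def r_def)
  have Kr: "K * root 3 (r - l) < m * c / 2" using \<delta>(5) by (simp add: l_def r_def)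
  have loc: "dist (h u - u) (h q - q) < c" "m \<le> \<theta>' u" if "u \<in> {l..<r}" for u
  proof -
    have "dist u q < e" using that \<delta> by (auto simp: dist_real_def l_def r_def)
    from e(2)[OF this] have "dist (h u - u) (h q - q) < c" "\<bar>\<theta>' u - \<theta>' q\<bar> < m" by (auto simp: dist_real_def)
    then show "dist (h u - u) (h q - q) < c" "m \<le> \<theta>' u" unfolding m_def by linarith+
  qed
  have sp: "0 < measure \<mu> U" if "open U" "q \<in> U" "U \<subseteq> {0..1}" for U
    using q(1) that by (auto simp: measure_supp_def Int_absorb2)
  have ev: "A \<in> events" if "A \<subseteq> {0..1}" "A \<in> sets borel" for A by (rule prob01(3)[OF \<mu> that])
  show False
  proof (cases "h q > q")
    case True
    define g where "g = (\<lambda>x. if l < x \<and> x < r then r else x :: real)"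
    have gm: "g \<in> borel_measurable borel" unfolding g_def by measurable
    have g01: "g x \<in> {0..1}" if "x \<in> {0..1}" for x using that lr by (auto simp: g_def)
    define \<nu> where "\<nu> = distr \<mu> borel01 g"
    have \<nu>: "\<nu> \<in> prob_measures01" unfolding \<nu>_def by (rule distr_prob01(1)[OF \<mu> gm g01])
    have \<nu>u: "dist_fun \<nu> u = measure \<mu> {x \<in> {0..1}. g x \<in> {0..u}}" if "u \<in> {0..1}" for u
      unfolding \<nu>_def dist_fun_def by (rule distr_prob01(2)[OF \<mu> gm g01]) (use that in auto)
    have out: "dist_fun \<nu> u = dist_fun \<mu> u" if "u \<in> {0..1}" "u \<notin> {l..<r}" for u
    proof -
      have "{x \<in> {0..1}. g x \<in> {0..u}} = {0..u}" using that lr by (auto simp: g_def split: if_splits)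
      then show ?thesis unfolding \<nu>u[OF that(1)] by (simp add: dist_fun_def)
    qed
    have inn: "dist_fun \<mu> u - dist_fun \<nu> u = measure \<mu> {l<..u}" if "u \<in> {l..<r}" for u
    proof -
      have u: "u \<in> {0..1}" using that lr by auto
      have "{x \<in> {0..1}. g x \<in> {0..u}} = {0..l}" using that lr by (auto simp: g_def split: if_splits)
      then have "dist_fun \<nu> u = dist_fun \<mu> l" unfolding \<nu>u[OF u] by (simp add: dist_fun_def)
      then show ?thesis using dist_fun_diff[OF \<mu>, of l u] that lr by auto
    qed
    \<comment> \<open>\<open>q\<close> lies strictly between \<open>l\<close> and \<open>q'\<close>,
      so for every \<open>u\<close> from \<open>q'\<close> on the distribution function has dropped
      at least by the mass \<open>p\<close> of that interval.\<close>
    define q' where "q' = (q + r) / 2"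
    have q': "q < q'" "q' < r" "l < q'" using lr by (auto simp: q'_def)
    define p where "p = measure \<mu> {l<..<q'}"
    have p: "0 < p" unfolding p_def by (rule sp) (use q' lr in auto)
    have "parisi_functional \<xi> \<nu> < parisi_functional \<xi> \<mu>"
    proof (rule window_variation[OF \<mu> \<nu> expand[OF \<nu>] hc lr(1) q'(3,2) lr(4) out _ m loc(2) c K Kr p])
      fix u assume u: "u \<in> {l..<r}"
      have "c = (h q - q) / 2" using True by (simp add: c_def)
      then have a: "c \<le> h u - u" using loc(1)[OF u] by (simp add: dist_real_def abs_less_iff)
      have b: "dist_fun \<nu> u - dist_fun \<mu> u \<le> 0" using inn[OF u] measure_nonneg[of \<mu> "{l<..u}"] by linarith
      have "(dist_fun \<mu> u - dist_fun \<nu> u) * c \<le> (dist_fun \<mu> u - dist_fun \<nu> u) * (h u - u)"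
        using a b by (intro mult_left_mono) auto
      then show "(dist_fun \<nu> u - dist_fun \<mu> u) * (h u - u) \<le> - (c * \<bar>dist_fun \<nu> u - dist_fun \<mu> u\<bar>)"
        using b by (simp add: algebra_simps)
    next
      have "p \<le> \<bar>dist_fun \<nu> u - dist_fun \<mu> u\<bar>" if "u \<in> {q'..<r}" for u
      proof -
        have u: "u \<in> {l..<r}" using that q' by auto
        have "p \<le> measure \<mu> {l<..u}"
          unfolding p_def by (rule finite_measure_mono) (use that lr in \<open>auto intro!: ev\<close>)
        then show ?thesis using inn[OF u] by linarith
      qed
      then show "(\<forall>u\<in>{q'..<r}. p \<le> \<bar>dist_fun \<nu> u - dist_fun \<mu> u\<bar>) \<or> (\<forall>u\<in>{l..<q'}. p \<le> \<bar>dist_fun \<nu> u - dist_fun \<mu> u\<bar>)" by blast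
    qed
    with min[OF \<nu>] show False by simp
  next
    case False
    define g where "g = (\<lambda>x. if l < x \<and> x < r then l else x :: real)"
    have gm: "g \<in> borel_measurable borel" unfolding g_def by measurable
    have g01: "g x \<in> {0..1}" if "x \<in> {0..1}" for x using that lr by (auto simp: g_def)
    define \<nu> where "\<nu> = distr \<mu> borel01 g"
    have \<nu>: "\<nu> \<in> prob_measures01" unfolding \<nu>_def by (rule distr_prob01(1)[OF \<mu> gm g01])
    have \<nu>u: "dist_fun \<nu> u = measure \<mu> {x \<in> {0..1}. g x \<in> {0..u}}" if "u \<in> {0..1}" for u
      unfolding \<nu>_def dist_fun_def by (rule distr_prob01(2)[OF \<mu> gm g01]) (use that in auto)
    have out: "dist_fun \<nu> u = dist_fun \<mu> u" if "u \<in> {0..1}" "u \<notin> {l..<r}" for u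
    proof -
      have "{x \<in> {0..1}. g x \<in> {0..u}} = {0..u}" using that lr by (auto simp: g_def split: if_splits)
      then show ?thesis unfolding \<nu>u[OF that(1)] by (simp add: dist_fun_def)
    qed
    have inn: "dist_fun \<nu> u - dist_fun \<mu> u = measure \<mu> {u<..<r}" if "u \<in> {l..<r}" for u
    proof -
      have u: "u \<in> {0..1}" using that lr by auto
      have "{x \<in> {0..1}. g x \<in> {0..u}} = {0..u} \<union> {u<..<r}" using that lr by (auto simp: g_def split: if_splits)
      then have "dist_fun \<nu> u = measure \<mu> ({0..u} \<union> {u<..<r})" unfolding \<nu>u[OF u] by simp
      also have "\<dots> = measure \<mu> {0..u} + measure \<mu> {u<..<r}"
      proof (rule finite_measure_Union)
        show "{0..u} \<in> events" "{u<..<r} \<in> events" by (rule ev; use that lr in auto)+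
      qed auto
      finally show ?thesis by (simp add: dist_fun_def)
    qed
    define q' where "q' = (l + q) / 2"
    have q': "q' < q" "q' < r" "l < q'" using lr by (auto simp: q'_def)
    define p where "p = measure \<mu> {q'<..<r}"
    have p: "0 < p" unfolding p_def by (rule sp) (use q' lr in auto)
    have "parisi_functional \<xi> \<nu> < parisi_functional \<xi> \<mu>"
    proof (rule window_variation[OF \<mu> \<nu> expand[OF \<nu>] hc lr(1) q'(3,2) lr(4) out _ m loc(2) c K Kr p])
      fix u assume u: "u \<in> {l..<r}"
      have "c = (q - h q) / 2" using False by (simp add: c_def)
      then have a: "h u - u \<le> - c" using loc(1)[OF u] by (simp add: dist_real_def abs_less_iff)
      have b: "0 \<le> dist_fun \<nu> u - dist_fun \<mu> u" using inn[OF u] measure_nonneg[of \<mu> "{u<..<r}"] by linarith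
      have "(dist_fun \<nu> u - dist_fun \<mu> u) * (h u - u) \<le> (dist_fun \<nu> u - dist_fun \<mu> u) * (- c)"
        using a b by (intro mult_left_mono) auto
      then show "(dist_fun \<nu> u - dist_fun \<mu> u) * (h u - u) \<le> - (c * \<bar>dist_fun \<nu> u - dist_fun \<mu> u\<bar>)"
        using b by (simp add: algebra_simps)
    next
      have "p \<le> \<bar>dist_fun \<nu> u - dist_fun \<mu> u\<bar>" if "u \<in> {l..<q'}" for u
      proof -
        have u: "u \<in> {l..<r}" using that q' by auto
        have "p \<le> measure \<mu> {u<..<r}"
          unfolding p_def by (rule finite_measure_mono) (use that lr in \<open>auto intro!: ev\<close>)
        then show ?thesis using inn[OF u] by linarith
      qed
      then show "(\<forall>u\<in>{q'..<r}. p \<le> \<bar>dist_fun \<nu> u - dist_fun \<mu> u\<bar>) \<or> (\<forall>u\<in>{l..<q'}. p \<le> \<bar>dist_fun \<nu> u - dist_fun \<mu> u\<bar>)" by blast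
    qed
    with min[OF \<nu>] show False by simp
  qed
qed

end

section \<open>Critical points and regularity\<close>

text \<open>Derivatives are taken within \<open>S\<close>, hence one-sided at an endpoint in
  \<open>S\<close>. As for \<open>bsm\<close>, the derivative is quantified anew at each level, and
  coherence is settled afterwards.\<close>

primrec cdiff :: "real set \<Rightarrow> nat \<Rightarrow> (real \<Rightarrow> real) \<Rightarrow> bool" where
  "cdiff S 0 f = continuous_on S f"
| "cdiff S (Suc n) f = (\<exists>f'. (\<forall>u\<in>S. (f has_real_derivative f' u) (at u within S)) \<and> cdiff S n f')"

lemma cdiffI: "(\<And>u. u \<in> S \<Longrightarrow> (f has_real_derivative f' u) (at u within S)) \<Longrightarrow> cdiff S n f' \<Longrightarrow> cdiff S (Suc n) f"
  by auto

lemma cdiffE: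
  assumes "cdiff S (Suc n) f"
  obtains f' where "\<And>u. u \<in> S \<Longrightarrow> (f has_real_derivative f' u) (at u within S)" "cdiff S n f'"
  using assms by auto

lemma cdiff_dec: "cdiff S (Suc n) f \<Longrightarrow> cdiff S n f"
proof (induction n arbitrary: f)
  case 0
  then show ?case by (auto intro: DERIV_continuous_on)
next
  case (Suc n)
  from Suc.prems obtain f' where "\<And>u. u \<in> S \<Longrightarrow> (f has_real_derivative f' u) (at u within S)" "cdiff S (Suc n) f'"
    by (rule cdiffE) blast
  with Suc.IH show ?case by (intro cdiffI) auto
qed

lemma cdiff_cong:
  assumes "cdiff S n f" "\<And>u. u \<in> S \<Longrightarrow> f u = g u" shows "cdiff S n g"
proof (cases n)
  case 0
  then show ?thesis using assms by (auto intro: continuous_on_eq)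
next
  case (Suc m)
  then obtain f' where f': "\<And>u. u \<in> S \<Longrightarrow> (f has_real_derivative f' u) (at u within S)" "cdiff S m f'"
    using assms(1) by (auto elim: cdiffE)
  have "(g has_real_derivative f' u) (at u within S)" if "u \<in> S" for u
    by (rule has_field_derivative_transform_within[OF f'(1)[OF that], of 1]) (use that assms(2) in auto)
  with f'(2) Suc show ?thesis by auto
qed

lemma cdiff_const: "cdiff S n (\<lambda>_. c)"
proof (induction n arbitrary: c)
  case (Suc n)
  show ?case by (rule cdiffI[OF _ Suc[of 0]]) auto
qed auto

lemma cdiff_add: "cdiff S n f \<Longrightarrow> cdiff S n g \<Longrightarrow> cdiff S n (\<lambda>u. f u + g u)"
proof (induction n arbitrary: f g)
  case 0 then show ?case by (auto intro: continuous_intros)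
next
  case (Suc n)
  obtain f' where f': "\<And>u. u \<in> S \<Longrightarrow> (f has_real_derivative f' u) (at u within S)" "cdiff S n f'" using Suc.prems(1) by (rule cdiffE) blast
  obtain g' where g': "\<And>u. u \<in> S \<Longrightarrow> (g has_real_derivative g' u) (at u within S)" "cdiff S n g'" using Suc.prems(2) by (rule cdiffE) blast
  show ?case by (rule cdiffI[OF DERIV_add[OF f'(1) g'(1)] Suc.IH[OF f'(2) g'(2)]])
qed

lemma cdiff_mult: "cdiff S n f \<Longrightarrow> cdiff S n g \<Longrightarrow> cdiff S n (\<lambda>u. f u * g u)"
proof (induction n arbitrary: f g)
  case 0 then show ?case by (auto intro: continuous_intros)
next
  case (Suc n)
  obtain f' where f': "\<And>u. u \<in> S \<Longrightarrow> (f has_real_derivative f' u) (at u within S)" "cdiff S n f'" using Suc.prems(1) by (rule cdiffE) blast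
  obtain g' where g': "\<And>u. u \<in> S \<Longrightarrow> (g has_real_derivative g' u) (at u within S)" "cdiff S n g'" using Suc.prems(2) by (rule cdiffE) blast
  show ?case
  proof (rule cdiffI)
    show "((\<lambda>u. f u * g u) has_real_derivative f' u * g u + g' u * f u) (at u within S)" if "u \<in> S" for u
      by (rule DERIV_mult[OF f'(1)[OF that] g'(1)[OF that]])
    show "cdiff S n (\<lambda>u. f' u * g u + g' u * f u)"
      by (intro cdiff_add Suc.IH f' g' cdiff_dec[OF Suc.prems(1)] cdiff_dec[OF Suc.prems(2)])
  qed
qed

lemma cdiff_inverse:
  assumes nz: "\<And>u. u \<in> S \<Longrightarrow> f u \<noteq> 0"
  shows "cdiff S n f \<Longrightarrow> cdiff S n (\<lambda>u. inverse (f u))"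
proof (induction n)
  case 0 then show ?case using nz by (auto intro!: continuous_on_inverse)
next
  case (Suc n)
  obtain f' where f': "\<And>u. u \<in> S \<Longrightarrow> (f has_real_derivative f' u) (at u within S)" "cdiff S n f'" using Suc.prems(1) by (rule cdiffE) blast
  have i: "cdiff S n (\<lambda>u. inverse (f u))" by (rule Suc.IH[OF cdiff_dec[OF Suc.prems]])
  show ?case
  proof (rule cdiffI)
    show "((\<lambda>u. inverse (f u)) has_real_derivative (-1) * (inverse (f u) * f' u * inverse (f u))) (at u within S)" if "u \<in> S" for u
      using DERIV_inverse'[OF f'(1)[OF that] nz[OF that]] by simp
    show "cdiff S n (\<lambda>u. (-1) * (inverse (f u) * f' u * inverse (f u)))"
      by (intro cdiff_mult cdiff_const f' i)
  qed
qed

lemma cdiff_sum_of: "(\<And>w. cdiff S n (h w)) \<Longrightarrow> cdiff S n (\<lambda>u. sum_of (\<lambda>w. h w u) P)"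
  by (induction P) (simp_all add: cdiff_const cdiff_add)

lemma cdiff_subset: "cdiff T n f \<Longrightarrow> S \<subseteq> T \<Longrightarrow> cdiff S n f"
proof (induction n arbitrary: f)
  case 0 then show ?case by (auto intro: continuous_on_subset)
next
  case (Suc n)
  obtain f' where f': "\<And>u. u \<in> T \<Longrightarrow> (f has_real_derivative f' u) (at u within T)" "cdiff T n f'" using Suc.prems(1) by (rule cdiffE) blast
  show ?case by (rule cdiffI[OF DERIV_subset[OF f'(1)] Suc.IH[OF f'(2)]]) (use Suc.prems in auto)
qed

lemma cdiff_family:
  assumes "\<And>j u. u \<in> S \<Longrightarrow> (F j has_real_derivative F (Suc j) u) (at u)" shows "cdiff S n (F j)"
proof (induction n arbitrary: j)
  case 0
  have "continuous_on S (F j)" by (rule DERIV_continuous_on[OF has_field_derivative_at_within[OF assms]])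
  then show ?case by simp
next
  case (Suc n)
  show ?case by (rule cdiffI[OF has_field_derivative_at_within[OF assms] Suc])
qed

text \<open>The derivatives provided at different orders must be combined into one sequence. A
  half-open interval has no isolated points, so derivatives within it are unique and
  \<open>vector_derivative\<close> selects them consistently.\<close>

lemma infinitely_differentiable_onI:
  assumes ab: "a < b" and f: "\<And>n. cdiff {a..<b} n f"
  shows "infinitely_differentiable_on f {a..<b}"
proof -
  let ?S = "{a..<b}"
  define d where "d = (\<lambda>g u. vector_derivative g (at u within ?S) :: real)"
  have nt: "at u within ?S \<noteq> bot" if "u \<in> ?S" for u
  proof -
    have "u islimpt {u<..<b}" by (rule islimpt_greaterThanLessThan1) (use that in auto)
    then have "u islimpt ?S" by (rule islimpt_subset) (use that in auto)
    then show ?thesis by (simp add: trivial_limit_within)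
  qed
  have d: "d g u = g' u" if "(g has_real_derivative g' u) (at u within ?S)" "u \<in> ?S" for g g' u
    unfolding d_def
    by (rule vector_derivative_within[OF nt[OF that(2)]])
       (use that(1) in \<open>simp add: has_real_derivative_iff_has_vector_derivative\<close>)
  have step: "cdiff ?S n (d g)" "u \<in> ?S \<Longrightarrow> (g has_real_derivative d g u) (at u within ?S)" if g: "\<And>n. cdiff ?S n g" for g n u
  proof -
    obtain g' where g': "\<And>u. u \<in> ?S \<Longrightarrow> (g has_real_derivative g' u) (at u within ?S)" "cdiff ?S n g'"
      using g[of "Suc n"] by (rule cdiffE) blast
    have e: "g' u = d g u" if "u \<in> ?S" for u using d[of g g' u, OF g'(1)[OF that] that] by simp
    show "cdiff ?S n (d g)" by (rule cdiff_cong[OF g'(2) e])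
    show "u \<in> ?S \<Longrightarrow> (g has_real_derivative d g u) (at u within ?S)" using g'(1) e by metis
  qed
  have D: "cdiff ?S n ((d ^^ j) f)" for n j by (induction j arbitrary: n) (auto intro: f step)
  show ?thesis
    unfolding infinitely_differentiable_on_def
    by (rule exI[of _ "\<lambda>j. (d ^^ j) f"]) (use step(2)[OF D] in auto)
qed

text \<open>A fundamental theorem for an integrand that merely has a limit \<open>L\<close> along
  \<open>S\<close> at \<open>u\<close>; the single point \<open>u\<close> is negligible. As
  \<open>S\<close> is an interval, it contains the points between \<open>u\<close> and
  \<open>v\<close>, where the limit controls the integrand.\<close>

lemma integral_deriv_within:
  fixes F f :: "real \<Rightarrow> real"
  assumes F: "\<And>a b. 0 \<le> a \<Longrightarrow> a \<le> b \<Longrightarrow> b \<le> 1 \<Longrightarrow> (f has_integral F b - F a) {a..b}"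
    and S: "S \<subseteq> {0..1}" "is_interval S" "u \<in> S" and L: "(f \<longlongrightarrow> L) (at u within S)"
  shows "(F has_real_derivative L) (at u within S)"
  unfolding has_field_derivative_iff
proof (rule tendstoI)
  fix e :: real assume e: "0 < e"
  then have "\<forall>\<^sub>F v in at u within S. dist (f v) L < e / 2" using tendstoD[OF L, of "e / 2"] by simp
  then obtain d where d: "d > 0" "\<And>v. v \<in> S \<Longrightarrow> v \<noteq> u \<Longrightarrow> dist v u < d \<Longrightarrow> dist (f v) L < e / 2"
    unfolding eventually_at by auto
  have "dist ((F v - F u) / (v - u)) L < e" if v: "v \<in> S" "v \<noteq> u" "dist v u < d" for v
  proof -
    define a where "a = min u v"
    define b where "b = max u v"
    have ab: "0 \<le> a" "a < b" "b \<le> 1" "a \<in> S" "b \<in> S" using v S by (auto simp: a_def b_def min_def max_def)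
    have I: "((\<lambda>r. f r - L) has_integral (F b - F a) - (b - a) * L) {a..b}"
      using has_integral_diff[OF F[of a b] has_integral_const_real[of L a b]] ab by simp
    have "norm ((F b - F a) - (b - a) * L) \<le> e / 2 * measure lborel {a..b}"
    proof (rule has_integral_bound_real[OF _ _ I, of _ "{u}"])
      fix r assume r: "r \<in> {a..b} - {u}"
      then have "r \<in> S" using mem_is_interval_1_I[OF S(2) ab(4,5)] by auto
      moreover have "dist r u < d" using r v(3) by (auto simp: a_def b_def dist_real_def min_def max_def split: if_splits)
      ultimately show "norm (f r - L) \<le> e / 2" using d(2)[of r] r by (auto simp: dist_real_def)
    qed (use e in auto)
    then have n: "\<bar>(F b - F a) - (b - a) * L\<bar> \<le> e / 2 * (b - a)" using ab by simp
    have "(F v - F u) / (v - u) = (F b - F a) / (b - a)"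
      unfolding a_def b_def min_def max_def using v(2) by (auto simp: field_simps)
    then have "(F v - F u) / (v - u) - L = ((F b - F a) - (b - a) * L) / (b - a)"
      using ab by (simp add: field_simps)
    then have "\<bar>(F v - F u) / (v - u) - L\<bar> \<le> e / 2"
      using n ab by (simp add: abs_divide divide_le_eq)
    then show ?thesis using e by (simp add: dist_real_def)
  qed
  then show "\<forall>\<^sub>F v in at u within S. dist ((F v - F u) / (v - u)) L < e"
    unfolding eventually_at using d(1) by blast
qed

lemma deriv_zero_of_seq:
  assumes D: "(E has_real_derivative D) (at u within S)" and X: "\<And>n. X n \<in> S" "\<And>n. X n \<noteq> u" "X \<longlonglongrightarrow> u" "\<And>n. E (X n) = E u"
  shows "D = 0"
proof -
  have "\<forall>X. (\<forall>i. X i \<in> S - {u}) \<longrightarrow> X \<longlonglongrightarrow> u \<longrightarrow> (\<lambda>n. (E (X n) - E u) / (X n - u)) \<longlonglongrightarrow> D"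
    using D unfolding has_field_derivative_iff tendsto_at_iff_sequentially comp_def .
  then have "(\<lambda>n. (E (X n) - E u) / (X n - u)) \<longlonglongrightarrow> D" using X(1-3) by blast
  then have "(\<lambda>n. 0) \<longlonglongrightarrow> D" using X(4) by simp
  then show ?thesis using LIMSEQ_unique[OF tendsto_const] by metis
qed

section \<open>One-sided limits of distribution functions\<close>

lemma dist_fun_right:
  assumes \<mu>: "\<mu> \<in> prob_measures01" and u: "0 \<le> u" "u < 1"
  shows "(dist_fun \<mu> \<longlongrightarrow> dist_fun \<mu> u) (at u within {u..1})"
proof (rule tendstoI)
  interpret prob_space \<mu> by (rule prob01(1)[OF \<mu>])
  fix e :: real assume e: "0 < e"
  define v where "v = (\<lambda>n. u + (1 - u) * (1 / real (Suc n)))"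
  have v: "u < v n" "v n \<le> 1" for n
  proof -
    show "u < v n" using u by (simp add: v_def)
    have "(1 - u) * (1 / real (Suc n)) \<le> (1 - u) * 1" using u by (intro mult_left_mono) auto
    then show "v n \<le> 1" by (simp add: v_def)
  qed
  have vl: "v \<longlonglongrightarrow> u + (1 - u) * 0"
    unfolding v_def by (intro tendsto_intros LIMSEQ_Suc[OF lim_1_over_n])
  have vd: "v (Suc n) \<le> v n" for n
    unfolding v_def using u by (intro add_left_mono mult_left_mono divide_left_mono) auto
  have dec: "decseq (\<lambda>n. {0..v n})" by (rule decseq_SucI) (use vd in auto)
  have "(\<lambda>n. measure \<mu> {0..v n}) \<longlonglongrightarrow> measure \<mu> (\<Inter>n. {0..v n})"
    by (rule finite_Lim_measure_decseq[OF _ dec]) (use v prob01(3)[OF \<mu>] in auto)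
  moreover have "(\<Inter>n. {0..v n}) = {0..u}"
  proof (intro equalityI subsetI)
    fix x assume x: "x \<in> (\<Inter>n. {0..v n})"
    then have "x \<le> u + (1 - u) * 0" by (intro LIMSEQ_le_const[OF vl]) auto
    with x show "x \<in> {0..u}" by auto
  qed (use v less_imp_le order_trans in fastforce)
  ultimately have "(\<lambda>n. dist_fun \<mu> (v n)) \<longlonglongrightarrow> dist_fun \<mu> u" by (simp add: dist_fun_def)
  then have "\<forall>\<^sub>F n in sequentially. dist_fun \<mu> (v n) < dist_fun \<mu> u + e"
    by (rule order_tendstoD(2)) (use e in auto)
  then obtain n where n: "dist_fun \<mu> (v n) < dist_fun \<mu> u + e" using eventually_happens' sequentially_bot by blast
  have "dist (dist_fun \<mu> x) (dist_fun \<mu> u) < e" if x: "x \<in> {u..1}" "dist x u < v n - u" for x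
  proof -
    have "dist_fun \<mu> u \<le> dist_fun \<mu> x" using dist_fun_mono[OF \<mu>] x u by auto
    moreover have "dist_fun \<mu> x \<le> dist_fun \<mu> (v n)" using dist_fun_mono[OF \<mu>, of x "v n"] x u v[of n] by (auto simp: dist_real_def)
    ultimately show ?thesis using n by (simp add: dist_real_def)
  qed
  then show "\<forall>\<^sub>F x in at u within {u..1}. dist (dist_fun \<mu> x) (dist_fun \<mu> u) < e"
    unfolding eventually_at using v[of n] by (intro exI[of _ "v n - u"]) auto
qed

lemma dist_fun_left:
  assumes \<mu>: "\<mu> \<in> prob_measures01" and u: "0 < u" "u \<le> 1"
  obtains L where "(dist_fun \<mu> \<longlongrightarrow> L) (at u within {0..u})"
proof -
  define L where "L = (SUP v\<in>{0..<u}. dist_fun \<mu> v)"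
  have bdd: "bdd_above (dist_fun \<mu> ` {0..<u})" using dist_fun_bounds(2)[OF \<mu>] by (auto intro!: bdd_aboveI2)
  have ne: "{0..<u} \<noteq> {}" using u by auto
  have up: "dist_fun \<mu> v \<le> L" if "v \<in> {0..<u}" for v unfolding L_def by (rule cSUP_upper[OF that bdd])
  have "(dist_fun \<mu> \<longlongrightarrow> L) (at u within {0..u})"
  proof (rule tendstoI)
    fix e :: real assume e: "0 < e"
    have "L - e < L" using e by simp
    then obtain v where v: "v \<in> {0..<u}" "L - e < dist_fun \<mu> v"
      unfolding L_def using less_cSUP_iff[OF ne bdd] by blast
    have "dist (dist_fun \<mu> x) L < e" if x: "x \<in> {0..u}" "x \<noteq> u" "dist x u < u - v" for x
    proof -
      have "dist_fun \<mu> v \<le> dist_fun \<mu> x" using dist_fun_mono[OF \<mu>, of v x] x u v by (auto simp: dist_real_def)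
      moreover have "dist_fun \<mu> x \<le> L" using up[of x] x by auto
      ultimately show ?thesis using v by (simp add: dist_real_def)
    qed
    then show "\<forall>\<^sub>F x in at u within {0..u}. dist (dist_fun \<mu> x) L < e"
      unfolding eventually_at using v by (intro exI[of _ "u - v"]) auto
  qed
  then show ?thesis by (rule that)
qed

text \<open>What is left of the dynamics of a minimiser: the functions \<open>h w\<close> are limits of the expected
  monomials.\<close>

locale critical_system = parisi_setup +
  fixes \<mu> :: "real measure" and h :: "nat list \<Rightarrow> real \<Rightarrow> real"
  assumes mu: "\<mu> \<in> prob_measures01"
    and theta'_smooth: "\<And>n. cdiff {0..1} n \<theta>'"
    and h_cont: "\<And>w. continuous_on {0..1} (h w)"
    and h_int: "\<And>w a b. 0 \<le> a \<Longrightarrow> a \<le> b \<Longrightarrow> b \<le> 1 \<Longrightarrow>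
      ((\<lambda>r. \<theta>' r * (sum_of (\<lambda>w. h w r) (gen0 w) - dist_fun \<mu> r * sum_of (\<lambda>w. h w r) (gen1 w))) has_integral h w b - h w a) {a..b}"
    and h_cube: "\<And>u. 0 \<le> u \<Longrightarrow> u \<le> 1 \<Longrightarrow> (h [1,1] u)\<^sup>2 \<le> h [1,1,1] u"
    and h_supp: "\<And>q. q \<in> measure_supp \<mu> \<Longrightarrow> 0 < q \<Longrightarrow> q < 1 \<Longrightarrow> h [0,0] q = q"
begin

lemma h_lim: "u \<in> {0..1} \<Longrightarrow> S \<subseteq> {0..1} \<Longrightarrow> (h w \<longlongrightarrow> h w u) (at u within S)"
  using h_cont[of w] by (meson continuous_on tendsto_within_subset)

lemma theta'_lim: "u \<in> {0..1} \<Longrightarrow> S \<subseteq> {0..1} \<Longrightarrow> (\<theta>' \<longlongrightarrow> \<theta>' u) (at u within S)"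
  using theta'_cont by (meson continuous_on tendsto_within_subset)

lemma h_deriv:
  assumes S: "S \<subseteq> {0..1}" "is_interval S" "u \<in> S" and L: "(dist_fun \<mu> \<longlongrightarrow> L) (at u within S)"
  shows "(h w has_real_derivative \<theta>' u * (sum_of (\<lambda>w. h w u) (gen0 w) - L * sum_of (\<lambda>w. h w u) (gen1 w))) (at u within S)"
proof (rule integral_deriv_within[OF h_int S])
  have sl: "((\<lambda>r. sum_of (\<lambda>w. h w r) P) \<longlongrightarrow> sum_of (\<lambda>w. h w u) P) (at u within S)" for P
    by (induction P) (use S in \<open>auto intro!: tendsto_intros h_lim\<close>)
  show "((\<lambda>r. \<theta>' r * (sum_of (\<lambda>w. h w r) (gen0 w) - dist_fun \<mu> r * sum_of (\<lambda>w. h w r) (gen1 w))) \<longlongrightarrow>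
     \<theta>' u * (sum_of (\<lambda>w. h w u) (gen0 w) - L * sum_of (\<lambda>w. h w u) (gen1 w))) (at u within S)"
    by (intro tendsto_intros sl L theta'_lim) (use S in auto)
qed

text \<open>The Leibniz remainder at index 0 is empty, so the distribution function drops out of
  this equation and the derivative exists across its jumps.\<close>

lemma h00_deriv: "u \<in> {0..1} \<Longrightarrow> (h [0,0] has_real_derivative \<theta>' u * h [1,1] u) (at u within {0..1})"
proof (rule integral_deriv_within[where S="{0..1}"])
  show "((\<lambda>r. \<theta>' r * h [1,1] r) has_integral h [0,0] b - h [0,0] a) {a..b}" if "0 \<le> a" "a \<le> b" "b \<le> 1" for a b
    using h_int[OF that, of "[0,0]"] by simp
  show "((\<lambda>r. \<theta>' r * h [1,1] r) \<longlongrightarrow> \<theta>' u * h [1,1] u) (at u within {0..1})" if "u \<in> {0..1}"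
    by (intro tendsto_intros h_lim theta'_lim that order_refl)
qed (auto simp: is_interval_cc)

text \<open>Interior support points are zeros of \<open>h [0,0] u - u\<close>. Between two of them a
  point with the relation for \<open>h [1,1]\<close> appears, which itself may lie outside the
  support.\<close>

lemma rolle_point:
  assumes ab: "0 < a" "a < b" "b < 1" "h [0,0] a = a" "h [0,0] b = b"
  obtains c where "a < c" "c < b" "\<theta>' c * h [1,1] c = 1"
proof -
  let ?E = "\<lambda>u. h [0,0] u - u"
  have d: "(?E has_real_derivative \<theta>' u * h [1,1] u - 1) (at u)" if "a < u" "u < b" for u
  proof -
    have "at u within {0..1} = at u" by (rule at_within_interior) (use that ab in auto)
    then have "(h [0,0] has_real_derivative \<theta>' u * h [1,1] u) (at u)" using h00_deriv[of u] that ab by auto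
    then show ?thesis by (auto intro!: derivative_eq_intros)
  qed
  have "\<exists>z. a < z \<and> z < b \<and> DERIV ?E z :> 0"
  proof (rule Rolle[OF ab(2)])
    show "continuous_on {a..b} ?E"
      by (intro continuous_intros continuous_on_subset[OF h_cont]) (use ab in auto)
    show "?E differentiable at x" if "a < x" "x < b" for x using d[OF that] by (auto simp: real_differentiable_def)
  qed (use ab in auto)
  then obtain c where c: "a < c" "c < b" "DERIV ?E c :> 0" by blast
  have "\<theta>' c * h [1,1] c - 1 = 0" by (rule DERIV_unique[OF d[OF c(1,2)] c(3)])
  then show ?thesis using that c by auto
qed

text \<open>At a limit of critical points inside \<open>S\<close> the derivative along \<open>S\<close> of \<open>h [1,1]\<close>, which involves the
  one-sided limit \<open>L\<close> of the distribution function, agrees with that of \<open>1 / \<theta>'\<close>.\<close>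

lemma one_sided:
  assumes S: "S \<subseteq> {0..1}" "is_interval S" "u \<in> S" and L: "(dist_fun \<mu> \<longlongrightarrow> L) (at u within S)"
    and c: "\<And>n. c n \<in> S" "\<And>n. c n \<noteq> u" "c \<longlonglongrightarrow> u" "\<And>n. \<theta>' (c n) * h [1,1] (c n) = 1"
    and t: "(\<theta>' has_real_derivative t) (at u within {0..1})"
  shows "\<theta>' u * h [1,1] u = 1" "\<theta>' u * (h [2,2] u - L * (2 * h [1,1,1] u)) = - t / (\<theta>' u)\<^sup>2"
proof -
  have cont: "continuous_on {0..1} (\<lambda>u. \<theta>' u * h [1,1] u)" by (intro continuous_intros theta'_cont h_cont)
  have "(\<lambda>n. \<theta>' (c n) * h [1,1] (c n)) \<longlonglongrightarrow> \<theta>' u * h [1,1] u"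
  proof (rule continuous_on_tendsto_compose[OF cont c(3)])
    show "\<forall>\<^sub>F n in sequentially. c n \<in> {0..1}" using S(1) c(1) by (intro always_eventually) blast
  qed (use S in blast)
  then show 1: "\<theta>' u * h [1,1] u = 1" unfolding c(4) using LIMSEQ_unique[OF tendsto_const] by metis
  then have nz: "\<theta>' u \<noteq> 0" by auto
  let ?E = "\<lambda>u. h [1,1] u - inverse (\<theta>' u)"
  have d1: "(h [1,1] has_real_derivative \<theta>' u * (h [2,2] u - L * (2 * h [1,1,1] u))) (at u within S)"
    using h_deriv[OF S L, of "[1,1]"] by (simp add: numeral_2_eq_2)
  have d2: "((\<lambda>u. inverse (\<theta>' u)) has_real_derivative - (inverse (\<theta>' u) * t * inverse (\<theta>' u))) (at u within S)"
    by (rule DERIV_inverse'[OF DERIV_subset[OF t S(1)] nz])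
  have "\<theta>' u * (h [2,2] u - L * (2 * h [1,1,1] u)) - - (inverse (\<theta>' u) * t * inverse (\<theta>' u)) = 0"
  proof (rule deriv_zero_of_seq[OF DERIV_diff[OF d1 d2] c(1-3)])
    fix n
    have e: "\<theta>' v * h [1,1] v = 1 \<Longrightarrow> h [1,1] v - inverse (\<theta>' v) = 0" for v
      by (metis eq_iff_diff_eq_0 inverse_unique)
    show "h [1,1] (c n) - inverse (\<theta>' (c n)) = h [1,1] u - inverse (\<theta>' u)" using e[OF c(4)] e[OF 1] by simp
  qed
  then show "\<theta>' u * (h [2,2] u - L * (2 * h [1,1,1] u)) = - t / (\<theta>' u)\<^sup>2"
    using nz by (simp add: field_simps power2_eq_square)
qed

text \<open>The relation forces \<open>h [1,1] u\<close> to be nonzero, and its square bounds the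
  cubic term from below.\<close>

lemma cube_pos: "u \<in> {0..1} \<Longrightarrow> \<theta>' u * h [1,1] u = 1 \<Longrightarrow> 0 < h [1,1,1] u"
proof -
  assume u: "u \<in> {0..1}" and 1: "\<theta>' u * h [1,1] u = 1"
  then have "h [1,1] u \<noteq> 0" by auto
  then have "0 < (h [1,1] u)\<^sup>2" by (metis zero_less_power2)
  also have "\<dots> \<le> h [1,1,1] u" by (rule h_cube) (use u in auto)
  finally show ?thesis .
qed

text \<open>Each order of smoothness comes with its own derivative; uniqueness on a nondegenerate
  interval identifies them.\<close>

lemma theta''_ex: obtains t where "\<And>u. u \<in> {0..1} \<Longrightarrow> (\<theta>' has_real_derivative t u) (at u within {0..1})" "\<And>n. cdiff {0..1} n t"
proof -
  let ?S = "{0..1::real}"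
  obtain t where t: "\<And>u. u \<in> ?S \<Longrightarrow> (\<theta>' has_real_derivative t u) (at u within ?S)" using theta'_smooth[of "Suc 0"] by (rule cdiffE) blast
  have "cdiff ?S n t" for n
  proof -
    obtain t' where t': "\<And>u. u \<in> ?S \<Longrightarrow> (\<theta>' has_real_derivative t' u) (at u within ?S)" "cdiff ?S n t'"
      using theta'_smooth[of "Suc n"] by (rule cdiffE) blast
    have "t' u = t u" if u: "u \<in> ?S" for u
    proof (rule vector_derivative_unique_within)
      show "at u within ?S \<noteq> bot" using u by (simp add: trivial_limit_within islimpt_Icc)
    qed (use t[OF u] t'(1)[OF u] in \<open>simp_all add: has_real_derivative_iff_has_vector_derivative\<close>)
    then show ?thesis by (rule cdiff_cong[OF t'(2)])
  qed
  with t show ?thesis by (rule that)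
qed

lemma continuous_at_accumulation:
  assumes um: "strict_mono um" "range um \<subseteq> measure_supp \<mu>" "um \<longlonglongrightarrow> u0"
    and up: "monotone (<) (>) up" "range up \<subseteq> measure_supp \<mu>" "up \<longlonglongrightarrow> u0"
  shows "continuous (at u0 within {0..1}) (dist_fun \<mu>)"
proof -
  have s01: "um n \<in> {0..1}" "up n \<in> {0..1}" for n using um(2) up(2) unfolding measure_supp_def by blast+
  have uml: "um n < u0" for n
  proof -
    have "um (Suc n) \<le> u0"
      by (rule LIMSEQ_le_const[OF um(3)]) (use strict_mono_mono[OF um(1)] in \<open>auto simp: mono_def\<close>)
    moreover have "um n < um (Suc n)" using um(1) by (simp add: strict_mono_Suc_iff)
    ultimately show ?thesis by simp
  qed
  have upd: "up n < up m" if "m < n" for m n using up(1) that by (auto simp: monotone_on_def)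
  have upl: "u0 < up n" for n
  proof -
    have "u0 \<le> up (Suc n)"
      by (rule LIMSEQ_le_const2[OF up(3)]) (use upd in \<open>auto simp: le_less intro!: exI[of _ "Suc n"]\<close>)
    then show ?thesis using upd[of n "Suc n"] by simp
  qed
  have u0: "0 < u0" "u0 < 1" using uml[of 0] upl[of 0] s01[of 0] by auto
  obtain t where t: "\<And>u. u \<in> {0..1} \<Longrightarrow> (\<theta>' has_real_derivative t u) (at u within {0..1})"
    using theta''_ex by blast
  obtain L where L: "(dist_fun \<mu> \<longlongrightarrow> L) (at u0 within {0..u0})" using dist_fun_left[OF mu, of u0] u0 by auto
  have R: "(dist_fun \<mu> \<longlongrightarrow> dist_fun \<mu> u0) (at u0 within {u0..1})" using dist_fun_right[OF mu] u0 by auto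
  have ump: "0 < um (Suc n)" for n
  proof -
    have "um n < um (Suc n)" using um(1) by (simp add: strict_mono_Suc_iff)
    then show ?thesis using s01(1)[of n] by auto
  qed
  have upp: "up (Suc n) < 1" for n using s01(2)[of n] upd[of n "Suc n"] by auto
  have hum: "h [0,0] (um (Suc n)) = um (Suc n)" for n
  proof (rule h_supp)
    show "um (Suc n) \<in> measure_supp \<mu>" using um(2) by blast
  qed (use ump[of n] uml[of "Suc n"] u0 in auto)
  have hup: "h [0,0] (up (Suc n)) = up (Suc n)" for n
  proof (rule h_supp)
    show "up (Suc n) \<in> measure_supp \<mu>" using up(2) by blast
  qed (use upp[of n] upl[of "Suc n"] u0 in auto)
  have "\<exists>c. um (Suc n) < c \<and> c < um (Suc (Suc n)) \<and> \<theta>' c * h [1,1] c = 1" for n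
  proof (rule rolle_point[OF ump _ _ hum hum])
    show "um (Suc n) < um (Suc (Suc n))" using um(1) by (simp add: strict_mono_Suc_iff)
    show "um (Suc (Suc n)) < 1" using uml[of "Suc (Suc n)"] u0 by simp
  qed blast
  then obtain c where c: "\<And>n. um (Suc n) < c n" "\<And>n. c n < um (Suc (Suc n))" "\<And>n. \<theta>' (c n) * h [1,1] (c n) = 1" by metis
  have "\<exists>d. up (Suc (Suc n)) < d \<and> d < up (Suc n) \<and> \<theta>' d * h [1,1] d = 1" for n
  proof (rule rolle_point[OF _ upd upp hup hup])
    show "0 < up (Suc (Suc n))" using upl[of "Suc (Suc n)"] u0 by simp
    show "Suc n < Suc (Suc n)" by simp
  qed blast
  then obtain d where d: "\<And>n. up (Suc (Suc n)) < d n" "\<And>n. d n < up (Suc n)" "\<And>n. \<theta>' (d n) * h [1,1] (d n) = 1" by metis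
  have c0: "0 \<le> c n" "c n < u0" for n using c(1)[of n] ump[of n] c(2)[of n] uml[of "Suc (Suc n)"] by auto
  have d0: "d n \<le> 1" "u0 < d n" for n using d(2)[of n] upp[of n] d(1)[of n] upl[of "Suc (Suc n)"] by auto
  have cl: "c \<longlonglongrightarrow> u0"
    by (rule tendsto_sandwich[OF _ _ LIMSEQ_Suc[OF um(3)] tendsto_const[of u0]])
       (use c(1) c0(2) in \<open>auto intro!: always_eventually less_imp_le\<close>)
  have dl: "d \<longlonglongrightarrow> u0"
    by (rule tendsto_sandwich[OF _ _ tendsto_const[of u0] LIMSEQ_Suc[OF up(3)]])
       (use d(2) d0(2) in \<open>auto intro!: always_eventually less_imp_le\<close>)
  have t0: "(\<theta>' has_real_derivative t u0) (at u0 within {0..1})" by (rule t) (use u0 in auto)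
  have A: "\<theta>' u0 * h [1,1] u0 = 1" "\<theta>' u0 * (h [2,2] u0 - L * (2 * h [1,1,1] u0)) = - t u0 / (\<theta>' u0)\<^sup>2"
    by (rule one_sided[OF _ _ _ L _ _ cl c(3) t0]; use u0 c0 in \<open>auto simp: is_interval_cc less_imp_le less_imp_neq\<close>)+
  have B: "\<theta>' u0 * (h [2,2] u0 - dist_fun \<mu> u0 * (2 * h [1,1,1] u0)) = - t u0 / (\<theta>' u0)\<^sup>2"
  proof (rule one_sided(2)[OF _ _ _ R _ _ dl d(3) t0])
    show "d n \<noteq> u0" for n using d0(2)[of n] by auto
  qed (use u0 d0 in \<open>auto simp: is_interval_cc less_imp_le\<close>)
  have "0 < h [1,1,1] u0" by (rule cube_pos[OF _ A(1)]) (use u0 in auto)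
  moreover have "\<theta>' u0 \<noteq> 0" using A(1) by auto
  \<comment> \<open>The equations from the two sides differ only in the one-sided limit, and its
    coefficient is nonzero.\<close>
  moreover have "\<theta>' u0 * (h [2,2] u0 - L * (2 * h [1,1,1] u0)) = \<theta>' u0 * (h [2,2] u0 - dist_fun \<mu> u0 * (2 * h [1,1,1] u0))"
    using A(2) B by simp
  ultimately have "L = dist_fun \<mu> u0" by simp
  then have "(dist_fun \<mu> \<longlongrightarrow> dist_fun \<mu> u0) (at u0 within ({0..u0} \<union> {u0..1}))"
    unfolding at_within_union using L R by (intro filterlim_sup) auto
  moreover have "{0..u0} \<union> {u0..1} = {0..1}" using u0 by auto
  ultimately show ?thesis by (simp add: continuous_within)
qed

text \<open>The relation for \<open>h [1,1]\<close> holds on the open interval and is used at each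
  \<open>u\<close> along points decreasing to \<open>u\<close>, where right continuity supplies the
  limit of the distribution function. This includes the left end; at \<open>b\<close> the left limit
  could differ from the value, and \<open>b\<close> stays excluded.\<close>

lemma smooth_on_interval:
  assumes ab: "0 \<le> a" "a < b" "b \<le> 1" and sub: "{a<..<b} \<subseteq> measure_supp \<mu>"
  shows "infinitely_differentiable_on (dist_fun \<mu>) {a..<b}"
proof -
  let ?S = "{a..<b}"
  have S01: "?S \<subseteq> {0..1}" using ab by auto
  have inner: "\<theta>' u * h [1,1] u = 1" if u: "a < u" "u < b" for u
  proof -
    have fixed: "h [0,0] v = v" if "v \<in> {a<..<b}" for v using h_supp[of v] sub that ab by auto
    have "at u within {0..1} = at u" by (rule at_within_interior) (use u ab in auto)
    then have "(h [0,0] has_real_derivative \<theta>' u * h [1,1] u) (at u)" using h00_deriv[of u] u ab by auto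
    moreover have "(h [0,0] has_real_derivative 1) (at u)"
      by (rule has_field_derivative_transform_within_open[OF DERIV_ident, of "{a<..<b}"]) (use u fixed in auto)
    ultimately show ?thesis by (rule DERIV_unique)
  qed
  obtain t where t: "\<And>u. u \<in> {0..1} \<Longrightarrow> (\<theta>' has_real_derivative t u) (at u within {0..1})" "\<And>n. cdiff {0..1} n t"
    using theta''_ex by blast
  have key: "\<theta>' u * h [1,1] u = 1 \<and> \<theta>' u * (h [2,2] u - dist_fun \<mu> u * (2 * h [1,1,1] u)) = - t u / (\<theta>' u)\<^sup>2" if u: "u \<in> ?S" for u
  proof -
    define c where "c = (\<lambda>n. u + (b - u) / 2 * (1 / real (Suc n)))"
    have c: "u < c n" "c n < b" for n
    proof -
      show "u < c n" using u by (simp add: c_def)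
      have "(b - u) / 2 * (1 / real (Suc n)) \<le> (b - u) / 2 * 1" using u by (intro mult_left_mono) auto
      then show "c n < b" using u by (simp add: c_def field_simps)
    qed
    have "c \<longlonglongrightarrow> u + (b - u) / 2 * 0"
      unfolding c_def by (intro tendsto_intros LIMSEQ_Suc[OF lim_1_over_n])
    then have cl: "c \<longlonglongrightarrow> u" by simp
    have R: "(dist_fun \<mu> \<longlongrightarrow> dist_fun \<mu> u) (at u within {u..1})" using dist_fun_right[OF mu, of u] u ab by auto
    have in1: "\<theta>' (c n) * h [1,1] (c n) = 1" for n using inner[of "c n"] c[of n] u by auto
    have cI: "c n \<in> {u..1}" "c n \<noteq> u" for n using c[of n] ab by auto
    have uI: "{u..1} \<subseteq> {0..1}" "u \<in> {u..1}" "u \<in> {0..1}" using u ab by auto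
    from one_sided[OF uI(1) is_interval_cc uI(2) R cI cl in1 t(1)[OF uI(3)]] show ?thesis by blast
  qed
  \<comment> \<open>At \<open>u = 0\<close> positivity of \<theta>' is not among the assumptions;
    the limiting relation itself rules out a zero there.\<close>
  have nz: "\<theta>' u \<noteq> 0" if "u \<in> ?S" for u using key[OF that] by auto
  have cp: "2 * h [1,1,1] u \<noteq> 0" if "u \<in> ?S" for u using cube_pos[of u] key[OF that] that S01 by force
  \<comment> \<open>\<open>A\<close> is the second equation of \<open>key\<close> solved for the
    distribution function.\<close>
  define A where "A = (\<lambda>u. (h [2,2] u + t u * (inverse (\<theta>' u) * (inverse (\<theta>' u) * inverse (\<theta>' u)))) * inverse (2 * h [1,1,1] u))"
  have Ae: "A u = dist_fun \<mu> u" if u: "u \<in> ?S" for u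
  proof -
    have "h [2,2] u - dist_fun \<mu> u * (2 * h [1,1,1] u) = - t u * (inverse (\<theta>' u) * (inverse (\<theta>' u) * inverse (\<theta>' u)))"
      using key[OF u] nz[OF u] by (simp add: field_simps power2_eq_square)
    then have "h [2,2] u + t u * (inverse (\<theta>' u) * (inverse (\<theta>' u) * inverse (\<theta>' u))) = dist_fun \<mu> u * (2 * h [1,1,1] u)" by simp
    then show ?thesis unfolding A_def using cp[OF u] by simp
  qed
  have th: "cdiff ?S n \<theta>'" "cdiff ?S n t" for n using cdiff_subset[OF theta'_smooth S01] cdiff_subset[OF t(2) S01] by auto
  have alpha: "cdiff ?S n (dist_fun \<mu>)" if "\<And>w. cdiff ?S n (h w)" for n
  proof (rule cdiff_cong[OF _ Ae])
    show "cdiff ?S n A"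
      unfolding A_def by (intro cdiff_mult cdiff_add cdiff_const cdiff_inverse nz cp th that)
  qed
  \<comment> \<open>Bootstrapping: through \<open>A\<close> the distribution function is as smooth
    as the \<open>h w\<close>, and through their differential equations the \<open>h w\<close> gain
    one order over it. All words are treated at once because the equations couple them.\<close>
  have all: "(\<forall>w. cdiff ?S n (h w)) \<and> cdiff ?S n (dist_fun \<mu>)" for n
  proof (induction n)
    case 0
    have "cdiff ?S 0 (h w)" for w using continuous_on_subset[OF h_cont S01] by simp
    then show ?case using alpha by blast
  next
    case (Suc n)
    have ac: "continuous_on ?S (dist_fun \<mu>)"
      using alpha[of 0] continuous_on_subset[OF h_cont S01] by simp
    have "cdiff ?S (Suc n) (h w)" for w
    proof (rule cdiffI)
      show "(h w has_real_derivative \<theta>' u * (sum_of (\<lambda>w. h w u) (gen0 w) + (-1) * (dist_fun \<mu> u * sum_of (\<lambda>w. h w u) (gen1 w)))) (at u within ?S)"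
        if "u \<in> ?S" for u
      proof -
        have "(dist_fun \<mu> \<longlongrightarrow> dist_fun \<mu> u) (at u within ?S)" using ac that by (auto simp: continuous_on)
        from h_deriv[OF S01 is_interval_co that this, of w] show ?thesis by simp
      qed
      show "cdiff ?S n (\<lambda>u. \<theta>' u * (sum_of (\<lambda>w. h w u) (gen0 w) + (-1) * (dist_fun \<mu> u * sum_of (\<lambda>w. h w u) (gen1 w))))"
        by (intro cdiff_mult cdiff_add cdiff_const cdiff_sum_of th) (use Suc in auto)
    qed
    then show ?case using alpha[of "Suc n"] by blast
  qed
  show ?thesis by (rule infinitely_differentiable_onI[OF ab(2)]) (use all in blast)
qed

end

lemma (in parisi_setup) critical_system_exists:
  assumes P: "parisi_measure \<xi> \<mu>" and sm: "\<And>n. cdiff {0..1} n \<theta>'"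
  obtains h where "critical_system \<xi> \<mu> h"
proof -
  have \<mu>: "\<mu> \<in> prob_measures01" and min: "\<And>\<nu>. \<nu> \<in> prob_measures01 \<Longrightarrow> parisi_functional \<xi> \<mu> \<le> parisi_functional \<xi> \<nu>"
    using P by (auto simp: parisi_measure_def is_arg_min_def not_less)
  show ?thesis
  proof (rule limit_system[OF \<mu>])
    fix k h assume k: "strict_mono (k :: nat \<Rightarrow> nat)"
      and lim: "\<And>w u. u \<in> {0..1} \<Longrightarrow> (\<lambda>n. H (disc (k n) \<mu>) w u) \<longlonglongrightarrow> h w u"
      and hc: "\<And>w. continuous_on {0..1} (h w)"
      and hi: "\<And>w a b. 0 \<le> a \<Longrightarrow> a \<le> b \<Longrightarrow> b \<le> 1 \<Longrightarrow>
        ((\<lambda>r. \<theta>' r * (sum_of (\<lambda>w. h w r) (gen0 w) - dist_fun \<mu> r * sum_of (\<lambda>w. h w r) (gen1 w))) has_integral h w b - h w a) {a..b}"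
    have "critical_system \<xi> \<mu> h"
    proof (unfold_locales)
      show "(h [1,1] u)\<^sup>2 \<le> h [1,1,1] u" if "0 \<le> u" "u \<le> 1" for u
      proof (rule LIMSEQ_le)
        show "(\<lambda>n. (H (disc (k n) \<mu>) [1,1] u)\<^sup>2) \<longlonglongrightarrow> (h [1,1] u)\<^sup>2" by (intro tendsto_intros lim) (use that in auto)
        show "(\<lambda>n. H (disc (k n) \<mu>) [1,1,1] u) \<longlonglongrightarrow> h [1,1,1] u" by (rule lim) (use that in auto)
      qed (use H_cube[OF disc_discrete[OF \<mu>] that] in auto)
      show "h [0,0] q = q" if "q \<in> measure_supp \<mu>" "0 < q" "q < 1" for q
        by (rule support_critical[OF \<mu> min k lim hc that])
      show "((\<lambda>r. \<theta>' r * (sum_of (\<lambda>w. h w r) (gen0 w) - dist_fun \<mu> r * sum_of (\<lambda>w. h w r) (gen1 w))) has_integral h w b - h w a) {a..b}"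
        if "0 \<le> a" "a \<le> b" "b \<le> 1" for w a b by (rule hi[OF that])
    qed (rule \<mu> sm hc)+
    then show ?thesis by (rule that)
  qed
qed

text \<open>The summability condition makes the power series converge on the open ball of radius 2,
  so the unit interval lies in its interior and derivatives at the endpoints are two-sided. A
  nonzero coefficient makes the second derivative positive to the right of 0.\<close>

lemma mixture_smooth:
  assumes s: "summable (\<lambda>p. 2 ^ (p + 2) * (\<beta> (p + 2))\<^sup>2)" and nz: "\<exists>p\<ge>2. \<beta> p \<noteq> 0"
  shows "parisi_setup (mixture \<beta>)" "cdiff {0..1} n (deriv (deriv (mixture \<beta>)))"
proof -
  \<comment> \<open>The series starts at index 2, so the coefficients at 0 and 1 are set to 0 in
    this standard form.\<close>
  define c where "c = (\<lambda>p. if p < 2 then 0 else (\<beta> p)\<^sup>2)"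
  define P where "P = (\<lambda>j x. \<Sum>n. (diffs ^^ j) c n * x ^ n :: real)"
  have s2: "summable (\<lambda>p. c p * 2 ^ p)"
  proof (subst summable_iff_shift[symmetric, of _ 2])
    have "(\<lambda>n. c (n + 2) * 2 ^ (n + 2)) = (\<lambda>p. 2 ^ (p + 2) * (\<beta> (p + 2))\<^sup>2)" by (auto simp: c_def mult.commute)
    then show "summable (\<lambda>n. c (n + 2) * 2 ^ (n + 2))" using s by simp
  qed
  have sj: "summable (\<lambda>n. (diffs ^^ j) c n * x ^ n)" if "norm x < 2" for j and x :: real
    using that
  proof (induction j arbitrary: x)
    case 0
    then show ?case using powser_inside[OF s2, of x] by simp
  next
    case (Suc j)
    then show ?case using termdiff_converges[of x 2 "(diffs ^^ j) c"] by simp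
  qed
  have dP: "(P j has_real_derivative P (Suc j) x) (at x)" if "norm x < 2" for j x
    using termdiffs_strong'[of 2 "(diffs ^^ j) c" x, OF sj that] unfolding P_def by simp
  have m0: "mixture \<beta> x = P 0 x" if "norm x < 2" for x
  proof -
    have "P 0 x = (\<Sum>n. c (n + 2) * x ^ (n + 2)) + (\<Sum>i<2. c i * x ^ i)"
      using suminf_split_initial_segment[OF sj[OF that, of 0], of 2] by (simp add: P_def)
    also have "\<dots> = mixture \<beta> x" by (simp add: c_def mixture_def eval_nat_numeral)
    finally show ?thesis ..
  qed
  have op: "open (ball 0 2 :: real set)" by simp
  have m1: "deriv (mixture \<beta>) x = P 1 x" if "norm x < 2" for x
  proof (rule DERIV_imp_deriv)
    show "(mixture \<beta> has_real_derivative P 1 x) (at x)"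
      using has_field_derivative_transform_within_open[OF dP[OF that, of 0] op, of "mixture \<beta>"] that m0 by simp
  qed
  have m2: "deriv (deriv (mixture \<beta>)) x = P 2 x" "(deriv (mixture \<beta>) has_real_derivative P 2 x) (at x)" if "norm x < 2" for x
  proof -
    show *: "(deriv (mixture \<beta>) has_real_derivative P 2 x) (at x)"
      using has_field_derivative_transform_within_open[OF dP[OF that, of 1] op, of "deriv (mixture \<beta>)"] that m1 by (simp add: numeral_2_eq_2)
    then show "deriv (deriv (mixture \<beta>)) x = P 2 x" by (rule DERIV_imp_deriv)
  qed
  have cd: "cdiff {0..1} n (P j)" for n j by (rule cdiff_family) (use dP in auto)
  show cd2: "cdiff {0..1} n (deriv (deriv (mixture \<beta>)))" for n
    by (rule cdiff_cong[OF cd[of n 2]]) (use m2 in auto)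
  show "parisi_setup (mixture \<beta>)"
  proof
    show "(deriv (mixture \<beta>) has_real_derivative deriv (deriv (mixture \<beta>)) u) (at u)" if "0 \<le> u" "u \<le> 1" for u
      using m2[of u] that by simp
    show "continuous_on {0..1} (deriv (deriv (mixture \<beta>)))" using cd2[of 0] by simp
    show "0 < deriv (deriv (mixture \<beta>)) u" if u: "0 < u" "u \<le> 1" for u
    proof -
      obtain p where p: "p \<ge> 2" "\<beta> p \<noteq> 0" using nz by blast
      have d: "(diffs ^^ 2) c n = real (Suc n) * (real (Suc (Suc n)) * c (Suc (Suc n)))" for n
        by (simp add: numeral_2_eq_2 diffs_def)
      \<comment> \<open>All terms are nonnegative, and the one at \<open>p - 2\<close> is positive
        because it stems from the nonzero coefficient at \<open>p\<close>.\<close>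
      have "0 < (\<Sum>n. (diffs ^^ 2) c n * u ^ n)"
      proof (rule suminf_pos2[where i="p - 2"])
        show "summable (\<lambda>n. (diffs ^^ 2) c n * u ^ n)" by (rule sj) (use u in auto)
        have "0 \<le> c n" for n by (simp add: c_def)
        then show "0 \<le> (diffs ^^ 2) c n * u ^ n" for n unfolding d using u by (intro mult_nonneg_nonneg) auto
        have "Suc (Suc (p - 2)) = p" using p by simp
        moreover have "0 < c p" using p by (simp add: c_def)
        ultimately show "0 < (diffs ^^ 2) c (p - 2) * u ^ (p - 2)" unfolding d using u by simp
      qed
      then show ?thesis using m2(1)[of u] u by (simp add: P_def)
    qed
  qed
qed

theorem theorem2:
  fixes \<beta> :: "nat \<Rightarrow> real" and \<mu>\<^sub>P :: "real measure"
  assumes "summable (\<lambda>p. 2 ^ (p + 2) * (\<beta> (p + 2))\<^sup>2)"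
    and "\<exists>p\<ge>2. \<beta> p \<noteq> 0"
    and "parisi_measure (mixture \<beta>) \<mu>\<^sub>P"
  shows "(\<forall>u\<^sub>0. (\<exists>um up. strict_mono um \<and> monotone (<) (>) up
              \<and> range um \<subseteq> measure_supp \<mu>\<^sub>P \<and> range up \<subseteq> measure_supp \<mu>\<^sub>P
              \<and> um \<longlonglongrightarrow> u\<^sub>0 \<and> up \<longlonglongrightarrow> u\<^sub>0)
            \<longrightarrow> continuous (at u\<^sub>0 within {0..1}) (dist_fun \<mu>\<^sub>P))
       \<and> (\<forall>a b. 0 \<le> a \<and> a < b \<and> b \<le> 1 \<and> {a<..<b} \<subseteq> measure_supp \<mu>\<^sub>P
            \<longrightarrow> infinitely_differentiable_on (dist_fun \<mu>\<^sub>P) {a..<b})"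
proof -
  interpret parisi_setup "mixture \<beta>" by (rule mixture_smooth(1)[OF assms(1,2)])
  obtain h where "critical_system (mixture \<beta>) \<mu>\<^sub>P h"
    using critical_system_exists[OF assms(3) mixture_smooth(2)[OF assms(1,2)]] by blast
  then interpret critical_system "mixture \<beta>" \<mu>\<^sub>P h .
  show ?thesis using continuous_at_accumulation smooth_on_interval by blast
qed

end
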